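(* Let $1<p<\infty$, $n\ge2$, let $\Omega\subseteq\mathbb{R}^n$ be a domain having a smooth exhaustion $\{\omega_i\}_{i\in\mathbb{N}}$ such that $\omega_{i+1}\setminus\overline{\omega_i}$ is a domain for all $i\in\mathbb{N}$, and fix such an exhaustion. Let $H$ be an admissible norm family on $\Omega$ that is commonly uniformly convex and satisfies the Bregman lower bound, let $V\in\widetilde{M}^q_{\mathrm{loc}}(p;\Omega)$ be such that $(H,V)$ has the gradient regularity property in $\Omega$, and suppose that $Q=Q_{p,\mathcal{A},V}$ is subcritical in $\Omega$ (all these notions are defined in the context). Let $g\in\mathcal{H}(\Omega)\cap\widetilde{M}^q_{\mathrm{loc}}(p;\Omega)\setminus\{0\}$. Suppose that $S_g<S_g^\infty$, that $Q_{p,\mathcal{A},V-S_g|g|}$ is critical in $\Omega$, and that $(H,V-S_g|g|)$ has the gradient regularity property in $\Omega$ and in $\Omega\setminus\overline{\omega_i}$ for all $i\in\mathbb{N}$. If $\int_\Omega V^-\Phi^p\,dx<\infty$ for the ground state $\Phi$ of $Q_{p,\mathcal{A},V-S_g|g|}$, then $\Phi\in\widetilde{W}^{1,p}_0(\Omega)$ and $S_g$ is attained at $\Phi$, that is, $\int_\Omega|g|\Phi^p\,dx>0$ and $S_g=Q[\Phi]/\int_\Omega|g|\Phi^p\,dx$.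
   Context: $\omega\Subset\Omega$ means that the closure of $\omega$ is a compact subset of $\Omega$; $C_c(\Omega)$: continuous functions with compact support in $\Omega$; $V^-=-\min\{V,0\}$. A smooth exhaustion of $\Omega$ is a sequence of $C^1$ domains with $\omega_k\Subset\omega_{k+1}\Subset\Omega$ and $\bigcup_k\omega_k=\Omega$. (Under the assumption made on the exhaustion each $\Omega\setminus\overline{\omega_i}$ is a domain.) Admissible norm family: $H:\Omega\times\mathbb{R}^n\to\mathbb{R}$ such that for a.e. $x$, $H(x,\cdot)$ is a norm on $\mathbb{R}^n$; $x\mapsto H(x,\xi)$ is measurable for all $\xi$; for every domain $\omega\Subset\Omega$ there are $0<\kappa_\omega\le\nu_\omega<\infty$ with $\kappa_\omega|\xi|\le H(x,\xi)\le\nu_\omega|\xi|$ for a.e. $x\in\omega$ and all $\xi$; for a.e. $x$, $\mathbb{R}^n_x=(\mathbb{R}^n,H(x,\cdot))$ is uniformly convex and $H(x,\cdot)$ is differentiable in $\mathbb{R}^n\setminus\{0\}$. Write $|\xi|_{\mathcal{A}}=H(x,\xi)$ and $\mathcal{A}(x,\xi)=\nabla_\xi(\tfrac1pH(x,\xi)^p)$. Common uniform convexity: there is a null set $N\subseteq\Omega$ with $\inf_{x\in\Omega\setminus N}\delta_{\mathbb{R}^n_x}(\varepsilon)>0$ for all $\varepsilon\in(0,2]$, where $\delta_X(\varepsilon)=\inf\{1-\|\frac{x+y}2\|:\|x\|=\|y\|=1,\ \|x-y\|\ge\varepsilon\}$. Bregman lower bound: for some locally bounded measurable $\tilde\delta:\Omega\to[2,\infty)$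 and every domain $\omega\Subset\Omega$ there is $C_\omega>0$ with $|\xi+\eta|_{\mathcal{A}}^p-|\xi|_{\mathcal{A}}^p-p\mathcal{A}(x,\xi)\cdot\eta\ge C_\omega|\eta|_{\mathcal{A}}^{\tilde\delta}(|\eta|_{\mathcal{A}}+|\xi|_{\mathcal{A}})^{p-\tilde\delta}$ for a.e. $x\in\omega$ and all $\xi,\eta\in\mathbb{R}^n$ (with $\tilde\delta=\tilde\delta(x)$). Morrey spaces: for a domain $\omega\Subset\Omega$: if $p<n$, $q>n/p$, $\|f\|_{M^q(p;\omega)}=\sup_{y\in\omega,0<r<\mathrm{diam}\,\omega}r^{-n/q'}\int_{\omega\cap B_r(y)}|f|\,dx$, $q'=q/(q-1)$; if $p=n$, $q>n$, $\|f\|_{M^q(n;\omega)}=\sup_{y\in\omega,0<r<\mathrm{diam}\,\omega}(\log(\mathrm{diam}(\omega)/r))^{q/n'}\int_{\omega\cap B_r(y)}|f|\,dx$, $n'=n/(n-1)$; then $M^q(p;\omega)=\{f\in L^1_{\mathrm{loc}}(\omega):\|f\|_{M^q(p;\omega)}<\infty\}$; if $p>n$, $q=1$, $M^q(p;\omega)=L^1(\omega)$. $M^q_{\mathrm{loc}}(p;\Omega)=\bigcap_{\omega\Subset\Omega}M^q(p;\omega)$. The space $\widetilde{M}^q_{\mathrm{loc}}(p;\Omega)$ is defined as $M^q_{\mathrm{loc}}(p;\Omega)$ with the further requirements that $q>n$ when $p<n$, and that when $p=n$, for some $\theta\in(n-1,n)$ and all domains $\omega\Subset\Omega$, $\sup_{y\in\omega,0<r<\mathrm{diam}\,\omega}r^{-\theta}\int_{B_r(y)\cap\omega}|f|\,dx<\infty$.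 Functional and equation: for a potential $V$ and a domain $U\subseteq\Omega$, $Q_{p,\mathcal{A},V}[\phi;U]=\int_U(|\nabla\phi|_{\mathcal{A}}^p+V|\phi|^p)\,dx$, $Q[\phi]=Q_{p,\mathcal{A},V}[\phi;\Omega]$. A solution of $Q'_{p,\mathcal{A},V}[u]=f$ in $U$, where $Q'_{p,\mathcal{A},V}[u]=-\mathrm{div}\,\mathcal{A}(x,\nabla u)+V|u|^{p-2}u$, is $v\in W^{1,p}_{\mathrm{loc}}(U)$ with $\int_U\mathcal{A}(x,\nabla v)\cdot\nabla\phi\,dx+\int_UV|v|^{p-2}v\phi\,dx=\int_Uf\phi\,dx$ for all $\phi\in C_c^\infty(U)$. Gradient regularity property of $(H,V)$ in a domain $U$: if $p<\tilde\delta$ on a subset of $U$ of positive measure, then for every subdomain $U'\subseteq U$ and $W\in L^\infty_{\mathrm{loc}}(U')$ positive solutions of $Q'_{p,\mathcal{A},V-W}[u]=0$ in $U'$ are in $W^{1,\infty}_{\mathrm{loc}}(U')$, and for every $0\le f\in C_c^\infty(U)\setminus\{0\}$ positive solutions of $Q'_{p,\mathcal{A},V}[u]=f$ in $U$ are in $W^{1,\infty}_{\mathrm{loc}}(U)$. Hardy-weights and criticality: for a functional $Q$ on a domain $U$, $g\in L^1_{\mathrm{loc}}(U)$ is a Hardy-weight if there is $C>0$ with $Q[\phi]\ge C\int_U|g||\phi|^p\,dx$ for all $\phi\in C_c^\infty(U)$; $\mathcal{H}(U)$ is the space of all Hardy-weights. If $Q\ge0$ on $C_c^\infty(U)$, $Q$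 is critical in $U$ if its space of Hardy-weights is $\{0\}$ and subcritical otherwise. A null-sequence of a nonnegative functional $Q$ in $\Omega$ is a nonnegative sequence $\{\phi_k\}\subseteq W^{1,p}(\Omega)\cap C_c(\Omega)$ with $\|\phi_k\|_{L^p(U)}=1$ for all $k$ for some fixed open $U\Subset\Omega$ and $Q[\phi_k]\to0$. A ground state is a positive function in $W^{1,p}_{\mathrm{loc}}(\Omega)$ that is an $L^p_{\mathrm{loc}}(\Omega)$ limit of a null-sequence (in the critical case it exists and is unique up to a positive factor). $S_g=\inf\{Q[\phi]/\int_\Omega|g||\phi|^p\,dx:\phi\in W^{1,p}(\Omega)\cap C_c(\Omega),\ \int_\Omega|g||\phi|^p\,dx>0\}$. Spaces: for a domain $U\subseteq\Omega$ in which $Q$ is subcritical, fix a positive $\mathcal{V}\in C(U)\cap\mathcal{H}(U)$ (one exists; a functional subcritical in $\Omega$ is subcritical in all subdomains). $\widetilde{W}^{1,p}(U)$ is the set of $u\in L^p(U,(|V|+\mathcal{V})\,dx)$ with a weak gradient and finite norm $\left(\int_U(|\nabla u|_{\mathcal{A}}^p+(|V|+\mathcal{V})|u|^p)\,dx\right)^{1/p}$; $\widetilde{W}^{1,p}_0(U)$ is the closure of $W^{1,p}(U)\cap C_c(U)$ in it (independent of $\mathcal{V}$). Finally $$S_g^\infty=\lim_{i\to\infty}\inf\left\{Q[\phi;\Omega\setminus\overline{\omega_i}]:\phi\in\widetilde{W}^{1,p}_0(\Omega\setminus\overline{\omega_i}),\ \int_{\Omega\setminus\overline{\omega_i}}|g||\phi|^p\,dx=1\right\}.$$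 *)

theory Defs
  imports "HOL-Analysis.Analysis"
begin

text \<open>
  Functions on an open set \<open>U\<close> are represented by total functions on \<open>real ^ 'n\<close> whose values outside
  \<open>U\<close> are irrelevant. Elements of Lebesgue and Sobolev spaces are represented by arbitrary pointwise
  representatives, so positivity and equality of such functions are meant almost everywhere.
  Throughout, \<open>n = CARD('n)\<close>.
\<close>

section \<open>Domains\<close>

definition is_domain :: "(real ^ 'n) set \<Rightarrow> bool" where
  "is_domain U \<longleftrightarrow> open U \<and> connected U \<and> U \<noteq> {}"

definition compactly_in :: "(real ^ 'n) set \<Rightarrow> (real ^ 'n) set \<Rightarrow> bool" (infix \<open>\<Subset>\<close> 50) where
  "\<omega> \<Subset> \<Omega> \<longleftrightarrow> compact (closure \<omega>) \<and> closure \<omega> \<subseteq> \<Omega>"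

definition gradient :: "(real ^ 'n \<Rightarrow> real) \<Rightarrow> real ^ 'n \<Rightarrow> real ^ 'n" where
  "gradient f x = (THE D. GDERIV f x :> D)"

primrec C_k :: "nat \<Rightarrow> (real ^ 'n \<Rightarrow> real) \<Rightarrow> bool" where
  "C_k 0 f \<longleftrightarrow> continuous_on UNIV f"
| "C_k (Suc k) f \<longleftrightarrow> (\<forall>x. f differentiable (at x)) \<and> (\<forall>i. C_k k (\<lambda>x. gradient f x $ i))"

text \<open>
  Near each boundary point, a \<open>C\<^sup>1\<close> domain is the region above the graph of a \<open>C\<^sup>1\<close> function in some
  rotated coordinate system: \<open>e\<close> is the vertical direction, and \<open>x - (x \<bullet> e) *\<^sub>R e\<close> is the
  horizontal part of \<open>x\<close>, so only the values of \<open>\<gamma>\<close> on the hyperplane orthogonal to \<open>e\<close> matter.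
\<close>
definition C1_domain :: "(real ^ 'n) set \<Rightarrow> bool" where
  "C1_domain \<omega> \<longleftrightarrow> is_domain \<omega> \<and>
     (\<forall>z\<in>frontier \<omega>. \<exists>r>0. \<exists>e \<gamma>. norm e = 1 \<and> C_k 1 \<gamma> \<and>
        \<omega> \<inter> ball z r = {x \<in> ball z r. \<gamma> (x - (x \<bullet> e) *\<^sub>R e) < x \<bullet> e})"

definition smooth_exhaustion :: "(real ^ 'n) set \<Rightarrow> (nat \<Rightarrow> (real ^ 'n) set) \<Rightarrow> bool" where
  "smooth_exhaustion \<Omega> \<omega> \<longleftrightarrow>
     (\<forall>k. C1_domain (\<omega> k) \<and> \<omega> k \<Subset> \<omega> (Suc k) \<and> \<omega> (Suc k) \<Subset> \<Omega>) \<and> (\<Union>k. \<omega> k) = \<Omega>"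

section \<open>Function spaces\<close>

definition Cc :: "(real ^ 'n) set \<Rightarrow> (real ^ 'n \<Rightarrow> real) set" where
  "Cc U = {\<phi>. continuous_on UNIV \<phi> \<and> (\<exists>K. compact K \<and> K \<subseteq> U \<and> (\<forall>x. x \<notin> K \<longrightarrow> \<phi> x = 0))}"

definition Cc_infty :: "(real ^ 'n) set \<Rightarrow> (real ^ 'n \<Rightarrow> real) set" where
  "Cc_infty U = {\<phi> \<in> Cc U. \<forall>k. C_k k \<phi>}"

definition Lp :: "real \<Rightarrow> (real ^ 'n) set \<Rightarrow> (real ^ 'n \<Rightarrow> 'b::euclidean_space) set" where
  "Lp p U = {f \<in> borel_measurable (lebesgue_on U). integrable (lebesgue_on U) (\<lambda>x. norm (f x) powr p)}"

definition Lp_loc :: "real \<Rightarrow> (real ^ 'n) set \<Rightarrow> (real ^ 'n \<Rightarrow> 'b::euclidean_space) set" where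
  "Lp_loc p U = {f. \<forall>K. compact K \<and> K \<subseteq> U \<longrightarrow> f \<in> Lp p K}"

definition Linfty_loc :: "(real ^ 'n) set \<Rightarrow> (real ^ 'n \<Rightarrow> 'b::euclidean_space) set" where
  "Linfty_loc U = {f. \<forall>K. compact K \<and> K \<subseteq> U \<longrightarrow>
     f \<in> borel_measurable (lebesgue_on K) \<and> (\<exists>C. AE x in lebesgue_on K. norm (f x) \<le> C)}"

definition has_weak_gradient ::
    "(real ^ 'n) set \<Rightarrow> (real ^ 'n \<Rightarrow> real) \<Rightarrow> (real ^ 'n \<Rightarrow> real ^ 'n) \<Rightarrow> bool" where
  "has_weak_gradient U u G \<longleftrightarrow> u \<in> Lp_loc 1 U \<and> G \<in> Lp_loc 1 U \<and>
     (\<forall>\<psi>\<in>Cc_infty U. (LINT x|lebesgue_on U. u x *\<^sub>R gradient \<psi> x) = - (LINT x|lebesgue_on U. \<psi> x *\<^sub>R G x))"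

text \<open>Weak gradients are unique up to null sets, so the choice does not affect any integral below.\<close>
definition weak_gradient :: "(real ^ 'n) set \<Rightarrow> (real ^ 'n \<Rightarrow> real) \<Rightarrow> real ^ 'n \<Rightarrow> real ^ 'n" where
  "weak_gradient U u = (SOME G. has_weak_gradient U u G)"

definition W1p :: "real \<Rightarrow> (real ^ 'n) set \<Rightarrow> (real ^ 'n \<Rightarrow> real) set" where
  "W1p p U = {u \<in> Lp p U. \<exists>G. has_weak_gradient U u G \<and> G \<in> Lp p U}"

definition W1p_loc :: "real \<Rightarrow> (real ^ 'n) set \<Rightarrow> (real ^ 'n \<Rightarrow> real) set" where
  "W1p_loc p U = {u \<in> Lp_loc p U. \<exists>G. has_weak_gradient U u G \<and> G \<in> Lp_loc p U}"

definition W1infty_loc :: "(real ^ 'n) set \<Rightarrow> (real ^ 'n \<Rightarrow> real) set" where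
  "W1infty_loc U = {u \<in> Linfty_loc U. \<exists>G. has_weak_gradient U u G \<and> G \<in> Linfty_loc U}"

section \<open>Morrey spaces\<close>

definition morrey_sup :: "(real \<Rightarrow> real) \<Rightarrow> (real ^ 'n) set \<Rightarrow> (real ^ 'n \<Rightarrow> real) \<Rightarrow> ennreal" where
  "morrey_sup c \<omega> f = (SUP (y, r) \<in> \<omega> \<times> {0<..<diameter \<omega>}.
      ennreal (c r) * (\<integral>\<^sup>+x. ennreal \<bar>f x\<bar> \<partial>lebesgue_on (\<omega> \<inter> ball y r)))"

definition morrey :: "real \<Rightarrow> real \<Rightarrow> (real ^ 'n) set \<Rightarrow> (real ^ 'n \<Rightarrow> real) set" where
  "morrey p q \<omega> = (let n = real CARD('n) in
     if p < n then
       {f \<in> Lp_loc 1 \<omega>. n / p < q \<and> morrey_sup (\<lambda>r. r powr (- n / (q / (q - 1)))) \<omega> f < \<infinity>}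
     else if p = n then
       {f \<in> Lp_loc 1 \<omega>. n < q \<and>
          morrey_sup (\<lambda>r. ln (diameter \<omega> / r) powr (q / (n / (n - 1)))) \<omega> f < \<infinity>}
     else {f \<in> Lp 1 \<omega>. q = 1})"

definition morrey_loc :: "real \<Rightarrow> real \<Rightarrow> (real ^ 'n) set \<Rightarrow> (real ^ 'n \<Rightarrow> real) set" where
  "morrey_loc p q \<Omega> = {f. \<forall>\<omega>. is_domain \<omega> \<and> \<omega> \<Subset> \<Omega> \<longrightarrow> f \<in> morrey p q \<omega>}"

definition morrey_tilde_loc :: "real \<Rightarrow> real \<Rightarrow> (real ^ 'n) set \<Rightarrow> (real ^ 'n \<Rightarrow> real) set" where
  "morrey_tilde_loc p q \<Omega> = {f \<in> morrey_loc p q \<Omega>.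
     (p < real CARD('n) \<longrightarrow> real CARD('n) < q) \<and>
     (p = real CARD('n) \<longrightarrow>
        (\<exists>\<theta>. real CARD('n) - 1 < \<theta> \<and> \<theta> < real CARD('n) \<and>
           (\<forall>\<omega>. is_domain \<omega> \<and> \<omega> \<Subset> \<Omega> \<longrightarrow> morrey_sup (\<lambda>r. r powr (- \<theta>)) \<omega> f < \<infinity>)))}"

section \<open>Families of norms\<close>

definition is_norm :: "(real ^ 'n \<Rightarrow> real) \<Rightarrow> bool" where
  "is_norm N \<longleftrightarrow> (\<forall>\<xi>. 0 \<le> N \<xi>) \<and> (\<forall>\<xi>. N \<xi> = 0 \<longleftrightarrow> \<xi> = 0) \<and>
     (\<forall>c \<xi>. N (c *\<^sub>R \<xi>) = \<bar>c\<bar> * N \<xi>) \<and> (\<forall>\<xi> \<eta>. N (\<xi> + \<eta>) \<le> N \<xi> + N \<eta>)"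

definition convexity_modulus :: "(real ^ 'n \<Rightarrow> real) \<Rightarrow> real \<Rightarrow> real" where
  "convexity_modulus N \<epsilon> =
     Inf {1 - N ((1 / 2) *\<^sub>R (x + y)) | x y. N x = 1 \<and> N y = 1 \<and> \<epsilon> \<le> N (x - y)}"

definition uniformly_convex_norm :: "(real ^ 'n \<Rightarrow> real) \<Rightarrow> bool" where
  "uniformly_convex_norm N \<longleftrightarrow> (\<forall>\<epsilon>\<in>{0<..2}. 0 < convexity_modulus N \<epsilon>)"

definition admissible :: "(real ^ 'n) set \<Rightarrow> (real ^ 'n \<Rightarrow> real ^ 'n \<Rightarrow> real) \<Rightarrow> bool" where
  "admissible \<Omega> H \<longleftrightarrow>
     (AE x in lebesgue_on \<Omega>. is_norm (H x)) \<and>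
     (\<forall>\<xi>. (\<lambda>x. H x \<xi>) \<in> borel_measurable (lebesgue_on \<Omega>)) \<and>
     (\<forall>\<omega>. is_domain \<omega> \<and> \<omega> \<Subset> \<Omega> \<longrightarrow> (\<exists>\<kappa> \<nu>. 0 < \<kappa> \<and> \<kappa> \<le> \<nu> \<and>
        (AE x in lebesgue_on \<omega>. \<forall>\<xi>. \<kappa> * norm \<xi> \<le> H x \<xi> \<and> H x \<xi> \<le> \<nu> * norm \<xi>))) \<and>
     (AE x in lebesgue_on \<Omega>. uniformly_convex_norm (H x)) \<and>
     (AE x in lebesgue_on \<Omega>. \<forall>\<xi>. \<xi> \<noteq> 0 \<longrightarrow> H x differentiable (at \<xi>))"

text \<open>
  Requiring \<open>H x\<close> to be a norm off \<open>N\<close> ensures that all the moduli there are nonnegative, so that the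
  real-valued infimum is the usual one.
\<close>
definition commonly_uniformly_convex :: "(real ^ 'n) set \<Rightarrow> (real ^ 'n \<Rightarrow> real ^ 'n \<Rightarrow> real) \<Rightarrow> bool" where
  "commonly_uniformly_convex \<Omega> H \<longleftrightarrow> (\<exists>N \<in> null_sets lebesgue. N \<subseteq> \<Omega> \<and> (\<forall>x \<in> \<Omega> - N. is_norm (H x)) \<and>
     (\<forall>\<epsilon>\<in>{0<..2}. 0 < (INF x \<in> \<Omega> - N. convexity_modulus (H x) \<epsilon>)))"

definition op_A :: "real \<Rightarrow> (real ^ 'n \<Rightarrow> real ^ 'n \<Rightarrow> real) \<Rightarrow> real ^ 'n \<Rightarrow> real ^ 'n \<Rightarrow> real ^ 'n" where
  "op_A p H x \<xi> = gradient (\<lambda>\<zeta>. 1 / p * H x \<zeta> powr p) \<xi>"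

definition bregman_bound ::
    "real \<Rightarrow> (real ^ 'n) set \<Rightarrow> (real ^ 'n \<Rightarrow> real ^ 'n \<Rightarrow> real) \<Rightarrow> (real ^ 'n \<Rightarrow> real) \<Rightarrow> bool" where
  "bregman_bound p \<Omega> H \<delta> \<longleftrightarrow>
     \<delta> \<in> borel_measurable (lebesgue_on \<Omega>) \<and> (\<forall>x\<in>\<Omega>. 2 \<le> \<delta> x) \<and>
     (\<forall>K. compact K \<and> K \<subseteq> \<Omega> \<longrightarrow> bounded (\<delta> ` K)) \<and>
     (\<forall>\<omega>. is_domain \<omega> \<and> \<omega> \<Subset> \<Omega> \<longrightarrow> (\<exists>C>0. AE x in lebesgue_on \<omega>. \<forall>\<xi> \<eta>.
        C * H x \<eta> powr \<delta> x * (H x \<eta> + H x \<xi>) powr (p - \<delta> x)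
          \<le> H x (\<xi> + \<eta>) powr p - H x \<xi> powr p - p * (op_A p H x \<xi> \<bullet> \<eta>)))"

section \<open>The functional and the equation\<close>

definition energy :: "real \<Rightarrow> (real ^ 'n \<Rightarrow> real ^ 'n \<Rightarrow> real) \<Rightarrow> (real ^ 'n \<Rightarrow> real) \<Rightarrow>
    (real ^ 'n) set \<Rightarrow> (real ^ 'n \<Rightarrow> real) \<Rightarrow> real" where
  "energy p H V U \<phi> =
     (LINT x|lebesgue_on U. H x (weak_gradient U \<phi> x) powr p + V x * \<bar>\<phi> x\<bar> powr p)"

definition is_solution :: "real \<Rightarrow> (real ^ 'n \<Rightarrow> real ^ 'n \<Rightarrow> real) \<Rightarrow> (real ^ 'n \<Rightarrow> real) \<Rightarrow>
    (real ^ 'n \<Rightarrow> real) \<Rightarrow> (real ^ 'n) set \<Rightarrow> (real ^ 'n \<Rightarrow> real) \<Rightarrow> bool" where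
  "is_solution p H V f U v \<longleftrightarrow> v \<in> W1p_loc p U \<and>
     (\<forall>\<phi>\<in>Cc_infty U.
        (LINT x|lebesgue_on U. op_A p H x (weak_gradient U v x) \<bullet> gradient \<phi> x) +
        (LINT x|lebesgue_on U. V x * \<bar>v x\<bar> powr (p - 2) * v x * \<phi> x) =
        (LINT x|lebesgue_on U. f x * \<phi> x))"

definition positive_solution :: "real \<Rightarrow> (real ^ 'n \<Rightarrow> real ^ 'n \<Rightarrow> real) \<Rightarrow> (real ^ 'n \<Rightarrow> real) \<Rightarrow>
    (real ^ 'n \<Rightarrow> real) \<Rightarrow> (real ^ 'n) set \<Rightarrow> (real ^ 'n \<Rightarrow> real) \<Rightarrow> bool" where
  "positive_solution p H V f U v \<longleftrightarrow>
     is_solution p H V f U v \<and> (AE x in lebesgue_on U. 0 < v x)"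

text \<open>\<open>\<delta>\<close> is the exponent function of the Bregman lower bound.\<close>
definition gradient_regularity :: "real \<Rightarrow> (real ^ 'n \<Rightarrow> real) \<Rightarrow> (real ^ 'n \<Rightarrow> real ^ 'n \<Rightarrow> real) \<Rightarrow>
    (real ^ 'n \<Rightarrow> real) \<Rightarrow> (real ^ 'n) set \<Rightarrow> bool" where
  "gradient_regularity p \<delta> H V U \<longleftrightarrow> (0 < emeasure lebesgue {x \<in> U. p < \<delta> x} \<longrightarrow>
     (\<forall>U' W v. is_domain U' \<and> U' \<subseteq> U \<and> W \<in> Linfty_loc U' \<and>
        positive_solution p H (\<lambda>x. V x - W x) (\<lambda>x. 0) U' v \<longrightarrow> v \<in> W1infty_loc U') \<and>
     (\<forall>f v. f \<in> Cc_infty U \<and> (\<forall>x. 0 \<le> f x) \<and> f \<noteq> (\<lambda>x. 0) \<and>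
        positive_solution p H V f U v \<longrightarrow> v \<in> W1infty_loc U))"

section \<open>Hardy-weights and criticality\<close>

definition hardy_weights :: "real \<Rightarrow> (real ^ 'n \<Rightarrow> real ^ 'n \<Rightarrow> real) \<Rightarrow> (real ^ 'n \<Rightarrow> real) \<Rightarrow>
    (real ^ 'n) set \<Rightarrow> (real ^ 'n \<Rightarrow> real) set" where
  "hardy_weights p H V U = {g \<in> Lp_loc 1 U. \<exists>C>0. \<forall>\<phi>\<in>Cc_infty U.
     C * (LINT x|lebesgue_on U. \<bar>g x\<bar> * \<bar>\<phi> x\<bar> powr p) \<le> energy p H V U \<phi>}"

definition nonneg_functional :: "real \<Rightarrow> (real ^ 'n \<Rightarrow> real ^ 'n \<Rightarrow> real) \<Rightarrow> (real ^ 'n \<Rightarrow> real) \<Rightarrow>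
    (real ^ 'n) set \<Rightarrow> bool" where
  "nonneg_functional p H V U \<longleftrightarrow> (\<forall>\<phi>\<in>Cc_infty U. 0 \<le> energy p H V U \<phi>)"

definition critical :: "real \<Rightarrow> (real ^ 'n \<Rightarrow> real ^ 'n \<Rightarrow> real) \<Rightarrow> (real ^ 'n \<Rightarrow> real) \<Rightarrow>
    (real ^ 'n) set \<Rightarrow> bool" where
  "critical p H V U \<longleftrightarrow> nonneg_functional p H V U \<and>
     (\<forall>g\<in>hardy_weights p H V U. AE x in lebesgue_on U. g x = 0)"

definition subcritical :: "real \<Rightarrow> (real ^ 'n \<Rightarrow> real ^ 'n \<Rightarrow> real) \<Rightarrow> (real ^ 'n \<Rightarrow> real) \<Rightarrow>
    (real ^ 'n) set \<Rightarrow> bool" where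
  "subcritical p H V U \<longleftrightarrow> nonneg_functional p H V U \<and> \<not> critical p H V U"

definition null_sequence :: "real \<Rightarrow> (real ^ 'n \<Rightarrow> real ^ 'n \<Rightarrow> real) \<Rightarrow> (real ^ 'n \<Rightarrow> real) \<Rightarrow>
    (real ^ 'n) set \<Rightarrow> (nat \<Rightarrow> real ^ 'n \<Rightarrow> real) \<Rightarrow> bool" where
  "null_sequence p H V \<Omega> \<phi> \<longleftrightarrow>
     (\<forall>k. \<phi> k \<in> W1p p \<Omega> \<inter> Cc \<Omega> \<and> (\<forall>x. 0 \<le> \<phi> k x)) \<and>
     (\<exists>U. open U \<and> U \<Subset> \<Omega> \<and>
        (\<forall>k. (LINT x|lebesgue_on U. \<bar>\<phi> k x\<bar> powr p) powr (1 / p) = 1)) \<and>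
     (\<lambda>k. energy p H V \<Omega> (\<phi> k)) \<longlonglongrightarrow> 0"

definition ground_state :: "real \<Rightarrow> (real ^ 'n \<Rightarrow> real ^ 'n \<Rightarrow> real) \<Rightarrow> (real ^ 'n \<Rightarrow> real) \<Rightarrow>
    (real ^ 'n) set \<Rightarrow> (real ^ 'n \<Rightarrow> real) \<Rightarrow> bool" where
  "ground_state p H V \<Omega> \<Phi> \<longleftrightarrow> \<Phi> \<in> W1p_loc p \<Omega> \<and> (AE x in lebesgue_on \<Omega>. 0 < \<Phi> x) \<and>
     (\<exists>\<phi>. null_sequence p H V \<Omega> \<phi> \<and>
        (\<forall>K. compact K \<and> K \<subseteq> \<Omega> \<longrightarrow>
           (\<lambda>k. LINT x|lebesgue_on K. \<bar>\<phi> k x - \<Phi> x\<bar> powr p) \<longlonglongrightarrow> 0))"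

definition hardy_const :: "real \<Rightarrow> (real ^ 'n \<Rightarrow> real ^ 'n \<Rightarrow> real) \<Rightarrow> (real ^ 'n \<Rightarrow> real) \<Rightarrow>
    (real ^ 'n) set \<Rightarrow> (real ^ 'n \<Rightarrow> real) \<Rightarrow> real" where
  "hardy_const p H V \<Omega> g =
     Inf {energy p H V \<Omega> \<phi> / (LINT x|lebesgue_on \<Omega>. \<bar>g x\<bar> * \<bar>\<phi> x\<bar> powr p) | \<phi>.
       \<phi> \<in> W1p p \<Omega> \<inter> Cc \<Omega> \<and> 0 < (LINT x|lebesgue_on \<Omega>. \<bar>g x\<bar> * \<bar>\<phi> x\<bar> powr p)}"

section \<open>The energy space\<close>

text \<open>
  The positive continuous Hardy-weight used to define the space on a subdomain \<open>U\<close> is passed as the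
  explicit argument \<open>\<V>\<close>; where several subdomains occur, the argument is a family indexed by them.
\<close>

definition reference_weights :: "real \<Rightarrow> (real ^ 'n \<Rightarrow> real ^ 'n \<Rightarrow> real) \<Rightarrow> (real ^ 'n \<Rightarrow> real) \<Rightarrow>
    (real ^ 'n) set \<Rightarrow> ((real ^ 'n) set \<Rightarrow> real ^ 'n \<Rightarrow> real) \<Rightarrow> bool" where
  "reference_weights p H V \<Omega> \<V> \<longleftrightarrow>
     (\<forall>U. is_domain U \<and> U \<subseteq> \<Omega> \<and> subcritical p H V U \<longrightarrow>
        continuous_on U (\<V> U) \<and> (\<forall>x\<in>U. 0 < \<V> U x) \<and> \<V> U \<in> hardy_weights p H V U)"

definition W_tilde :: "real \<Rightarrow> (real ^ 'n \<Rightarrow> real ^ 'n \<Rightarrow> real) \<Rightarrow> (real ^ 'n \<Rightarrow> real) \<Rightarrow>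
    (real ^ 'n \<Rightarrow> real) \<Rightarrow> (real ^ 'n) set \<Rightarrow> (real ^ 'n \<Rightarrow> real) set" where
  "W_tilde p H V \<V> U = {u \<in> borel_measurable (lebesgue_on U).
     integrable (lebesgue_on U) (\<lambda>x. (\<bar>V x\<bar> + \<V> x) * \<bar>u x\<bar> powr p) \<and>
     (\<exists>G. has_weak_gradient U u G \<and> integrable (lebesgue_on U) (\<lambda>x. H x (G x) powr p))}"

definition W_tilde_norm :: "real \<Rightarrow> (real ^ 'n \<Rightarrow> real ^ 'n \<Rightarrow> real) \<Rightarrow> (real ^ 'n \<Rightarrow> real) \<Rightarrow>
    (real ^ 'n \<Rightarrow> real) \<Rightarrow> (real ^ 'n) set \<Rightarrow> (real ^ 'n \<Rightarrow> real) \<Rightarrow> real" where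
  "W_tilde_norm p H V \<V> U u =
     (LINT x|lebesgue_on U. H x (weak_gradient U u x) powr p + (\<bar>V x\<bar> + \<V> x) * \<bar>u x\<bar> powr p) powr (1 / p)"

definition W_tilde0 :: "real \<Rightarrow> (real ^ 'n \<Rightarrow> real ^ 'n \<Rightarrow> real) \<Rightarrow> (real ^ 'n \<Rightarrow> real) \<Rightarrow>
    (real ^ 'n \<Rightarrow> real) \<Rightarrow> (real ^ 'n) set \<Rightarrow> (real ^ 'n \<Rightarrow> real) set" where
  "W_tilde0 p H V \<V> U = {u \<in> W_tilde p H V \<V> U. \<forall>\<epsilon>>0. \<exists>\<phi> \<in> W1p p U \<inter> Cc U \<inter> W_tilde p H V \<V> U.
     W_tilde_norm p H V \<V> U (\<lambda>x. u x - \<phi> x) < \<epsilon>}"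

text \<open>
  The infima are taken in the extended reals: they are \<open>\<infinity>\<close> when \<open>g\<close> vanishes almost everywhere on
  \<open>\<Omega> - closure (\<omega> i)\<close>.
\<close>
definition hardy_const_infty :: "real \<Rightarrow> (real ^ 'n \<Rightarrow> real ^ 'n \<Rightarrow> real) \<Rightarrow> (real ^ 'n \<Rightarrow> real) \<Rightarrow>
    ((real ^ 'n) set \<Rightarrow> real ^ 'n \<Rightarrow> real) \<Rightarrow> (real ^ 'n) set \<Rightarrow> (nat \<Rightarrow> (real ^ 'n) set) \<Rightarrow>
    (real ^ 'n \<Rightarrow> real) \<Rightarrow> ereal" where
  "hardy_const_infty p H V \<V> \<Omega> \<omega> g = lim (\<lambda>i. let U = \<Omega> - closure (\<omega> i) in
     INF \<phi> \<in> {\<phi> \<in> W_tilde0 p H V (\<V> U) U. (LINT x|lebesgue_on U. \<bar>g x\<bar> * \<bar>\<phi> x\<bar> powr p) = 1}.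
       ereal (energy p H V U \<phi>))"

end

theory Submission
  imports Defs
begin

text \<open>
 Write \<open>Q\<close> for the functional with potential \<open>V\<close> and \<open>Q_S\<close> for the one with potential \<open>V - S |g|\<close>, which is
 nonnegative by the definition of \<open>S\<close>. Since \<open>Q_S (min u w) + Q_S (max u w) \<le> Q_S u + Q_S w\<close>, the null sequence
 converging to \<open>\<Phi>\<close> can be replaced by finite minima \<open>v\<close> of its members; these still have small \<open>Q_S\<close> but
 exceed \<open>\<Phi>\<close> only by a small error, so that the hypothesis on \<open>V\<^sup>-\<close> bounds \<open>\<integral> V\<^sup>- v\<^sup>p\<close>. If \<open>\<integral> |g| v\<^sup>p\<close> were unbounded,
 the normalised functions would vanish locally, by the Morrey condition also with weight \<open>|g|\<close>, and cutting
 them off near \<open>closure (\<omega> i)\<close> would show that the infimum at infinity is \<open>S\<close>. Hence all weighted norms of \<open>v\<close> are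
 bounded, \<open>v\<close> converges to \<open>\<Phi>\<close> in them, and the uniform convexity of \<open>\<integral> H(x, G)\<^sup>p\<close> makes the gradients
 converge strongly.
\<close>

text \<open>A null sequence converges to \<Phi> only in L^p on compact sets, so integrability of V^-
  \<Phi>^p says nothing about its members far out. A minimum over a tail lies below \<Phi> in the
  limit, and dropping the nonnegative energy of each maximum leaves only the sum of the energies of
  the members. The infimum of an infinite tail need not be continuous with compact support; hence
  finite minima, whose remainder \<open>r\<close> is small against the weight |V| + |g| + c + 1 with
  the reference Hardy-weight c. Bounds against V^- and |g| are enough: |V| = V + 2 V^- and the Hardy
  inequality for c yield the others. The gradients are handled without weak limits. At the midpoint
  of two minima Q_S >= 0 bounds the gradient energy from below by a quantity with the same limit as
  the energies of the two, and a modulus of convexity independent of x turns this into the Cauchy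
  property. That Q_S(\<Phi>) = 0, which is the claim on S, is then a limit too.\<close>

abbreviation LIMSEQ_input (infix "~~>" 60) where "X ~~> L \<equiv> X \<longlonglongrightarrow> L"

abbreviation scaleR_input (infixr "*r" 75) where "c *r x \<equiv> c *\<^sub>R x"

abbreviation nn_integral_lborel (binder "NL " 10) where "nn_integral_lborel f \<equiv> nn_integral lborel f"

section \<open>Gradients and mollification\<close>

lemma GDERIV_unique:
 assumes "GDERIV f x :> D" "GDERIV f x :> E"
 shows "D = E"
proof -
 have "(%h. inner h D) = (%h. inner h E)"
  using assms has_derivative_unique unfolding gderiv_def by blast
 then have "inner (D - E) D = inner (D - E) E" by metis
 then have "inner (D - E) (D - E) = 0" by (simp add: inner_diff_right)
 then show ?thesis by simp
qed

lemma gradient_eqI: "GDERIV f x :> D ==> gradient f x = D"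
 unfolding gradient_def by (rule the_equality) (auto dest: GDERIV_unique)

lemma GDERIV_gradient:
 fixes f :: "real ^ 'n => real"
 assumes "f differentiable (at x)"
 shows "GDERIV f x :> gradient f x"
proof -
 obtain f' where f': "(f has_derivative f') (at x)"
  using assms by (auto simp: differentiable_def)
 have "f' h = inner h (\<chi> i. f' (axis i 1))" for h
 proof -
  have lin: "linear f'" using f' has_derivative_linear by blast
  have "f' h = f' (\<Sum>i\<in>UNIV. h $ i *r axis i 1)"
   using basis_expansion[of h] by (simp add: scalar_mult_eq_scaleR)
  also have "... = (\<Sum>i\<in>UNIV. h $ i * f' (axis i 1))"
   using lin by (simp add: linear_sum linear_cmul)
  finally show ?thesis by (simp add: inner_vec_def)
 qed
 then have "f' = (%h. inner h (\<chi> i. f' (axis i 1)))" by blast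
 then have "GDERIV f x :> (\<chi> i. f' (axis i 1))"
  using f' unfolding gderiv_def by metis
 then show ?thesis using gradient_eqI by metis
qed

text \<open>\<open>gradient\<close> is a definite description, so smoothness is awkward to verify
  from the definition of \<open>C_k\<close>. With this rule any explicit field of derivatives can be
  used in an induction on the order.\<close>

lemma C_k_SucI:
 assumes "!!x. GDERIV f x :> D x" "!!i. C_k k (%x. D x $ i)"
 shows "C_k (Suc k) f"
proof -
 have "gradient f = D" using assms(1) gradient_eqI by blast
 moreover have "f differentiable (at x)" for x
  using assms(1)[of x] unfolding gderiv_def differentiable_def by blast
 ultimately show ?thesis using assms(2) by simp
qed

lemma C_k_GDERIV: "C_k (Suc k) f ==> GDERIV f x :> gradient f x"
 by (rule GDERIV_gradient) simp

lemma C_k_continuous: "C_k k f ==> continuous_on UNIV f"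
proof (cases k)
 case (Suc m)
 assume "C_k k f"
 with Suc show ?thesis
  by (simp add: continuous_at_imp_continuous_on differentiable_imp_continuous_within)
qed simp

lemma C_k_Suc_imp: "C_k (Suc k) f ==> C_k k f"
proof (induction k arbitrary: f)
 case 0
 then show ?case using C_k_continuous by (metis C_k.simps(1))
next
 case (Suc k)
 then show ?case by (metis C_k.simps(2))
qed

lemma C_k_const: "C_k k (%_. c)"
proof (induction k arbitrary: c)
 case (Suc k)
 show ?case by (rule C_k_SucI[where D="%_. 0"]) (auto simp: Suc GDERIV_const)
qed simp

lemma C_k_component: "C_k k (%x::real^'n. x $ i)"
proof (cases k)
 case (Suc m)
 have "GDERIV (%x. x $ i) x :> axis i (1::real)" for x :: "real ^ 'n"
  unfolding gderiv_def
  by (simp add: inner_axis bounded_linear_vec_nth bounded_linear_imp_has_derivative)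
 then show ?thesis unfolding Suc by (rule C_k_SucI) (rule C_k_const)
qed (simp add: continuous_on_component)

lemma C_k_add:
 assumes "C_k k f" "C_k k g" shows "C_k k (%x. f x + g x)"
 using assms
proof (induction k arbitrary: f g)
 case (Suc k)
 show ?case
  by (rule C_k_SucI[OF GDERIV_add]) (use Suc in \<open>auto intro!: GDERIV_gradient\<close>)
qed (simp add: continuous_on_add)

lemma C_k_mult:
 assumes "C_k k f" "C_k k g" shows "C_k k (%x. f x * g x)"
 using assms
proof (induction k arbitrary: f g)
 case (Suc k)
 have "C_k k f" "C_k k g" using Suc.prems C_k_Suc_imp by blast+
 with Suc show ?case
  by (intro C_k_SucI[OF GDERIV_mult]) (auto intro!: GDERIV_gradient C_k_add)
qed (simp add: continuous_on_mult)

lemma C_k_cmult: "C_k k f ==> C_k k (%x. c * f x)"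
 by (intro C_k_mult C_k_const)

lemma GDERIV_affine:
 assumes "GDERIV f (a + c *r x) :> D"
 shows "GDERIV (%y. f (a + c *r y)) x :> c *r D"
proof -
 have "((%y. a + c *r y) has_derivative (%h. c *r h)) (at x)"
  by (auto intro!: derivative_eq_intros)
 from diff_chain_at[OF this assms[unfolded gderiv_def]] show ?thesis
  unfolding gderiv_def by (simp add: o_def)
qed

lemma C_k_affine: "C_k k f ==> C_k k (%y. f (a + c *r y))"
proof (induction k arbitrary: f)
 case 0
 then show ?case
  by (auto intro!: continuous_on_compose2[of UNIV f] continuous_intros)
next
 case (Suc k)
 show ?case
  by (rule C_k_SucI[OF GDERIV_affine], rule GDERIV_gradient)
    (use Suc in \<open>auto intro!: C_k_cmult\<close>)
qed

text \<open>The bump function only uses \<open>m = 0\<close>. The whole family is introduced because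
  differentiation leads from \<open>m\<close> to \<open>m + 1\<close> and \<open>m + 2\<close>;
  smoothness of all orders is then a single induction, uniform in \<open>m\<close>.\<close>

definition flat :: "nat => real => real" where
 "flat m t = (if t <= 0 then 0 else inverse t ^ m * exp (- inverse t))"

lemma flat_nonneg: "0 <= flat m t" and flat_pos: "0 < t ==> 0 < flat m t"
 and flat_zero: "t <= 0 ==> flat m t = 0"
 by (auto simp: flat_def)

lemma flat_tendsto: "(flat m \<longlongrightarrow> 0) (at_right 0)"
proof -
 have "((%x. x ^ m / exp x) \<longlongrightarrow> 0) (at_top :: real filter)"
  by (rule tendsto_power_div_exp_0)
 then have "((%x. flat m (inverse x)) \<longlongrightarrow> 0) at_top"
  by (rule Lim_transform_eventually)
    (use eventually_gt_at_top[of 0] in \<open>eventually_elim, simp add: flat_def exp_minus field_simps\<close>)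
 then show ?thesis by (simp add: filterlim_at_right_to_top)
qed

lemma DERIV_flat: "DERIV (flat m) t :> - real m * flat (Suc m) t + flat (m + 2) t"
proof -
 consider "t < 0" | "t = 0" | "t > 0" by linarith
 then show ?thesis
 proof cases
  case 1
  have "DERIV (%_. 0) t :> 0" by simp
  then have "DERIV (flat m) t :> 0"
   by (rule has_field_derivative_transform_within_open[where S="{..<0}"]) (use 1 in \<open>auto simp: flat_def\<close>)
  then show ?thesis using 1 by (simp add: flat_def)
 next
  case 2
  have "((%h. (flat m (0 + h) - flat m 0) / h) \<longlongrightarrow> 0) (at 0)"
  proof (rule filterlim_split_at)
   have "((%h::real. 0) \<longlongrightarrow> 0) (at_left 0)" by simp
   then show "((%h. (flat m (0 + h) - flat m 0) / h) \<longlongrightarrow> 0) (at_left 0)"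
    by (rule Lim_transform_eventually) (auto simp: flat_def eventually_at_filter)
   \<comment> \<open>For positive \<open>h\<close> division by \<open>h\<close> raises the index:
     the quotient is \<open>flat (Suc m) h\<close>.\<close>
   show "((%h. (flat m (0 + h) - flat m 0) / h) \<longlongrightarrow> 0) (at_right 0)"
    using flat_tendsto[of "Suc m"]
    by (rule Lim_transform_eventually)
      (auto simp: flat_def eventually_at_filter divide_inverse)
  qed
  then show ?thesis using 2 by (simp add: DERIV_def flat_def)
 next
  case 3
  have inv: "DERIV inverse t :> - (inverse t)\<^sup>2"
   using 3 DERIV_inverse[of t UNIV] by (simp add: numeral_2_eq_2)
  have "DERIV (%t. inverse t ^ m * exp (- inverse t)) t :>
    inverse t ^ m * (exp (- inverse t) * (- (- (inverse t)\<^sup>2))) +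
    (real m * (- (inverse t)\<^sup>2 * inverse t ^ (m - Suc 0))) * exp (- inverse t)"
   by (intro DERIV_mult' DERIV_power DERIV_fun_exp DERIV_minus inv)
  moreover have "inverse t ^ m * (exp (- inverse t) * (- (- (inverse t)\<^sup>2))) +
    (real m * (- (inverse t)\<^sup>2 * inverse t ^ (m - Suc 0))) * exp (- inverse t)
    = - real m * flat (Suc m) t + flat (m + 2) t"
   using 3 by (cases m) (simp_all add: flat_def power2_eq_square algebra_simps)
  ultimately have "DERIV (%t. inverse t ^ m * exp (- inverse t)) t :>
    - real m * flat (Suc m) t + flat (m + 2) t" by simp
  then show ?thesis
   by (rule has_field_derivative_transform_within_open[where S="{0<..}"])
     (use 3 in \<open>auto simp: flat_def\<close>)
 qed
qed

lemma C_k_flat: "C_k k (%x::real^'n. flat m (1 - x \<bullet> x))"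
proof (induction k arbitrary: m)
 case 0
 have "continuous_on UNIV (flat m)"
  using DERIV_flat by (meson DERIV_isCont continuous_at_imp_continuous_on)
 then show ?case
  by (auto intro!: continuous_on_compose2[of UNIV "flat m"] continuous_intros)
next
 case (Suc k)
 have 1: "GDERIV (%x. 1 - x \<bullet> x) x :> (-2) *r x" for x :: "real^'n"
  unfolding gderiv_def
  by (auto intro!: derivative_eq_intros simp: inner_commute algebra_simps)
 show ?case
 proof (rule C_k_SucI[OF GDERIV_DERIV_compose[OF 1 DERIV_flat]])
  fix i :: 'n
  have "C_k k (%x::real^'n. (- real m * flat (Suc m) (1 - x \<bullet> x) + flat (m + 2) (1 - x \<bullet> x)) * ((-2) * x $ i))"
   by (intro C_k_mult C_k_add C_k_const C_k_component Suc)
  then show "C_k k (%x::real^'n. ((- real m * flat (Suc m) (1 - x \<bullet> x) + flat (m + 2) (1 - x \<bullet> x)) *r (- 2 *r x)) $ i)"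
   by (simp only: vector_scaleR_component real_scaleR_def)
 qed
qed

section \<open>Convexity of powers and Jensen's inequality\<close>

lemma powr_tangent:
 fixes a m r :: real
 assumes "0 <= a" "0 <= m" "1 <= r"
 shows "m powr r + r * m powr (r - 1) * (a - m) <= a powr r"
proof -
 \<comment> \<open>The rule for convex differentiable functions needs both points in the open half
   line, so a vanishing \<open>m\<close> (where both powers are 0 by convention) and a vanishing
   \<open>a\<close> are done by hand.\<close>
 consider "m = 0" | "0 < m" "a = 0" | "0 < m" "0 < a" using assms by linarith
 then show ?thesis
 proof cases
  case 2
  have "m powr (r - 1) * m = m powr r" using 2 by (simp add: powr_diff)
  then have "m powr r + r * m powr (r - 1) * (a - m) = (1 - r) * m powr r"
   using 2 by (simp add: algebra_simps)
  also have "... <= 0" using assms by (simp add: mult_nonpos_nonneg)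
  finally show ?thesis using 2 by simp
 next
  case 3
  have "a powr r - m powr r \<ge> r * m powr (r - 1) * (a - m)"
  proof (rule convex_on_imp_above_tangent[OF powr_convex[OF assms(3)]])
   show "((%x. x powr r) has_real_derivative r * m powr (r - 1)) (at m within {0<..})"
    using 3 by (auto intro!: derivative_eq_intros)
  qed (use 3 in \<open>auto simp: interior_open\<close>)
  then show ?thesis by simp
 qed auto
qed

text \<open>The two end points lie above the tangent at the combination; in the weighted sum of
  these two inequalities the linear terms cancel.\<close>

lemma powr_convex_combination:
 fixes x y r t :: real
 assumes "0 <= x" "0 <= y" "1 <= r" "0 <= t" "t <= 1"
 shows "((1 - t) * x + t * y) powr r <= (1 - t) * x powr r + t * y powr r"
proof -
 define m where "m = (1 - t) * x + t * y"
 have m: "0 <= m" using assms by (simp add: m_def)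
 have "(1 - t) * (m powr r + r * m powr (r - 1) * (x - m)) <= (1 - t) * x powr r"
    "t * (m powr r + r * m powr (r - 1) * (y - m)) <= t * y powr r"
  using assms m by (intro mult_left_mono powr_tangent; simp)+
 moreover have "(1 - t) * (m powr r + r * m powr (r - 1) * (x - m)) +
   t * (m powr r + r * m powr (r - 1) * (y - m)) =
   m powr r + r * m powr (r - 1) * ((1 - t) * x + t * y - m)"
  by (simp add: algebra_simps)
 ultimately show ?thesis unfolding m_def[symmetric] by simp
qed

text \<open>Convexity applied to the combination of \<open>a / (1 - t)\<close> and
  \<open>d / t\<close> with weights \<open>1 - t\<close> and \<open>t\<close>. What matters is that
  the factor of the main term \<open>a\<close> tends to 1 as \<open>t\<close> tends to 0; the factor
  of \<open>d\<close> blows up, which is harmless when \<open>d\<close> tends to 0 for each fixed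
  \<open>t\<close>. This takes the place of Minkowski's inequality in the limits below.\<close>

lemma powr_add_le_split:
 fixes a d r t :: real
 assumes "0 <= a" "0 <= d" "1 <= r" "0 < t" "t < 1"
 shows "(a + d) powr r <= (1 - t) powr (1 - r) * a powr r + t powr (1 - r) * d powr r"
proof -
 have e: "s * (x / s) powr r = s powr (1 - r) * x powr r" if "0 < s" "0 <= x" for s x :: real
  using that by (simp add: powr_divide powr_diff)
 show ?thesis
  using powr_convex_combination[of "a / (1 - t)" "d / t" r t] assms
  by (simp add: e)
qed

lemma powr_add_le:
 fixes a d r :: real
 assumes "0 <= a" "0 <= d" "0 <= r"
 shows "(a + d) powr r <= 2 powr r * (a powr r + d powr r)"
proof -
 have "(a + d) powr r <= (2 * max a d) powr r" using assms by (intro powr_mono2) auto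
 also have "... = 2 powr r * max a d powr r" using assms by (simp add: powr_mult)
 also have "... <= 2 powr r * (a powr r + d powr r)" by (intro mult_left_mono) (auto simp: max_def)
 finally show ?thesis .
qed

text \<open>The tangent inequality at the mean, integrated against the probability density
  \<open>w\<close>, loses its linear term. The right side is a nonnegative integral, so
  integrability of \<open>a powr r\<close> against \<open>w\<close> is not presupposed: if it fails,
  the right side is infinite.\<close>

lemma jensen_powr:
 fixes w a :: "'a => real"
 assumes "1 <= r" "!!x. 0 <= w x" "!!x. 0 <= a x"
  and w: "integrable M w" "(LINT x|M. w x) = 1" and wa: "integrable M (%x. w x * a x)"
  and [measurable]: "a \<in> borel_measurable M"
 shows "ennreal ((LINT x|M. w x * a x) powr r) <= (\<integral>\<^sup>+x. ennreal (w x * a x powr r) \<partial>M)"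
proof (cases "(\<integral>\<^sup>+x. ennreal (w x * a x powr r) \<partial>M) < \<infinity>")
 case True
 have [measurable]: "w \<in> borel_measurable M" using w by auto
 have int: "integrable M (%x. w x * a x powr r)"
  by (rule integrableI_nonneg) (use True assms in auto)
 define m where "m = (LINT x|M. w x * a x)"
 have m: "0 <= m" unfolding m_def using assms by (intro integral_nonneg_AE) auto
 have eq: "(%x. w x * (m powr r + r * m powr (r - 1) * (a x - m))) =
   (%x. (m powr r - r * m powr (r - 1) * m) * w x + (r * m powr (r - 1)) * (w x * a x))"
  by (auto simp: fun_eq_iff algebra_simps)
 have "(LINT x|M. w x * (m powr r + r * m powr (r - 1) * (a x - m))) <= (LINT x|M. w x * a x powr r)"
  (is "?L <= ?R")
 proof (rule integral_mono)
  show "integrable M (%x. w x * (m powr r + r * m powr (r - 1) * (a x - m)))"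
   unfolding eq using w(1) wa by simp
 qed (use int assms m powr_tangent in \<open>auto intro!: mult_left_mono\<close>)
 also have "?L = m powr r"
  unfolding eq using w wa by (simp add: m_def)
 finally have "m powr r <= ?R" .
 then show ?thesis
  unfolding m_def using nn_integral_eq_integral[OF int] assms by (simp add: ennreal_leI)
next
 case False
 then show ?thesis by (simp add: not_less top_unique)
qed

section \<open>Translations, reflections and functions of compact support\<close>

lemma lborel_distr_reflect:
 fixes c :: "'a::euclidean_space" shows "distr lborel borel (%x. c - x) = lborel"
 by (subst (2) lborel_affine[of "-1" c]) (auto simp: density_1)

lemma nn_integral_lborel_shift:
 fixes c :: "'a::euclidean_space"
 assumes [measurable]: "f \<in> borel_measurable borel"
 shows "(NL x. f (c + x)) = (NL x. f x)"
  and "(NL x. f (c - x)) = (NL x. f x)"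
 using nn_integral_distr[of "(+) c" lborel borel f] nn_integral_distr[of "%x. c - x" lborel borel f]
 by (simp_all add: lborel_distr_plus lborel_distr_reflect)

lemma integral_lborel_shift:
 fixes c :: "'a::euclidean_space" and f :: "'a => 'b::{banach, second_countable_topology}"
 assumes [measurable]: "f \<in> borel_measurable borel"
 shows "(LINT x|lborel. f (c + x)) = (LINT x|lborel. f x)"
  and "(LINT x|lborel. f (c - x)) = (LINT x|lborel. f x)"
  and "integrable lborel (%x. f (c + x)) \<longleftrightarrow> integrable lborel f"
  and "integrable lborel (%x. f (c - x)) \<longleftrightarrow> integrable lborel f"
 using integral_distr[of "(+) c" lborel borel f] integral_distr[of "%x. c - x" lborel borel f]
  integrable_distr_eq[of "(+) c" lborel borel f] integrable_distr_eq[of "%x. c - x" lborel borel f]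
 by (simp_all add: lborel_distr_plus lborel_distr_reflect)

lemma integrable_continuous_compact_support:
 fixes f :: "'a::euclidean_space => 'b::{banach, second_countable_topology}"
 assumes "continuous_on UNIV f" "compact K" "!!x. x \<notin> K ==> f x = 0"
 shows "integrable lborel f"
proof -
 have "(%x. indicator K x *r f x) = f" using assms(3) by (auto simp: indicator_def)
 then show ?thesis
  using borel_integrable_compact[OF assms(2) continuous_on_subset[OF assms(1)]] by simp
qed

lemma compact_support_bounded:
 fixes f :: "'a::euclidean_space => 'b::real_normed_vector"
 assumes "continuous_on UNIV f" "compact K" "!!x. x \<notin> K ==> f x = 0"
 obtains B where "0 < B" "!!x. norm (f x) <= B"
proof -
 have "bounded (f ` K)"
  using assms by (intro compact_imp_bounded compact_continuous_image) (auto intro: continuous_on_subset)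
 then obtain B where "0 < B" "\<forall>x\<in>K. norm (f x) <= B" unfolding bounded_pos by auto
 then show thesis using that[of B] assms(3) by (metis less_imp_le norm_zero)
qed

lemma compact_support_uniformly_continuous:
 fixes f :: "'a::euclidean_space => 'b::real_normed_vector"
 assumes "continuous_on UNIV f" "compact K" "!!x. x \<notin> K ==> f x = 0" "0 < e"
 obtains d where "0 < d" "!!x y. norm (x - y) < d ==> norm (f x - f y) < e"
proof -
 obtain R where R: "!!x. x \<in> K ==> norm x <= R"
  using compact_imp_bounded[OF assms(2)] by (auto simp: bounded_iff)
 have "uniformly_continuous_on (cball 0 (R + 1)) f"
  by (intro compact_uniformly_continuous continuous_on_subset[OF assms(1)]) auto
 then obtain d where d: "0 < d"
  "!!x y. [|x \<in> cball 0 (R + 1); y \<in> cball 0 (R + 1); dist y x < d|] ==> dist (f y) (f x) < e"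
  using \<open>0 < e\<close> unfolding uniformly_continuous_on_def by metis
 show thesis
 \<comment> \<open>The cap 1 puts a point this close to a point of \<open>K\<close> into the ball of
   radius \<open>R + 1\<close>, where uniform continuity is known; two points off \<open>K\<close>
   need no estimate.\<close>
 proof (rule that[of "min d 1"])
  fix x y :: 'a assume xy: "norm (x - y) < min d 1"
  have n: "norm x <= norm y + norm (x - y)" "norm y <= norm x + norm (x - y)"
   using norm_triangle_sub[of x y] norm_triangle_sub[of y x] by (simp_all add: norm_minus_commute)
  show "norm (f x - f y) < e"
  proof (cases "x \<in> K \<or> y \<in> K")
   case True
   then have "norm x <= R + 1" "norm y <= R + 1" using R n xy by fastforce+
   then show ?thesis using d(2)[of y x] xy by (simp add: dist_norm)
  qed (use assms in auto)
 qed (use d in auto)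
qed

lemma GDERIV_continuous_on:
 assumes "!!x. GDERIV f x :> D x" shows "continuous_on A f"
proof (rule continuous_at_imp_continuous_on, rule ballI)
 fix x show "isCont f x"
  using has_derivative_continuous[OF assms[of x, unfolded gderiv_def]] .
qed

lemma GDERIV_zero_off_closed:
 assumes "closed K" "!!x. x \<notin> K ==> f x = 0" "x \<notin> K"
 shows "GDERIV f x :> 0"
proof -
 have "((%_. 0::real) has_derivative (%_. 0)) (at x)" by simp
 then have "(f has_derivative (%_. 0)) (at x)"
  by (rule has_derivative_transform_within_open[where s="- K"]) (use assms in auto)
 then show ?thesis by (simp add: gderiv_def)
qed

lemma C_k_continuous_gradient:
 fixes f :: "real ^ 'n => real"
 assumes "C_k (Suc k) f" shows "continuous_on UNIV (gradient f)"
proof -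
 have "continuous_on UNIV (%x. gradient f x $ i)" for i
  using assms C_k_continuous by auto
 then have "continuous_on UNIV (%x. \<chi> i. gradient f x $ i)"
  by (rule continuous_on_vec_lambda)
 then show ?thesis by simp
qed

lemma GDERIV_bound:
 fixes f :: "real ^ 'n => real"
 assumes "convex S" "!!x. x \<in> S ==> GDERIV f x :> D x" "!!x. x \<in> S ==> norm (D x) <= B" "x \<in> S" "y \<in> S"
 shows "\<bar>f x - f y\<bar> <= B * norm (x - y)"
proof -
 have "norm (f x - f y) <= B * norm (x - y)"
 proof (rule differentiable_bound[OF \<open>convex S\<close>])
  show "(f has_derivative (%h. h \<bullet> D x)) (at x within S)" if "x \<in> S" for x
   using assms(2)[OF that] unfolding gderiv_def by (rule has_derivative_at_withinI)
  show "onorm (%h. h \<bullet> D x) <= B" if "x \<in> S" for x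
  proof (rule onorm_le)
   fix h show "norm (h \<bullet> D x) <= B * norm h"
    using Cauchy_Schwarz_ineq2[of h "D x"] mult_right_mono[OF assms(3)[OF that], of "norm h"]
    by (simp add: mult.commute)
  qed
 qed (use assms in auto)
 then show ?thesis by simp
qed

text \<open>Translation invariance makes the integral of every difference quotient of
  \<open>f\<close> zero, and dominated convergence carries this over to the partial derivatives.
  Applied to products it is integration by parts for smooth functions.\<close>

lemma integral_GDERIV_zero:
 fixes f :: "real ^ 'n => real"
 assumes der: "!!x. GDERIV f x :> D x" and cont: "continuous_on UNIV D"
  and K: "compact K" "!!x. x \<notin> K ==> f x = 0"
 shows "(LINT x|lborel. D x) = 0" "integrable lborel D"
proof -
 have D0: "D x = 0" if "x \<notin> K" for x
  by (rule GDERIV_unique[OF der GDERIV_zero_off_closed[OF compact_imp_closed[OF K(1)] K(2) that]])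
 show intD: "integrable lborel D"
  by (rule integrable_continuous_compact_support[OF cont K(1) D0])
 obtain B where B: "0 < B" "!!x. norm (D x) <= B"
  using compact_support_bounded[OF cont K(1) D0] by blast
 have contf: "continuous_on UNIV f"
  by (rule GDERIV_continuous_on[OF der])
 have [measurable]: "f \<in> borel_measurable borel" using contf by (rule borel_measurable_continuous_onI)
 have [measurable]: "D \<in> borel_measurable borel" using cont by (rule borel_measurable_continuous_onI)
 have intf: "integrable lborel f"
  by (rule integrable_continuous_compact_support[OF contf K])
 have "(LINT x|lborel. D x) $ i = 0" for i
 proof -
  define e :: "real^'n" where "e = axis i 1"
  have ne: "norm e = 1" by (simp add: e_def norm_axis_1)
  define h where "h m = inverse (real (Suc m))" for m
  have h: "0 < h m" "h m <= 1" for m by (auto simp: h_def field_simps)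
  define s where "s m x = (f (h m *r e + x) - f x) / h m" for m x
  \<comment> \<open>A compact set off which all the difference quotients vanish, the steps
    \<open>h m\<close> being at most 1; it carries the dominating function.\<close>
  define K' where "K' = (%(a, b). a - b) ` (K \<times> cball (0::real^'n) 1)"
  have K': "compact K'" unfolding K'_def
   by (intro compact_continuous_image compact_Times K) (auto intro!: continuous_intros simp: case_prod_beta)
  have KK': "K \<subseteq> K'" unfolding K'_def by force
  have "(%m. LINT x|lborel. s m x) ~~> (LINT x|lborel. D x \<bullet> e)"
  proof (rule integral_dominated_convergence[where w="%x. B * indicator K' x"])
   show "integrable lborel (%x. B * indicator K' x)"
    using emeasure_compact_finite[OF K'] K' by (auto intro!: integrable_real_indicator borel_compact)
   show "AE x in lborel. (%m. s m x) ~~> D x \<bullet> e"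
   proof (rule AE_I2)
    fix x
    have "((%y. x + y *r e) has_derivative (%y. y *r e)) (at 0)"
     by (auto intro!: derivative_eq_intros)
    moreover have "(f has_derivative (%h. h \<bullet> D x)) (at (x + 0 *r e))"
     using der[of x] by (simp add: gderiv_def)
    ultimately have "((%y. f (x + y *r e)) has_derivative (%y. (y *r e) \<bullet> D x)) (at 0)"
     using diff_chain_at[of "%y. x + y *r e" "%y. y *r e" 0 f "%h. h \<bullet> D x"] by (simp add: o_def)
    then have "DERIV (%y. f (x + y *r e)) 0 :> D x \<bullet> e"
     unfolding has_field_derivative_def
     by (rule has_derivative_eq_rhs) (auto simp: inner_commute mult.commute)
    then have "((%y. (f (x + y *r e) - f x) / y) \<longlongrightarrow> D x \<bullet> e) (at 0)"
     by (simp add: DERIV_def)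
    moreover have "filterlim h (at 0) sequentially"
     unfolding filterlim_at using LIMSEQ_inverse_real_of_nat
     by (auto simp: h_def[abs_def] intro!: always_eventually)
    ultimately have "(%m. (f (x + h m *r e) - f x) / h m) ~~> D x \<bullet> e"
     by (rule filterlim_compose)
    then show "(%m. s m x) ~~> D x \<bullet> e" by (simp add: s_def add.commute)
   qed
   show "AE x in lborel. norm (s m x) <= B * indicator K' x" for m
   proof (rule AE_I2)
    fix x
    have 1: "\<bar>f (h m *r e + x) - f x\<bar> <= B * h m"
     using GDERIV_bound[of UNIV f D B "h m *r e + x" x] der B h[of m] ne by simp
    have 2: "s m x = 0" if "x \<notin> K'"
    proof -
     have "x \<notin> K" using that KK' by auto
     moreover have "h m *r e + x \<notin> K"
     proof
      assume "h m *r e + x \<in> K"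
      then have "(h m *r e + x) - h m *r e \<in> K'"
       unfolding K'_def using h[of m] ne
       by (intro image_eqI[where x="(h m *r e + x, h m *r e)"]) auto
      then show False using that by simp
     qed
     ultimately show ?thesis by (simp add: s_def K)
    qed
    show "norm (s m x) <= B * indicator K' x"
     using 1 2 h[of m] by (cases "x \<in> K'") (auto simp: s_def divide_simps)
   qed
  qed (auto simp: s_def[abs_def])
  moreover have "(LINT x|lborel. s m x) = 0" for m
   unfolding s_def using intf integral_lborel_shift[of f "h m *r e"] by simp
  ultimately have "(LINT x|lborel. D x \<bullet> e) = 0" by (simp add: LIMSEQ_const_iff)
  then have "(LINT x|lborel. D x) \<bullet> e = 0" using intD by simp
  then show ?thesis by (simp add: e_def inner_axis)
 qed
 then show "(LINT x|lborel. D x) = 0" by (simp add: vec_eq_iff)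
qed

text \<open>Only the kernel has to be differentiable. Its gradient is uniformly continuous, being
  continuous with compact support, so the first order expansion of the kernel is uniform in the base
  point and its error can be integrated against |f|.\<close>

lemma GDERIV_convolution:
 fixes f :: "real ^ 'n => real"
 assumes f: "integrable lborel f"
  and der: "!!x. GDERIV \<eta> x :> D x" and cont: "continuous_on UNIV D"
  and K: "compact K" "!!x. x \<notin> K ==> \<eta> x = 0"
 shows "GDERIV (%x. LINT y|lborel. \<eta> (x - y) * f y) x :> (LINT y|lborel. f y *r D (x - y))"
proof -
 have D0: "D x = 0" if "x \<notin> K" for x
  by (rule GDERIV_unique[OF der GDERIV_zero_off_closed[OF compact_imp_closed[OF K(1)] K(2) that]])
 have cont\<eta>: "continuous_on UNIV \<eta>"
  by (rule GDERIV_continuous_on[OF der])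
 have [measurable]: "\<eta> \<in> borel_measurable borel" using cont\<eta> by (rule borel_measurable_continuous_onI)
 have [measurable]: "D \<in> borel_measurable borel" using cont by (rule borel_measurable_continuous_onI)
 have [measurable]: "f \<in> borel_measurable borel" using f by (auto dest: borel_measurable_integrable)
 obtain B where B: "0 < B" "!!x. norm (D x) <= B"
  using compact_support_bounded[OF cont K(1) D0] by blast
 obtain B' where B': "0 < B'" "!!x. norm (\<eta> x) <= B'"
  using compact_support_bounded[OF cont\<eta> K] by blast
 have i1: "integrable lborel (%y. \<eta> (x - y) * f y)" for x
  by (rule Bochner_Integration.integrable_bound[where f="%y. B' * f y"])
    (use f B' in \<open>auto simp: abs_mult intro!: mult_right_mono\<close>)
 have i2: "integrable lborel (%y. f y *r D (x - y))" for x
  by (rule Bochner_Integration.integrable_bound[where f="%y. f y * B"])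
    (use f B in \<open>auto simp: abs_mult intro!: mult_left_mono\<close>)
 define G where "G = (LINT y|lborel. f y *r D (x - y))"
 define C where "C = (LINT y|lborel. \<bar>f y\<bar>)"
 have C: "0 <= C" unfolding C_def by simp
 have "\<exists>d>0. \<forall>z. norm (z - x) < d -->
   norm ((LINT y|lborel. \<eta> (z - y) * f y) - (LINT y|lborel. \<eta> (x - y) * f y) - (z - x) \<bullet> G)
    <= e * norm (z - x)" if e: "0 < e" for e
 proof -
  \<comment> \<open>\<open>C + 1\<close> rather than \<open>C\<close>, which is zero if
    \<open>f\<close> vanishes almost everywhere.\<close>
  define e' where "e' = e / (C + 1)"
  have e': "0 < e'" using e C by (simp add: e'_def)
  obtain d where d: "0 < d" "!!x y. norm (x - y) < d ==> norm (D x - D y) < e'"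
   using compact_support_uniformly_continuous[OF cont K(1) D0 e'] by blast
  \<comment> \<open>The mean value inequality for \<eta> minus its linear part at \<open>a\<close>:
    the gradient of this difference is at most \<open>e'\<close> on the ball around
    \<open>a\<close>.\<close>
  have key: "\<bar>\<eta> (a + h) - \<eta> a - h \<bullet> D a\<bar> <= e' * norm h" if "norm h < d" for a h
  proof -
   have "\<bar>(\<eta> (a + h) - (a + h) \<bullet> D a) - (\<eta> a - a \<bullet> D a)\<bar> <= e' * norm ((a + h) - a)"
   proof (rule GDERIV_bound[where S="ball a d"])
    fix z assume z: "z \<in> ball a d"
    have "GDERIV (%z. z \<bullet> D a) z :> D a"
     unfolding gderiv_def by (auto intro!: derivative_eq_intros)
    then show "GDERIV (%z. \<eta> z - z \<bullet> D a) z :> D z - D a"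
     by (intro GDERIV_diff der)
    show "norm (D z - D a) <= e'"
     using d(2)[of z a] z by (simp add: dist_norm norm_minus_commute)
   qed (use that d in \<open>auto simp: dist_norm\<close>)
   then show ?thesis by (simp add: inner_add_left algebra_simps)
  qed
  show ?thesis
  proof (intro exI[of _ d] conjI allI impI d)
   fix z assume z: "norm (z - x) < d"
   have i3: "integrable lborel (%y. (z - x) \<bullet> (f y *r D (x - y)))"
    using i2[of x] by (rule integrable_inner_right)
   have "(LINT y|lborel. \<eta> (z - y) * f y) - (LINT y|lborel. \<eta> (x - y) * f y) - (z - x) \<bullet> G
    = (LINT y|lborel. \<eta> (z - y) * f y - \<eta> (x - y) * f y - (z - x) \<bullet> (f y *r D (x - y)))"
    unfolding G_def integral_inner_right[OF i2[of x], symmetric]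
    using i1 i3 by (simp only: Bochner_Integration.integral_diff Bochner_Integration.integrable_diff)
   also have "norm ... <= (LINT y|lborel. e' * norm (z - x) * \<bar>f y\<bar>)"
   proof (rule Bochner_Integration.integral_norm_bound_integral)
    fix y
    have "\<bar>\<eta> (z - y) - \<eta> (x - y) - (z - x) \<bullet> D (x - y)\<bar> <= e' * norm (z - x)"
     using key[of "z - x" "x - y"] z by simp
    from mult_right_mono[OF this, of "\<bar>f y\<bar>"]
    show "norm (\<eta> (z - y) * f y - \<eta> (x - y) * f y - (z - x) \<bullet> (f y *r D (x - y))) <=
     e' * norm (z - x) * \<bar>f y\<bar>"
     by (simp add: abs_mult[symmetric] algebra_simps)
   qed (use i1 i3 f in auto)
   also have "... = e * norm (z - x) * (C / (C + 1))" by (simp add: C_def e'_def)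
   also have "... <= e * norm (z - x) * 1" using C e by (intro mult_left_mono) auto
   finally show "norm ((LINT y|lborel. \<eta> (z - y) * f y) - (LINT y|lborel. \<eta> (x - y) * f y) - (z - x) \<bullet> G)
    <= e * norm (z - x)" by simp
  qed
 qed
 then show ?thesis
  unfolding gderiv_def has_derivative_at_alt G_def[symmetric]
  by (auto intro: bounded_linear_inner_left)
qed

text \<open>The induction runs over all kernels at once: a partial derivative of the convolution is
  the convolution with the same partial derivative of the kernel, which is again smooth and vanishes
  off the same compact set.\<close>

lemma C_k_convolution:
 fixes f :: "real ^ 'n => real"
 assumes f: "integrable lborel f"
  and "!!k. C_k k \<eta>" and K: "compact K" "!!x. x \<notin> K ==> \<eta> x = 0"
 shows "C_k k (%x. LINT y|lborel. \<eta> (x - y) * f y)"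
 using assms(2-)
proof (induction k arbitrary: \<eta>)
 case (0 \<eta>)
 have "GDERIV \<eta> x :> gradient \<eta> x" for x by (rule C_k_GDERIV[OF 0(1)])
 moreover have "continuous_on UNIV (gradient \<eta>)"
  by (rule C_k_continuous_gradient[OF 0(1)])
 ultimately have "GDERIV (%x. LINT y|lborel. \<eta> (x - y) * f y) x :> (LINT y|lborel. f y *r gradient \<eta> (x - y))" for x
  by (rule GDERIV_convolution[OF f _ _ 0(2,3)])
 from GDERIV_continuous_on[OF this] show ?case by simp
next
 case (Suc k \<eta>)
 have 1: "GDERIV \<eta> x :> gradient \<eta> x" for x by (rule C_k_GDERIV[OF Suc(2)])
 have 2: "continuous_on UNIV (gradient \<eta>)"
  by (rule C_k_continuous_gradient[OF Suc(2)])
 have g0: "gradient \<eta> x = 0" if "x \<notin> K" for x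
  by (rule gradient_eqI[OF GDERIV_zero_off_closed[OF compact_imp_closed[OF Suc(3)] Suc(4) that]])
 show ?case
 proof (rule C_k_SucI[OF GDERIV_convolution[OF f 1 2 Suc(3,4)]])
  fix i
  have "(LINT y|lborel. f y *r gradient \<eta> (x - y)) $ i = (LINT y|lborel. gradient \<eta> (x - y) $ i * f y)" for x
  proof -
   obtain B where B: "0 < B" "!!x. norm (gradient \<eta> x) <= B"
    using compact_support_bounded[OF 2 Suc(3) g0] by blast
   have [measurable]: "gradient \<eta> \<in> borel_measurable borel" using 2 by (rule borel_measurable_continuous_onI)
   have [measurable]: "f \<in> borel_measurable borel" using f by (auto dest: borel_measurable_integrable)
   have "integrable lborel (%y. f y *r gradient \<eta> (x - y))"
    by (rule Bochner_Integration.integrable_bound[where f="%y. f y * B"])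
      (use f B in \<open>auto simp: abs_mult intro!: mult_left_mono\<close>)
   then have "(LINT y|lborel. f y *r gradient \<eta> (x - y)) \<bullet> axis i 1 = (LINT y|lborel. (f y *r gradient \<eta> (x - y)) \<bullet> axis i 1)"
    by (rule integral_inner_left[symmetric])
   then show ?thesis by (simp add: inner_axis mult.commute)
  qed
  moreover have "C_k k (%x. LINT y|lborel. gradient \<eta> (x - y) $ i * f y)"
  proof (rule Suc.IH)
   show "C_k k (%x. gradient \<eta> x $ i)" for k using Suc(2)[of "Suc k"] by simp
  qed (use Suc(3) g0 in auto)
  ultimately show "C_k k (%x. (LINT y|lborel. f y *r gradient \<eta> (x - y)) $ i)" by simp
 qed
qed

section \<open>Mollifiers, convolution and cut-off functions\<close>

lemma AE_avoid_open_imp_empty: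
 fixes S :: "'a::euclidean_space set"
 assumes "open S" "AE x in lborel. x \<notin> S" shows "S = {}"
proof -
 have "AE x in lebesgue. x \<notin> S" using assms(2) by (rule AE_completion)
 then have "S \<in> null_sets lebesgue"
  using assms(1) by (subst AE_iff_null_sets) (auto intro: borel_open)
 then show ?thesis
  using assms(1) open_not_negligible negligible_iff_null_sets by blast
qed

text \<open>\<open>flat 0\<close> of 1 - |x/e|^2 is the classical bump exp(-1 / (1 - |x/e|^2)),
  which is zero off the ball of radius \<open>e\<close>; the division gives it integral 1.\<close>

definition mollifier :: "real => real ^ 'n => real" where
 "mollifier e x = flat 0 (1 - (x /\<^sub>R e) \<bullet> (x /\<^sub>R e)) /
   (LINT y|lborel. flat 0 (1 - (y /\<^sub>R e) \<bullet> (y /\<^sub>R e :: real ^ 'n)))"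

lemma mollifier:
 fixes x :: "real ^ 'n"
 assumes "0 < e"
 shows C_k_mollifier: "C_k k (mollifier e :: real ^ 'n => real)"
  and mollifier_nonneg: "0 <= mollifier e x"
  and mollifier_zero: "e <= norm x ==> mollifier e x = 0"
  and mollifier_int: "integrable lborel (mollifier e :: real ^ 'n => real)"
   "(LINT x|lborel. mollifier e (x :: real ^ 'n)) = 1"
proof -
 define b :: "real ^ 'n => real" where "b x = flat 0 (1 - (x /\<^sub>R e) \<bullet> (x /\<^sub>R e))" for x
 have Cb: "C_k k b" for k
  using C_k_affine[OF C_k_flat[of k 0], of 0 "inverse e"] unfolding b_def by (simp add: fun_eq_iff)
 have b0: "0 <= b x" for x by (simp add: b_def flat_nonneg)
 have bz: "b x = 0" if "e <= norm x" for x
 proof -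
  have "1 <= norm (x /\<^sub>R e)" using that assms by (simp add: field_simps)
  then have "1 <= norm (x /\<^sub>R e) ^ 2" by (metis one_le_power)
  then show ?thesis unfolding b_def power2_norm_eq_inner by (intro flat_zero) simp
 qed
 have bp: "0 < b x" if "norm x < e" for x
 proof -
  have "norm (x /\<^sub>R e) < 1" using that assms by (simp add: field_simps)
  then have "norm (x /\<^sub>R e) ^ 2 < 1" by (simp add: abs_square_less_1)
  then show ?thesis unfolding b_def power2_norm_eq_inner by (intro flat_pos) simp
 qed
 have intb: "integrable lborel b"
  by (rule integrable_continuous_compact_support[OF C_k_continuous[OF Cb] compact_cball[of 0 e]])
    (use bz in auto)
 have pos: "0 < (LINT y|lborel. b y)"
 proof -
  have "(LINT y|lborel. b y) \<noteq> 0"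
  proof
   assume "(LINT y|lborel. b y) = 0"
   then have "AE y in lborel. b y = 0"
    using integral_nonneg_eq_0_iff_AE[OF intb] b0 by simp
   then have "AE y in lborel. y \<notin> ball (0 :: real ^ 'n) e"
    by eventually_elim (use bp in force)
   then have "ball (0 :: real ^ 'n) e = {}" by (intro AE_avoid_open_imp_empty) auto
   then show False using assms by simp
  qed
  moreover have "0 <= (LINT y|lborel. b y)" using b0 by simp
  ultimately show ?thesis by simp
 qed
 have m: "mollifier e = (%x. inverse (LINT y|lborel. b y) * b x)"
  by (auto simp: mollifier_def b_def fun_eq_iff divide_inverse)
 show "C_k k (mollifier e :: real ^ 'n => real)" unfolding m by (rule C_k_cmult[OF Cb])
 show "0 <= mollifier e x" unfolding m using pos b0 by simp
 show "e <= norm x ==> mollifier e x = 0" unfolding m using bz by simp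
 show "integrable lborel (mollifier e :: real ^ 'n => real)" unfolding m using intb by simp
 show "(LINT x|lborel. mollifier e (x :: real ^ 'n)) = 1" unfolding m using pos by simp
qed

lemma borel_measurable_mollifier [measurable]:
 assumes "0 < e" shows "mollifier e \<in> borel_measurable borel"
 using C_k_continuous[OF C_k_mollifier[OF assms]] by (rule borel_measurable_continuous_onI)

definition conv :: "real => (real ^ 'n => 'b::euclidean_space) => real ^ 'n => 'b" where
 "conv e f x = (LINT y|lborel. mollifier e (x - y) *r f y)"

lemma integrable_mollifier_scaleR:
 fixes f :: "real ^ 'n => 'b::euclidean_space"
 assumes "0 < e" "integrable lborel f"
 shows "integrable lborel (%y. mollifier e (x - y) *r f y)"
proof -
 note [measurable] = borel_measurable_mollifier[OF assms(1)]
 have [measurable]: "f \<in> borel_measurable borel" using assms(2) by (auto dest: borel_measurable_integrable)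
 obtain B where B: "!!x::real^'n. norm (mollifier e x) <= B"
  using compact_support_bounded[OF C_k_continuous[OF C_k_mollifier[OF assms(1)]] compact_cball[of 0 e]]
   mollifier_zero[OF assms(1)] by (metis linorder_not_le mem_cball_0 less_imp_le)
 then have B': "\<bar>mollifier e (x::real^'n)\<bar> <= \<bar>B\<bar>" for x by (simp add: order_trans[OF _ abs_ge_self])
 show ?thesis
  by (rule Bochner_Integration.integrable_bound[where f="%y. B *r f y"])
    (use assms B' in \<open>auto intro!: mult_right_mono\<close>)
qed

lemma mollifier_shift_int:
 fixes x :: "real ^ 'n"
 assumes "0 < e"
 shows "integrable lborel (%y. mollifier e (x - y))" "(LINT y|lborel. mollifier e (x - y)) = 1"
proof -
 note [measurable] = borel_measurable_mollifier[OF assms(1)]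
 show "integrable lborel (%y. mollifier e (x - y))" "(LINT y|lborel. mollifier e (x - y)) = 1"
  using integral_lborel_shift[of "mollifier e" x] mollifier_int[OF assms] by simp_all
qed

lemma conv_zero:
 assumes "0 < e" "!!y. norm (x - y) < e ==> f y = 0"
 shows "conv e f x = 0"
proof -
 have "(%y. mollifier e (x - y) *r f y) = (%_. 0)"
 proof
  fix y show "mollifier e (x - y) *r f y = 0"
   using assms(2)[of y] mollifier_zero[OF assms(1), of "x - y"] by (cases "norm (x - y) < e") auto
 qed
 then show ?thesis by (simp add: conv_def)
qed

lemma conv_diff_eq:
 fixes f :: "real ^ 'n => 'b::euclidean_space"
 assumes "0 < e" "integrable lborel f"
 shows "conv e f x - c = (LINT y|lborel. mollifier e (x - y) *r (f y - c))"
  and "integrable lborel (%y. mollifier e (x - y) *r (f y - c))"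
 using mollifier_shift_int[OF assms(1), of x] integrable_mollifier_scaleR[OF assms]
 by (simp_all add: conv_def scaleR_diff_right)

text \<open>The kernel has integral 1, so \<open>c\<close> can be subtracted under the integral, and
  only points closer than \<open>e\<close> contribute.\<close>

lemma norm_conv_diff_le:
 fixes f :: "real ^ 'n => 'b::euclidean_space"
 assumes "0 < e" "integrable lborel f" "!!y. norm (x - y) < e ==> norm (f y - c) <= B"
 shows "norm (conv e f x - c) <= B"
proof -
 have "norm (conv e f x - c) <= (LINT y|lborel. B * mollifier e (x - y))"
  unfolding conv_diff_eq[OF assms(1,2)]
 proof (rule Bochner_Integration.integral_norm_bound_integral)
  fix y
  show "norm (mollifier e (x - y) *r (f y - c)) <= B * mollifier e (x - y)"
   using assms(3)[of y] mollifier_zero[OF assms(1), of "x - y"] mollifier_nonneg[OF assms(1), of "x - y"]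
   by (cases "norm (x - y) < e") (auto simp: mult.commute[of B] mult_left_mono)
 qed (use conv_diff_eq[OF assms(1,2)] mollifier_shift_int[OF assms(1), of x] in auto)
 then show ?thesis using mollifier_shift_int[OF assms(1), of x] by simp
qed

lemma conv_Cc_infty:
 fixes f :: "real ^ 'n => real"
 assumes "0 < e" "integrable lborel f" "compact K" "!!y. y \<notin> K ==> f y = 0"
  and "!!x z. x \<in> K ==> norm z <= e ==> x + z \<in> U"
 shows "conv e f \<in> Cc_infty U"
proof -
 have C: "C_k k (conv e f)" for k
 proof -
  have "C_k k (%x. LINT y|lborel. mollifier e (x - y) * f y)"
   by (rule C_k_convolution[OF assms(2) C_k_mollifier[OF assms(1)] compact_cball[of 0 e]])
     (auto intro!: mollifier_zero assms(1))
  then show ?thesis by (simp add: conv_def[abs_def])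
 qed
 define K' where "K' = {x + z | x z. x \<in> K \<and> z \<in> cball 0 e}"
 have "compact K'" unfolding K'_def by (intro compact_sums assms compact_cball)
 moreover have "K' \<subseteq> U" unfolding K'_def using assms(5) by auto
 moreover have "conv e f x = 0" if "x \<notin> K'" for x
 proof (rule conv_zero[OF assms(1)])
  fix y assume "norm (x - y) < e"
  have "y \<notin> K"
  proof
   assume "y \<in> K"
   then have "y + (x - y) \<in> K'" unfolding K'_def using \<open>norm (x - y) < e\<close>
    by (intro CollectI exI[of _ y] exI[of _ "x - y"]) auto
   then show False using that by simp
  qed
  then show "f y = 0" by (rule assms(4))
 qed
 ultimately show ?thesis unfolding Cc_infty_def Cc_def using C C_k_continuous[OF C] by blast
qed

lemma Cc_inftyD:
 fixes \<psi> :: "real ^ 'n => real"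
 assumes "\<psi> \<in> Cc_infty U"
 shows "GDERIV \<psi> x :> gradient \<psi> x" "continuous_on A (gradient \<psi>)" "continuous_on A \<psi>" "C_k k \<psi>"
  and "\<exists>K. compact K \<and> K \<subseteq> U \<and> (\<forall>x. x \<notin> K --> \<psi> x = 0 \<and> gradient \<psi> x = 0)"
proof -
 show C: "C_k k \<psi>" for k using assms by (simp add: Cc_infty_def)
 show "GDERIV \<psi> x :> gradient \<psi> x" by (rule C_k_GDERIV[OF C])
 show "continuous_on A (gradient \<psi>)" using C_k_continuous_gradient[OF C] continuous_on_subset by blast
 show "continuous_on A \<psi>" using C_k_continuous[OF C] continuous_on_subset by blast
 obtain K where "compact K" "K \<subseteq> U" "\<forall>x. x \<notin> K --> \<psi> x = 0"
  using assms by (auto simp: Cc_infty_def Cc_def)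
 then show "\<exists>K. compact K \<and> K \<subseteq> U \<and> (\<forall>x. x \<notin> K --> \<psi> x = 0 \<and> gradient \<psi> x = 0)"
  using GDERIV_zero_off_closed[of K \<psi>] gradient_eqI compact_imp_closed by metis
qed

lemma Cc_infty_bounded:
 fixes \<psi> :: "real ^ 'n => real"
 assumes "\<psi> \<in> Cc_infty U"
 obtains B where "0 < B" "!!x. \<bar>\<psi> x\<bar> <= B" "!!x. norm (gradient \<psi> x) <= B"
proof -
 obtain K where K: "compact K" "!!x. x \<notin> K ==> \<psi> x = 0" "!!x. x \<notin> K ==> gradient \<psi> x = 0"
  using Cc_inftyD(5)[OF assms] by blast
 obtain B1 where "0 < B1" "!!x. norm (\<psi> x) <= B1"
  using compact_support_bounded[OF Cc_inftyD(3)[OF assms] K(1,2)] by blast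
 moreover obtain B2 where "0 < B2" "!!x. norm (gradient \<psi> x) <= B2"
  using compact_support_bounded[OF Cc_inftyD(2)[OF assms] K(1,3)] by blast
 ultimately show thesis by (intro that[of "B1 + B2"]) (smt (verit) real_norm_def)+
qed

lemma Cc_infty_mono: "U \<subseteq> U' ==> Cc_infty U \<subseteq> Cc_infty U'"
 unfolding Cc_infty_def Cc_def by (blast intro: order_trans)

lemma Cc_infty_mult:
 assumes "!!k. C_k k f" "\<zeta> \<in> Cc_infty U"
 shows "(%x. f x * \<zeta> x) \<in> Cc_infty U"
proof -
 have C: "C_k k (%x. f x * \<zeta> x)" for k
  using assms by (intro C_k_mult) (auto simp: Cc_infty_def)
 obtain K where "compact K" "K \<subseteq> U" "\<forall>x. x \<notin> K --> \<zeta> x = 0"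
  using assms(2) by (auto simp: Cc_infty_def Cc_def)
 then have "\<exists>K. compact K \<and> K \<subseteq> U \<and> (\<forall>x. x \<notin> K --> f x * \<zeta> x = 0)" by auto
 then show ?thesis
  using C C_k_continuous[OF C] unfolding Cc_infty_def Cc_def by blast
qed

text \<open>The indicator of the \<open>e / 3\<close>-neighbourhood of \<open>K\<close> is mollified
  at scale \<open>e / 3\<close>: at points of \<open>K\<close> only values 1 are averaged, and the
  support stays within distance 2e/3 of \<open>K\<close>, hence in \<open>U\<close>.\<close>

lemma cutoff_exists:
 fixes U :: "(real ^ 'n) set"
 assumes "compact K" "open U" "K \<subseteq> U"
 obtains \<zeta> where "\<zeta> \<in> Cc_infty U" "!!x. 0 <= \<zeta> x" "!!x. \<zeta> x <= 1" "!!x. x \<in> K ==> \<zeta> x = 1"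
proof -
 obtain e where e: "e > 0" "(\<Union>x\<in>K. ball x e) \<subseteq> U"
  using compact_subset_open_imp_ball_epsilon_subset[OF assms] by blast
 define d where "d = e / 3"
 have d: "0 < d" using e by (simp add: d_def)
 define K' where "K' = {x + z | x z. x \<in> K \<and> z \<in> cball (0 :: real ^ 'n) d}"
 have K': "compact K'" unfolding K'_def by (intro compact_sums assms compact_cball)
 define f :: "real ^ 'n => real" where "f = indicator K'"
 have f: "integrable lborel f"
  unfolding f_def using K' emeasure_compact_finite[OF K'] by (auto intro!: integrable_real_indicator borel_compact)
 have f01: "0 <= f y" "f y <= 1" for y by (auto simp: f_def indicator_def)
 show thesis
 proof (rule that[of "conv d f"])
  show "conv d f \<in> Cc_infty U"
  proof (rule conv_Cc_infty[OF d f K'])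
   fix x z :: "real^'n" assume "x \<in> K'" "norm z <= d"
   then obtain a b where "x = a + b" "a \<in> K" "norm b <= d" by (auto simp: K'_def)
   then have "norm (x + z - a) <= norm b + norm z" using norm_triangle_ineq[of b z] by (simp add: add.assoc)
   then have "x + z \<in> ball a e"
    using \<open>norm z <= d\<close> \<open>norm b <= d\<close> e(1) by (simp add: dist_norm d_def norm_minus_commute)
   then show "x + z \<in> U" using e(2) \<open>a \<in> K\<close> by blast
  qed (simp add: f_def)
  show "0 <= conv d f x" for x
   unfolding conv_def by (auto intro!: Bochner_Integration.integral_nonneg mult_nonneg_nonneg f01 mollifier_nonneg[OF d])
  show "conv d f x <= 1" for x
  proof -
   have "conv d f x <= (LINT y|lborel. mollifier d (x - y))"
    unfolding conv_def
    by (rule integral_mono)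
      (use integrable_mollifier_scaleR[OF d f, of x] mollifier_shift_int[OF d]
       in \<open>auto simp: mollifier_shift_int[OF d] intro!: mult_left_le mollifier_nonneg[OF d] f01\<close>)
   then show ?thesis by (simp add: mollifier_shift_int[OF d])
  qed
  show "conv d f x = 1" if "x \<in> K" for x
  proof -
   have "norm (conv d f x - 1) <= 0"
   proof (rule norm_conv_diff_le[OF d f])
    fix y assume "norm (x - y) < d"
    then have "x + (y - x) \<in> K'" unfolding K'_def using that
     by (intro CollectI exI[of _ x] exI[of _ "y - x"]) (auto simp: norm_minus_commute)
    then show "norm (f y - 1) <= 0" by (simp add: f_def)
   qed
   then show ?thesis by simp
  qed
 qed
qed

section \<open>Approximation and mollification in L^r\<close>

definition clip :: "real => 'b::euclidean_space => 'b" where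
 "clip N y = (N / max N (norm y)) *r y"

text \<open>Scaling large vectors back to norm \<open>N\<close> is continuous, unlike replacing them
  by zero, so continuous approximants remain continuous after truncation.\<close>

lemma clip:
 assumes "0 < N"
 shows continuous_clip: "continuous_on A (clip N)"
  and norm_clip: "norm (clip N y) <= N"
  and clip_id: "norm y <= N ==> clip N y = y"
  and norm_clip_diff: "norm (clip N y - y) <= norm y"
  and clip_0: "clip N 0 = 0"
proof -
 show "continuous_on A (clip N)"
  unfolding clip_def[abs_def] using assms by (intro continuous_intros) auto
 show "norm (clip N y) <= N" using assms by (simp add: clip_def divide_simps max_def)
 show "norm y <= N ==> clip N y = y" using assms by (simp add: clip_def max_def)
 show "clip N 0 = 0" by (simp add: clip_def)
 have "clip N y - y = (- (1 - N / max N (norm y))) *r y" by (simp add: clip_def algebra_simps)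
 then have "norm (clip N y - y) = \<bar>1 - N / max N (norm y)\<bar> * norm y"
  by (simp only: norm_scaleR abs_minus_cancel)
 also have "... <= 1 * norm y"
  using assms by (intro mult_right_mono) (auto simp: divide_simps max_def abs_le_iff)
 finally show "norm (clip N y - y) <= norm y" by simp
qed

text \<open>Truncation at a large level changes \<open>G\<close> little. The function
  \<open>G\<close> is the limit, off a negligible set, of continuous functions, which is what
  \<open>measurable_on\<close> provides; once these are truncated and cut off too, a constant on a
  ball dominates the differences.\<close>

lemma Lr_approx_continuous:
 fixes G :: "real ^ 'n => 'b::euclidean_space"
 assumes [measurable]: "G \<in> borel_measurable borel" and r: "0 < r"
  and fin: "(NL x. ennreal (norm (G x) powr r)) < \<infinity>"
  and supp: "!!x. R < norm x ==> G x = 0" and "0 < ep"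
 obtains h K where "continuous_on UNIV h" "compact K" "!!x. x \<notin> K ==> h x = 0"
  "(NL x. ennreal (norm (G x - h x) powr r)) <= ennreal ep"
proof -
 \<comment> \<open>Two errors of this size are added at the end, at the price of the factor
   \<open>2 powr r\<close> of \<open>powr_add_le\<close>.\<close>
 define ep' where "ep' = ep / (2 * 2 powr r)"
 have ep': "0 < ep'" using \<open>0 < ep\<close> by (simp add: ep'_def)
 have "(%m. \<integral>\<^sup>+x. ennreal (norm (G x - clip (real (Suc m)) (G x)) powr r) \<partial>lborel)
   ~~> (\<integral>\<^sup>+x. 0 \<partial>(lborel :: (real^'n) measure))"
 proof (rule nn_integral_dominated_convergence[where w="%x. ennreal (norm (G x) powr r)"])
  have [measurable]: "clip (real (Suc m)) \<in> borel_measurable borel" for m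
   by (rule borel_measurable_continuous_onI[OF continuous_clip]) simp
  show "(%x. ennreal (norm (G x - clip (real (Suc m)) (G x)) powr r)) \<in> borel_measurable lborel" for m
   by measurable
  show "AE x in lborel. ennreal (norm (G x - clip (real (Suc m)) (G x)) powr r) <= ennreal (norm (G x) powr r)" for m
   using norm_clip_diff[of "real (Suc m)"] r
   by (auto intro!: AE_I2 ennreal_leI powr_mono2 simp: norm_minus_commute)
  show "AE x in lborel. (%m. ennreal (norm (G x - clip (real (Suc m)) (G x)) powr r)) ~~> 0"
  proof (rule AE_I2, rule tendsto_eventually)
   fix x
   obtain m0 :: nat where "norm (G x) <= m0" using real_arch_simple by blast
   show "\<forall>\<^sub>F m in sequentially. ennreal (norm (G x - clip (real (Suc m)) (G x)) powr r) = 0"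
    using eventually_ge_at_top[of m0]
    by eventually_elim (use r \<open>norm (G x) <= m0\<close> in \<open>simp add: clip_id\<close>)
  qed
 qed (use fin in auto)
 then have "\<forall>\<^sub>F m in sequentially. (NL x. ennreal (norm (G x - clip (real (Suc m)) (G x)) powr r)) < ennreal ep'"
  using ep' by (intro order_tendstoD(2)[where y=0]) auto
 then obtain m where m: "(NL x. ennreal (norm (G x - clip (real (Suc m)) (G x)) powr r)) < ennreal ep'"
  by (auto simp: eventually_sequentially)
 define N where "N = real (Suc m)"
 have N: "0 < N" by (simp add: N_def)
 have [measurable]: "clip N \<in> borel_measurable borel"
  by (rule borel_measurable_continuous_onI[OF continuous_clip[OF N]])
 have "G \<in> borel_measurable lebesgue" by (simp add: measurable_completion)
 then have "G measurable_on UNIV" by (rule lebesgue_measurable_imp_measurable_on) simp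
 then obtain N0 g where N0: "negligible N0" and g: "!!n. continuous_on UNIV (g n)"
  and lim: "!!x. x \<notin> N0 ==> (%n. g n x) ~~> G x"
  unfolding measurable_on_def by auto
 \<comment> \<open>One up to radius \<open>R\<close> and zero beyond \<open>R + 1\<close>: the limit
   is unchanged because \<open>G\<close> vanishes beyond \<open>R\<close>, and the approximants get
   compact support.\<close>
 define c where "c x = max 0 (1 - max 0 (norm x - R))" for x :: "real^'n"
 have c: "0 <= c x" "c x <= 1" "norm x <= R ==> c x = 1" "R + 1 < norm x ==> c x = 0" for x
  by (auto simp: c_def)
 have cc: "continuous_on UNIV c" unfolding c_def by (intro continuous_intros)
 define h where "h n x = c x *r clip N (g n x)" for n x
 have hc: "continuous_on UNIV (h n)" for n
  unfolding h_def by (intro continuous_intros cc continuous_on_compose2[OF continuous_clip[OF N] g]) auto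
 then have [measurable]: "h n \<in> borel_measurable borel" for n by (rule borel_measurable_continuous_onI)
 have AEN: "AE x in lborel. x \<notin> N0"
  using N0 by (subst AE_completion_iff[symmetric]) (simp add: AE_not_in negligible_iff_null_sets)
 have "(%n. \<integral>\<^sup>+x. ennreal (norm (clip N (G x) - h n x) powr r) \<partial>lborel)
   ~~> (\<integral>\<^sup>+x. 0 \<partial>(lborel :: (real^'n) measure))"
 proof (rule nn_integral_dominated_convergence[where w="%x. ennreal ((2 * N) powr r) * indicator (cball 0 (R + 1)) x"])
  show "AE x in lborel. ennreal (norm (clip N (G x) - h n x) powr r) <= ennreal ((2 * N) powr r) * indicator (cball 0 (R + 1)) x" for n
  proof (rule AE_I2)
   fix x
   have "norm (h n x) <= 1 * N"
    unfolding h_def norm_scaleR using c norm_clip[OF N, of "g n x"] by (intro mult_mono) auto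
   then have "norm (clip N (G x) - h n x) <= 2 * N"
    using norm_triangle_ineq4[of "clip N (G x)" "h n x"] norm_clip[OF N, of "G x"] by simp
   moreover have "clip N (G x) - h n x = 0" if "x \<notin> cball 0 (R + 1)"
    using that c(4)[of x] supp[of x] by (simp add: h_def clip_0[OF N])
   ultimately show "ennreal (norm (clip N (G x) - h n x) powr r) <= ennreal ((2 * N) powr r) * indicator (cball 0 (R + 1)) x"
    using r by (cases "x \<in> cball 0 (R + 1)") (auto intro!: ennreal_leI powr_mono2)
  qed
  show "(\<integral>\<^sup>+x. ennreal ((2 * N) powr r) * indicator (cball 0 (R + 1)) x \<partial>(lborel :: (real^'n) measure)) < \<infinity>"
   using emeasure_compact_finite[OF compact_cball[of "0::real^'n" "R + 1"]]
   by (subst nn_integral_cmult_indicator) (auto simp: ennreal_mult_less_top)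
  show "AE x in lborel. (%n. ennreal (norm (clip N (G x) - h n x) powr r)) ~~> 0"
   using AEN
  proof eventually_elim
   case (elim x)
   have "(%n. clip N (g n x)) ~~> clip N (G x)"
    using continuous_clip[OF N, of UNIV] lim[OF \<open>x \<notin> N0\<close>]
    by (auto simp: continuous_on_eq_continuous_at intro: isCont_tendsto_compose)
   then have "(%n. h n x) ~~> c x *r clip N (G x)"
    unfolding h_def by (intro tendsto_intros)
   also have "c x *r clip N (G x) = clip N (G x)"
    using c(3)[of x] supp[of x] by (cases "norm x <= R") (auto simp: clip_0[OF N])
   finally have "(%n. norm (clip N (G x) - h n x)) ~~> norm (clip N (G x) - clip N (G x))"
    by (intro tendsto_intros)
   then have "(%n. norm (clip N (G x) - h n x) powr r) ~~> 0 powr r"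
    using r by (intro tendsto_powr2) auto
   then show ?case
    using tendsto_ennrealI by fastforce
  qed
  show "(%x. ennreal (norm (clip N (G x) - h n x) powr r)) \<in> borel_measurable lborel" for n
   by measurable
  have "cball (0::real^'n) (R + 1) \<in> sets lborel" by simp
  then show "(%x. ennreal ((2 * N) powr r) * indicator (cball 0 (R + 1)) x) \<in> borel_measurable (lborel :: (real^'n) measure)"
   by (intro borel_measurable_times_ennreal borel_measurable_const borel_measurable_indicator)
 qed (rule borel_measurable_const)
 then have "\<forall>\<^sub>F n in sequentially. (NL x. ennreal (norm (clip N (G x) - h n x) powr r)) < ennreal ep'"
  using ep' by (intro order_tendstoD(2)[where y=0]) auto
 then obtain n where n: "(NL x. ennreal (norm (clip N (G x) - h n x) powr r)) < ennreal ep'"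
  by (auto simp: eventually_sequentially)
 show thesis
 proof (rule that[of "h n" "cball 0 (R + 1)"])
  show "h n x = 0" if "x \<notin> cball 0 (R + 1)" for x using that c(4)[of x] by (simp add: h_def)
  have "(NL x. ennreal (norm (G x - h n x) powr r)) <=
   (NL x. ennreal (2 powr r) * (ennreal (norm (G x - clip N (G x)) powr r) + ennreal (norm (clip N (G x) - h n x) powr r)))"
  proof (rule nn_integral_mono)
   fix x
   have "norm (G x - h n x) powr r <= (norm (G x - clip N (G x)) + norm (clip N (G x) - h n x)) powr r"
    using norm_triangle_ineq[of "G x - clip N (G x)" "clip N (G x) - h n x"] r by (intro powr_mono2) auto
   also have "... <= 2 powr r * (norm (G x - clip N (G x)) powr r + norm (clip N (G x) - h n x) powr r)"
    using r by (intro powr_add_le) auto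
   finally show "ennreal (norm (G x - h n x) powr r) <= ennreal (2 powr r) * (ennreal (norm (G x - clip N (G x)) powr r) + ennreal (norm (clip N (G x) - h n x) powr r))"
    by (simp add: ennreal_mult[symmetric] ennreal_plus[symmetric] ennreal_leI del: ennreal_plus)
  qed
  also have "... = ennreal (2 powr r) * ((NL x. ennreal (norm (G x - clip N (G x)) powr r)) + (NL x. ennreal (norm (clip N (G x) - h n x) powr r)))"
   by (simp add: nn_integral_cmult nn_integral_add)
  also have "... <= ennreal (2 powr r) * (ennreal ep' + ennreal ep')"
   using m n unfolding N_def by (intro mult_left_mono add_mono) auto
  also have "... = ennreal ep"
   using ep' by (simp add: ennreal_mult[symmetric] ennreal_plus[symmetric] ep'_def del: ennreal_plus)
  finally show "(NL x. ennreal (norm (G x - h n x) powr r)) <= ennreal ep" .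
 qed (use hc in auto)
qed

text \<open>For a continuous function of compact support this is uniform continuity. A difference of
  three terms transfers it to \<open>G\<close> by density, since the approximation error has the
  same norm after translation.\<close>

lemma translation_continuous_Lr:
 fixes G :: "real ^ 'n => 'b::euclidean_space"
 assumes G[measurable]: "G \<in> borel_measurable borel" and r: "0 < r"
  and fin: "(NL x. ennreal (norm (G x) powr r)) < \<infinity>"
  and supp: "!!x. R < norm x ==> G x = 0" and "0 < ep"
 obtains d where "0 < d"
  "!!z. norm z < d ==> (NL x. ennreal (norm (G (x - z) - G x) powr r)) <= ennreal ep"
proof -
 \<comment> \<open>The factor lost when a sum of three terms is split by \<open>powr_add_le\<close>
   twice.\<close>
 define C where "C = 2 powr r * (2 powr r + 1)"
 have C: "0 < C" by (simp add: C_def add_pos_pos)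
 define ep' where "ep' = ep / (3 * C)"
 have ep': "0 < ep'" using \<open>0 < ep\<close> C by (simp add: ep'_def)
 obtain h K where h: "continuous_on UNIV h" "compact K" "!!x. x \<notin> K ==> h x = 0"
  and hG: "(NL x. ennreal (norm (G x - h x) powr r)) <= ennreal ep'"
  using Lr_approx_continuous[OF G r fin supp ep'] by blast
 have [measurable]: "h \<in> borel_measurable borel" using h(1) by (rule borel_measurable_continuous_onI)
 obtain R' where R': "0 < R'" "!!x. x \<in> K ==> norm x <= R'"
  using compact_imp_bounded[OF h(2)] by (auto simp: bounded_pos)
 define M where "M = measure lborel (cball (0 :: real^'n) (R' + 1))"
 have M: "emeasure lborel (cball (0 :: real^'n) (R' + 1)) = ennreal M" "0 <= M"
  using emeasure_compact_finite[OF compact_cball[of "0::real^'n" "R' + 1"]]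
  by (simp_all add: M_def emeasure_eq_ennreal_measure less_top)
 \<comment> \<open>A uniform error \<open>s\<close> on the ball of measure \<open>M\<close>
   contributes at most \<open>ep'\<close>; adding 1 to \<open>M\<close> makes the denominator
   positive in any case.\<close>
 define s where "s = (ep' / (M + 1)) powr (1 / r)"
 have s: "0 < s" using ep' M(2) by (simp add: s_def)
 have sr: "s powr r * M <= ep'"
 proof -
  have "s powr r = ep' / (M + 1)" using ep' M(2) r by (simp add: s_def powr_powr)
  then have "s powr r * (M + 1) = ep'" using M(2) by simp
  moreover have "s powr r * M <= s powr r * (M + 1)" by (intro mult_left_mono) auto
  ultimately show ?thesis by simp
 qed
 obtain d where d: "0 < d" "!!x y. norm (x - y) < d ==> norm (h x - h y) < s"
  using compact_support_uniformly_continuous[OF h s] by blast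
 show thesis
 proof (rule that[of "min d 1"])
  show "0 < min d 1" using d by simp
  fix z :: "real^'n" assume z: "norm z < min d 1"
  have hz: "(NL x. ennreal (norm (h (x - z) - h x) powr r)) <= ennreal ep'"
  proof -
   have "(NL x. ennreal (norm (h (x - z) - h x) powr r)) <=
    (\<integral>\<^sup>+x. ennreal (s powr r) * indicator (cball 0 (R' + 1)) x \<partial>(lborel :: (real^'n) measure))"
   proof (rule nn_integral_mono)
    fix x
    have "h (x - z) - h x = 0" if "x \<notin> cball 0 (R' + 1)"
    proof -
     have "norm x <= norm (x - z) + norm z" using norm_triangle_ineq[of "x - z" z] by simp
     then have "x - z \<notin> K" "x \<notin> K" using that z R'(2)[of "x - z"] R'(2)[of x] by auto
     then show ?thesis using h(3) by simp
    qed
    moreover have "norm (h (x - z) - h x) <= s" using d(2)[of "x - z" x] z by simp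
    ultimately show "ennreal (norm (h (x - z) - h x) powr r) <= ennreal (s powr r) * indicator (cball 0 (R' + 1)) x"
     using r by (cases "x \<in> cball 0 (R' + 1)") (auto intro!: ennreal_leI powr_mono2)
   qed
   also have "... = ennreal (s powr r * M)"
    by (subst nn_integral_cmult_indicator) (auto simp: M ennreal_mult)
   finally show ?thesis using sr ennreal_leI order_trans by blast
  qed
  have "(NL x. ennreal (norm (G (x - z) - G x) powr r)) <=
   (NL x. ennreal C * (ennreal (norm (G (x - z) - h (x - z)) powr r) + (ennreal (norm (h (x - z) - h x) powr r)
     + ennreal (norm (G x - h x) powr r))))"
  proof (rule nn_integral_mono)
   fix x
   let ?a = "norm (G (x - z) - h (x - z))" and ?b = "norm (h (x - z) - h x)" and ?c = "norm (G x - h x)"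
   have "norm (G (x - z) - G x) <= ?a + ?b + ?c"
    using norm_triangle_ineq[of "G (x - z) - h (x - z)" "h (x - z) - h x"]
     norm_triangle_ineq4[of "G (x - z) - h x" "G x - h x"] by simp
   then have "norm (G (x - z) - G x) powr r <= (?a + ?b + ?c) powr r" using r by (intro powr_mono2) auto
   also have "... <= 2 powr r * ((?a + ?b) powr r + ?c powr r)" using r by (intro powr_add_le) auto
   also have "... <= 2 powr r * (2 powr r * (?a powr r + ?b powr r) + ?c powr r)"
    using r by (intro mult_left_mono add_right_mono powr_add_le) auto
   also have "... <= C * (?a powr r + (?b powr r + ?c powr r))"
    by (simp add: C_def algebra_simps)
   finally show "ennreal (norm (G (x - z) - G x) powr r) <= ennreal C * (ennreal (?a powr r) + (ennreal (?b powr r) + ennreal (?c powr r)))"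
    using C by (simp add: ennreal_mult[symmetric] ennreal_plus[symmetric] ennreal_leI del: ennreal_plus)
  qed
  also have "... = ennreal C * ((NL x. ennreal (norm (G (x - z) - h (x - z)) powr r))
    + ((NL x. ennreal (norm (h (x - z) - h x) powr r)) + (NL x. ennreal (norm (G x - h x) powr r))))"
   by (simp add: nn_integral_cmult nn_integral_add)
  also have "(NL x. ennreal (norm (G (x - z) - h (x - z)) powr r)) = (NL x. ennreal (norm (G x - h x) powr r))"
   using nn_integral_lborel_shift(1)[of "%x. ennreal (norm (G x - h x) powr r)" "- z"] by simp
  also have "ennreal C * ((NL x. ennreal (norm (G x - h x) powr r))
    + ((NL x. ennreal (norm (h (x - z) - h x) powr r)) + (NL x. ennreal (norm (G x - h x) powr r))))
    <= ennreal C * (ennreal ep' + (ennreal ep' + ennreal ep'))"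
   using hG hz by (intro mult_left_mono add_mono) auto
  also have "... = ennreal ep"
   using ep' C by (simp add: ennreal_mult[symmetric] ennreal_plus[symmetric] ep'_def del: ennreal_plus)
  finally show "(NL x. ennreal (norm (G (x - z) - G x) powr r)) <= ennreal ep" .
 qed
qed

text \<open>On the bounded support |G| is at most 1 + |G|^r, and both terms are integrable
  there.\<close>

lemma Lr_compact_support_integrable:
 fixes G :: "real ^ 'n => 'b::euclidean_space"
 assumes [measurable]: "G \<in> borel_measurable borel" and r: "1 <= r"
  and fin: "integrable lborel (%x. norm (G x) powr r)"
  and supp: "!!x. R < norm x ==> G x = 0"
 shows "integrable lborel G"
proof (rule Bochner_Integration.integrable_bound)
 show "integrable lborel (%x. indicator (cball 0 R) x + norm (G x) powr r)"
  using fin emeasure_compact_finite[OF compact_cball[of "0::real^'n" R]] by auto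
 show "AE x in lborel. norm (G x) <= norm (indicator (cball 0 R) x + norm (G x) powr r)"
 proof (rule AE_I2)
  fix x
  have "norm (G x) <= 1 + norm (G x) powr r"
  proof (cases "norm (G x) <= 1")
   case False
   then have "norm (G x) powr 1 <= norm (G x) powr r" using r by (intro powr_mono) auto
   then show ?thesis using False by simp
  next
   case True
   then show ?thesis by (rule order_trans) simp
  qed
  moreover have "0 <= norm (G x) powr r" by simp
  ultimately show "norm (G x) <= norm (indicator (cball 0 R) x + norm (G x) powr r)"
   using supp[of x] by (cases "norm x <= R") (auto simp: not_le)
 qed
qed simp

text \<open>Jensen's inequality bounds the error by an average of translation errors over |z| < e.
  After the integrals are exchanged, continuity of translations in L^r bounds each of them.\<close>

lemma conv_Lr_bound:
 fixes G :: "real ^ 'n => 'b::euclidean_space"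
 assumes G[measurable]: "G \<in> borel_measurable borel" and r: "1 <= r"
  and int: "integrable lborel (%x. norm (G x) powr r)"
  and supp: "!!x. R < norm x ==> G x = 0" and "0 < ep"
 obtains d where "0 < d"
  "!!e. 0 < e ==> e < d ==> (NL x. ennreal (norm (conv e G x - G x) powr r)) <= ennreal ep"
proof -
 have intG: "integrable lborel G" by (rule Lr_compact_support_integrable[OF G r int supp])
 have fin: "(NL x. ennreal (norm (G x) powr r)) < \<infinity>"
  using int by (simp add: integrable_iff_bounded)
 obtain d where d: "0 < d"
  "!!z. norm z < d ==> (NL x. ennreal (norm (G (x - z) - G x) powr r)) <= ennreal ep"
  using translation_continuous_Lr[OF G _ fin supp \<open>0 < ep\<close>] r by auto
 show thesis
 proof (rule that[OF d(1)])
  fix e :: real assume e: "0 < e" "e < d"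
  note [measurable] = borel_measurable_mollifier[OF e(1)]
  have one: "(\<integral>\<^sup>+z. ennreal (mollifier e z) \<partial>(lborel :: (real^'n) measure)) = 1"
   by (subst nn_integral_eq_integral[OF mollifier_int(1)[OF e(1)]])
     (auto simp: mollifier_nonneg[OF e(1)] mollifier_int(2)[OF e(1)])
  have "(NL x. ennreal (norm (conv e G x - G x) powr r)) <=
   (NL x. (NL z. ennreal (mollifier e z) * ennreal (norm (G (x - z) - G x) powr r)))"
  proof (rule nn_integral_mono)
   fix x
   have i: "integrable lborel (%y. mollifier e (x - y) * norm (G y - G x))"
    using integrable_norm[OF conv_diff_eq(2)[OF e(1) intG, of x "G x"]] by (simp add: mollifier_nonneg[OF e(1)])
   have "norm (conv e G x - G x) <= (LINT y|lborel. norm (mollifier e (x - y) *r (G y - G x)))"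
    unfolding conv_diff_eq(1)[OF e(1) intG] by (rule integral_norm_bound)
   also have "... = (LINT y|lborel. mollifier e (x - y) * norm (G y - G x))"
    by (simp add: mollifier_nonneg[OF e(1)])
   finally have "ennreal (norm (conv e G x - G x) powr r) <= ennreal ((LINT y|lborel. mollifier e (x - y) * norm (G y - G x)) powr r)"
    using r by (intro ennreal_leI powr_mono2) auto
   also have "... <= (NL y. ennreal (mollifier e (x - y) * norm (G y - G x) powr r))"
    by (intro jensen_powr r i mollifier_nonneg[OF e(1)] mollifier_shift_int[OF e(1)]) auto
   also have "... = (NL z. ennreal (mollifier e z * norm (G (x - z) - G x) powr r))"
    using nn_integral_lborel_shift(2)[of "%y. ennreal (mollifier e (x - y) * norm (G y - G x) powr r)" x] by simp
   finally show "ennreal (norm (conv e G x - G x) powr r) <= (NL z. ennreal (mollifier e z) * ennreal (norm (G (x - z) - G x) powr r))"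
    by (simp add: ennreal_mult mollifier_nonneg[OF e(1)])
  qed
  also have "... = (NL z. (NL x. ennreal (mollifier e z) * ennreal (norm (G (x - z) - G x) powr r)))"
   by (rule lborel_pair.Fubini') measurable
  also have "... <= (\<integral>\<^sup>+z. ennreal (mollifier e z) * ennreal ep \<partial>(lborel :: (real^'n) measure))"
  proof (rule nn_integral_mono)
   fix z :: "real^'n"
   show "(NL x. ennreal (mollifier e z) * ennreal (norm (G (x - z) - G x) powr r)) <= ennreal (mollifier e z) * ennreal ep"
   proof (cases "norm z < e")
    case True
    then show ?thesis using d(2)[of z] e by (subst nn_integral_cmult) (auto intro!: mult_left_mono)
   qed (use mollifier_zero[OF e(1), of z] in simp)
  qed
  also have "... = ennreal ep"
   using one by (subst nn_integral_multc) auto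
  finally show "(NL x. ennreal (norm (conv e G x - G x) powr r)) <= ennreal ep" .
 qed
qed

lemma conv_uniform_bound:
 fixes w :: "real ^ 'n => 'b::euclidean_space"
 assumes "continuous_on UNIV w" "compact K" "!!x. x \<notin> K ==> w x = 0" "0 < ep"
 obtains d where "0 < d" "!!e x. 0 < e ==> e < d ==> norm (conv e w x - w x) <= ep"
proof -
 obtain d where d: "0 < d" "!!x y. norm (x - y) < d ==> norm (w x - w y) < ep"
  using compact_support_uniformly_continuous[OF assms] by blast
 show thesis
 proof (rule that[OF d(1)])
  fix e x assume e: "0 < e" "e < d"
  show "norm (conv e w x - w x) <= ep"
  proof (rule norm_conv_diff_le[OF e(1) integrable_continuous_compact_support[OF assms(1-3)]])
   fix y assume "norm (x - y) < e"
   then show "norm (w y - w x) <= ep" using d(2)[of y x] e by (simp add: norm_minus_commute)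
  qed
 qed
qed

section \<open>From Lebesgue measurable functions on a set to Borel functions on the whole
  space\<close>

lemma borel_representative_real:
 fixes f :: "'a::euclidean_space => real"
 assumes "f \<in> borel_measurable lebesgue"
 obtains f' where "f' \<in> borel_measurable borel" "AE x in lebesgue. f x = f' x"
proof -
 obtain g where g: "g \<in> borel_measurable lborel" "AE x in lborel. f x = g x"
  using completion_ex_borel_measurable_real[OF assms] by blast
 show thesis by (rule that[of g]) (use g in \<open>auto intro: AE_completion\<close>)
qed

lemma borel_representative:
 fixes f :: "'a::euclidean_space => real ^ 'm"
 assumes "f \<in> borel_measurable lebesgue"
 obtains f' where "f' \<in> borel_measurable borel" "AE x in lebesgue. f x = f' x"
proof -
 have "\<exists>f'. f' \<in> borel_measurable borel \<and> (AE x in lebesgue. f x $ i = f' x)" for i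
 proof -
  have "(%x. f x $ i) \<in> borel_measurable lebesgue"
   using borel_measurable_continuous_onI[OF continuous_on_component[OF continuous_on_id, of UNIV i]] assms
   by (rule measurable_compose[rotated])
  then show ?thesis using borel_representative_real by blast
 qed
 then have "\<forall>i. \<exists>f'. f' \<in> borel_measurable borel \<and> (AE x in lebesgue. f x $ i = f' x)" by blast
 from choice[OF this] obtain F where "\<forall>i. F i \<in> borel_measurable borel \<and> (AE x in lebesgue. f x $ i = F i x)" ..
 then have F: "!!i. F i \<in> borel_measurable borel" "!!i. AE x in lebesgue. f x $ i = F i x" by blast+
 show thesis
 proof (rule that[of "%x. \<chi> i. F i x"])
  show "(%x. \<chi> i. F i x) \<in> borel_measurable borel"
  proof (subst borel_measurable_euclidean_space, rule ballI)
   fix b :: "real^'m" assume "b \<in> Basis"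
   then obtain i where "b = axis i 1" by (auto simp: Basis_vec_def)
   then show "(%x. (\<chi> i. F i x) \<bullet> b) \<in> borel_measurable borel" using F(1)[of i] by (simp add: inner_axis)
  qed
  have "AE x in lebesgue. \<forall>i. f x $ i = F i x" using F(2) by (simp add: AE_all_countable)
  then show "AE x in lebesgue. f x = (\<chi> i. F i x)" by eventually_elim (simp add: vec_eq_iff)
 qed
qed

text \<open>The definitions use the completed measure on \<open>U\<close>, whereas translations,
  scalings and Fubini's theorem are applied to \<open>lborel\<close>. The bridge is a Borel function
  that agrees almost everywhere with the extension of \<open>f\<close> by zero.\<close>

lemma integral_lebesgue_on_eq_lborel:
 fixes f :: "'a::euclidean_space => 'b::euclidean_space"
 assumes U: "U \<in> sets lebesgue" and g: "g \<in> borel_measurable borel"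
  and "AE x in lebesgue. (if x \<in> U then f x else 0) = g x"
 shows "(LINT x|lebesgue_on U. f x) = (LINT x|lborel. g x)"
  and "integrable (lebesgue_on U) f \<longleftrightarrow> integrable lborel g"
proof -
 have g': "g \<in> borel_measurable lebesgue" using g by (simp add: measurable_completion)
 have eq: "(%x. indicator U x *r f x) = (%x. if x \<in> U then f x else 0)" by (auto simp: fun_eq_iff)
 have m: "(%x. if x \<in> U then f x else 0) \<in> borel_measurable lebesgue"
 proof (rule borel_measurable_AE[OF g'])
  show "AE x in lebesgue. g x = (if x \<in> U then f x else 0)"
   using assms(3) by eventually_elim (rule sym)
 qed
 have "(LINT x|lebesgue_on U. f x) = (LINT x|lebesgue. (if x \<in> U then f x else 0))"
  using U by (subst integral_restrict_space) (auto simp: eq)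
 also have "... = (LINT x|lebesgue. g x)" by (rule integral_cong_AE[OF m g' assms(3)])
 also have "... = (LINT x|lborel. g x)" using g by (simp add: integral_completion)
 finally show "(LINT x|lebesgue_on U. f x) = (LINT x|lborel. g x)" .
 have "integrable (lebesgue_on U) f \<longleftrightarrow> integrable lebesgue (%x. if x \<in> U then f x else 0)"
  using U by (subst integrable_restrict_space) (auto simp: eq)
 also have "... \<longleftrightarrow> integrable lebesgue g" by (rule integrable_cong_AE[OF m g' assms(3)])
 also have "... \<longleftrightarrow> integrable lborel g" using g by (simp add: integrable_completion)
 finally show "integrable (lebesgue_on U) f \<longleftrightarrow> integrable lborel g" .
qed

lemma continuous_on_norm_powr:
 assumes "continuous_on A f" "0 < p"
 shows "continuous_on A (%x. norm (f x) powr p)"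
 by (rule continuous_on_powr') (use assms in \<open>auto intro!: continuous_on_norm\<close>)

lemma Lp_locD:
 fixes f :: "real ^ 'n => 'b::euclidean_space"
 assumes "f \<in> Lp_loc 1 U" "compact K" "K \<subseteq> U"
 shows "f \<in> borel_measurable (lebesgue_on K)" "integrable (lebesgue_on K) f"
proof -
 have "f \<in> Lp 1 K" using assms by (auto simp: Lp_loc_def)
 then show "f \<in> borel_measurable (lebesgue_on K)" "integrable (lebesgue_on K) f"
  using integrable_norm_cancel[of "lebesgue_on K" f] by (auto simp: Lp_def)
qed

lemma compact_imp_sets_lebesgue:
 fixes K :: "'a::euclidean_space set"
 assumes "compact K" shows "K \<in> sets lebesgue"
 using borel_compact[OF assms] by simp

text \<open>Let \<zeta> be a cut-off that is 1 on \<open>K\<close>. The mollifications of \<zeta> f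
  are integrals of f against the test functions y -> mollifier(x - y) \<zeta>(y), hence zero, and
  they converge to \<zeta> f in L^1.\<close>

lemma fundamental_lemma:
 fixes f :: "real ^ 'n => real"
 assumes U: "open U" and f: "f \<in> Lp_loc 1 U"
  and zero: "!!\<psi>. \<psi> \<in> Cc_infty U ==> (LINT x|lebesgue_on U. \<psi> x * f x) = 0"
 shows "AE x in lebesgue_on U. f x = 0"
proof -
 have K0: "AE x in lebesgue. x \<in> K --> f x = 0" if K: "compact K" "K \<subseteq> U" for K
 proof -
  obtain \<zeta> where z: "\<zeta> \<in> Cc_infty U" "!!x. x \<in> K ==> \<zeta> x = 1"
   using cutoff_exists[OF K(1) U K(2)] by metis
  obtain S where S: "compact S" "S \<subseteq> U" "!!x. x \<notin> S ==> \<zeta> x = 0"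
   using Cc_inftyD(5)[OF z(1)] by blast
  have Sb: "S \<in> sets borel" using S(1) by (rule borel_compact)
  obtain R where R: "!!x. x \<in> S ==> norm x <= R"
   using compact_imp_bounded[OF S(1)] by (auto simp: bounded_iff)
  have [measurable]: "\<zeta> \<in> borel_measurable borel"
   using Cc_inftyD(3)[OF z(1)] by (rule borel_measurable_continuous_onI)
  have "(%x. if x \<in> S then f x else 0) \<in> borel_measurable lebesgue"
   using Lp_locD(1)[OF f S(1,2)] compact_imp_sets_lebesgue[OF S(1)] by (intro borel_measurable_if_I) auto
  then obtain f' where [measurable]: "f' \<in> borel_measurable borel"
   and f': "AE x in lebesgue. (if x \<in> S then f x else 0) = f' x"
   by (rule borel_representative_real)
  define F where "F x = indicator S x * (\<zeta> x * f' x)" for x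
  have [measurable]: "F \<in> borel_measurable borel" unfolding F_def using Sb by measurable
  have "integrable (lebesgue_on S) (%x. \<zeta> x * f x)"
  proof -
   obtain B where B: "!!x. \<bar>\<zeta> x\<bar> <= B" using Cc_infty_bounded[OF z(1)] by metis
   show ?thesis
   proof (rule Bochner_Integration.integrable_bound[where f="%x. B * f x"])
    show "(%x. \<zeta> x * f x) \<in> borel_measurable (lebesgue_on S)"
     using Lp_locD(1)[OF f S(1,2)] measurable_restrict_space1[OF measurable_completion, of \<zeta> lborel borel S]
     by (intro borel_measurable_times) auto
    show "AE x in lebesgue_on S. norm (\<zeta> x * f x) <= norm (B * f x)"
     using B by (auto simp: abs_mult intro!: AE_I2 mult_right_mono order_trans[OF B abs_ge_self])
   qed (use Lp_locD(2)[OF f S(1,2)] in auto)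
  qed
  moreover have "AE x in lebesgue. (if x \<in> S then \<zeta> x * f x else 0) = F x"
   using f' by eventually_elim (auto simp: F_def)
  ultimately have intF: "integrable lborel F"
   using integral_lebesgue_on_eq_lborel(2)[of S F "%x. \<zeta> x * f x"] compact_imp_sets_lebesgue[OF S(1)] by auto
  have cF: "conv e F x = 0" if e: "0 < e" for e x
  proof -
   note [measurable] = borel_measurable_mollifier[OF e]
   have "(%y. mollifier e (x - y) * \<zeta> y) \<in> Cc_infty U"
    using Cc_infty_mult[OF _ z(1), of "%y. mollifier e (x - y)"] C_k_affine[OF C_k_mollifier[OF e], of _ x "-1"]
    by simp
   then have "0 = (LINT y|lebesgue_on U. mollifier e (x - y) * \<zeta> y * f y)" using zero by simp
   also have "... = (LINT y|lborel. mollifier e (x - y) * F y)"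
   proof (rule integral_lebesgue_on_eq_lborel)
    show "U \<in> sets lebesgue" using U by simp
    show "(%y. mollifier e (x - y) * F y) \<in> borel_measurable borel" by measurable
    show "AE y in lebesgue. (if y \<in> U then mollifier e (x - y) * \<zeta> y * f y else 0) = mollifier e (x - y) * F y"
     using f' by eventually_elim (use S in \<open>auto simp: F_def indicator_def\<close>)
   qed
   finally show ?thesis by (simp add: conv_def)
  qed
  have "(NL x. ennreal (norm (F x) powr 1)) <= ennreal ep" if eps: "0 < ep" for ep
  proof -
   obtain d where d: "0 < d" "!!e. 0 < e ==> e < d ==> (NL x. ennreal (norm (conv e F x - F x) powr 1)) <= ennreal ep"
   proof (rule conv_Lr_bound[of F 1 R ep])
    show "integrable lborel (%x. norm (F x) powr 1)" using intF by simp
    show "R < norm x ==> F x = 0" for x using R[of x] by (auto simp: F_def indicator_def)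
   qed (use eps in auto)
   show ?thesis using d(2)[of "d / 2"] d(1) by (simp add: cF)
  qed
  then have le: "(NL x. ennreal (norm (F x))) <= ennreal ep" if "0 < ep" for ep
   using that by simp
  have "(NL x. ennreal (norm (F x))) <= 0"
   by (rule ennreal_le_epsilon) (use le in simp)
  then have "(NL x. ennreal (norm (F x))) = 0" by simp
  then have "AE x in lborel. F x = 0" by (simp add: nn_integral_0_iff_AE)
  then have "AE x in lebesgue. F x = 0" by (rule AE_completion)
  with f' show ?thesis
   by eventually_elim (use z(2) S in \<open>auto simp: F_def indicator_def split: if_splits\<close>, metis zero_neq_one)
 qed
 obtain C where C: "!!n. compact (C n)" "!!n. C n \<subseteq> U"
   and "!!n. C n \<subseteq> interior (C (Suc n))"
   and CU: "\<Union>(range C) = U" and "!!K. [|compact K; K \<subseteq> U|] ==> \<exists>N. \<forall>n\<ge>N. K \<subseteq> C n"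
  by (rule open_Union_compact_subsets[OF U]) iprover
 have "AE x in lebesgue. \<forall>n::nat. x \<in> C n --> f x = 0"
  unfolding AE_all_countable using K0[OF C(1,2)] by (rule allI)
 then have "AE x in lebesgue. x \<in> U --> f x = 0"
  by eventually_elim (use CU in blast)
 then show ?thesis using U by (subst AE_restrict_space_iff) auto
qed

section \<open>Integrability against test functions and uniqueness of weak gradients\<close>

lemma integrable_test_scaleR:
 fixes G :: "real ^ 'n => 'b::euclidean_space"
 assumes U: "open U" and G: "G \<in> Lp_loc 1 U" and \<psi>: "\<psi> \<in> Cc_infty U"
 shows "integrable (lebesgue_on U) (%x. \<psi> x *r G x)"
proof -
 obtain S where S: "compact S" "S \<subseteq> U" "!!x. x \<notin> S ==> \<psi> x = 0"
  using Cc_inftyD(5)[OF \<psi>] by blast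
 obtain B where B: "!!x. \<bar>\<psi> x\<bar> <= B" using Cc_infty_bounded[OF \<psi>] by metis
 have m: "\<psi> \<in> borel_measurable borel"
  using Cc_inftyD(3)[OF \<psi>] by (rule borel_measurable_continuous_onI)
 have "integrable (lebesgue_on S) (%x. \<psi> x *r G x)"
 proof (rule Bochner_Integration.integrable_bound[where f="%x. B *r G x"])
  show "(%x. \<psi> x *r G x) \<in> borel_measurable (lebesgue_on S)"
   using Lp_locD(1)[OF G S(1,2)] measurable_restrict_space1[OF measurable_completion, of \<psi> lborel borel S] m
   by (intro borel_measurable_scaleR) auto
  show "AE x in lebesgue_on S. norm (\<psi> x *r G x) <= norm (B *r G x)"
   by (auto intro!: AE_I2 mult_right_mono order_trans[OF B abs_ge_self])
 qed (use Lp_locD(2)[OF G S(1,2)] in auto)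
 then have "integrable lebesgue (%x. indicator S x *r \<psi> x *r G x)"
  using compact_imp_sets_lebesgue[OF S(1)] by (subst (asm) integrable_restrict_space) auto
 also have "(%x. indicator S x *r \<psi> x *r G x) = (%x. indicator U x *r \<psi> x *r G x)"
  using S by (auto simp: fun_eq_iff indicator_def)
 finally show ?thesis using U by (subst integrable_restrict_space) auto
qed

lemma Lp_loc_component:
 fixes G :: "real ^ 'n => real ^ 'm"
 assumes "G \<in> Lp_loc 1 U" shows "(%x. G x $ i) \<in> Lp_loc 1 U"
proof -
 have "(%x. G x $ i) \<in> Lp 1 K" if "compact K" "K \<subseteq> U" for K
 proof -
  have "integrable (lebesgue_on K) (%x. G x \<bullet> axis i 1)"
   using Lp_locD(2)[OF assms that] by (rule integrable_inner_left)
  then have "integrable (lebesgue_on K) (%x. G x $ i)" by (simp add: inner_axis)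
  then show ?thesis by (auto simp: Lp_def)
 qed
 then show ?thesis by (simp add: Lp_loc_def)
qed

lemma Lp_loc_diff:
 fixes f g :: "real ^ 'n => real"
 assumes "f \<in> Lp_loc 1 U" "g \<in> Lp_loc 1 U" shows "(%x. f x - g x) \<in> Lp_loc 1 U"
 using Lp_locD[OF assms(1)] Lp_locD[OF assms(2)] unfolding Lp_loc_def Lp_def by auto

lemma weak_gradient_zero_AE:
 fixes G :: "real ^ 'n => real ^ 'n"
 assumes U: "open U" and G: "G \<in> Lp_loc 1 U"
  and zero: "!!\<psi>. \<psi> \<in> Cc_infty U ==> (LINT x|lebesgue_on U. \<psi> x *r G x) = 0"
 shows "AE x in lebesgue_on U. G x = 0"
proof -
 have "AE x in lebesgue_on U. G x $ i = 0" for i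
 proof (rule fundamental_lemma[OF U Lp_loc_component[OF G]])
  fix \<psi> assume \<psi>: "\<psi> \<in> Cc_infty U"
  have "(LINT x|lebesgue_on U. (\<psi> x *r G x) \<bullet> axis i 1) = (LINT x|lebesgue_on U. \<psi> x *r G x) \<bullet> axis i 1"
   by (rule integral_inner_left[OF integrable_test_scaleR[OF U G \<psi>]])
  then show "(LINT x|lebesgue_on U. \<psi> x * G x $ i) = 0" by (simp add: zero[OF \<psi>] inner_axis)
 qed
 then have "AE x in lebesgue_on U. \<forall>i. G x $ i = 0" by (simp add: AE_all_countable)
 then show ?thesis by eventually_elim (simp add: vec_eq_iff)
qed

lemma has_weak_gradient_unique:
 fixes G1 :: "real ^ 'n => real ^ 'n"
 assumes "open U" "has_weak_gradient U u G1" "has_weak_gradient U u G2"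
 shows "AE x in lebesgue_on U. G1 x = G2 x"
proof -
 have L: "G1 \<in> Lp_loc 1 U" "G2 \<in> Lp_loc 1 U" using assms by (auto simp: has_weak_gradient_def)
 have "AE x in lebesgue_on U. G1 x - G2 x = 0"
 proof (rule weak_gradient_zero_AE[OF assms(1)])
  show "(%x. G1 x - G2 x) \<in> Lp_loc 1 U"
   using Lp_locD[OF L(1)] Lp_locD[OF L(2)] unfolding Lp_loc_def Lp_def by auto
  fix \<psi> assume \<psi>: "\<psi> \<in> Cc_infty U"
  show "(LINT x|lebesgue_on U. \<psi> x *r (G1 x - G2 x)) = 0"
   using assms(2,3) \<psi> integrable_test_scaleR[OF assms(1) L(1) \<psi>] integrable_test_scaleR[OF assms(1) L(2) \<psi>]
   by (simp add: has_weak_gradient_def scaleR_diff_right)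
 qed
 then show ?thesis by eventually_elim simp
qed

text \<open>\<open>weak_gradient\<close> is an arbitrary choice; by uniqueness it agrees almost
  everywhere with any weak gradient at hand, which is all that integrals see.\<close>

lemma weak_gradient_AE:
 fixes G :: "real ^ 'n => real ^ 'n"
 assumes "open U" "has_weak_gradient U u G"
 shows "AE x in lebesgue_on U. weak_gradient U u x = G x"
proof -
 have "has_weak_gradient U u (weak_gradient U u)"
  unfolding weak_gradient_def by (rule someI[of "has_weak_gradient U u", OF assms(2)])
 then show ?thesis using has_weak_gradient_unique assms by blast
qed

section \<open>Compactly supported Sobolev functions\<close>

text \<open>
 \<open>G\<close> is a Borel representative of the weak gradient, on the whole space, of the continuous function
 \<open>\<phi>\<close>, both vanishing off a compact subset of \<open>U\<close>.
\<close>
definition sob :: "real => (real ^ 'n) set => (real ^ 'n => real) => (real ^ 'n => real ^ 'n) => bool" where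
 "sob p U \<phi> G \<longleftrightarrow> continuous_on UNIV \<phi> \<and> G \<in> borel_measurable borel \<and>
   integrable lborel (%x. norm (G x) powr p) \<and>
   (\<exists>K. compact K \<and> K \<subseteq> U \<and> (\<forall>x. x \<notin> K --> \<phi> x = 0 \<and> G x = 0)) \<and>
   (\<forall>\<psi>\<in>Cc_infty UNIV. (LINT x|lborel. \<phi> x *r gradient \<psi> x) = - (LINT x|lborel. \<psi> x *r G x))"

lemma sobD:
 assumes "sob p U \<phi> G"
 shows "continuous_on UNIV \<phi>" "G \<in> borel_measurable borel" "\<phi> \<in> borel_measurable borel"
  "integrable lborel (%x. norm (G x) powr p)"
  "\<exists>K. compact K \<and> K \<subseteq> U \<and> (\<forall>x. x \<notin> K --> \<phi> x = 0 \<and> G x = 0)"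
  "\<psi> \<in> Cc_infty UNIV ==> (LINT x|lborel. \<phi> x *r gradient \<psi> x) = - (LINT x|lborel. \<psi> x *r G x)"
 using assms borel_measurable_continuous_onI[of \<phi>] unfolding sob_def by auto

lemma sob_integrable:
 fixes \<phi> :: "real ^ 'n => real"
 assumes "sob p U \<phi> G" "1 <= p"
 shows "integrable lborel \<phi>" "integrable lborel G"
proof -
 obtain K where K: "compact K" "!!x. x \<notin> K ==> \<phi> x = 0" "!!x. x \<notin> K ==> G x = 0"
  using sobD(5)[OF assms(1)] by blast
 show "integrable lborel \<phi>"
  by (rule integrable_continuous_compact_support[OF sobD(1)[OF assms(1)] K(1,2)])
 obtain R where R: "!!x. x \<in> K ==> norm x <= R"
  using compact_imp_bounded[OF K(1)] by (auto simp: bounded_iff)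
 show "integrable lborel G"
  by (rule Lr_compact_support_integrable[OF sobD(2)[OF assms(1)] assms(2) sobD(4)[OF assms(1)], of R])
    (use R K(3) in force)
qed

lemma integrable_bounded_scaleR:
 fixes f :: "'a => 'b::{banach, second_countable_topology}"
 assumes "integrable M f" "b \<in> borel_measurable M" "!!x. \<bar>b x\<bar> <= (B::real)"
 shows "integrable M (%x. b x *r f x)"
 by (rule Bochner_Integration.integrable_bound[where f="%x. B *r f x"])
   (use assms in \<open>auto intro!: AE_I2 mult_right_mono order_trans[OF assms(3) abs_ge_self]\<close>)

lemma Cc_infty_borel:
 assumes "\<psi> \<in> Cc_infty U"
 shows "\<psi> \<in> borel_measurable borel" "gradient \<psi> \<in> borel_measurable borel"
 using Cc_inftyD(2,3)[OF assms] by (auto intro: borel_measurable_continuous_onI)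

lemma sob_test_integrable:
 fixes \<phi> :: "real ^ 'n => real"
 assumes "sob p U \<phi> G" "1 <= p" "\<psi> \<in> Cc_infty UNIV"
 shows "integrable lborel (%x. \<phi> x *r gradient \<psi> x)" "integrable lborel (%x. \<psi> x *r G x)"
proof -
 obtain B where B: "!!x. \<bar>\<psi> x\<bar> <= B" "!!x. norm (gradient \<psi> x) <= B"
  using Cc_infty_bounded[OF assms(3)] by metis
 note [measurable] = Cc_infty_borel[OF assms(3)] sobD(2,3)[OF assms(1)]
 show "integrable lborel (%x. \<psi> x *r G x)"
  by (rule integrable_bounded_scaleR[OF sob_integrable(2)[OF assms(1,2)] _ B(1)]) simp
 show "integrable lborel (%x. \<phi> x *r gradient \<psi> x)"
  by (rule Bochner_Integration.integrable_bound[where f="%x. \<phi> x * B"])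
    (use sob_integrable(1)[OF assms(1,2)] B in \<open>auto simp: abs_mult intro!: AE_I2 mult_left_mono order_trans[OF B(2) abs_ge_self]\<close>)
qed

lemma Lp_I:
 fixes f :: "real ^ 'n => 'b::euclidean_space"
 assumes "f \<in> borel_measurable borel" "integrable lborel (%x. norm (f x) powr r)" "A \<in> sets lebesgue"
 shows "f \<in> Lp r A"
proof -
 have "integrable lebesgue (%x. norm (f x) powr r)"
  using assms(1,2) by (subst integrable_completion) auto
 then have "integrable lebesgue (%x. indicator A x *r (norm (f x) powr r))"
  using assms(3) by (rule integrable_mult_indicator[rotated])
 then have "integrable (lebesgue_on A) (%x. norm (f x) powr r)"
  using assms(3) by (subst integrable_restrict_space) auto
 moreover have "f \<in> borel_measurable (lebesgue_on A)"
  using assms(1) by (intro measurable_restrict_space1 measurable_completion) auto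
 ultimately show ?thesis by (simp add: Lp_def)
qed

lemma sob_mono: "sob p U \<phi> G ==> U \<subseteq> U' ==> sob p U' \<phi> G"
 unfolding sob_def by (blast intro: order_trans)

lemma sob_has_weak_gradient:
 fixes \<phi> :: "real ^ 'n => real"
 assumes s: "sob p U \<phi> G" and p: "1 <= p" and U: "open U"
 shows "has_weak_gradient U \<phi> G" "G \<in> Lp p U" "\<phi> \<in> Lp p U" "\<phi> \<in> W1p p U" "\<phi> \<in> Cc U"
proof -
 obtain K where K: "compact K" "K \<subseteq> U" "!!x. x \<notin> K ==> \<phi> x = 0" "!!x. x \<notin> K ==> G x = 0"
  using sobD(5)[OF s] by blast
 note [measurable] = sobD(2,3)[OF s]
 show "\<phi> \<in> Cc U" using K sobD(1)[OF s] unfolding Cc_def by blast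
 have "\<phi> \<in> Lp 1 A" "G \<in> Lp 1 A" if "A \<in> sets lebesgue" for A
  using sob_integrable[OF s p] that by (auto intro!: Lp_I)
 then have L: "\<phi> \<in> Lp_loc 1 U" "G \<in> Lp_loc 1 U" by (auto simp: Lp_loc_def compact_imp_sets_lebesgue)
 show "has_weak_gradient U \<phi> G" unfolding has_weak_gradient_def
 proof (intro conjI ballI L)
  fix \<psi> assume \<psi>: "\<psi> \<in> Cc_infty U"
  then have \<psi>': "\<psi> \<in> Cc_infty UNIV" using Cc_infty_mono[of U UNIV] by auto
  note [measurable] = Cc_infty_borel[OF \<psi>]
  have "(LINT x|lebesgue_on U. \<phi> x *r gradient \<psi> x) = (LINT x|lborel. \<phi> x *r gradient \<psi> x)"
   by (rule integral_lebesgue_on_eq_lborel) (use U K in \<open>auto intro!: AE_I2\<close>)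
  also have "... = - (LINT x|lborel. \<psi> x *r G x)" by (rule sobD(6)[OF s \<psi>'])
  also have "(LINT x|lborel. \<psi> x *r G x) = (LINT x|lebesgue_on U. \<psi> x *r G x)"
   by (rule integral_lebesgue_on_eq_lborel[symmetric]) (use U K in \<open>auto intro!: AE_I2\<close>)
  finally show "(LINT x|lebesgue_on U. \<phi> x *r gradient \<psi> x) = - (LINT x|lebesgue_on U. \<psi> x *r G x)" .
 qed
 moreover show G: "G \<in> Lp p U" using U sobD(4)[OF s] by (intro Lp_I) auto
 moreover show "\<phi> \<in> Lp p U"
 proof (rule Lp_I)
  show "integrable lborel (%x. norm (\<phi> x) powr p)"
   by (rule integrable_continuous_compact_support[OF _ K(1)], rule continuous_on_norm_powr)
     (use K p sobD(1)[OF s] in auto)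
 qed (use U in auto)
 ultimately show "\<phi> \<in> W1p p U" unfolding W1p_def by blast
qed

text \<open>The given gradient is determined only up to null sets, and only on \<open>U\<close>. It
  vanishes almost everywhere off the support \<open>K\<close> of \<phi>, so a Borel representative
  may be set to zero there. Test functions on the whole space become admissible in \<open>U\<close>
  after multiplication by a cut-off that is 1 on \<open>K\<close>.\<close>

lemma W1p_Cc_imp_sob:
 fixes \<phi> :: "real ^ 'n => real"
 assumes U: "open U" and p: "1 <= p" and \<phi>: "\<phi> \<in> W1p p U" "\<phi> \<in> Cc U"
 obtains G where "sob p U \<phi> G"
proof -
 obtain G0 where G0: "has_weak_gradient U \<phi> G0" "G0 \<in> Lp p U" using \<phi>(1) by (auto simp: W1p_def)
 obtain K where K: "compact K" "K \<subseteq> U" "!!x. x \<notin> K ==> \<phi> x = 0" and c: "continuous_on UNIV \<phi>"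
  using \<phi>(2) by (auto simp: Cc_def)
 have Kb: "K \<in> sets borel" using K(1) by (rule borel_compact)
 have L: "G0 \<in> Lp_loc 1 U" using G0(1) by (simp add: has_weak_gradient_def)
 have wg: "(LINT x|lebesgue_on U. \<phi> x *r gradient \<psi> x) = - (LINT x|lebesgue_on U. \<psi> x *r G0 x)"
  if "\<psi> \<in> Cc_infty U" for \<psi> using G0(1) that by (simp add: has_weak_gradient_def)
 have oUK: "open (U - K)" using U K(1) compact_imp_closed by blast
 have restr: "(LINT x|lebesgue_on (U - K). \<psi> x *r G0 x) = (LINT x|lebesgue_on U. \<psi> x *r G0 x)"
  if "!!x. x \<in> K ==> \<psi> x = 0" for \<psi>
 proof -
  have "(%x. indicator (U - K) x *r \<psi> x *r G0 x) = (%x. indicator U x *r \<psi> x *r G0 x)"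
   using that by (auto simp: fun_eq_iff indicator_def)
  then show ?thesis using U oUK by (simp add: integral_restrict_space)
 qed
 \<comment> \<open>Test functions supported off \<open>K\<close> do not see \<phi>, so the gradient
   integrates to zero against them.\<close>
 have "AE x in lebesgue_on (U - K). G0 x = 0"
 proof (rule weak_gradient_zero_AE[OF oUK])
  show "G0 \<in> Lp_loc 1 (U - K)" using L by (auto simp: Lp_loc_def)
  fix \<psi> assume \<psi>: "\<psi> \<in> Cc_infty (U - K)"
  then have \<psi>': "\<psi> \<in> Cc_infty U" using Cc_infty_mono[of "U - K" U] by auto
  obtain S where S: "S \<subseteq> U - K" "!!x. x \<notin> S ==> \<psi> x = 0 \<and> gradient \<psi> x = 0"
   using Cc_inftyD(5)[OF \<psi>] by blast
  have "(%x. \<phi> x *r gradient \<psi> x) = (%_. 0)" using S K(3) by (fastforce simp: fun_eq_iff)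
  then have "(LINT x|lebesgue_on U. \<psi> x *r G0 x) = 0" using wg[OF \<psi>'] by simp
  then show "(LINT x|lebesgue_on (U - K). \<psi> x *r G0 x) = 0" using restr[of \<psi>] S by fastforce
 qed
 then have zUK: "AE x in lebesgue. x \<in> U - K --> G0 x = 0"
  using oUK by (subst (asm) AE_restrict_space_iff) auto
 have "(%x. if x \<in> K then G0 x else 0) \<in> borel_measurable lebesgue"
  using Lp_locD(1)[OF L K(1,2)] compact_imp_sets_lebesgue[OF K(1)] by (intro borel_measurable_if_I) auto
 then obtain G1 where [measurable]: "G1 \<in> borel_measurable borel"
  and G1: "AE x in lebesgue. (if x \<in> K then G0 x else 0) = G1 x"
  by (rule borel_representative)
 define G where "G x = indicator K x *r G1 x" for x
 have [measurable]: "G \<in> borel_measurable borel" unfolding G_def using Kb by measurable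
 have [measurable]: "\<phi> \<in> borel_measurable borel" using c by (rule borel_measurable_continuous_onI)
 have UG: "AE x in lebesgue. (if x \<in> U then G0 x else 0) = G x"
  using G1 zUK by eventually_elim (use K in \<open>auto simp: G_def indicator_def split: if_splits\<close>)
 have "sob p U \<phi> G" unfolding sob_def
 proof (intro conjI c ballI)
  show "integrable lborel (%x. norm (G x) powr p)"
  proof (subst integral_lebesgue_on_eq_lborel(2)[symmetric])
   show "AE x in lebesgue. (if x \<in> U then norm (G0 x) powr p else 0) = norm (G x) powr p"
    using UG by eventually_elim auto
  qed (use U G0(2) in \<open>auto simp: Lp_def\<close>)
  show "\<exists>K. compact K \<and> K \<subseteq> U \<and> (\<forall>x. x \<notin> K --> \<phi> x = 0 \<and> G x = 0)"
   using K by (intro exI[of _ K]) (auto simp: G_def)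
  fix \<psi> :: "real ^ 'n => real" assume \<psi>: "\<psi> \<in> Cc_infty UNIV"
  obtain \<zeta> where z: "\<zeta> \<in> Cc_infty U" "!!x. x \<in> K ==> \<zeta> x = 1"
   using cutoff_exists[OF K(1) U K(2)] by metis
  note [measurable] = Cc_infty_borel[OF \<psi>] Cc_infty_borel[OF z(1)]
  have \<psi>z: "(%x. \<psi> x * \<zeta> x) \<in> Cc_infty U" using Cc_infty_mult[OF Cc_inftyD(4)[OF \<psi>] z(1)] .
  \<comment> \<open>Where \<phi> is nonzero it is nonzero on an open set, which lies in
    \<open>K\<close>; there \<zeta> is constant and the extra term of the product rule
    disappears.\<close>
  have grad: "\<phi> x *r gradient (%x. \<psi> x * \<zeta> x) x = \<phi> x *r gradient \<psi> x" for x
  proof (cases "\<phi> x = 0")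
   case False
   have op: "open {x. \<phi> x \<noteq> 0}" using c by (simp add: open_Collect_neq)
   have "GDERIV (%x. \<zeta> x - 1) x :> 0"
    by (rule GDERIV_zero_off_closed[where K="- {x. \<phi> x \<noteq> 0}"]) (use op z(2) K(3) False in \<open>auto simp: closed_def\<close>)
   then have "GDERIV (%x. (\<zeta> x - 1) + 1) x :> 0 + 0" by (intro GDERIV_add GDERIV_const)
   then have "GDERIV \<zeta> x :> 0" by simp
   then have "GDERIV (%x. \<psi> x * \<zeta> x) x :> \<psi> x *r 0 + \<zeta> x *r gradient \<psi> x"
    by (intro GDERIV_mult Cc_inftyD(1)[OF \<psi>])
   moreover have "\<zeta> x = 1" using z(2) K(3) False by auto
   ultimately show ?thesis using gradient_eqI by fastforce
  qed simp
  have "(LINT x|lborel. \<phi> x *r gradient \<psi> x) = (LINT x|lebesgue_on U. \<phi> x *r gradient \<psi> x)"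
   by (rule integral_lebesgue_on_eq_lborel[symmetric]) (use U K in \<open>auto intro!: AE_I2\<close>)
  also have "... = (LINT x|lebesgue_on U. \<phi> x *r gradient (%x. \<psi> x * \<zeta> x) x)" by (simp only: grad)
  also have "... = - (LINT x|lebesgue_on U. (\<psi> x * \<zeta> x) *r G0 x)" by (rule wg[OF \<psi>z])
  also have "(LINT x|lebesgue_on U. (\<psi> x * \<zeta> x) *r G0 x) = (LINT x|lborel. \<psi> x *r G x)"
  proof (rule integral_lebesgue_on_eq_lborel)
   show "AE x in lebesgue. (if x \<in> U then (\<psi> x * \<zeta> x) *r G0 x else 0) = \<psi> x *r G x"
    using G1 zUK by eventually_elim (use K z in \<open>auto simp: G_def indicator_def split: if_splits\<close>)
  qed (use U in auto)
  finally show "(LINT x|lborel. \<phi> x *r gradient \<psi> x) = - (LINT x|lborel. \<psi> x *r G x)" .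
 qed simp
 then show thesis by (rule that)
qed

lemma integrable_powr_add:
 fixes f g :: "'a => 'b::{real_normed_vector, second_countable_topology}"
 assumes [measurable]: "f \<in> borel_measurable M" "g \<in> borel_measurable M"
  and "integrable M (%x. norm (f x) powr p)" "integrable M (%x. norm (g x) powr p)" "0 <= p"
 shows "integrable M (%x. norm (f x + g x) powr p)"
proof (rule Bochner_Integration.integrable_bound)
 show "integrable M (%x. 2 powr p * (norm (f x) powr p + norm (g x) powr p))" using assms by auto
 show "AE x in M. norm (norm (f x + g x) powr p) <= norm (2 powr p * (norm (f x) powr p + norm (g x) powr p))"
 proof (rule AE_I2)
  fix x
  have "norm (f x + g x) powr p <= (norm (f x) + norm (g x)) powr p"
   using assms by (intro powr_mono2 norm_triangle_ineq) auto
  also have "... <= 2 powr p * (norm (f x) powr p + norm (g x) powr p)"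
   using assms by (intro powr_add_le) auto
  finally show "norm (norm (f x + g x) powr p) <= norm (2 powr p * (norm (f x) powr p + norm (g x) powr p))" by simp
 qed
qed measurable

lemma sob_add:
 assumes "sob p U \<phi> G" "sob p U \<phi>' G'" "1 <= p"
 shows "sob p U (%x. \<phi> x + \<phi>' x) (%x. G x + G' x)"
 unfolding sob_def
proof (intro conjI ballI)
 note [measurable] = sobD(2,3)[OF assms(1)] sobD(2,3)[OF assms(2)]
 show "(%x. G x + G' x) \<in> borel_measurable borel" by measurable
 show "continuous_on UNIV (%x. \<phi> x + \<phi>' x)" using sobD(1)[OF assms(1)] sobD(1)[OF assms(2)] by (intro continuous_intros)
 show "integrable lborel (%x. norm (G x + G' x) powr p)"
  using sobD(4)[OF assms(1)] sobD(4)[OF assms(2)] assms(3) by (intro integrable_powr_add) auto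
 obtain K K' where "compact K" "K \<subseteq> U" "!!x. x \<notin> K ==> \<phi> x = 0 \<and> G x = 0"
  "compact K'" "K' \<subseteq> U" "!!x. x \<notin> K' ==> \<phi>' x = 0 \<and> G' x = 0"
  using sobD(5)[OF assms(1)] sobD(5)[OF assms(2)] by blast
 then show "\<exists>K. compact K \<and> K \<subseteq> U \<and> (\<forall>x. x \<notin> K --> \<phi> x + \<phi>' x = 0 \<and> G x + G' x = 0)"
  by (intro exI[of _ "K \<union> K'"]) (auto intro: compact_Un)
 fix \<psi> :: "real ^ 'a => real" assume \<psi>: "\<psi> \<in> Cc_infty UNIV"
 show "(LINT x|lborel. (\<phi> x + \<phi>' x) *r gradient \<psi> x) = - (LINT x|lborel. \<psi> x *r (G x + G' x))"
  using sob_test_integrable[OF assms(1,3) \<psi>] sob_test_integrable[OF assms(2,3) \<psi>]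
   sobD(6)[OF assms(1) \<psi>] sobD(6)[OF assms(2) \<psi>]
  by (simp add: scaleR_add_left scaleR_add_right)
qed

lemma sob_cmult:
 assumes "sob p U \<phi> G" "1 <= p"
 shows "sob p U (%x. c * \<phi> x) (%x. c *r G x)"
 unfolding sob_def
proof (intro conjI ballI)
 note [measurable] = sobD(2,3)[OF assms(1)]
 show "(%x. c *r G x) \<in> borel_measurable borel" by measurable
 show "continuous_on UNIV (%x. c * \<phi> x)" using sobD(1)[OF assms(1)] by (intro continuous_intros)
 show "integrable lborel (%x. norm (c *r G x) powr p)"
  using sobD(4)[OF assms(1)] by (simp add: powr_mult)
 show "\<exists>K. compact K \<and> K \<subseteq> U \<and> (\<forall>x. x \<notin> K --> c * \<phi> x = 0 \<and> c *r G x = 0)"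
  using sobD(5)[OF assms(1)] by force
 fix \<psi> :: "real ^ 'a => real" assume \<psi>: "\<psi> \<in> Cc_infty UNIV"
 have "(LINT x|lborel. (c * \<phi> x) *r gradient \<psi> x) = c *r (LINT x|lborel. \<phi> x *r gradient \<psi> x)"
  unfolding scaleR_scaleR[symmetric] by (rule integral_scaleR_right)
 also have "... = - (LINT x|lborel. c *r \<psi> x *r G x)"
  unfolding sobD(6)[OF assms(1) \<psi>] by (simp only: integral_scaleR_right scaleR_minus_right)
 finally show "(LINT x|lborel. (c * \<phi> x) *r gradient \<psi> x) = - (LINT x|lborel. \<psi> x *r c *r G x)"
  by (simp add: mult.commute)
qed

text \<open>\<open>\<eta> x * \<psi> x\<close> is a test function for the weak gradient of \<phi>,
  and the two terms of its own gradient are exactly those that the product rule asks for.\<close>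

lemma sob_smooth_mult:
 fixes \<eta> :: "real ^ 'n => real"
 assumes s: "sob p U \<phi> G" and p: "1 <= p" and \<eta>: "!!k. C_k k \<eta>"
 shows "sob p U (%x. \<eta> x * \<phi> x) (%x. \<eta> x *r G x + \<phi> x *r gradient \<eta> x)"
 unfolding sob_def
proof (intro conjI ballI)
 have c: "continuous_on A \<eta>" "continuous_on A (gradient \<eta>)" for A
  using C_k_continuous[OF \<eta>] C_k_continuous_gradient[OF \<eta>] continuous_on_subset by blast+
 have c\<phi>: "continuous_on A \<phi>" for A using sobD(1)[OF s] continuous_on_subset by blast
 have [measurable]: "\<eta> \<in> borel_measurable borel" "gradient \<eta> \<in> borel_measurable borel"
  using c by (auto intro: borel_measurable_continuous_onI)
 note [measurable] = sobD(2,3)[OF s]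
 obtain K where K: "compact K" "K \<subseteq> U" "!!x. x \<notin> K ==> \<phi> x = 0" "!!x. x \<notin> K ==> G x = 0"
  using sobD(5)[OF s] by blast
 show "(%x. \<eta> x *r G x + \<phi> x *r gradient \<eta> x) \<in> borel_measurable borel" by measurable
 show "continuous_on UNIV (%x. \<eta> x * \<phi> x)" by (intro continuous_intros c c\<phi>)
 show "\<exists>K. compact K \<and> K \<subseteq> U \<and> (\<forall>x. x \<notin> K --> \<eta> x * \<phi> x = 0 \<and> \<eta> x *r G x + \<phi> x *r gradient \<eta> x = 0)"
  using K by (intro exI[of _ K]) auto
 show "integrable lborel (%x. norm (\<eta> x *r G x + \<phi> x *r gradient \<eta> x) powr p)"
 proof (rule integrable_powr_add)
  obtain B where B: "!!x. x \<in> K ==> \<bar>\<eta> x\<bar> <= B"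
   using compact_imp_bounded[OF compact_continuous_image[OF c(1) K(1)]] by (auto simp: bounded_iff)
  show "integrable lborel (%x. norm (\<eta> x *r G x) powr p)"
  proof (rule Bochner_Integration.integrable_bound)
   show "integrable lborel (%x. \<bar>B\<bar> powr p * norm (G x) powr p)" using sobD(4)[OF s] by auto
   show "AE x in lborel. norm (norm (\<eta> x *r G x) powr p) <= norm (\<bar>B\<bar> powr p * norm (G x) powr p)"
   proof (rule AE_I2)
    fix x show "norm (norm (\<eta> x *r G x) powr p) <= norm (\<bar>B\<bar> powr p * norm (G x) powr p)"
    proof (cases "x \<in> K")
     case True
     then have "\<bar>\<eta> x\<bar> powr p <= \<bar>B\<bar> powr p" using B[of x] p by (intro powr_mono2) auto
     then show ?thesis by (simp add: powr_mult mult_right_mono)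
    qed (simp add: K)
   qed
  qed measurable
  have "continuous_on UNIV (%x. norm (\<phi> x *r gradient \<eta> x) powr p)"
   by (intro continuous_on_norm_powr continuous_on_scaleR c c\<phi>) (use p in auto)
  then show "integrable lborel (%x. norm (\<phi> x *r gradient \<eta> x) powr p)"
   by (rule integrable_continuous_compact_support[OF _ K(1)]) (use K in simp)
 qed (use p in auto)
 fix \<psi> :: "real ^ 'n => real" assume \<psi>: "\<psi> \<in> Cc_infty UNIV"
 note [measurable] = Cc_infty_borel[OF \<psi>]
 have \<eta>\<psi>: "(%x. \<eta> x * \<psi> x) \<in> Cc_infty UNIV" by (rule Cc_infty_mult[OF \<eta> \<psi>])
 have grad: "gradient (%x. \<eta> x * \<psi> x) x = \<eta> x *r gradient \<psi> x + \<psi> x *r gradient \<eta> x" for x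
  by (rule gradient_eqI[OF GDERIV_mult[OF C_k_GDERIV[OF \<eta>] Cc_inftyD(1)[OF \<psi>]]])
 have i1: "integrable lborel (%x. \<phi> x *r \<eta> x *r gradient \<psi> x)"
  by (rule integrable_continuous_compact_support[OF _ K(1)])
    (use K in \<open>auto intro!: continuous_intros c c\<phi> Cc_inftyD(2)[OF \<psi>]\<close>)
 have i2: "integrable lborel (%x. \<phi> x *r \<psi> x *r gradient \<eta> x)"
  by (rule integrable_continuous_compact_support[OF _ K(1)])
    (use K in \<open>auto intro!: continuous_intros c c\<phi> Cc_inftyD(3)[OF \<psi>]\<close>)
 have i3: "integrable lborel (%x. (\<eta> x * \<psi> x) *r G x)" by (rule sob_test_integrable(2)[OF s p \<eta>\<psi>])
 have "(LINT x|lborel. \<phi> x *r \<eta> x *r gradient \<psi> x) + (LINT x|lborel. \<phi> x *r \<psi> x *r gradient \<eta> x)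
   = - (LINT x|lborel. (\<eta> x * \<psi> x) *r G x)"
  using sobD(6)[OF s \<eta>\<psi>] i1 i2 by (simp add: grad scaleR_add_right)
 then have "(LINT x|lborel. \<phi> x *r \<eta> x *r gradient \<psi> x) =
   - ((LINT x|lborel. (\<eta> x * \<psi> x) *r G x) + (LINT x|lborel. \<phi> x *r \<psi> x *r gradient \<eta> x))"
  by (simp add: algebra_simps eq_neg_iff_add_eq_0)
 also have "(LINT x|lborel. (\<eta> x * \<psi> x) *r G x) + (LINT x|lborel. \<phi> x *r \<psi> x *r gradient \<eta> x)
   = (LINT x|lborel. (\<eta> x * \<psi> x) *r G x + \<phi> x *r \<psi> x *r gradient \<eta> x)"
  using i2 i3 by (rule Bochner_Integration.integral_add[symmetric, rotated])
 also have "... = (LINT x|lborel. \<psi> x *r (\<eta> x *r G x + \<phi> x *r gradient \<eta> x))"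
  by (rule Bochner_Integration.integral_cong) (auto simp: scaleR_add_right mult.commute)
 finally show "(LINT x|lborel. (\<eta> x * \<phi> x) *r gradient \<psi> x) = - (LINT x|lborel. \<psi> x *r (\<eta> x *r G x + \<phi> x *r gradient \<eta> x))"
  by (simp add: mult.commute)
qed

lemma sob_shrink:
 fixes \<phi> :: "real ^ 'n => real"
 assumes "sob p U \<phi> G" "open W" "!!x. x \<in> W ==> \<phi> x = 0" "!!x. x \<in> W ==> G x = 0"
 shows "sob p (U - W) \<phi> G"
proof -
 obtain K where "compact K" "K \<subseteq> U" "\<forall>x. x \<notin> K --> \<phi> x = 0 \<and> G x = 0" using sobD(5)[OF assms(1)] by blast
 then have "compact (K - W) \<and> K - W \<subseteq> U - W \<and> (\<forall>x. x \<notin> K - W --> \<phi> x = 0 \<and> G x = 0)"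
  using assms by (auto intro: compact_diff)
 then have "\<exists>K. compact K \<and> K \<subseteq> U - W \<and> (\<forall>x. x \<notin> K --> \<phi> x = 0 \<and> G x = 0)" by blast
 then show ?thesis using assms(1) unfolding sob_def by auto
qed

lemma Cc_infty_sob:
 fixes \<phi> :: "real ^ 'n => real"
 assumes \<phi>: "\<phi> \<in> Cc_infty U" and p: "1 <= p"
 shows "sob p U \<phi> (gradient \<phi>)"
 unfolding sob_def
proof (intro conjI ballI)
 obtain K where K: "compact K" "K \<subseteq> U" "\<forall>x. x \<notin> K --> \<phi> x = 0 \<and> gradient \<phi> x = 0"
  using Cc_inftyD(5)[OF \<phi>] by blast
 then show "\<exists>K. compact K \<and> K \<subseteq> U \<and> (\<forall>x. x \<notin> K --> \<phi> x = 0 \<and> gradient \<phi> x = 0)" by blast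
 show "continuous_on UNIV \<phi>" by (rule Cc_inftyD(3)[OF \<phi>])
 show "gradient \<phi> \<in> borel_measurable borel" by (rule Cc_infty_borel[OF \<phi>])
 have "continuous_on UNIV (%x. norm (gradient \<phi> x) powr p)"
  by (intro continuous_on_norm_powr Cc_inftyD(2)[OF \<phi>]) (use p in auto)
 then show "integrable lborel (%x. norm (gradient \<phi> x) powr p)"
  by (rule integrable_continuous_compact_support[OF _ K(1)]) (use K in simp)
 fix \<psi> :: "real ^ 'n => real" assume \<psi>: "\<psi> \<in> Cc_infty UNIV"
 have i1: "integrable lborel (%x. \<phi> x *r gradient \<psi> x)"
  by (rule integrable_continuous_compact_support[OF _ K(1)])
    (use K in \<open>auto intro!: continuous_intros Cc_inftyD(2,3)[OF \<psi>] Cc_inftyD(2,3)[OF \<phi>]\<close>)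
 have i2: "integrable lborel (%x. \<psi> x *r gradient \<phi> x)"
  by (rule integrable_continuous_compact_support[OF _ K(1)])
    (use K in \<open>auto intro!: continuous_intros Cc_inftyD(2,3)[OF \<psi>] Cc_inftyD(2,3)[OF \<phi>]\<close>)
 have "(LINT x|lborel. \<phi> x *r gradient \<psi> x + \<psi> x *r gradient \<phi> x) = 0"
  by (rule integral_GDERIV_zero(1)[OF GDERIV_mult[OF Cc_inftyD(1)[OF \<phi>] Cc_inftyD(1)[OF \<psi>]] _ K(1)])
    (use K in \<open>auto intro!: continuous_intros Cc_inftyD(2,3)[OF \<psi>] Cc_inftyD(2,3)[OF \<phi>]\<close>)
 then show "(LINT x|lborel. \<phi> x *r gradient \<psi> x) = - (LINT x|lborel. \<psi> x *r gradient \<phi> x)"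
  using i1 i2 by (simp add: eq_neg_iff_add_eq_0)
qed

text \<open>The derivative first falls on the kernel. The reflected and translated mollifier is a
  test function for the weak gradient of \<phi>, and the sign produced by the reflection cancels the
  one of integration by parts.\<close>

lemma sob_GDERIV_conv:
 fixes \<phi> :: "real ^ 'n => real"
 assumes s: "sob p U \<phi> G" and p: "1 <= p" and e: "0 < e"
 shows "GDERIV (conv e \<phi>) x :> conv e G x"
proof -
 let ?m = "mollifier e :: real^'n => real"
 have D: "GDERIV ?m y :> gradient ?m y" for y by (rule C_k_GDERIV[OF C_k_mollifier[OF e]])
 have "GDERIV (%x. LINT y|lborel. ?m (x - y) * \<phi> y) x :> (LINT y|lborel. \<phi> y *r gradient ?m (x - y))"
  by (rule GDERIV_convolution[OF sob_integrable(1)[OF s p] D C_k_continuous_gradient[OF C_k_mollifier[OF e]] compact_cball[of 0 e]])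
    (auto intro!: mollifier_zero e)
 moreover have "(LINT y|lborel. \<phi> y *r gradient ?m (x - y)) = conv e G x"
 proof -
  define \<psi> where "\<psi> y = ?m (x + (-1) *r y)" for y
  have g: "gradient \<psi> y = (-1) *r gradient ?m (x - y)" for y
   using gradient_eqI[OF GDERIV_affine[OF D, of x "-1" y]] unfolding \<psi>_def by simp
  have "\<psi> \<in> Cc_infty UNIV"
  proof -
   have C: "C_k k \<psi>" for k unfolding \<psi>_def by (rule C_k_affine[OF C_k_mollifier[OF e]])
   have "\<psi> y = 0" if "y \<notin> cball x e" for y
    using that mollifier_zero[OF e, of "x - y"] by (simp add: \<psi>_def dist_norm)
   then have "\<exists>K. compact K \<and> K \<subseteq> UNIV \<and> (\<forall>y. y \<notin> K --> \<psi> y = 0)"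
    using compact_cball by blast
   then show ?thesis using C C_k_continuous[OF C] unfolding Cc_infty_def Cc_def by blast
  qed
  from sobD(6)[OF s this] show ?thesis by (simp add: g conv_def \<psi>_def)
 qed
 ultimately show ?thesis by (simp add: conv_def[abs_def])
qed

text \<open>One compact set carries all the approximants, so local bounds of \<open>H\<close> on it
  serve them all at once. The uniform rate is the square of the inverse of m + 1 because
  \<open>sob_abs\<close> regularises the absolute value at the scale 1/(m + 1) and needs an error of
  smaller order where the function vanishes. The exponent \<open>r\<close> is separate from
  \<open>p\<close> since there gradients are wanted in L^1.\<close>

lemma sob_approx:
 fixes \<phi> :: "real ^ 'n => real"
 assumes s: "sob p U \<phi> G" and p: "1 <= p" and U: "open U"
  and r: "1 <= r" "integrable lborel (%x. norm (G x) powr r)"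
 obtains K \<phi>' where "compact K" "K \<subseteq> U" "!!x. x \<notin> K ==> \<phi> x = 0 \<and> G x = 0"
  "!!m::nat. \<phi>' m \<in> Cc_infty U" "!!m x. x \<notin> K ==> \<phi>' m x = 0 \<and> gradient (\<phi>' m) x = 0"
  "!!m x. \<bar>\<phi>' m x - \<phi> x\<bar> <= inverse (real (Suc m)) ^ 2"
  "!!m. (NL x. ennreal (norm (gradient (\<phi>' m) x - G x) powr r)) <= ennreal (inverse (real (Suc m)))"
proof -
 obtain K where K: "compact K" "K \<subseteq> U" "!!x. x \<notin> K ==> \<phi> x = 0" "!!x. x \<notin> K ==> G x = 0"
  using sobD(5)[OF s] by blast
 obtain R where R: "!!x. x \<in> K ==> norm x <= R"
  using compact_imp_bounded[OF K(1)] by (auto simp: bounded_iff)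
 obtain e0 where e0: "e0 > 0" "(\<Union>x\<in>K. ball x e0) \<subseteq> U"
  using compact_subset_open_imp_ball_epsilon_subset[OF K(1) U K(2)] by blast
 define K' where "K' = {x + z | x z. x \<in> K \<and> z \<in> cball (0::real^'n) (e0 / 2)}"
 have K': "compact K'" unfolding K'_def by (intro compact_sums K compact_cball)
 have K'U: "K' \<subseteq> U"
 proof
  fix y assume "y \<in> K'"
  then obtain x z where "y = x + z" "x \<in> K" "norm z <= e0 / 2" by (auto simp: K'_def)
  then have "y \<in> ball x e0" using e0(1) by (auto simp: dist_norm)
  then show "y \<in> U" using \<open>x \<in> K\<close> e0(2) by blast
 qed
 have KK': "K \<subseteq> K'" unfolding K'_def using e0(1) by force
 have "\<exists>f. f \<in> Cc_infty U \<and> (\<forall>x. x \<notin> K' --> f x = 0 \<and> gradient f x = 0)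
   \<and> (\<forall>x. \<bar>f x - \<phi> x\<bar> <= inverse (real (Suc m)) ^ 2)
   \<and> (NL x. ennreal (norm (gradient f x - G x) powr r)) <= ennreal (inverse (real (Suc m)))" for m
 proof -
  obtain d1 where d1: "0 < d1"
   "!!e x. 0 < e ==> e < d1 ==> norm (conv e \<phi> x - \<phi> x) <= inverse (real (Suc m)) ^ 2"
   using conv_uniform_bound[OF sobD(1)[OF s] K(1,3), of "inverse (real (Suc m)) ^ 2"] by auto
  obtain d2 where d2: "0 < d2" "!!e. 0 < e ==> e < d2 ==>
    (NL x. ennreal (norm (conv e G x - G x) powr r)) <= ennreal (inverse (real (Suc m)))"
  proof (rule conv_Lr_bound[OF sobD(2)[OF s] r, of R "inverse (real (Suc m))"])
   show "R < norm x ==> G x = 0" for x using R[of x] K(4)[of x] by force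
  qed auto
  define e where "e = min (e0 / 2) (min (d1 / 2) (d2 / 2))"
  have e: "0 < e" "e < d1" "e < d2" "e <= e0 / 2" using e0 d1 d2 by (auto simp: e_def)
  have g: "gradient (conv e \<phi>) = conv e G"
   using gradient_eqI[OF sob_GDERIV_conv[OF s p e(1)]] by auto
  have ball: "y \<notin> K" if "x \<notin> K'" "norm (x - y) < e" for x y
  proof
   assume "y \<in> K"
   then have "y + (x - y) \<in> K'" unfolding K'_def using that e
    by (intro CollectI exI[of _ y] exI[of _ "x - y"]) auto
   then show False using that by simp
  qed
  show ?thesis
  proof (intro exI[of _ "conv e \<phi>"] conjI allI impI)
   show "conv e \<phi> \<in> Cc_infty U"
   proof (rule conv_Cc_infty[OF e(1) sob_integrable(1)[OF s p] K(1) K(3)])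
    fix x z :: "real^'n" assume "x \<in> K" "norm z <= e"
    then have "x + z \<in> K'" unfolding K'_def using e(4) by (intro CollectI exI[of _ x] exI[of _ z]) auto
    then show "x + z \<in> U" using K'U by blast
   qed
   show "conv e \<phi> x = 0" if "x \<notin> K'" for x
    using ball[OF that] K(3) by (intro conv_zero e) auto
   show "gradient (conv e \<phi>) x = 0" if "x \<notin> K'" for x
    unfolding g using ball[OF that] K(4) by (intro conv_zero e) auto
   show "\<bar>conv e \<phi> x - \<phi> x\<bar> <= inverse (real (Suc m)) ^ 2" for x using d1(2)[OF e(1,2), of x] by simp
   show "(NL x. ennreal (norm (gradient (conv e \<phi>) x - G x) powr r)) <= ennreal (inverse (real (Suc m)))"
    unfolding g by (rule d2(2)[OF e(1,3)])
  qed
 qed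
 then have "\<forall>m. \<exists>f. f \<in> Cc_infty U \<and> (\<forall>x. x \<notin> K' --> f x = 0 \<and> gradient f x = 0)
   \<and> (\<forall>x. \<bar>f x - \<phi> x\<bar> <= inverse (real (Suc m)) ^ 2)
   \<and> (NL x. ennreal (norm (gradient f x - G x) powr r)) <= ennreal (inverse (real (Suc m)))" by blast
 from choice[OF this] obtain \<phi>' where \<phi>': "!!m. \<phi>' m \<in> Cc_infty U"
  "!!m x. x \<notin> K' ==> \<phi>' m x = 0 \<and> gradient (\<phi>' m) x = 0"
  "!!m x. \<bar>\<phi>' m x - \<phi> x\<bar> <= inverse (real (Suc m)) ^ 2"
  "!!m. (NL x. ennreal (norm (gradient (\<phi>' m) x - G x) powr r)) <= ennreal (inverse (real (Suc m)))"
  by blast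
 show thesis
  by (rule that[OF K' K'U _ \<phi>']) (use K KK' in auto)
qed

text \<open>The chain rule for the root sqrt(w'^2 + d^2), where w' is a smooth approximant of w,
  passes to the limit. The choice of the rates makes the limit gradient zero on the zero set of
  \<open>w\<close>, in accordance with \<open>sgn 0 = 0\<close>, without the knowledge that
  \<open>G\<close> vanishes almost everywhere there.\<close>

lemma sob_abs:
 fixes w :: "real ^ 'n => real"
 assumes s: "sob p U w G" and p: "1 <= p"
 shows "sob p U (%x. \<bar>w x\<bar>) (%x. sgn (w x) *r G x)"
 unfolding sob_def
proof (intro conjI ballI)
 note [measurable] = sobD(2,3)[OF s]
 have ms[measurable]: "(%x. sgn (w x)) \<in> borel_measurable borel"
  unfolding sgn_if by measurable
 show "continuous_on UNIV (%x. \<bar>w x\<bar>)" using sobD(1)[OF s] by (intro continuous_intros)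
 show mG[measurable]: "(%x. sgn (w x) *r G x) \<in> borel_measurable borel" by measurable
 show "integrable lborel (%x. norm (sgn (w x) *r G x) powr p)"
 proof (rule Bochner_Integration.integrable_bound[OF sobD(4)[OF s]])
  show "AE x in lborel. norm (norm (sgn (w x) *r G x) powr p) <= norm (norm (G x) powr p)"
   using p by (intro AE_I2) (simp add: sgn_if)
 qed measurable
 show "\<exists>K. compact K \<and> K \<subseteq> U \<and> (\<forall>x. x \<notin> K --> \<bar>w x\<bar> = 0 \<and> sgn (w x) *r G x = 0)"
  using sobD(5)[OF s] by auto
 fix \<psi> :: "real ^ 'n => real" assume \<psi>: "\<psi> \<in> Cc_infty UNIV"
 note [measurable] = Cc_infty_borel[OF \<psi>]
 obtain B where B: "0 < B" "!!x. \<bar>\<psi> x\<bar> <= B" "!!x. norm (gradient \<psi> x) <= B"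
  using Cc_infty_bounded[OF \<psi>] by metis
 obtain S where S: "compact S" "!!x. x \<notin> S ==> \<psi> x = 0" "!!x. x \<notin> S ==> gradient \<psi> x = 0"
  using Cc_inftyD(5)[OF \<psi>] by blast
 have intG: "integrable lborel G" by (rule sob_integrable(2)[OF s p])
 have intG1: "integrable lborel (%x. norm (G x) powr 1)" using intG by simp
 obtain K w' where "compact K" "K \<subseteq> UNIV" "!!x. x \<notin> K ==> w x = 0 \<and> G x = 0" and w': "!!m::nat. w' m \<in> Cc_infty UNIV" and "!!m x. x \<notin> K ==> w' m x = 0 \<and> gradient (w' m) x = 0"
  and w'2: "!!m x. \<bar>w' m x - w x\<bar> <= inverse (real (Suc m)) ^ 2"
  and w'3: "!!m. (NL x. ennreal (norm (gradient (w' m) x - G x) powr 1)) <= ennreal (inverse (real (Suc m)))"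
  by (rule sob_approx[OF sob_mono[OF s subset_UNIV] p open_UNIV order_refl intG1]) (rule that; assumption)
 define d where "d m = inverse (real (Suc m))" for m
 have d0: "0 < d m" "d m <= 1" for m by (auto simp: d_def field_simps)
 have dlim: "d ~~> 0" unfolding d_def[abs_def] by (rule LIMSEQ_inverse_real_of_nat)
 note [measurable] = Cc_infty_borel[OF w']
 define f where "f m x = sqrt (w' m x ^ 2 + d m ^ 2)" for m x
 define t where "t m x = w' m x / f m x" for m x
 have fpos: "0 < f m x" for m x unfolding f_def using d0(1)[of m] by (simp add: add_nonneg_pos)
 have fge: "\<bar>w' m x\<bar> <= f m x" "d m <= f m x" for m x
  unfolding f_def using d0(1)[of m] by (auto intro!: real_le_rsqrt)
 have fle: "f m x <= \<bar>w' m x\<bar> + d m" for m x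
  unfolding f_def using sqrt_sum_squares_le_sum_abs[of "w' m x" "d m"] d0(1)[of m] by simp
 have t1: "\<bar>t m x\<bar> <= 1" for m x unfolding t_def using fge(1)[of m x] fpos[of m x] by simp
 have [measurable]: "f m \<in> borel_measurable borel" "t m \<in> borel_measurable borel" for m
  unfolding f_def[abs_def] t_def[abs_def] by measurable
 have cw: "continuous_on UNIV (w' m)" "continuous_on UNIV (gradient (w' m))" for m
  by (rule Cc_inftyD[OF w'])+
 have cf: "continuous_on UNIV (f m)" for m
  unfolding f_def[abs_def] by (intro continuous_intros cw)
 have ct: "continuous_on UNIV (t m)" for m
  unfolding t_def[abs_def] using fpos by (intro continuous_intros cw cf) (metis less_irrefl)
 have Df: "GDERIV (f m) x :> t m x *r gradient (w' m) x" for m x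
 proof -
  have pos: "0 < w' m x ^ 2 + d m ^ 2" using d0(1)[of m] by (simp add: add_nonneg_pos)
  have "DERIV (%y. sqrt (y ^ 2 + d m ^ 2)) (w' m x) :> w' m x / f m x"
   using pos by (auto intro!: derivative_eq_intros simp: f_def field_simps)
  from GDERIV_DERIV_compose[OF Cc_inftyD(1)[OF w'] this] show ?thesis unfolding t_def f_def by simp
 qed
 have ibp: "(LINT x|lborel. f m x *r gradient \<psi> x) = - (LINT x|lborel. \<psi> x *r t m x *r gradient (w' m) x)" for m
 proof -
  have i1: "integrable lborel (%x. f m x *r gradient \<psi> x)"
   by (rule integrable_continuous_compact_support[OF _ S(1)])
     (use S in \<open>auto intro!: continuous_intros cf Cc_inftyD(2)[OF \<psi>]\<close>)
  have i2: "integrable lborel (%x. \<psi> x *r t m x *r gradient (w' m) x)"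
   by (rule integrable_continuous_compact_support[OF _ S(1)])
     (use S in \<open>auto intro!: continuous_intros ct cw Cc_inftyD(3)[OF \<psi>]\<close>)
  have "(LINT x|lborel. f m x *r gradient \<psi> x + \<psi> x *r t m x *r gradient (w' m) x) = 0"
   by (rule integral_GDERIV_zero(1)[OF GDERIV_mult[OF Df Cc_inftyD(1)[OF \<psi>]] _ S(1)])
     (use S in \<open>auto intro!: continuous_intros cf ct cw Cc_inftyD(2,3)[OF \<psi>]\<close>)
  then show ?thesis using i1 i2 by (simp add: eq_neg_iff_add_eq_0)
 qed
 have w'lim: "(%m. w' m x) ~~> w x" for x
 proof (rule LIM_zero_cancel, rule Lim_null_comparison)
  show "\<forall>\<^sub>F m in sequentially. norm (w' m x - w x) <= d m ^ 2" using w'2 by (simp add: d_def)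
  show "(%m. d m ^ 2) ~~> 0" using tendsto_power[OF dlim, of 2] by simp
 qed
 have flim: "(%m. f m x) ~~> \<bar>w x\<bar>" for x
 proof -
  have "(%m. sqrt (w' m x ^ 2 + d m ^ 2)) ~~> sqrt (w x ^ 2 + 0 ^ 2)"
   by (intro tendsto_intros w'lim dlim)
  then show ?thesis by (simp add: f_def)
 qed
 have tlim: "(%m. t m x) ~~> sgn (w x)" for x
 proof (cases "w x = 0")
  case True
  \<comment> \<open>Here |w'| is at most the square of \<open>d m\<close>, while the root is at
    least \<open>d m\<close>.\<close>
  have "(%m. t m x) ~~> 0"
  proof (rule Lim_null_comparison[OF _ dlim], rule always_eventually, rule allI)
   fix m
   have "\<bar>w' m x\<bar> <= d m * d m" using w'2[of m x] True by (simp add: d_def power2_eq_square)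
   also have "... <= d m * f m x" using d0(1)[of m] fge(2)[of m x] by (intro mult_left_mono) auto
   finally show "norm (t m x) <= d m" using fpos[of m x] by (simp add: t_def divide_le_eq)
  qed
  then show ?thesis using True by simp
 next
  case False
  have "(%m. t m x) ~~> w x / \<bar>w x\<bar>"
   unfolding t_def using False by (intro tendsto_divide w'lim flim) auto
  then show ?thesis by (simp add: real_sgn_eq)
 qed
 have L: "(%m. LINT x|lborel. f m x *r gradient \<psi> x) ~~> (LINT x|lborel. \<bar>w x\<bar> *r gradient \<psi> x)"
 proof (rule integral_dominated_convergence[where w="%x. norm ((\<bar>w x\<bar> + 2) *r gradient \<psi> x)"])
  have "integrable lborel (%x. (\<bar>w x\<bar> + 2) *r gradient \<psi> x)"
   by (rule integrable_continuous_compact_support[OF _ S(1)])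
     (use S sobD(1)[OF s] in \<open>auto intro!: continuous_intros Cc_inftyD(2)[OF \<psi>]\<close>)
  then show "integrable lborel (%x. norm ((\<bar>w x\<bar> + 2) *r gradient \<psi> x))" by (rule integrable_norm)
  show "AE x in lborel. norm (f m x *r gradient \<psi> x) <= norm ((\<bar>w x\<bar> + 2) *r gradient \<psi> x)" for m
  proof (rule AE_I2)
   fix x
   have "d m ^ 2 <= 1" using d0[of m] by (simp add: power_le_one)
   then have "\<bar>w' m x - w x\<bar> <= 1" using w'2[of m x] by (simp add: d_def)
   then have "\<bar>f m x\<bar> <= \<bar>\<bar>w x\<bar> + 2\<bar>" using fle[of m x] d0[of m] fpos[of m x] by linarith
   then show "norm (f m x *r gradient \<psi> x) <= norm ((\<bar>w x\<bar> + 2) *r gradient \<psi> x)"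
    by (simp add: mult_right_mono)
  qed
  show "AE x in lborel. (%m. f m x *r gradient \<psi> x) ~~> \<bar>w x\<bar> *r gradient \<psi> x"
   by (intro AE_I2 tendsto_intros flim)
 qed measurable
 have bb: "norm (\<psi> x *r t m x *r v) <= B * norm v" for m x and v :: "real^'n"
 proof -
  have "\<bar>t m x\<bar> * norm v <= 1 * norm v" by (intro mult_right_mono t1) simp
  then have "\<bar>\<psi> x\<bar> * (\<bar>t m x\<bar> * norm v) <= B * norm v" using B(1) by (intro mult_mono B(2)) auto
  then show ?thesis by (simp add: abs_mult mult.assoc)
 qed
 \<comment> \<open>The gradients of the approximants converge only in L^1, the factors
   \<open>t m\<close> only pointwise. Against the fixed field \<open>G\<close> the bounded factors
   converge by domination; the rest, treated in \<open>R2\<close>, has an L^1 norm of order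
   \<open>d m\<close>.\<close>
 have R1: "(%m. LINT x|lborel. \<psi> x *r t m x *r G x) ~~> (LINT x|lborel. \<psi> x *r sgn (w x) *r G x)"
 proof (rule integral_dominated_convergence[where w="%x. B * norm (G x)"])
  show "AE x in lborel. norm (\<psi> x *r t m x *r G x) <= B * norm (G x)" for m
   by (intro AE_I2 bb)
  show "AE x in lborel. (%m. \<psi> x *r t m x *r G x) ~~> \<psi> x *r sgn (w x) *r G x"
   by (intro AE_I2 tendsto_intros tlim)
  show "integrable lborel (%x. B * norm (G x))" using intG by auto
 qed measurable
 have intw': "integrable lborel (gradient (w' m))" for m
  using sob_integrable(2)[OF Cc_infty_sob[OF w', of 1]] by simp
 have R2: "(%m. LINT x|lborel. \<psi> x *r t m x *r (gradient (w' m) x - G x)) ~~> 0"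
 proof (rule Lim_null_comparison)
  show "\<forall>\<^sub>F m in sequentially. norm (LINT x|lborel. \<psi> x *r t m x *r (gradient (w' m) x - G x)) <= B * d m"
  proof (rule always_eventually, rule allI)
   fix m
   have i: "integrable lborel (%x. gradient (w' m) x - G x)" using intw' intG by auto
   have "norm (LINT x|lborel. \<psi> x *r t m x *r (gradient (w' m) x - G x)) <= (LINT x|lborel. B * norm (gradient (w' m) x - G x))"
   proof (rule Bochner_Integration.integral_norm_bound_integral)
    show "integrable lborel (%x. \<psi> x *r t m x *r (gradient (w' m) x - G x))"
     by (intro integrable_bounded_scaleR[OF _ _ B(2)] integrable_bounded_scaleR[OF _ _ t1] i) measurable
    show "norm (\<psi> x *r t m x *r (gradient (w' m) x - G x)) <= B * norm (gradient (w' m) x - G x)" for x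
     by (rule bb)
   qed (use i in auto)
   also have "... = B * (LINT x|lborel. norm (gradient (w' m) x - G x))" by simp
   also have "(LINT x|lborel. norm (gradient (w' m) x - G x)) <= d m"
   proof -
    have "ennreal (LINT x|lborel. norm (gradient (w' m) x - G x)) = (NL x. ennreal (norm (gradient (w' m) x - G x)))"
     using i by (intro nn_integral_eq_integral[symmetric]) auto
    also have "... <= ennreal (d m)" using w'3[of m] by (simp add: d_def)
    finally show ?thesis using d0(1)[of m] by (simp add: ennreal_le_iff)
   qed
   finally show "norm (LINT x|lborel. \<psi> x *r t m x *r (gradient (w' m) x - G x)) <= B * d m" using B(1) by simp
  qed
  show "(%m. B * d m) ~~> 0" using tendsto_mult_right_zero[OF dlim] by simp
 qed
 have "(LINT x|lborel. \<psi> x *r t m x *r gradient (w' m) x) =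
   (LINT x|lborel. \<psi> x *r t m x *r G x) + (LINT x|lborel. \<psi> x *r t m x *r (gradient (w' m) x - G x))" for m
 proof -
  have "integrable lborel (%x. \<psi> x *r t m x *r G x)" "integrable lborel (%x. \<psi> x *r t m x *r gradient (w' m) x)"
   by (intro integrable_bounded_scaleR[OF _ _ B(2)] integrable_bounded_scaleR[OF _ _ t1] intG intw'; measurable)+
  then show ?thesis by (simp add: scaleR_diff_right)
 qed
 with tendsto_add[OF R1 R2]
 have "(%m. LINT x|lborel. \<psi> x *r t m x *r gradient (w' m) x) ~~> (LINT x|lborel. \<psi> x *r sgn (w x) *r G x)" by simp
 from tendsto_minus[OF this] have "(%m. LINT x|lborel. f m x *r gradient \<psi> x) ~~> - (LINT x|lborel. \<psi> x *r sgn (w x) *r G x)"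
  by (simp add: ibp)
 with L show "(LINT x|lborel. \<bar>w x\<bar> *r gradient \<psi> x) = - (LINT x|lborel. \<psi> x *r sgn (w x) *r G x)"
  by (rule LIMSEQ_unique)
qed

section \<open>Uniform convexity of the gradient energy\<close>

lemma powr_split_factor_tendsto: "((%t::real. (1 - t) powr (1 - p)) \<longlongrightarrow> 1) (at_right 0)"
proof -
 have "((%t::real. (1 - t) powr (1 - p)) \<longlongrightarrow> (1 - 0) powr (1 - p)) (at_right 0)"
  by (intro tendsto_intros) auto
 then show ?thesis by simp
qed

text \<open>By \<open>powr_add_le_split\<close> each of the two integrals is at most the other times
  a factor close to 1, plus a multiple of the integral of \<open>dj\<close>. For fixed
  \<open>t\<close> the last term vanishes as \<open>j\<close> grows; only then is \<open>t\<close>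
  sent to 0. It will be applied to norms of gradients, with \<open>dj\<close> the norm of the
  difference.\<close>

lemma integral_powr_tendsto:
 fixes a :: "'a => real"
 assumes p: "1 <= p"
  and a: "a \<in> borel_measurable M" "AE x in M. 0 <= a x" "integrable M (%x. a x powr p)"
  and aj: "!!j. aj j \<in> borel_measurable M" "!!j. AE x in M. 0 <= aj j x"
  and dj: "!!j. AE x in M. 0 <= dj j x \<and> \<bar>aj j x - a x\<bar> <= dj j x" "!!j. integrable M (%x. dj j x powr p)"
  and lim: "(%j. LINT x|M. dj j x powr p) ~~> 0"
 shows "integrable M (%x. aj j x powr p)" "(%j. LINT x|M. aj j x powr p) ~~> (LINT x|M. a x powr p)"
proof -
 note [measurable] = a(1) aj(1)
 define c where "c t = (1 - t) powr (1 - p)" for t :: real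
 define k where "k t = t powr (1 - p)" for t :: real
 have ptw1: "AE x in M. aj j x powr p <= c t * a x powr p + k t * dj j x powr p" if "0 < t" "t < 1" for j t
  using a(2) aj(2)[of j] dj(1)[of j]
 proof eventually_elim
  case *: (elim x)
  have "aj j x powr p <= (a x + dj j x) powr p" using * p by (intro powr_mono2) auto
  also have "... <= c t * a x powr p + k t * dj j x powr p"
   unfolding c_def k_def using * p that by (intro powr_add_le_split) auto
  finally show ?case .
 qed
 have ptw2: "AE x in M. a x powr p <= c t * aj j x powr p + k t * dj j x powr p" if "0 < t" "t < 1" for j t
  using a(2) aj(2)[of j] dj(1)[of j]
 proof eventually_elim
  case *: (elim x)
  have "a x powr p <= (aj j x + dj j x) powr p" using * p by (intro powr_mono2) auto
  also have "... <= c t * aj j x powr p + k t * dj j x powr p"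
   unfolding c_def k_def using * p that by (intro powr_add_le_split) auto
  finally show ?case .
 qed
 have int: "integrable M (%x. aj j x powr p)" for j
 proof (rule Bochner_Integration.integrable_bound)
  show "integrable M (%x. c (1/2) * a x powr p + k (1/2) * dj j x powr p)" using a(3) dj(2) by auto
  show "AE x in M. norm (aj j x powr p) <= norm (c (1/2) * a x powr p + k (1/2) * dj j x powr p)"
  proof -
   have "AE x in M. aj j x powr p <= c (1/2) * a x powr p + k (1/2) * dj j x powr p" by (rule ptw1) auto
   then show ?thesis by eventually_elim auto
  qed
 qed measurable
 then show "integrable M (%x. aj j x powr p)" .
 define A where "A = (LINT x|M. a x powr p)"
 define Aj where "Aj j = (LINT x|M. aj j x powr p)" for j
 define D where "D j = (LINT x|M. dj j x powr p)" for j
 have b1: "Aj j <= c t * A + k t * D j" if "0 < t" "t < 1" for j t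
 proof -
  have "Aj j <= (LINT x|M. c t * a x powr p + k t * dj j x powr p)"
   unfolding Aj_def by (rule integral_mono_AE[OF int _ ptw1[OF that]]) (use a(3) dj(2) in auto)
  then show ?thesis using a(3) dj(2) by (simp add: A_def D_def)
 qed
 have b2: "A <= c t * Aj j + k t * D j" if "0 < t" "t < 1" for j t
 proof -
  have "A <= (LINT x|M. c t * aj j x powr p + k t * dj j x powr p)"
   unfolding A_def by (rule integral_mono_AE[OF a(3) _ ptw2[OF that]]) (use int dj(2) in auto)
  then show ?thesis using int dj(2) by (simp add: Aj_def D_def)
 qed
 have Dlim: "D ~~> 0" using lim by (simp add: D_def[abs_def])
 have clim: "(c \<longlongrightarrow> 1) (at_right 0)" unfolding c_def[abs_def] by (rule powr_split_factor_tendsto)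
 have t01: "\<forall>\<^sub>F t in at_right (0::real). 0 < t \<and> t < 1"
  by (auto simp: eventually_at_right_field intro!: exI[of _ 1])
 have "Aj ~~> A"
 proof (rule order_tendstoI)
  fix y assume y: "A < y"
  have "((%t. c t * A) \<longlongrightarrow> 1 * A) (at_right 0)" by (intro tendsto_intros clim)
  then have "\<forall>\<^sub>F t in at_right 0. c t * A < y" using y by (intro order_tendstoD) auto
  with t01 have "\<forall>\<^sub>F t in at_right 0. (0 < t \<and> t < 1) \<and> c t * A < y" by (rule eventually_conj)
  then obtain t where t: "0 < t" "t < 1" "c t * A < y"
   using eventually_happens'[OF trivial_limit_at_right_real] by blast
  have "(%j. c t * A + k t * D j) ~~> c t * A + k t * 0" by (intro tendsto_intros Dlim)
  then have "\<forall>\<^sub>F j in sequentially. c t * A + k t * D j < y" using t by (intro order_tendstoD) auto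
  then show "\<forall>\<^sub>F j in sequentially. Aj j < y" by eventually_elim (use b1[OF t(1,2)] in \<open>auto intro: le_less_trans\<close>)
 next
  fix y assume y: "y < A"
  have "((%t. c t * y) \<longlongrightarrow> 1 * y) (at_right 0)" by (intro tendsto_intros clim)
  then have "\<forall>\<^sub>F t in at_right 0. c t * y < A" using y by (intro order_tendstoD) auto
  with t01 have "\<forall>\<^sub>F t in at_right 0. (0 < t \<and> t < 1) \<and> c t * y < A" by (rule eventually_conj)
  then obtain t where t: "0 < t" "t < 1" "c t * y < A"
   using eventually_happens'[OF trivial_limit_at_right_real] by blast
  have ct: "0 < c t" using t by (simp add: c_def)
  have "(%j. A - k t * D j) ~~> A - k t * 0" by (intro tendsto_intros Dlim)
  then have "\<forall>\<^sub>F j in sequentially. c t * y < A - k t * D j" using t by (intro order_tendstoD) auto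
  then show "\<forall>\<^sub>F j in sequentially. y < Aj j"
  proof eventually_elim
   case (elim j)
   then have "c t * y < c t * Aj j" using b2[OF t(1,2), of j] by linarith
   then show ?case using ct by simp
  qed
 qed
 then show "(%j. LINT x|M. aj j x powr p) ~~> (LINT x|M. a x powr p)" by (simp add: Aj_def[abs_def] A_def)
qed

lemma is_normD:
 assumes "is_norm N"
 shows "0 <= N \<xi>" "N \<xi> = 0 \<longleftrightarrow> \<xi> = 0" "N (c *r \<xi>) = \<bar>c\<bar> * N \<xi>" "N (\<xi> + \<eta>) <= N \<xi> + N \<eta>"
  "N (- \<xi>) = N \<xi>" "N (\<xi> - \<eta>) <= N \<xi> + N \<eta>" "N 0 = 0" "N (\<xi> - \<eta>) = N (\<eta> - \<xi>)"
  "\<bar>N \<xi> - N \<eta>\<bar> <= N (\<xi> - \<eta>)"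
proof -
 note n = assms[unfolded is_norm_def]
 show 1: "0 <= N \<xi>" "N \<xi> = 0 \<longleftrightarrow> \<xi> = 0" "N (c *r \<xi>) = \<bar>c\<bar> * N \<xi>" "N (\<xi> + \<eta>) <= N \<xi> + N \<eta>" "N 0 = 0"
  using n by auto
 have m: "N (- x) = N x" for x
 proof -
  have "N ((-1) *r x) = \<bar>-1\<bar> * N x" using n by blast
  then show ?thesis by simp
 qed
 show "N (- \<xi>) = N \<xi>" by (rule m)
 have "N (\<xi> + (- \<eta>)) <= N \<xi> + N (- \<eta>)" using n by blast
 then show "N (\<xi> - \<eta>) <= N \<xi> + N \<eta>" by (simp add: m)
 show s: "N (\<xi> - \<eta>) = N (\<eta> - \<xi>)" using m[of "\<xi> - \<eta>"] by simp
 have "N ((\<xi> - \<eta>) + \<eta>) <= N (\<xi> - \<eta>) + N \<eta>" "N ((\<eta> - \<xi>) + \<xi>) <= N (\<eta> - \<xi>) + N \<xi>" using n by blast+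
 then show "\<bar>N \<xi> - N \<eta>\<bar> <= N (\<xi> - \<eta>)" using s by simp
qed

lemma is_norm_le_norm:
 fixes N :: "real ^ 'n => real"
 assumes "is_norm N"
 shows "N \<xi> <= (\<Sum>i\<in>UNIV. N (axis i 1)) * norm \<xi>"
proof -
 have s: "N (\<Sum>i\<in>I. f i) <= (\<Sum>i\<in>I. N (f i))" if "finite I" for I :: "'n set" and f
  using that
 proof (induction I rule: finite_induct)
  case (insert i I)
  then show ?case using is_normD(4)[OF assms, of "f i" "\<Sum>i\<in>I. f i"] by simp
 qed (simp add: is_normD(7)[OF assms])
 have "N \<xi> = N (\<Sum>i\<in>UNIV. \<xi> $ i *r axis i 1)"
  using basis_expansion[of \<xi>] by (simp add: scalar_mult_eq_scaleR)
 also have "... <= (\<Sum>i\<in>UNIV. N (\<xi> $ i *r axis i 1))" by (rule s) simp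
 also have "... <= (\<Sum>i\<in>UNIV. norm \<xi> * N (axis i 1))"
  using component_le_norm_cart[of \<xi>] is_normD(1,3)[OF assms] by (intro sum_mono) (simp add: mult_right_mono)
 finally show ?thesis by (simp add: sum_distrib_left mult.commute)
qed

lemma is_norm_tendsto:
 fixes N :: "real ^ 'n => real"
 assumes "is_norm N" "(f \<longlongrightarrow> l) F" shows "((%x. N (f x)) \<longlongrightarrow> N l) F"
proof (rule LIM_zero_cancel, rule Lim_null_comparison)
 let ?C = "\<Sum>i\<in>UNIV. N (axis i 1)"
 show "\<forall>\<^sub>F x in F. norm (N (f x) - N l) <= ?C * norm (f x - l)"
 proof (intro always_eventually allI)
  fix x
  have "norm (N (f x) - N l) <= N (f x - l)" using is_normD(9)[OF assms(1), of "f x" l] by simp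
  also have "... <= ?C * norm (f x - l)" by (rule is_norm_le_norm[OF assms(1)])
  finally show "norm (N (f x) - N l) <= ?C * norm (f x - l)" .
 qed
 show "((%x. ?C * norm (f x - l)) \<longlongrightarrow> 0) F"
  using assms(2) by (intro tendsto_mult_right_zero tendsto_norm_zero) (simp add: LIM_zero)
qed

text \<open>The way from the midpoint \<open>m\<close> up to 1 is made in two tangent steps, with a
  stop at \<open>v\<close>. The slope at \<open>v\<close> is strictly larger than that at
  \<open>m\<close>, and this is the source of strictness.\<close>

lemma powr_midpoint_strict:
 fixes t p :: real
 assumes "1 < p" "0 <= t" "t < 1"
 shows "((1 + t) / 2) powr p < (1 + t powr p) / 2"
proof -
 define m where "m = (1 + t) / 2"
 define v where "v = (1 + m) / 2"
 have m: "0 < m" "m < 1" "m < v" "v < 1" using assms by (auto simp: m_def v_def)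
 have 1: "v powr p + p * v powr (p - 1) * (1 - v) <= 1 powr p" using m assms by (intro powr_tangent) auto
 have 2: "m powr p + p * m powr (p - 1) * (v - m) <= v powr p" using m assms by (intro powr_tangent) auto
 have 3: "m powr p + p * m powr (p - 1) * (t - m) <= t powr p" using m assms by (intro powr_tangent) auto
 have vm: "1 - v = v - m" by (simp add: v_def field_simps)
 have "m powr (p - 1) < v powr (p - 1)" using m assms by (intro powr_less_mono2) auto
 then have "p * m powr (p - 1) * (v - m) < p * v powr (p - 1) * (v - m)" using m assms by simp
 then have "m powr p + 2 * (p * m powr (p - 1) * (v - m)) < 1" using 1 2 vm by simp
 moreover have "2 * (v - m) = - (t - m)" by (simp add: v_def m_def field_simps)
 ultimately have "m powr p + p * m powr (p - 1) * (- (t - m)) < 1" by (metis mult.assoc mult.left_commute)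
 moreover have "p * m powr (p - 1) * (- (t - m)) = - (p * m powr (p - 1) * (t - m))" by (rule mult_minus_right)
 ultimately have "2 * m powr p < 1 + t powr p" using 3 by linarith
 then show ?thesis by (simp add: m_def)
qed

lemma convexity_modulus_le:
 assumes "is_norm N" "N x = 1" "N y = 1" "ep <= N (x - y)"
 shows "convexity_modulus N ep <= 1 - N ((1 / 2) *r (x + y))"
 unfolding convexity_modulus_def
proof (rule cInf_lower)
 show "bdd_below {1 - N ((1 / 2) *r (x + y)) | x y. N x = 1 \<and> N y = 1 \<and> ep <= N (x - y)}"
 proof (rule bdd_belowI[of _ 0])
  fix z assume "z \<in> {1 - N ((1 / 2) *r (x + y)) | x y. N x = 1 \<and> N y = 1 \<and> ep <= N (x - y)}"
  then obtain x y where "z = 1 - N ((1 / 2) *r (x + y))" "N x = 1" "N y = 1" by auto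
  then show "0 <= z" using is_normD(3)[OF assms(1), of "1/2" "x + y"] is_normD(4)[OF assms(1), of x y] by simp
 qed
qed (use assms in blast)

text \<open>Antipodal unit vectors make the set nonempty for \<open>ep <= 2\<close>; the real
  \<open>Inf\<close> of an empty set would carry no information.\<close>

lemma convexity_modulus_nonneg:
 fixes N :: "real ^ 'n => real"
 assumes "is_norm N" "ep <= 2" shows "0 <= convexity_modulus N ep"
 unfolding convexity_modulus_def
proof (rule cInf_greatest)
 obtain e :: "real^'n" where "e \<noteq> 0" using nonzero_Basis nonempty_Basis by blast
 define x where "x = (1 / N e) *r e"
 have "0 < N e" using is_normD(1,2)[OF assms(1)] \<open>e \<noteq> 0\<close> by (simp add: less_le)
 then have x: "N x = 1" using is_normD(3)[OF assms(1), of "1 / N e" e] by (simp add: x_def)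
 have "N (x - (- x)) = 2" using is_normD(3)[OF assms(1), of 2 x] x by (simp add: scaleR_2)
 then have "1 - N ((1 / 2) *r (x + (- x))) \<in> {1 - N ((1 / 2) *r (x + y)) | x y. N x = 1 \<and> N y = 1 \<and> ep <= N (x - y)}"
  using x is_normD(5)[OF assms(1), of x] assms(2) by (intro CollectI exI[of _ x] exI[of _ "- x"]) auto
 then show "{1 - N ((1 / 2) *r (x + y)) | x y. N x = 1 \<and> N y = 1 \<and> ep <= N (x - y)} \<noteq> {}" by blast
 fix z assume "z \<in> {1 - N ((1 / 2) *r (x + y)) | x y. N x = 1 \<and> N y = 1 \<and> ep <= N (x - y)}"
 then obtain x y where "z = 1 - N ((1 / 2) *r (x + y))" "N x = 1" "N y = 1" by auto
 then show "0 <= z" using is_normD(3)[OF assms(1), of "1/2" "x + y"] is_normD(4)[OF assms(1), of x y] by simp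
qed

text \<open>The gain \<delta> depends on \<open>p\<close>, \<open>e\<close> and the modulus
  \<open>m\<close> only, so that it serves all the norms \<open>H x\<close> at once. The larger
  vector is scaled to norm 1; let \<open>t\<close> be the norm of the other. If \<open>t\<close>
  stays away from 1, strict convexity of the power gives the gain, uniformly by compactness. If
  \<open>t\<close> is close to 1, the second vector is nearly a unit vector, still separated from
  the first, and the modulus of convexity applies.\<close>

lemma uniform_convexity_powr:
 fixes m :: "real => real" and p e :: real
 assumes p: "1 < p" and m: "!!ep. 0 < ep ==> ep <= 2 ==> 0 < m ep" and e: "0 < e"
 obtains \<delta> where "0 < \<delta>"
  "!!(N :: real ^ 'n => real) \<xi> \<eta>. is_norm N ==> (\<forall>ep. 0 < ep \<and> ep <= 2 --> m ep <= convexity_modulus N ep) ==>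
   e * (N \<xi> powr p + N \<eta> powr p) <= N (\<xi> - \<eta>) powr p ==>
   N ((1 / 2) *r (\<xi> + \<eta>)) powr p <= (1 - \<delta>) * ((N \<xi> powr p + N \<eta> powr p) / 2)"
proof -
 \<comment> \<open>After scaling, the hypothesis forces distance at least
   \<open>e powr (1 / p)\<close>; the cap 2 keeps the argument of the modulus in its range.\<close>
 define b where "b = min (e powr (1 / p)) 2"
 have b: "0 < b" "b <= 2" "b <= e powr (1 / p)" using e by (auto simp: b_def)
 define d where "d = min (m (b / 2)) 1"
 have d: "0 < d" "d <= 1" "d <= m (b / 2)" using m[of "b / 2"] b by (auto simp: d_def)
 \<comment> \<open>Scaling a vector of norm larger than 1 - \<tau> to norm 1 moves it by less than
   \<tau>: this leaves distance \<open>b / 2\<close> to the first vector and costs the midpoint at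
   most \<open>d / 4\<close>.\<close>
 define \<tau> where "\<tau> = min (b / 2) (d / 2)"
 have \<tau>: "0 < \<tau>" "\<tau> <= b / 2" "\<tau> <= d / 2" "\<tau> <= 1/2" using b d by (auto simp: \<tau>_def)
 \<comment> \<open>The quotient of the power of the mean by the mean of the powers. It is continuous
   and smaller than 1 on the compact interval, so its maximum there is smaller than 1.\<close>
 define q where "q t = ((1 + t) / 2) powr p / ((1 + t powr p) / 2)" for t
 have "continuous_on {0..1 - \<tau>} q"
  unfolding q_def by (intro continuous_intros continuous_on_powr') (use p in \<open>auto simp: add_nonneg_eq_0_iff\<close>)
 then obtain t0 where t0: "t0 \<in> {0..1 - \<tau>}" "!!t. t \<in> {0..1 - \<tau>} ==> q t <= q t0"
  using continuous_attains_sup[of "{0..1 - \<tau>}" q] \<tau> by (auto simp: not_less)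
 have pos: "0 < 1 + t powr p" for t :: real by (simp add: add_pos_nonneg)
 have qt0: "q t0 < 1"
  using powr_midpoint_strict[OF p, of t0] t0(1) \<tau>(1) pos[of t0] by (simp add: q_def divide_less_eq)
 define \<delta>1 where "\<delta>1 = 1 - q t0"
 \<comment> \<open>In the second case the midpoint has norm at most 1 - 3d/4, while the mean of the
   norms is at least 1 - d/4.\<close>
 define r where "r = ((1 - 3 * d / 4) / (1 - d / 4)) powr p"
 have r: "r < 1"
 proof -
  have "r < 1 powr p" unfolding r_def using d p by (intro powr_less_mono2) (auto simp: field_simps)
  then show ?thesis by simp
 qed
 define \<delta> where "\<delta> = min \<delta>1 (1 - r)"
 have \<delta>: "0 < \<delta>" "\<delta> <= 1 - q t0" "\<delta> <= 1 - r" using qt0 r by (auto simp: \<delta>_def \<delta>1_def)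
 have main: "N ((1 / 2) *r (x + y)) powr p <= (1 - \<delta>) * ((1 + N y powr p) / 2)"
  if N: "is_norm N" "!!ep. 0 < ep ==> ep <= 2 ==> m ep <= convexity_modulus N ep"
   and xy: "N x = 1" "N y <= 1" "e * (1 + N y powr p) <= N (x - y) powr p"
  for N :: "real ^ 'n => real" and x y
 proof -
  define t where "t = N y"
  have t: "0 <= t" "t <= 1" using xy is_normD(1)[OF N(1)] by (auto simp: t_def)
  have half: "N ((1 / 2) *r (x + z)) = N (x + z) / 2" for z using is_normD(3)[OF N(1), of "1/2" "x + z"] by simp
  have "e <= N (x - y) powr p"
  proof -
   have "e * 1 <= e * (1 + N y powr p)" using e by (intro mult_left_mono) auto
   then show ?thesis using xy(3) by simp
  qed
  then have "e powr (1 / p) <= (N (x - y) powr p) powr (1 / p)" using e p by (intro powr_mono2) auto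
  also have "... = N (x - y)" using p is_normD(1)[OF N(1)] by (simp add: powr_powr)
  finally have bxy: "b <= N (x - y)" using b by simp
  show ?thesis
  proof (cases "t <= 1 - \<tau>")
   case True
   have "N ((1 / 2) *r (x + y)) powr p <= ((1 + t) / 2) powr p"
    unfolding half using is_normD(1,4)[OF N(1), of "x + y"] is_normD(4)[OF N(1), of x y] xy p
    by (intro powr_mono2) (auto simp: t_def)
   also have "... = q t * ((1 + t powr p) / 2)" using pos[of t] by (simp add: q_def)
   also have "... <= (1 - \<delta>) * ((1 + t powr p) / 2)"
    using t0(2)[of t] True t \<delta> pos[of t] by (intro mult_right_mono) auto
   finally show ?thesis by (simp add: t_def)
  next
   case False
   then have t1: "1 - \<tau> < t" "0 < t" using \<tau> by auto
   define y' where "y' = (1 / t) *r y"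
   have y': "N y' = 1" using is_normD(3)[OF N(1), of "1 / t" y] t1 by (simp add: y'_def t_def)
   have yy: "N (y - y') = 1 - t"
   proof -
    have "y - y' = (1 - 1 / t) *r y" by (simp add: y'_def algebra_simps)
    then have "N (y - y') = \<bar>1 - 1 / t\<bar> * t" using is_normD(3)[OF N(1), of "1 - 1 / t" y] by (simp add: t_def)
    also have "... = (1 / t - 1) * t" using t t1 by (simp add: abs_if field_simps)
    also have "... = 1 - t" using t1 by (simp add: field_simps)
    finally show ?thesis .
   qed
   have "N (x - y) <= N (x - y') + N (y - y')"
    using is_normD(6)[OF N(1), of "x - y'" "y - y'"] by simp
   then have "b / 2 <= N (x - y')" using bxy yy t1 \<tau> by simp
   then have "convexity_modulus N (b / 2) <= 1 - N ((1 / 2) *r (x + y'))"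
    by (intro convexity_modulus_le N xy y')
   then have "N ((1 / 2) *r (x + y')) <= 1 - d" using N(2)[of "b / 2"] b d by simp
   moreover have "N (x + y) <= N (x + y') + N (y - y')"
    using is_normD(4)[OF N(1), of "x + y'" "y - y'"] by (simp add: add.commute add.left_commute)
   ultimately have "N ((1 / 2) *r (x + y)) <= 1 - 3 * d / 4" using yy t1 \<tau> by (simp add: half)
   then have "N ((1 / 2) *r (x + y)) powr p <= (1 - 3 * d / 4) powr p"
    using is_normD(1)[OF N(1)] p by (intro powr_mono2) auto
   also have "... = r * (1 - d / 4) powr p" using d by (simp add: r_def powr_divide)
   also have "... <= (1 - \<delta>) * ((1 + t powr p) / 2)"
   proof (intro mult_mono)
    have "(1 - d / 4) powr p <= ((1 - 1/2) * 1 + (1/2) * t) powr p" using t1 \<tau> d p by (intro powr_mono2) auto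
    also have "... <= (1 - 1/2) * 1 powr p + (1/2) * t powr p" using t p by (intro powr_convex_combination) auto
    finally show "(1 - d / 4) powr p <= (1 + t powr p) / 2" by (simp add: field_simps)
    have "0 <= r" by (simp add: r_def)
    then show "r <= 1 - \<delta>" "0 <= 1 - \<delta>" using \<delta> by auto
   qed simp
   finally show ?thesis by (simp add: t_def)
  qed
 qed
 have main2: "N ((1 / 2) *r (\<xi> + \<eta>)) powr p <= (1 - \<delta>) * ((N \<xi> powr p + N \<eta> powr p) / 2)"
  if N: "is_norm N" "!!ep. 0 < ep ==> ep <= 2 ==> m ep <= convexity_modulus N ep"
   and le: "e * (N \<xi> powr p + N \<eta> powr p) <= N (\<xi> - \<eta>) powr p" "N \<eta> <= N \<xi>"
  for N :: "real ^ 'n => real" and \<xi> \<eta>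
 proof (cases "N \<xi> = 0")
  case True
  then have "N \<eta> = 0" using le(2) is_normD(1)[OF N(1), of \<eta>] by linarith
  then have "\<xi> = 0" "\<eta> = 0" using True is_normD(2)[OF N(1), of \<xi>] is_normD(2)[OF N(1), of \<eta>] by blast+
  then show ?thesis by (simp add: is_normD(7)[OF N(1)])
 next
  case False
  define s where "s = N \<xi>"
  have s: "0 < s" using False is_normD(1)[OF N(1), of \<xi>] by (simp add: s_def)
  define x y where "x = (1 / s) *r \<xi>" and "y = (1 / s) *r \<eta>"
  have xy: "\<xi> = s *r x" "\<eta> = s *r y" using s by (auto simp: x_def y_def)
  have Ns: "N (s *r z) = s * N z" for z using is_normD(3)[OF N(1)] s by simp
  have "\<xi> - \<eta> = s *r (x - y)" unfolding xy by (rule scaleR_diff_right[symmetric])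
  moreover have "(1 / 2) *r (\<xi> + \<eta>) = s *r ((1 / 2) *r (x + y))"
   unfolding xy scaleR_add_right[symmetric] by (rule scaleR_left_commute)
  ultimately have sc: "N (\<xi> - \<eta>) = s * N (x - y)" "N ((1 / 2) *r (\<xi> + \<eta>)) = s * N ((1 / 2) *r (x + y))" "N \<eta> = s * N y"
   using Ns xy(2) by metis+
  have pm: "(s * N z) powr p = s powr p * N z powr p" for z
   using s is_normD(1)[OF N(1), of z] by (simp add: powr_mult)
  have "s = s * N x" using Ns[of x] unfolding xy(1)[symmetric] s_def[symmetric] .
  then have x1: "N x = 1" using s by simp
  have sp: "0 < s powr p" using s by simp
  have "N ((1 / 2) *r (x + y)) powr p <= (1 - \<delta>) * ((1 + N y powr p) / 2)"
  proof (rule main[OF N x1])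
   show "N y <= 1" using le(2) s sc(3) by (simp add: s_def[symmetric])
   have "s powr p * (e * (1 + N y powr p)) <= s powr p * N (x - y) powr p"
    using le(1) unfolding sc s_def[symmetric] pm by (simp add: algebra_simps)
   then show "e * (1 + N y powr p) <= N (x - y) powr p" using sp by simp
  qed auto
  from mult_left_mono[OF this, of "s powr p"] show ?thesis
   unfolding sc s_def[symmetric] pm by (simp add: algebra_simps)
 qed
 show thesis
 proof (rule that[OF \<delta>(1)])
  fix N :: "real ^ 'n => real" and \<xi> \<eta>
  assume N: "is_norm N" and "\<forall>ep. 0 < ep \<and> ep <= 2 --> m ep <= convexity_modulus N ep"
   and le: "e * (N \<xi> powr p + N \<eta> powr p) <= N (\<xi> - \<eta>) powr p"
  then have N2: "!!ep. 0 < ep ==> ep <= 2 ==> m ep <= convexity_modulus N ep" by blast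
  show "N ((1 / 2) *r (\<xi> + \<eta>)) powr p <= (1 - \<delta>) * ((N \<xi> powr p + N \<eta> powr p) / 2)"
  proof (cases "N \<eta> <= N \<xi>")
   case True
   show ?thesis by (rule main2[OF N N2 le True])
  next
   case False
   have "N ((1 / 2) *r (\<eta> + \<xi>)) powr p <= (1 - \<delta>) * ((N \<eta> powr p + N \<xi> powr p) / 2)"
    by (rule main2[OF N N2]) (use False le is_normD(8)[OF N, of \<xi> \<eta>] in \<open>simp_all add: add.commute\<close>)
   then show ?thesis by (simp add: add.commute)
  qed
 qed
qed

text \<open>At each point the power of the difference is either at most the fraction
  \<open>e\<close> of the sum of the energies, or convexity gains a fixed portion of that sum. In
  both cases it is at most \<open>e\<close> times the sum plus \<open>C\<close> times the convexity
  gap at the midpoint. After integration the gap is bounded above by a sequence tending to 0, since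
  \<open>c\<close> bounds the midpoint energy from below and has the common limit
  \<open>L\<close>.\<close>

lemma uniform_convexity_integral:
 fixes H :: "'a => real ^ 'n => real"
 assumes p: "1 < p" and m: "!!ep. 0 < ep ==> ep <= 2 ==> 0 < m ep"
  and H: "AE x in M. is_norm (H x) \<and> (\<forall>ep. 0 < ep \<and> ep <= 2 --> m ep <= convexity_modulus (H x) ep)"
  and int: "!!j. integrable M (%x. H x (A j x) powr p)" "!!j. integrable M (%x. H x (B j x) powr p)"
   "!!j. integrable M (%x. H x ((1 / 2) *r (A j x + B j x)) powr p)"
   "!!j. integrable M (%x. H x (A j x - B j x) powr p)"
  and lim: "(%j. LINT x|M. H x (A j x) powr p) ~~> L" "(%j. LINT x|M. H x (B j x) powr p) ~~> L"
  and c: "!!j. c j <= (LINT x|M. H x ((1 / 2) *r (A j x + B j x)) powr p)" "c ~~> L"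
 shows "(%j. LINT x|M. H x (A j x - B j x) powr p) ~~> 0"
proof -
 define I where "I j = (LINT x|M. H x (A j x - B j x) powr p)" for j
 define T where "T j = (LINT x|M. H x (A j x) powr p) + (LINT x|M. H x (B j x) powr p)" for j
 have I0: "0 <= I j" for j unfolding I_def by (intro Bochner_Integration.integral_nonneg) simp
 have Tlim: "T ~~> 2 * L" using tendsto_add[OF lim] by (simp add: T_def[abs_def])
 have key: "\<exists>C. \<forall>j. I j <= e * T j + C * (T j / 2 - c j)" if e: "0 < e" for e
 proof -
  obtain \<delta> where \<delta>: "0 < \<delta>"
   "!!(N :: real ^ 'n => real) \<xi> \<eta>. is_norm N ==> (\<forall>ep. 0 < ep \<and> ep <= 2 --> m ep <= convexity_modulus N ep) ==>
   e * (N \<xi> powr p + N \<eta> powr p) <= N (\<xi> - \<eta>) powr p ==>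
   N ((1 / 2) *r (\<xi> + \<eta>)) powr p <= (1 - \<delta>) * ((N \<xi> powr p + N \<eta> powr p) / 2)"
  proof (rule uniform_convexity_powr[OF p _ e])
   show "0 < m ep" if "0 < ep" "ep <= 2" for ep by (rule m[OF that])
  qed (rule that; assumption)
  \<comment> \<open>In the second case the gap is at least \<delta>/2 times the sum of the powers,
    and the power of the difference is at most \<open>2 powr p\<close> times that sum.\<close>
  define C where "C = 2 powr p * 2 / \<delta>"
  have C: "0 < C" using \<delta>(1) by (simp add: C_def)
  have "I j <= e * T j + C * (T j / 2 - c j)" for j
  proof -
   have "I j <= (LINT x|M. e * (H x (A j x) powr p + H x (B j x) powr p) +
     C * ((H x (A j x) powr p + H x (B j x) powr p) / 2 - H x ((1 / 2) *r (A j x + B j x)) powr p))"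
    unfolding I_def
   proof (rule integral_mono_AE)
    show "AE x in M. H x (A j x - B j x) powr p <= e * (H x (A j x) powr p + H x (B j x) powr p) +
     C * ((H x (A j x) powr p + H x (B j x) powr p) / 2 - H x ((1 / 2) *r (A j x + B j x)) powr p)"
     using H
    proof eventually_elim
     fix x assume Hx: "is_norm (H x) \<and> (\<forall>ep. 0 < ep \<and> ep <= 2 --> m ep <= convexity_modulus (H x) ep)"
     then have n: "is_norm (H x)" by blast
     let ?a = "H x (A j x)" and ?b = "H x (B j x)"
     let ?S = "?a powr p + ?b powr p" and ?mid = "H x ((1 / 2) *r (A j x + B j x)) powr p"
     have "?mid <= ((1 - 1/2) * ?a + (1/2) * ?b) powr p"
      using is_normD(1)[OF n] is_normD(3)[OF n, of "1/2" "A j x + B j x"] is_normD(4)[OF n, of "A j x" "B j x"] p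
      by (intro powr_mono2) auto
     also have "... <= (1 - 1/2) * ?a powr p + (1/2) * ?b powr p"
      using is_normD(1)[OF n] p by (intro powr_convex_combination) auto
     finally have mid: "?mid <= ?S / 2" by simp
     show "H x (A j x - B j x) powr p <= e * ?S + C * (?S / 2 - ?mid)"
     proof (cases "e * ?S <= H x (A j x - B j x) powr p")
      case True
      have "?mid <= (1 - \<delta>) * (?S / 2)" using Hx by (intro \<delta>(2)[OF n _ True]) blast
      moreover have "(1 - \<delta>) * (?S / 2) = ?S / 2 - \<delta> * (?S / 2)" by (simp only: left_diff_distrib mult_1_left)
      ultimately have "\<delta> * (?S / 2) <= ?S / 2 - ?mid" by linarith
      then have "C * (\<delta> * (?S / 2)) <= C * (?S / 2 - ?mid)" using C by (intro mult_left_mono) auto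
      also have "C * (\<delta> * (?S / 2)) = 2 powr p * ?S" using \<delta>(1) by (simp add: C_def)
      finally have "2 powr p * ?S <= C * (?S / 2 - ?mid)" .
      moreover have "H x (A j x - B j x) powr p <= (?a + ?b) powr p"
       using is_normD(1,6)[OF n] p by (intro powr_mono2) auto
      moreover have "... <= 2 powr p * ?S" using is_normD(1)[OF n] p by (intro powr_add_le) auto
      moreover have "0 <= e * ?S" using e by simp
      ultimately show ?thesis by linarith
     next
      case False
      moreover have "0 <= C * (?S / 2 - ?mid)" using C mid by simp
      ultimately show ?thesis by linarith
     qed
    qed
   qed (use int in auto)
   also have "... = e * T j + C * (T j / 2 - (LINT x|M. H x ((1 / 2) *r (A j x + B j x)) powr p))"
    using int by (simp add: T_def)
   also have "... <= e * T j + C * (T j / 2 - c j)" using C c(1)[of j] by (intro add_left_mono mult_left_mono) auto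
   finally show ?thesis .
  qed
  then show ?thesis by blast
 qed
 have L0: "0 <= L"
  by (rule LIMSEQ_le_const[OF lim(1)]) (auto intro!: Bochner_Integration.integral_nonneg)
 have "I ~~> 0"
 proof (rule order_tendstoI)
  fix y :: real assume "y < 0"
  show "\<forall>\<^sub>F j in sequentially. y < I j"
  proof (intro always_eventually allI)
   fix j show "y < I j" using I0[of j] \<open>y < 0\<close> by linarith
  qed
 next
  fix y :: real assume y: "0 < y"
  define e where "e = y / (2 * (2 * L + 1))"
  have e: "0 < e" using y L0 by (simp add: e_def)
  obtain C where C: "!!j. I j <= e * T j + C * (T j / 2 - c j)" using key[OF e] by blast
  have "(%j. e * T j + C * (T j / 2 - c j)) ~~> e * (2 * L) + C * (2 * L / 2 - L)"
   by (intro tendsto_intros Tlim c(2)) simp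
  moreover have "e * (2 * L) + C * (2 * L / 2 - L) < y"
  proof -
   have "e * (2 * L) <= e * (2 * L + 1)" using e by simp
   also have "... = y / 2"
    using L0 unfolding e_def by (simp only: divide_divide_eq_left[symmetric] times_divide_eq_left) (simp add: field_simps)
   also have "... < y" using y by simp
   finally show ?thesis by simp
  qed
  ultimately have "\<forall>\<^sub>F j in sequentially. e * T j + C * (T j / 2 - c j) < y" by (rule order_tendstoD)
  then show "\<forall>\<^sub>F j in sequentially. I j < y" by eventually_elim (use C in \<open>auto intro: le_less_trans\<close>)
 qed
 then show ?thesis by (simp add: I_def[abs_def])
qed

section \<open>Measurability along a family of norms\<close>

lemma borel_measurable_lebesgue_on_AE:
 fixes f g :: "real ^ 'n => 'b::euclidean_space"
 assumes "Om \<in> sets lebesgue" "f \<in> borel_measurable (lebesgue_on Om)" "AE x in lebesgue_on Om. f x = g x"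
 shows "g \<in> borel_measurable (lebesgue_on Om)"
proof -
 have "(%x. if x \<in> Om then f x else 0) \<in> borel_measurable lebesgue"
  by (rule borel_measurable_if_I[OF assms(2,1)])
 moreover have "AE x in lebesgue. x \<in> Om --> f x = g x"
  using assms(1,3) by (subst (asm) AE_restrict_space_iff) auto
 then have "AE x in lebesgue. (if x \<in> Om then f x else 0) = (if x \<in> Om then g x else 0)"
  by eventually_elim auto
 ultimately have "(%x. if x \<in> Om then g x else 0) \<in> borel_measurable lebesgue"
  by (rule borel_measurable_AE)
 then show ?thesis using assms(1) borel_measurable_if_D by blast
qed

text \<open>\<open>H\<close> is a Caratheodory function: measurable in the point and, where it is a
  norm, continuous in the vector. Simple functions approximating \<open>G\<close> reduce the claim
  to finitely many fixed vectors; the null set on which continuity may fail is first multiplied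
  away.\<close>

lemma borel_measurable_norm_family:
 fixes H :: "real ^ 'n => real ^ 'n => real" and G :: "real ^ 'n => real ^ 'n"
 assumes Om: "Om \<in> sets lebesgue" and H: "AE x in lebesgue_on Om. is_norm (H x)"
  "!!\<xi>. (%x. H x \<xi>) \<in> borel_measurable (lebesgue_on Om)"
  and G: "G \<in> borel_measurable (lebesgue_on Om)"
 shows "(%x. H x (G x)) \<in> borel_measurable (lebesgue_on Om)"
proof -
 let ?M = "lebesgue_on Om"
 obtain N where N: "{x \<in> space ?M. \<not> is_norm (H x)} \<subseteq> N" "N \<in> null_sets ?M"
  using H(1) by (auto elim: AE_E3 simp: eventually_ae_filter)
 obtain s where s: "!!i. simple_function ?M (s i)" "!!x. x \<in> space ?M ==> (%i. s i x) ~~> G x"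
  using borel_measurable_implies_sequence_metric[OF G, of 0] by blast
 have Nm: "N \<in> sets ?M" using N by auto
 define H' where "H' x \<xi> = indicator (space ?M - N) x * H x \<xi>" for x \<xi>
 have H'm: "(%x. H' x \<xi>) \<in> borel_measurable ?M" for \<xi>
  unfolding H'_def using Nm H(2) by (intro borel_measurable_times borel_measurable_indicator) auto
 have "(%x. H' x (s i x)) \<in> borel_measurable ?M" for i
 proof -
  have "(%x. \<Sum>y\<in>s i ` space ?M. indicator (s i -` {y} \<inter> space ?M) x * H' x y) \<in> borel_measurable ?M"
   using s(1)[of i] H'm by (intro borel_measurable_sum borel_measurable_times borel_measurable_indicator)
    (auto simp: simple_function_def)
  also have "?this \<longleftrightarrow> ?thesis"
  proof (rule measurable_cong)
   fix x assume x: "x \<in> space ?M"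
   have "(\<Sum>y\<in>s i ` space ?M. indicator (s i -` {y} \<inter> space ?M) x * H' x y)
     = (\<Sum>y\<in>s i ` space ?M. if y = s i x then H' x y else 0)"
    by (rule sum.cong) (use x in \<open>auto simp: indicator_def\<close>)
   also have "... = H' x (s i x)" using x s(1)[of i] by (subst sum.delta) (auto simp: simple_function_def)
   finally show "(\<Sum>y\<in>s i ` space ?M. indicator (s i -` {y} \<inter> space ?M) x * H' x y) = H' x (s i x)" .
  qed
  finally show ?thesis .
 qed
 moreover have "(%i. H' x (s i x)) ~~> H' x (G x)" if "x \<in> space ?M" for x
 proof (cases "x \<in> N")
  case False
  then have "is_norm (H x)" using N(1) that by blast
  then show ?thesis unfolding H'_def by (intro tendsto_intros is_norm_tendsto s(2) that)
 qed (simp add: H'_def)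
 ultimately have "(%x. H' x (G x)) \<in> borel_measurable ?M"
  by (rule borel_measurable_LIMSEQ_real[rotated])
 moreover have "AE x in ?M. H' x (G x) = H x (G x)"
  using AE_not_in[OF N(2)] AE_space by eventually_elim (simp add: H'_def)
 ultimately show ?thesis by (rule borel_measurable_lebesgue_on_AE[OF Om])
qed

section \<open>Topology of the complements of the exhausting sets\<close>

lemma C1_domain_frontier_exterior:
 assumes "C1_domain om" "z \<in> frontier om" "open W" "z \<in> W"
 obtains y where "y \<in> W" "y \<notin> closure om"
proof -
 obtain r e \<gamma> where r: "r > 0" and e: "norm e = 1" and \<gamma>: "C_k 1 \<gamma>"
  and eq: "om \<inter> ball z r = {x \<in> ball z r. \<gamma> (x - (x \<bullet> e) *r e) < x \<bullet> e}"
 proof -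
  have "\<exists>r>0. \<exists>e \<gamma>. norm e = 1 \<and> C_k 1 \<gamma> \<and>
    om \<inter> ball z r = {x \<in> ball z r. \<gamma> (x - (x \<bullet> e) *r e) < x \<bullet> e}"
   using assms(1,2) unfolding C1_domain_def by (rule conjunct2[THEN bspec])
  then show thesis using that by blast
 qed
 obtain ep where ep: "0 < ep" "ball z ep \<subseteq> W" using assms(3,4) openE by blast
 have c: "continuous_on UNIV (%x. \<gamma> (x - (x \<bullet> e) *r e))"
  by (rule continuous_on_compose2[OF C_k_continuous[OF \<gamma>]]) (auto intro!: continuous_intros)
 have "open om" using assms(1) by (simp add: C1_domain_def is_domain_def)
 then have "z \<notin> om" using assms(2) by (simp add: frontier_def interior_open)
 have z: "z \<bullet> e <= \<gamma> (z - (z \<bullet> e) *r e)" 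
 proof (rule ccontr)
  assume "\<not> ?thesis"
  then have "z \<in> {x \<in> ball z r. \<gamma> (x - (x \<bullet> e) *r e) < x \<bullet> e}" using r by simp
  then show False using \<open>z \<notin> om\<close> unfolding eq[symmetric] by simp
 qed
 define s where "s = min ep r / 2"
 have s: "0 < s" "s < ep" "s < r" using ep r by (auto simp: s_def)
 \<comment> \<open>Moving down in the direction \<open>e\<close> keeps the horizontal part, so
   \<open>y\<close> lies strictly below the graph, and a whole neighbourhood of it misses
   \<open>om\<close>.\<close>
 define y where "y = z - s *r e"
 have ye: "y \<bullet> e = z \<bullet> e - s" using e by (simp add: y_def inner_diff_left norm_eq_1)
 have yp: "y - (y \<bullet> e) *r e = z - (z \<bullet> e) *r e" unfolding ye by (simp add: y_def algebra_simps)
 have "y \<in> ball z r" "y \<in> ball z ep" using s e by (auto simp: y_def dist_norm)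
 define E where "E = ball z r \<inter> {x. x \<bullet> e < \<gamma> (x - (x \<bullet> e) *r e)}"
 have "open E" unfolding E_def by (intro open_Int open_ball open_Collect_less c continuous_intros)
 moreover have "y \<in> E" unfolding E_def using \<open>y \<in> ball z r\<close> yp ye z s by simp
 moreover have "E \<inter> om = {}" 
 proof (rule equals0I)
  fix x assume "x \<in> E \<inter> om"
  then have x: "x \<in> ball z r" "x \<bullet> e < \<gamma> (x - (x \<bullet> e) *r e)" "x \<in> om \<inter> ball z r" by (auto simp: E_def)
  from x(3) have "\<gamma> (x - (x \<bullet> e) *r e) < x \<bullet> e" unfolding eq by blast
  then show False using x(2) by simp
 qed
 ultimately have "y \<notin> closure om" using open_Int_closure_eq_empty[of E om] by blast
 then show thesis using that[of y] \<open>y \<in> ball z ep\<close> ep by blast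
qed

text \<open>The complement is an increasing union of shells. The next shell arises from the old one,
  \<open>A\<close>, by adding the interface \<open>F\<close> and an annulus \<open>B\<close>. Each
  of \<open>A\<close> and \<open>B\<close> stays connected when \<open>F\<close> is added because
  \<open>F\<close> lies in its closure, and the two enlarged sets meet in \<open>F\<close>. That
  boundary points can be approached from \<open>B\<close> is where the graph condition on the
  boundary enters.\<close>

lemma exhaustion_complement_domain:
 fixes om :: "nat => (real ^ 'n) set"
 assumes ex: "smooth_exhaustion Om om" and dom: "!!i. is_domain (om (Suc i) - closure (om i))"
  and Om: "open Om"
 shows "is_domain (Om - closure (om i))"
proof -
 have C1: "C1_domain (om k)" and cl: "closure (om k) \<subseteq> om (Suc k)" and cpt: "compact (closure (om k))"
  and un: "(\<Union>k. om k) = Om" for k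
  using ex by (auto simp: smooth_exhaustion_def compactly_in_def)
 have op: "open (om k)" and ne: "om k \<noteq> {}" for k using C1[of k] by (auto simp: C1_domain_def is_domain_def)
 have mono1: "om k \<subseteq> om (Suc k)" for k using cl[of k] closure_subset by blast
 have mono: "om k \<subseteq> om l" if "k <= l" for k l using that mono1 by (rule lift_Suc_mono_le[rotated])
 have conn: "connected (om (Suc (i + k)) - closure (om i))" for k
 proof (induction k)
  case 0
  then show ?case using dom[of i] by (simp add: is_domain_def)
 next
  case (Suc k)
  let ?j = "Suc (i + k)"
  define A B F where "A = om ?j - closure (om i)" and "B = om (Suc ?j) - closure (om ?j)" and "F = frontier (om ?j)"
  have clij: "closure (om i) \<subseteq> om ?j" using cl[of i] mono[of "Suc i" ?j] by auto
  have Fd: "F = closure (om ?j) - om ?j" by (simp add: F_def frontier_def interior_open op)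
  have FA: "F \<subseteq> closure A"
  proof
   fix z assume z: "z \<in> F"
   then have zc: "z \<in> closure (om ?j)" "z \<notin> closure (om i)" using Fd clij by auto
   show "z \<in> closure A" unfolding closure_iff_nhds_not_empty
   proof (intro allI impI)
    fix T S assume "S \<subseteq> T" "open S" "z \<in> S"
    then have "open (S - closure (om i))" "z \<in> S - closure (om i)" using zc by auto
    then have "(S - closure (om i)) \<inter> om ?j \<noteq> {}" using zc(1) open_Int_closure_eq_empty by blast
    then show "A \<inter> T \<noteq> {}" using \<open>S \<subseteq> T\<close> unfolding A_def by blast
   qed
  qed
  have FB: "F \<subseteq> closure B"
  proof
   fix z assume z: "z \<in> F"
   then have zo: "z \<in> om (Suc ?j)" using Fd cl[of ?j] by auto
   show "z \<in> closure B" unfolding closure_iff_nhds_not_empty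
   proof (intro allI impI)
    fix T S assume "S \<subseteq> T" "open S" "z \<in> S"
    obtain y where "y \<in> S \<inter> om (Suc ?j)" "y \<notin> closure (om ?j)"
     by (rule C1_domain_frontier_exterior[OF C1[of ?j], of z "S \<inter> om (Suc ?j)"])
       (use z zo \<open>open S\<close> \<open>z \<in> S\<close> op F_def in auto)
    then show "B \<inter> T \<noteq> {}" using \<open>S \<subseteq> T\<close> unfolding B_def by blast
   qed
  qed
  have "F \<noteq> {}"
  proof
   assume "F = {}"
   then have "om ?j = {} \<or> om ?j = UNIV" unfolding F_def by (simp add: frontier_eq_empty)
   then have "compact (UNIV :: (real^'n) set)" using ne[of ?j] cpt[of ?j] by auto
   then show False using not_compact_UNIV by blast
  qed
  moreover have "connected (A \<union> F)"
   by (rule connected_intermediate_closure[of A]) (use Suc FA closure_subset[of A] in \<open>auto simp: A_def\<close>)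
  moreover have "connected (B \<union> F)"
   by (rule connected_intermediate_closure[of B]) (use dom[of ?j] FB closure_subset[of B] in \<open>auto simp: B_def is_domain_def\<close>)
  ultimately have "connected ((A \<union> F) \<union> (B \<union> F))" using connected_Un[of "A \<union> F" "B \<union> F"] by blast
  moreover have "(A \<union> F) \<union> (B \<union> F) = om (Suc (i + Suc k)) - closure (om i)"
   unfolding A_def B_def Fd using cl[of ?j] mono1[of ?j] clij closure_subset[of "om ?j"] by auto
  ultimately show ?case by simp
 qed
 have eq: "Om - closure (om i) = (\<Union>k. om (Suc (i + k)) - closure (om i))"
 proof
  show "Om - closure (om i) \<subseteq> (\<Union>k. om (Suc (i + k)) - closure (om i))"
  proof
   fix x assume x: "x \<in> Om - closure (om i)"
   then obtain l where "x \<in> om l" using un by auto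
   then have "x \<in> om (Suc (i + l))" using mono[of l "Suc (i + l)"] by auto
   then show "x \<in> (\<Union>k. om (Suc (i + k)) - closure (om i))" using x by auto
  qed
 qed (use un in auto)
 have ne0: "om (Suc i) - closure (om i) \<noteq> {}" using dom[of i] by (simp add: is_domain_def)
 have "connected (\<Union>k. om (Suc (i + k)) - closure (om i))"
 proof (rule connected_Union)
  have "om (Suc i) - closure (om i) \<subseteq> \<Inter>(range (%k. om (Suc (i + k)) - closure (om i)))"
   using mono[of "Suc i" "Suc (i + k)" for k] by fastforce
  then show "\<Inter>(range (%k. om (Suc (i + k)) - closure (om i))) \<noteq> {}" using ne0 by blast
 qed (use conn in auto)
 then have "connected (Om - closure (om i))" by (simp add: eq)
 moreover have "Om - closure (om i) \<noteq> {}" using ne0 un by blast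
 ultimately show ?thesis using Om by (simp add: is_domain_def open_Diff)
qed

section \<open>Estimates from the Morrey condition\<close>

lemma nn_integral_powr_0:
 fixes a \<tau> :: real
 assumes "-1 < a" "0 <= \<tau>"
 shows "(NL s. ennreal (s powr a) * indicator {0..\<tau>} s) = ennreal (\<tau> powr (a + 1) / (a + 1))"
proof -
 have "((%s. if s \<in> {0..\<tau>} then s powr a else 0) has_integral \<tau> powr (a + 1) / (a + 1)) UNIV"
  using has_integral_powr_from_0[OF assms] by (simp only: has_integral_restrict_UNIV)
 then have "(NL s. ennreal (if s \<in> {0..\<tau>} then s powr a else 0)) = ennreal (\<tau> powr (a + 1) / (a + 1))"
  by (intro nn_integral_has_integral_lborel) auto
 moreover have "(%s. ennreal (if s \<in> {0..\<tau>} then s powr a else 0)) = (%s. ennreal (s powr a) * indicator {0..\<tau>} s)"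
  by (auto simp: fun_eq_iff indicator_def)
 ultimately show ?thesis by simp
qed

lemma nn_integral_lborel_scale:
 fixes f :: "real ^ 'n => ennreal"
 assumes [measurable]: "f \<in> borel_measurable borel" and c: "0 < c"
 shows "(NL z. f (x + c *r z)) = ennreal (c powr (- real CARD('n))) * (NL z. f z)"
proof -
 have "(NL z. f z) = ennreal (c ^ CARD('n)) * (NL z. f (x + c *r z))"
  using c by (subst lborel_affine[of c x]) (simp_all add: nn_integral_density nn_integral_distr nn_integral_cmult)
 then have "ennreal (c powr (- real CARD('n))) * (NL z. f z)
   = ennreal (c powr (- real CARD('n)) * c ^ CARD('n)) * (NL z. f (x + c *r z))"
  using c by (simp add: ennreal_mult mult.assoc)
 also have "c powr (- real CARD('n)) * c ^ CARD('n) = 1"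
  using c by (simp add: powr_minus powr_realpow)
 finally show ?thesis by simp
qed

lemma DERIV_abs_powr:
 fixes p t :: real
 assumes p: "1 < p"
 shows "DERIV (%t. \<bar>t\<bar> powr p) t :> p * \<bar>t\<bar> powr (p - 1) * sgn t"
proof -
 consider "t < 0" | "t = 0" | "0 < t" by linarith
 then show ?thesis
 proof cases
  case 1
  have "DERIV (%t. (- t) powr p) t :> p * (- t) powr (p - 1) * (- 1)"
   using 1 by (auto intro!: derivative_eq_intros)
  then show ?thesis
   by (rule has_field_derivative_transform_within_open[where S="{..<0}", THEN DERIV_cong]) (use 1 in auto)
 next
  case 2
  have "((%h. (\<bar>0 + h\<bar> powr p - \<bar>0\<bar> powr p) / h) \<longlongrightarrow> 0) (at 0)"
  proof (rule Lim_null_comparison)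
   show "\<forall>\<^sub>F h in at 0. norm ((\<bar>0 + h\<bar> powr p - \<bar>0\<bar> powr p) / h) <= \<bar>h\<bar> powr (p - 1)"
    by (auto simp: eventually_at_filter powr_diff abs_div intro!: always_eventually)
   have "((%h::real. \<bar>h\<bar> powr (p - 1)) \<longlongrightarrow> \<bar>0\<bar> powr (p - 1)) (at 0)"
    by (rule tendsto_powr2) (use p in \<open>auto intro!: tendsto_rabs_zero tendsto_ident_at\<close>)
   then show "((%h::real. \<bar>h\<bar> powr (p - 1)) \<longlongrightarrow> 0) (at 0)" by simp
  qed
  then show ?thesis using 2 by (simp add: DERIV_def)
 next
  case 3
  have "DERIV (%t. t powr p) t :> p * t powr (p - 1)"
   using 3 by (auto intro!: derivative_eq_intros)
  then show ?thesis
   by (rule has_field_derivative_transform_within_open[where S="{0<..}", THEN DERIV_cong]) (use 3 in auto)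
 qed
qed

lemma continuous_on_abs_powr_sgn:
 fixes p :: real
 assumes "1 < p" shows "continuous_on UNIV (%t. p * \<bar>t\<bar> powr (p - 1) * sgn t)"
proof (rule continuous_at_imp_continuous_on, rule ballI)
 fix t :: real
 show "isCont (%t. p * \<bar>t\<bar> powr (p - 1) * sgn t) t"
 proof (cases "t = 0")
  case True
  have "((%t. p * \<bar>t\<bar> powr (p - 1) * sgn t) \<longlongrightarrow> 0) (at 0)"
  proof (rule Lim_null_comparison)
   show "\<forall>\<^sub>F t in at 0. norm (p * \<bar>t\<bar> powr (p - 1) * sgn t) <= p * \<bar>t\<bar> powr (p - 1)"
    using assms by (auto simp: abs_mult sgn_if intro!: always_eventually)
   have "((%h::real. \<bar>h\<bar> powr (p - 1)) \<longlongrightarrow> \<bar>0\<bar> powr (p - 1)) (at 0)"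
    by (rule tendsto_powr2) (use assms in \<open>auto intro!: tendsto_rabs_zero tendsto_ident_at\<close>)
   then show "((%t::real. p * \<bar>t\<bar> powr (p - 1)) \<longlongrightarrow> 0) (at 0)" by (simp add: tendsto_mult_right_zero)
  qed
  then show ?thesis using True by (simp add: isCont_def)
 next
  case False
  then show ?thesis by (intro continuous_intros isCont_sgn) auto
 qed
qed

lemma line_bound:
 fixes \<phi> :: "real => real"
 assumes \<tau>: "0 <= \<tau>" and D: "!!s. DERIV \<phi> s :> \<phi>' s" and c: "continuous_on UNIV \<phi>'"
 shows "ennreal \<bar>\<phi> 0\<bar> <= ennreal \<bar>\<phi> \<tau>\<bar> + (NL s. ennreal \<bar>\<phi>' s\<bar> * indicator {0..\<tau>} s)"
proof -
 have b: "has_bochner_integral lborel (%s. \<phi>' s * indicator {0..\<tau>} s) (\<phi> \<tau> - \<phi> 0)"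
  using c by (intro has_bochner_integral_FTC_Icc_real \<tau> D) (auto simp: continuous_on_eq_continuous_at)
 have "ennreal \<bar>\<phi> \<tau> - \<phi> 0\<bar> <= (NL s. ennreal (norm (\<phi>' s * indicator {0..\<tau>} s)))"
  using has_bochner_integral_integral_eq[OF b] integral_norm_bound_ennreal[of lborel "%s. \<phi>' s * indicator {0..\<tau>} s"] b
  by (simp add: has_bochner_integral_iff)
 also have "... = (NL s. ennreal \<bar>\<phi>' s\<bar> * indicator {0..\<tau>} s)"
  by (rule nn_integral_cong) (auto simp: indicator_def)
 finally have 1: "ennreal \<bar>\<phi> \<tau> - \<phi> 0\<bar> <= (NL s. ennreal \<bar>\<phi>' s\<bar> * indicator {0..\<tau>} s)" .
 have "ennreal \<bar>\<phi> 0\<bar> <= ennreal (\<bar>\<phi> \<tau>\<bar> + \<bar>\<phi> \<tau> - \<phi> 0\<bar>)" by (intro ennreal_leI) auto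
 also have "... = ennreal \<bar>\<phi> \<tau>\<bar> + ennreal \<bar>\<phi> \<tau> - \<phi> 0\<bar>" by simp
 also have "... <= ennreal \<bar>\<phi> \<tau>\<bar> + (NL s. ennreal \<bar>\<phi>' s\<bar> * indicator {0..\<tau>} s)"
  using 1 by (intro add_left_mono)
 finally show ?thesis .
qed

lemma GDERIV_line:
 fixes u :: "real ^ 'n => real"
 assumes "!!x. GDERIV u x :> D x"
 shows "DERIV (%s. u (x + s *r z)) s :> D (x + s *r z) \<bullet> z"
proof -
 have "((%s. x + s *r z) has_derivative (%s. s *r z)) (at s)" by (auto intro!: derivative_eq_intros)
 from diff_chain_at[OF this assms[of "x + s *r z", unfolded gderiv_def]]
 have "((%s. u (x + s *r z)) has_derivative (%h. (h *r z) \<bullet> D (x + s *r z))) (at s)" by (simp add: o_def)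
 then show ?thesis unfolding has_field_derivative_def
  by (rule has_derivative_eq_rhs) (auto simp: inner_commute mult.commute)
qed

text \<open>Averaging over directions \<open>z\<close> in a set away from the origin replaces polar coordinates.\<close>
lemma averaged_line_bound:
 fixes f F :: "real ^ 'n => ennreal"
 assumes [measurable]: "f \<in> borel_measurable borel" "F \<in> borel_measurable borel" "Z \<in> sets borel"
  and line: "!!z. z \<in> Z ==> f x <= f (x + \<tau> *r z) + (NL s. F (x + s *r z) * indicator {0..\<tau>} s)"
 shows "f x * emeasure lborel Z <= (NL z. f (x + \<tau> *r z) * indicator Z z) +
   (NL s. (NL z. F (x + s *r z) * indicator Z z) * indicator {0..\<tau>} s)"
proof -
 have "f x * emeasure lborel Z = (NL z. f x * indicator Z z)" by (simp add: nn_integral_cmult_indicator)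
 also have "... <= (NL z. f (x + \<tau> *r z) * indicator Z z +
   (NL s. F (x + s *r z) * indicator Z z * indicator {0..\<tau>} s))"
 proof (rule nn_integral_mono)
  fix z :: "real^'n"
  show "f x * indicator Z z <= f (x + \<tau> *r z) * indicator Z z + (NL s. F (x + s *r z) * indicator Z z * indicator {0..\<tau>} s)"
   using line[of z] by (cases "z \<in> Z") auto
 qed
 also have "... = (NL z. f (x + \<tau> *r z) * indicator Z z) +
   (NL z. (NL s. F (x + s *r z) * indicator Z z * indicator {0..\<tau>} s))"
  by (rule nn_integral_add) measurable
 also have "(NL z. (NL s. F (x + s *r z) * indicator Z z * indicator {0..\<tau>} s))
   = (NL s. (NL z. F (x + s *r z) * indicator Z z * indicator {0..\<tau>} s))"
  by (rule lborel_pair.Fubini') measurable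
 also have "... = (NL s. (NL z. F (x + s *r z) * indicator Z z) * indicator {0..\<tau>} s)"
  by (rule nn_integral_cong, rule nn_integral_multc) measurable
 finally show ?thesis .
qed

lemma AE_lborel_nonzero: "AE s in lborel. s \<noteq> (0::real)"
 by (rule AE_lborel_singleton)

lemma powr_pred_mult_le:
 fixes a b p :: real
 assumes "0 <= a" "0 <= b" "1 < p"
 shows "a powr (p - 1) * b <= a powr p + b powr p"
proof -
 define m where "m = max a b"
 have m: "0 <= m" "a <= m" "b <= m" using assms by (auto simp: m_def)
 have "a powr (p - 1) * b <= m powr (p - 1) * m" using m assms by (intro mult_mono powr_mono2) auto
 also have "... = m powr p" using m by (cases "m = 0") (auto simp: powr_diff)
 also have "... <= a powr p + b powr p" by (auto simp: m_def max_def)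
 finally show ?thesis .
qed

text \<open>A crude form of Young's inequality. With \<open>l\<close> depending on the scale it
  replaces Hoelder's inequality when a gradient is to be estimated by its p-th power.\<close>

lemma le_add_powr:
 fixes a l p :: real
 assumes "0 <= a" "0 < l" "1 <= p"
 shows "a <= l + l powr (1 - p) * a powr p"
proof (cases "a <= l")
 case False
 then have a: "0 < a" "l < a" using assms by auto
 have "a = a powr (1 - p) * a powr p" using a by (simp add: powr_add[symmetric])
 also have "... <= l powr (1 - p) * a powr p"
  using a assms by (intro mult_right_mono powr_mono2') auto
 finally show ?thesis using assms by simp
next
 case True
 then show ?thesis by (simp add: add_increasing2)
qed

lemma nonzero_mult_div_cancel_left': "k \<noteq> 0 ==> k * (x / k) = (x::real)"
 by simp

text \<open>Following |u|^p along the segments x + s z for s up to \<tau> bounds it by its value at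
  s = \<tau> and an integral of \<open>F\<close>, which collects |u|^p and |grad u|^p. After
  averaging over z and integration against \<open>w\<close>, a point y receives at scale s the
  factor s^(-n) times the w-mass of a ball of radius 3s, that is, s^(\<theta> - n) up to constants.
  This is integrable at 0 because \<theta> > n - 1. A small \<tau> makes the segment part small, and
  then a small \<eta> does the same for the far end.\<close>

lemma morrey_core_low:
 fixes w :: "real ^ 'n => real"
 assumes p: "1 < p" and [measurable]: "w \<in> borel_measurable borel" and w0: "!!x. 0 <= w x"
  and A: "(NL x. ennreal (w x)) <= ennreal A" "0 <= A"
  and \<theta>: "real CARD('n) - 1 < \<theta>" and C: "0 <= C" and D: "0 < D"
  and mor: "!!y r. y \<in> om ==> 0 < r ==> r < D ==>
   (NL x. ennreal (w x) * (if norm (y - x) < r then 1 else 0)) <= ennreal (C * r powr \<theta>)"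
  and M: "0 <= M" and ep: "0 < ep"
 obtains \<eta> where "0 < \<eta>" "!!u. u \<in> Cc_infty om ==>
   (NL x. ennreal (norm (gradient u x) powr p)) <= ennreal M ==>
   (NL x. ennreal (\<bar>u x\<bar> powr p)) <= ennreal \<eta> ==>
   (NL x. ennreal (w x) * ennreal (\<bar>u x\<bar> powr p)) <= ennreal ep"
proof -
 obtain a :: "real^'n" where a: "norm a = 2" using vector_choose_size[of 2] by auto
 define Z where "Z = ball a 1"
 have Zn: "norm z < 3" if "z \<in> Z" for z
  using that norm_triangle_ineq[of a "z - a"] a by (simp add: Z_def dist_norm norm_minus_commute)
 have Zb[measurable]: "Z \<in> sets borel" by (simp add: Z_def)
 define m where "m = measure lborel Z"
 have "emeasure lborel Z \<noteq> \<infinity>" unfolding Z_def using emeasure_lborel_ball_finite[of a 1] by simp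
 then have m: "emeasure lborel Z = ennreal m" by (simp add: m_def emeasure_eq_ennreal_measure)
 have mpos: "0 < m"
  unfolding m_def Z_def using content_ball_pos[of 1 a] by simp
 let ?n = "real CARD('n)"
 define \<kappa> where "\<kappa> = \<theta> - ?n"
 have \<kappa>: "-1 < \<kappa>" using \<theta> by (simp add: \<kappa>_def)
 \<comment> \<open>The bound for the part along the segments; the exponent \<kappa> + 1 is positive,
   so it tends to 0 with \<tau>.\<close>
 define E where "E \<tau> = (C * 3 powr \<theta>) * (\<tau> powr (\<kappa> + 1) / (\<kappa> + 1)) * (3 * p * (1 + M))" for \<tau>
 have "(E \<longlongrightarrow> (C * 3 powr \<theta>) * (0 powr (\<kappa> + 1) / (\<kappa> + 1)) * (3 * p * (1 + M))) (at_right 0)"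
  unfolding E_def using \<kappa> by (intro tendsto_intros tendsto_powr2) (auto intro!: tendsto_ident_at simp: eventually_at_right_field intro: exI[of _ 1])
 then have "\<forall>\<^sub>F \<tau> in at_right 0. E \<tau> < ep * m / 2"
  using ep mpos by (intro order_tendstoD) auto
 \<comment> \<open>The balls that occur have radius at most 3 \<tau>, and the mass bound is
   available for radii below \<open>D\<close>.\<close>
 moreover have "\<forall>\<^sub>F \<tau> in at_right (0::real). 0 < \<tau> \<and> 3 * \<tau> < D"
  using D by (auto simp: eventually_at_right_field intro!: exI[of _ "D / 3"])
 ultimately have "\<forall>\<^sub>F \<tau> in at_right 0. E \<tau> < ep * m / 2 \<and> (0 < \<tau> \<and> 3 * \<tau> < D)" by (rule eventually_conj)
 then obtain \<tau> where \<tau>: "E \<tau> < ep * m / 2" "0 < \<tau>" "3 * \<tau> < D"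
  using eventually_happens'[OF trivial_limit_at_right_real] by blast
 \<comment> \<open>The cap 1 bounds the integral of \<open>F\<close> independently of \<eta>; the
   second entry makes the contribution of the far end at most half of what is allowed.\<close>
 define \<eta> where "\<eta> = min 1 (ep * m / 2 / ((A + 1) * \<tau> powr (- ?n)))"
 have \<eta>: "0 < \<eta>" "\<eta> <= 1" using ep mpos A \<tau> by (auto simp: \<eta>_def)
 have \<eta>2: "A * \<tau> powr (- ?n) * \<eta> <= ep * m / 2"
 proof -
  have pos: "0 < (A + 1) * \<tau> powr (- ?n)" using A \<tau> by simp
  have "A * \<tau> powr (- ?n) * \<eta> <= (A + 1) * \<tau> powr (- ?n) * \<eta>" using \<eta> \<tau> by (intro mult_right_mono) auto
  also have "... <= (A + 1) * \<tau> powr (- ?n) * (ep * m / 2 / ((A + 1) * \<tau> powr (- ?n)))"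
   using pos by (intro mult_left_mono) (auto simp: \<eta>_def)
  also have "... = ep * m / 2" by (rule nonzero_mult_div_cancel_left'[OF less_imp_neq[OF pos, symmetric]])
  finally show ?thesis .
 qed
 show thesis
 proof (rule that[OF \<eta>(1)])
  fix u :: "real^'n => real" assume u: "u \<in> Cc_infty om"
   and uM: "(NL x. ennreal (norm (gradient u x) powr p)) <= ennreal M"
   and u\<eta>: "(NL x. ennreal (\<bar>u x\<bar> powr p)) <= ennreal \<eta>"
  note [measurable] = Cc_infty_borel[OF u]
  define f where "f x = ennreal (\<bar>u x\<bar> powr p)" for x
  define F where "F x = ennreal (3 * p * (\<bar>u x\<bar> powr p + norm (gradient u x) powr p))" for x
  have [measurable]: "f \<in> borel_measurable borel" "F \<in> borel_measurable borel" unfolding f_def F_def by measurable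
  have F0: "F y = 0" if "y \<notin> om" for y
   using Cc_inftyD(5)[OF u] that p by (auto simp: F_def)
  have IF: "(NL y. F y) <= ennreal (3 * p * (1 + M))"
  proof -
   have "(NL y. F y) = ennreal (3 * p) * ((NL y. ennreal (\<bar>u y\<bar> powr p)) + (NL y. ennreal (norm (gradient u y) powr p)))"
    unfolding F_def using p by (simp add: ennreal_mult nn_integral_cmult nn_integral_add)
   also have "... <= ennreal (3 * p) * (ennreal 1 + ennreal M)"
    using uM order_trans[OF u\<eta> ennreal_leI[OF \<eta>(2)]] by (intro mult_left_mono add_mono) auto
   also have "... = ennreal (3 * p * (1 + M))"
    using p M by (simp only: ennreal_plus[symmetric] ennreal_mult[symmetric])
   finally show ?thesis .
  qed
  have line: "f x <= f (x + \<tau> *r z) + (NL s. F (x + s *r z) * indicator {0..\<tau>} s)" if z: "z \<in> Z" for x z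
  proof -
   let ?v = "%s. u (x + s *r z)"
   let ?d = "%s. (p * \<bar>?v s\<bar> powr (p - 1) * sgn (?v s)) * (gradient u (x + s *r z) \<bullet> z)"
   have D: "DERIV (%s. \<bar>?v s\<bar> powr p) s :> ?d s" for s
    using DERIV_chain2[OF DERIV_abs_powr[OF p] GDERIV_line[OF Cc_inftyD(1)[OF u]]] .
   have cv: "continuous_on UNIV ?v"
    by (rule continuous_on_compose2[OF Cc_inftyD(3)[OF u, of UNIV]]) (auto intro!: continuous_intros)
   have cg: "continuous_on UNIV (%s. gradient u (x + s *r z))"
    by (rule continuous_on_compose2[OF Cc_inftyD(2)[OF u, of UNIV]]) (auto intro!: continuous_intros)
   have c1: "continuous_on UNIV (%s. p * \<bar>?v s\<bar> powr (p - 1) * sgn (?v s))"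
    by (rule continuous_on_compose2[OF continuous_on_abs_powr_sgn[OF p] cv]) auto
   have c: "continuous_on UNIV ?d"
    by (intro continuous_on_mult c1 continuous_on_inner cg continuous_on_const)
   have "f x <= f (x + \<tau> *r z) + (NL s. ennreal \<bar>?d s\<bar> * indicator {0..\<tau>} s)"
    using line_bound[OF _ D c, of \<tau>] \<tau> by (simp add: f_def)
   also have "... <= f (x + \<tau> *r z) + (NL s. F (x + s *r z) * indicator {0..\<tau>} s)"
   proof (intro add_left_mono nn_integral_mono mult_right_mono)
    fix s
    let ?g = "norm (gradient u (x + s *r z))"
    have "\<bar>?d s\<bar> = p * \<bar>?v s\<bar> powr (p - 1) * \<bar>sgn (?v s)\<bar> * \<bar>gradient u (x + s *r z) \<bullet> z\<bar>"
     using p by (simp add: abs_mult)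
    also have "... <= p * \<bar>?v s\<bar> powr (p - 1) * 1 * (?g * 3)"
    proof (intro mult_mono)
     show "\<bar>gradient u (x + s *r z) \<bullet> z\<bar> <= ?g * 3"
      using Cauchy_Schwarz_ineq2[of "gradient u (x + s *r z)" z] mult_left_mono[of "norm z" 3 ?g] Zn[OF z] by simp
    qed (use p in \<open>auto simp: sgn_if\<close>)
    also have "... = 3 * p * (\<bar>?v s\<bar> powr (p - 1) * ?g)" by simp
    also have "... <= 3 * p * (\<bar>?v s\<bar> powr p + ?g powr p)"
     using p by (intro mult_left_mono powr_pred_mult_le) auto
    finally show "ennreal \<bar>?d s\<bar> <= F (x + s *r z)" unfolding F_def by (rule ennreal_leI)
   qed auto
   finally show ?thesis .
  qed
  define I1 where "I1 x = (NL z. f (x + \<tau> *r z) * indicator Z z)" for x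
  define I2 where "I2 s x = (NL z. F (x + s *r z) * indicator Z z)" for s x
  have [measurable]: "I1 \<in> borel_measurable borel" unfolding I1_def[abs_def] by measurable
  have [measurable]: "(%(s, x). I2 s x) \<in> borel_measurable (borel \<Otimes>\<^sub>M borel)" unfolding I2_def[abs_def] by measurable
  have I1: "I1 x <= ennreal (\<tau> powr (- ?n) * \<eta>)" for x
  proof -
   have "I1 x <= (NL z. f (x + \<tau> *r z))" unfolding I1_def by (intro nn_integral_mono) (auto simp: indicator_def)
   also have "... = ennreal (\<tau> powr (- ?n)) * (NL z. f z)" using \<tau> by (intro nn_integral_lborel_scale) auto
   also have "... <= ennreal (\<tau> powr (- ?n)) * ennreal \<eta>" using u\<eta> unfolding f_def by (intro mult_left_mono) auto
   also have "... = ennreal (\<tau> powr (- ?n) * \<eta>)" using \<eta> by (simp add: ennreal_mult)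
   finally show ?thesis .
  qed
  have I2: "(NL x. ennreal (w x) * I2 s x) <= ennreal (C * 3 powr \<theta> * s powr \<kappa>) * ennreal (3 * p * (1 + M))"
   if s: "0 < s" "s <= \<tau>" for s
  proof -
   have "(NL x. ennreal (w x) * I2 s x) <= (NL x. ennreal (w x) * (ennreal (s powr (- ?n)) * (NL y. F y * (if norm (y - x) < 3 * s then 1 else 0))))"
   proof (intro nn_integral_mono mult_left_mono)
    fix x
    have "I2 s x <= (NL z. F (x + s *r z) * (if norm ((x + s *r z) - x) < 3 * s then 1 else 0))"
     unfolding I2_def using s Zn by (intro nn_integral_mono mult_left_mono) (auto simp: indicator_def)
    also have "... = ennreal (s powr (- ?n)) * (NL y. F y * (if norm (y - x) < 3 * s then 1 else 0))"
     using s by (intro nn_integral_lborel_scale[of "%y. F y * (if norm (y - x) < 3 * s then 1 else 0)"]) measurable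
    finally show "I2 s x <= ennreal (s powr (- ?n)) * (NL y. F y * (if norm (y - x) < 3 * s then 1 else 0))" .
   qed auto
   also have "... = ennreal (s powr (- ?n)) * (NL x. (NL y. ennreal (w x) * (F y * (if norm (y - x) < 3 * s then 1 else 0))))"
    by (simp add: nn_integral_cmult[symmetric] mult.left_commute)
   also have "(NL x. (NL y. ennreal (w x) * (F y * (if norm (y - x) < 3 * s then 1 else 0))))
     = (NL y. (NL x. ennreal (w x) * (F y * (if norm (y - x) < 3 * s then 1 else 0))))"
    by (rule lborel_pair.Fubini') measurable
   \<comment> \<open>After the exchange of the integrals the inner one is the w-mass of a ball
     around \<open>y\<close>. The mass bound holds for centres in \<open>om\<close>, and elsewhere
     \<open>F\<close> vanishes.\<close>
   also have "... <= (NL y. ennreal (C * (3 * s) powr \<theta>) * F y)"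
   proof (rule nn_integral_mono)
    fix y
    show "(NL x. ennreal (w x) * (F y * (if norm (y - x) < 3 * s then 1 else 0))) <= ennreal (C * (3 * s) powr \<theta>) * F y"
    proof (cases "y \<in> om")
     case True
     have "(NL x. ennreal (w x) * (F y * (if norm (y - x) < 3 * s then 1 else 0)))
       = F y * (NL x. ennreal (w x) * (if norm (y - x) < 3 * s then 1 else 0))"
      by (subst nn_integral_cmult[symmetric]) (auto simp: mult.left_commute intro!: nn_integral_cong)
     also have "... <= F y * ennreal (C * (3 * s) powr \<theta>)"
      using s \<tau> by (intro mult_left_mono mor True) auto
     finally show ?thesis by (simp add: mult.commute)
    qed (simp add: F0)
   qed
   also have "... = ennreal (C * (3 * s) powr \<theta>) * (NL y. F y)" by (rule nn_integral_cmult) simp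
   also have "... <= ennreal (C * (3 * s) powr \<theta>) * ennreal (3 * p * (1 + M))" by (intro mult_left_mono IF) auto
   finally have "(NL x. ennreal (w x) * I2 s x) <= ennreal (s powr (- ?n)) * (ennreal (C * (3 * s) powr \<theta>) * ennreal (3 * p * (1 + M)))"
    by (simp add: mult_left_mono)
   also have "... = ennreal (s powr (- ?n) * (C * (3 * s) powr \<theta>)) * ennreal (3 * p * (1 + M))"
    using C by (simp add: ennreal_mult mult.assoc)
   also have "s powr (- ?n) * (C * (3 * s) powr \<theta>) = C * 3 powr \<theta> * s powr \<kappa>"
    using s by (simp add: \<kappa>_def powr_mult powr_diff powr_minus field_simps)
   finally show ?thesis .
  qed
  have "(NL x. ennreal (w x) * f x) * ennreal m = (NL x. ennreal (w x) * (f x * ennreal m))"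
   by (subst nn_integral_multc[symmetric]) (auto simp: mult.assoc)
  also have "... <= (NL x. ennreal (w x) * (I1 x + (NL s. I2 s x * indicator {0..\<tau>} s)))"
   using averaged_line_bound[OF _ _ Zb line] unfolding I1_def I2_def m[symmetric]
   by (intro nn_integral_mono mult_left_mono) auto
  also have "... = (NL x. ennreal (w x) * I1 x) + (NL x. (NL s. ennreal (w x) * (I2 s x * indicator {0..\<tau>} s)))"
   by (simp add: distrib_left nn_integral_add nn_integral_cmult)
  also have "(NL x. (NL s. ennreal (w x) * (I2 s x * indicator {0..\<tau>} s)))
    = (NL s. (NL x. ennreal (w x) * (I2 s x * indicator {0..\<tau>} s)))"
   by (rule lborel_pair.Fubini') measurable
  also have "... = (NL s. (NL x. ennreal (w x) * I2 s x) * indicator {0..\<tau>} s)"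
   by (rule nn_integral_cong, subst nn_integral_multc[symmetric]) (auto simp: mult.assoc)
  also have "... <= (NL s. ennreal (C * 3 powr \<theta> * (3 * p * (1 + M))) * (ennreal (s powr \<kappa>) * indicator {0..\<tau>} s))"
  proof (rule nn_integral_mono_AE)
   \<comment> \<open>The scaling bound \<open>I2\<close> requires positive \<open>s\<close>; the
     value 0 is a null set.\<close>
   show "AE s in lborel. (NL x. ennreal (w x) * I2 s x) * indicator {0..\<tau>} s <=
    ennreal (C * 3 powr \<theta> * (3 * p * (1 + M))) * (ennreal (s powr \<kappa>) * indicator {0..\<tau>} s)"
    using AE_lborel_nonzero
   proof eventually_elim
    fix s :: real assume "s \<noteq> 0"
    show "(NL x. ennreal (w x) * I2 s x) * indicator {0..\<tau>} s <=
     ennreal (C * 3 powr \<theta> * (3 * p * (1 + M))) * (ennreal (s powr \<kappa>) * indicator {0..\<tau>} s)"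
    proof (cases "s \<in> {0..\<tau>}")
     case True
     then have "(NL x. ennreal (w x) * I2 s x) <= ennreal (C * 3 powr \<theta> * s powr \<kappa>) * ennreal (3 * p * (1 + M))"
      using \<open>s \<noteq> 0\<close> by (intro I2) auto
     also have "... = ennreal (C * 3 powr \<theta> * (3 * p * (1 + M))) * ennreal (s powr \<kappa>)"
      using C p M by (simp add: ennreal_mult[symmetric] mult_ac)
     finally show ?thesis using True by simp
    qed simp
   qed
  qed
  also have "... = ennreal (C * 3 powr \<theta> * (3 * p * (1 + M))) * ennreal (\<tau> powr (\<kappa> + 1) / (\<kappa> + 1))"
   using nn_integral_powr_0[OF \<kappa>, of \<tau>] \<tau> by (subst nn_integral_cmult) auto
  also have "... = ennreal (E \<tau>)"
   using C p M \<kappa> by (simp add: E_def ennreal_mult[symmetric] mult_ac)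
  also have "(NL x. ennreal (w x) * I1 x) <= ennreal (A * \<tau> powr (- ?n) * \<eta>)"
  proof -
   have "(NL x. ennreal (w x) * I1 x) <= (NL x. ennreal (w x) * ennreal (\<tau> powr (- ?n) * \<eta>))"
    by (intro nn_integral_mono mult_left_mono I1) auto
   also have "... = (NL x. ennreal (w x)) * ennreal (\<tau> powr (- ?n) * \<eta>)" by (rule nn_integral_multc) simp
   also have "... <= ennreal A * ennreal (\<tau> powr (- ?n) * \<eta>)" by (intro mult_right_mono A) auto
   finally show ?thesis using A \<eta> by (simp add: ennreal_mult[symmetric] mult_ac)
  qed
  finally have "(NL x. ennreal (w x) * f x) * ennreal m <= ennreal (A * \<tau> powr (- ?n) * \<eta>) + ennreal (E \<tau>)"
   by (simp add: add_right_mono)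
  also have "... <= ennreal (ep * m / 2) + ennreal (ep * m / 2)"
   using \<eta>2 \<tau>(1) by (intro add_mono ennreal_leI) auto
  also have "... = ennreal ep * ennreal m" using ep mpos by (simp add: ennreal_plus[symmetric] ennreal_mult[symmetric] del: ennreal_plus)
  finally have "(NL x. ennreal (w x) * f x) * ennreal m <= ennreal ep * ennreal m" .
  then show "(NL x. ennreal (w x) * ennreal (\<bar>u x\<bar> powr p)) <= ennreal ep"
   unfolding f_def using mpos by (simp add: ennreal_mult_le_mult_iff mult.commute[of _ "ennreal m"])
 qed
qed

text \<open>Here |u| itself is followed along the segments, and |grad u| is split by
  \<open>le_add_powr\<close> at the level s^(-b). The two resulting powers of s are s^(-b) and
  s^(b(p - 1) - n); both are integrable at 0 exactly when b < 1 and b(p - 1) > n - 1. Such a b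
  exists because p > n, and the bound becomes pointwise.\<close>

lemma morrey_core_high:
 assumes p: "real CARD('n::finite) < p" and M: "0 <= M" and ep: "0 < ep"
 obtains \<eta> where "0 < \<eta>" "!!(u :: real ^ 'n => real) x. u \<in> Cc_infty om ==>
   (NL x. ennreal (norm (gradient u x) powr p)) <= ennreal M ==>
   (NL x. ennreal (\<bar>u x\<bar> powr p)) <= ennreal \<eta> ==> \<bar>u x\<bar> <= ep"
proof -
 let ?n = "real CARD('n)"
 have n1: "1 <= ?n" by (simp add: Suc_leI)
 with p have p1: "1 < p" by linarith
 obtain a :: "real^'n" where a: "norm a = 2" using vector_choose_size[of 2] by auto
 define Z where "Z = ball a 1"
 have Zn: "norm z < 3" if "z \<in> Z" for z
  using that norm_triangle_ineq[of a "z - a"] a by (simp add: Z_def dist_norm norm_minus_commute)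
 have Zb[measurable]: "Z \<in> sets borel" by (simp add: Z_def)
 define m where "m = measure lborel Z"
 have "emeasure lborel Z \<noteq> \<infinity>" unfolding Z_def using emeasure_lborel_ball_finite[of a 1] by simp
 then have m: "emeasure lborel Z = ennreal m" by (simp add: m_def emeasure_eq_ennreal_measure)
 have mpos: "0 < m"
  unfolding m_def Z_def using content_ball_pos[of 1 a] by simp
 \<comment> \<open>\<open>c0\<close> is the lower limit for the exponent and is smaller than 1 since
   \<open>p\<close> exceeds the dimension; \<open>b\<close> is taken halfway between it and
   1.\<close>
 define c0 where "c0 = (?n - 1) / (p - 1)"
 define b where "b = (c0 + 1) / 2"
 have "c0 < 1" using p p1 by (simp add: c0_def)
 then have b1: "b < 1" by (simp add: b_def)
 have b2: "(?n - 1) / (p - 1) < b" using \<open>c0 < 1\<close> unfolding c0_def[symmetric] by (simp add: b_def)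
 from b2 have "?n - 1 < b * (p - 1)" using p1 by (simp add: divide_less_eq)
 define \<kappa> where "\<kappa> = b * (p - 1) - ?n"
 have \<kappa>: "-1 < \<kappa>" using \<open>?n - 1 < b * (p - 1)\<close> by (simp add: \<kappa>_def)
 define E where "E \<tau> = 3 * (m * (\<tau> powr (- b + 1) / (- b + 1)) + M * (\<tau> powr (\<kappa> + 1) / (\<kappa> + 1)))" for \<tau>
 have "(E \<longlongrightarrow> 3 * (m * (0 powr (- b + 1) / (- b + 1)) + M * (0 powr (\<kappa> + 1) / (\<kappa> + 1)))) (at_right 0)"
  unfolding E_def using \<kappa> b1 by (intro tendsto_intros tendsto_powr2) (auto intro!: tendsto_ident_at simp: eventually_at_right_field intro: exI[of _ 1])
 then have "\<forall>\<^sub>F \<tau> in at_right 0. E \<tau> < ep * m / 2"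
  using ep mpos by (intro order_tendstoD) auto
 moreover have "\<forall>\<^sub>F \<tau> in at_right (0::real). 0 < \<tau>"
  by (auto simp: eventually_at_right_field intro!: exI[of _ 1])
 ultimately have "\<forall>\<^sub>F \<tau> in at_right 0. E \<tau> < ep * m / 2 \<and> 0 < \<tau>" by (rule eventually_conj)
 then obtain \<tau> where \<tau>: "E \<tau> < ep * m / 2" "0 < \<tau>"
  using eventually_happens'[OF trivial_limit_at_right_real] by blast
 \<comment> \<open>The far end is split at this level: the constant part contributes
   \<open>ep * m / 4\<close>, and \<eta> is chosen so that the p-th powers contribute as much
   again.\<close>
 define l where "l = ep / 4"
 have l: "0 < l" using ep by (simp add: l_def)
 define c where "c = l powr (1 - p) * \<tau> powr (- ?n)"
 have c: "0 < c" using l \<tau> by (simp add: c_def)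
 define \<eta> where "\<eta> = ep * m / 4 / c"
 have \<eta>: "0 < \<eta>" using ep mpos c by (simp add: \<eta>_def)
 show thesis
 proof (rule that[OF \<eta>])
  fix u :: "real^'n => real" and x assume u: "u \<in> Cc_infty om"
   and uM: "(NL x. ennreal (norm (gradient u x) powr p)) <= ennreal M"
   and u\<eta>: "(NL x. ennreal (\<bar>u x\<bar> powr p)) <= ennreal \<eta>"
  note [measurable] = Cc_infty_borel[OF u]
  define f where "f x = ennreal \<bar>u x\<bar>" for x
  define F where "F x = ennreal (3 * norm (gradient u x))" for x
  have [measurable]: "f \<in> borel_measurable borel" "F \<in> borel_measurable borel" unfolding f_def F_def by measurable
  have line: "f x <= f (x + \<tau> *r z) + (NL s. F (x + s *r z) * indicator {0..\<tau>} s)" if z: "z \<in> Z" for x z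
  proof -
   let ?d = "%s. gradient u (x + s *r z) \<bullet> z"
   have cg: "continuous_on UNIV (%s. gradient u (x + s *r z))"
    by (rule continuous_on_compose2[OF Cc_inftyD(2)[OF u, of UNIV]]) (auto intro!: continuous_intros)
   have c: "continuous_on UNIV ?d" by (intro continuous_on_inner cg continuous_on_const)
   have "f x <= f (x + \<tau> *r z) + (NL s. ennreal \<bar>?d s\<bar> * indicator {0..\<tau>} s)"
    using line_bound[OF _ GDERIV_line[OF Cc_inftyD(1)[OF u]] c, of \<tau>] \<tau> by (simp add: f_def)
   also have "... <= f (x + \<tau> *r z) + (NL s. F (x + s *r z) * indicator {0..\<tau>} s)"
   proof (intro add_left_mono nn_integral_mono mult_right_mono)
    fix s
    have "\<bar>?d s\<bar> <= 3 * norm (gradient u (x + s *r z))"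
     using Cauchy_Schwarz_ineq2[of "gradient u (x + s *r z)" z]
      mult_left_mono[of "norm z" 3 "norm (gradient u (x + s *r z))"] Zn[OF z] by simp
    then show "ennreal \<bar>?d s\<bar> <= F (x + s *r z)" unfolding F_def by (rule ennreal_leI)
   qed auto
   finally show ?thesis .
  qed
  have I1: "(NL z. f (x + \<tau> *r z) * indicator Z z) <= ennreal (ep * m / 2)"
  proof -
   have "(NL z. f (x + \<tau> *r z) * indicator Z z) <=
    (NL z. ennreal l * indicator Z z + ennreal (l powr (1 - p)) * ennreal (\<bar>u (x + \<tau> *r z)\<bar> powr p))"
   proof (rule nn_integral_mono)
    fix z
    have "f (x + \<tau> *r z) <= ennreal (l + l powr (1 - p) * \<bar>u (x + \<tau> *r z)\<bar> powr p)"
     unfolding f_def using l p1 by (intro ennreal_leI le_add_powr) auto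
    then show "f (x + \<tau> *r z) * indicator Z z <= ennreal l * indicator Z z + ennreal (l powr (1 - p)) * ennreal (\<bar>u (x + \<tau> *r z)\<bar> powr p)"
     using l by (cases "z \<in> Z") (auto simp: ennreal_mult)
   qed
   also have "... = ennreal l * ennreal m + ennreal (l powr (1 - p)) * (NL z. ennreal (\<bar>u (x + \<tau> *r z)\<bar> powr p))"
    by (simp add: nn_integral_add nn_integral_cmult nn_integral_cmult_indicator m)
   also have "(NL z. ennreal (\<bar>u (x + \<tau> *r z)\<bar> powr p)) = ennreal (\<tau> powr (- ?n)) * (NL z. ennreal (\<bar>u z\<bar> powr p))"
    using \<tau> by (intro nn_integral_lborel_scale) auto
   also have "ennreal l * ennreal m + ennreal (l powr (1 - p)) * (ennreal (\<tau> powr (- ?n)) * (NL z. ennreal (\<bar>u z\<bar> powr p)))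
     <= ennreal l * ennreal m + ennreal (l powr (1 - p)) * (ennreal (\<tau> powr (- ?n)) * ennreal \<eta>)"
    using u\<eta> by (intro add_left_mono mult_left_mono) auto
   also have "... = ennreal (l * m + c * \<eta>)"
    using l mpos \<eta> by (simp add: c_def ennreal_mult[symmetric] ennreal_plus[symmetric] mult.assoc del: ennreal_plus)
   also have "l * m + c * \<eta> = ep * m / 2" using c by (simp add: l_def \<eta>_def)
   finally show ?thesis .
  qed
  have I2: "(NL z. F (x + s *r z) * indicator Z z) <= ennreal (3 * m * s powr (- b)) + ennreal (3 * M * s powr \<kappa>)"
   if s: "0 < s" for s
  proof -
   let ?l = "s powr (- b)"
   have "(NL z. F (x + s *r z) * indicator Z z) <=
    (NL z. ennreal (3 * ?l) * indicator Z z + ennreal (3 * ?l powr (1 - p)) * ennreal (norm (gradient u (x + s *r z)) powr p))"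
   proof (rule nn_integral_mono)
    fix z
    have "3 * norm (gradient u (x + s *r z)) <= 3 * (?l + ?l powr (1 - p) * norm (gradient u (x + s *r z)) powr p)"
     using s p1 by (intro mult_left_mono le_add_powr) auto
    then have "F (x + s *r z) <= ennreal (3 * ?l + 3 * ?l powr (1 - p) * norm (gradient u (x + s *r z)) powr p)"
     unfolding F_def by (intro ennreal_leI) (simp add: distrib_left mult.assoc)
    then show "F (x + s *r z) * indicator Z z <= ennreal (3 * ?l) * indicator Z z + ennreal (3 * ?l powr (1 - p)) * ennreal (norm (gradient u (x + s *r z)) powr p)"
     by (cases "z \<in> Z") (auto simp: ennreal_mult)
   qed
   also have "... = ennreal (3 * ?l) * ennreal m + ennreal (3 * ?l powr (1 - p)) * (NL z. ennreal (norm (gradient u (x + s *r z)) powr p))"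
    by (simp add: nn_integral_add nn_integral_cmult nn_integral_cmult_indicator m)
   also have "(NL z. ennreal (norm (gradient u (x + s *r z)) powr p)) = ennreal (s powr (- ?n)) * (NL z. ennreal (norm (gradient u z) powr p))"
    using s by (intro nn_integral_lborel_scale) auto
   also have "ennreal (3 * ?l) * ennreal m + ennreal (3 * ?l powr (1 - p)) * (ennreal (s powr (- ?n)) * (NL z. ennreal (norm (gradient u z) powr p)))
     <= ennreal (3 * ?l) * ennreal m + ennreal (3 * ?l powr (1 - p)) * (ennreal (s powr (- ?n)) * ennreal M)"
    using uM by (intro add_left_mono mult_left_mono) auto
   also have "... = ennreal (3 * ?l * m) + ennreal (3 * ?l powr (1 - p) * s powr (- ?n) * M)"
    using mpos M s by (simp add: ennreal_mult[symmetric] mult.assoc)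
   also have "3 * ?l powr (1 - p) * s powr (- ?n) * M = 3 * M * s powr \<kappa>"
   proof -
    have "?l powr (1 - p) * s powr (- ?n) = s powr (- b * (1 - p) + (- ?n))"
     unfolding powr_powr powr_add ..
    also have "- b * (1 - p) + (- ?n) = \<kappa>" by (simp add: \<kappa>_def algebra_simps)
    finally show ?thesis by simp
   qed
   finally show ?thesis by (simp add: mult_ac)
  qed
  have "f x * ennreal m <= (NL z. f (x + \<tau> *r z) * indicator Z z) +
    (NL s. (NL z. F (x + s *r z) * indicator Z z) * indicator {0..\<tau>} s)"
   using averaged_line_bound[OF _ _ Zb line, of x] unfolding m[symmetric] by simp
  also have "... <= ennreal (ep * m / 2) + (NL s. ennreal (3 * m) * (ennreal (s powr (- b)) * indicator {0..\<tau>} s)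
    + ennreal (3 * M) * (ennreal (s powr \<kappa>) * indicator {0..\<tau>} s))"
  proof (intro add_mono I1 nn_integral_mono_AE)
   show "AE s in lborel. (NL z. F (x + s *r z) * indicator Z z) * indicator {0..\<tau>} s <=
     ennreal (3 * m) * (ennreal (s powr (- b)) * indicator {0..\<tau>} s) + ennreal (3 * M) * (ennreal (s powr \<kappa>) * indicator {0..\<tau>} s)"
    using AE_lborel_nonzero
   proof eventually_elim
    fix s :: real assume "s \<noteq> 0"
    show "(NL z. F (x + s *r z) * indicator Z z) * indicator {0..\<tau>} s <=
     ennreal (3 * m) * (ennreal (s powr (- b)) * indicator {0..\<tau>} s) + ennreal (3 * M) * (ennreal (s powr \<kappa>) * indicator {0..\<tau>} s)"
    proof (cases "s \<in> {0..\<tau>}")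
     case True
     then show ?thesis using I2[of s] \<open>s \<noteq> 0\<close> mpos M by (simp add: ennreal_mult)
    qed simp
   qed
  qed
  also have "(NL s. ennreal (3 * m) * (ennreal (s powr (- b)) * indicator {0..\<tau>} s)
    + ennreal (3 * M) * (ennreal (s powr \<kappa>) * indicator {0..\<tau>} s))
    = ennreal (3 * m) * ennreal (\<tau> powr (- b + 1) / (- b + 1)) + ennreal (3 * M) * ennreal (\<tau> powr (\<kappa> + 1) / (\<kappa> + 1))"
   using nn_integral_powr_0[of "- b" \<tau>] nn_integral_powr_0[OF \<kappa>, of \<tau>] b1 \<tau>
   by (simp add: nn_integral_add nn_integral_cmult)
  also have "... = ennreal (E \<tau>)"
   unfolding E_def using mpos M b1 \<kappa> by (simp add: ennreal_mult[symmetric] ennreal_plus[symmetric] distrib_left mult.assoc del: ennreal_plus)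
  also have "ennreal (ep * m / 2) + ennreal (E \<tau>) <= ennreal (ep * m / 2) + ennreal (ep * m / 2)"
   using \<tau>(1) by (intro add_left_mono ennreal_leI) auto
  also have "... = ennreal (ep * m)" using ep mpos by (simp add: ennreal_plus[symmetric] del: ennreal_plus)
  finally have "ennreal (\<bar>u x\<bar> * m) <= ennreal (ep * m)" using mpos by (simp add: f_def ennreal_mult)
  then have "\<bar>u x\<bar> * m <= ep * m" using ep mpos by (simp add: ennreal_le_iff)
  then show "\<bar>u x\<bar> <= ep" using mpos by simp
 qed
qed

section \<open>Energies of compactly supported functions\<close>

lemma integrable_extend_by_zero:
 fixes h :: "real ^ 'n => 'b::{banach, second_countable_topology}"
 assumes "K \<in> sets lebesgue" "Om \<in> sets lebesgue" "K \<subseteq> Om" "!!x. x \<in> Om - K ==> h x = 0"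
  "integrable (lebesgue_on K) h"
 shows "integrable (lebesgue_on Om) h"
proof -
 have "(%x. indicator K x *r h x) = (%x. indicator Om x *r h x)"
  using assms(3,4) by (auto simp: fun_eq_iff indicator_def)
 then show ?thesis using assms(1,2,5) by (simp add: integrable_restrict_space)
qed

lemma integral_extend_by_zero:
 fixes h :: "real ^ 'n => 'b::{banach, second_countable_topology}"
 assumes "K \<in> sets lebesgue" "Om \<in> sets lebesgue" "K \<subseteq> Om" "AE x in lebesgue_on Om. x \<notin> K --> h x = 0"
  and [measurable]: "h \<in> borel_measurable (lebesgue_on Om)"
 shows "(LINT x|lebesgue_on K. h x) = (LINT x|lebesgue_on Om. h x)"
proof -
 have "(LINT x|lebesgue_on K. h x) = (LINT x|lebesgue_on Om. indicator K x *r h x)"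
  using assms(1-3) by (simp add: integral_restrict_space mult.assoc[symmetric] indicator_inter_arith[symmetric] Int_absorb1)
 also have "... = (LINT x|lebesgue_on Om. h x)"
 proof (rule integral_cong_AE)
  have "K \<in> sets (lebesgue_on Om)" using assms(1-3) by (auto simp: sets_restrict_space)
  then show "(%x. indicator K x *r h x) \<in> borel_measurable (lebesgue_on Om)" by measurable
  show "AE x in lebesgue_on Om. indicator K x *r h x = h x"
   using assms(4) by eventually_elim (auto simp: indicator_def)
 qed measurable
 finally show ?thesis .
qed

lemma potential_integrable_on:
 fixes p :: real and W f :: "real ^ 'n => real"
 assumes p1: "1 < p" and setsOm: "Om \<in> sets lebesgue" and W: "W \<in> Lp_loc 1 Om" and f: "continuous_on UNIV f" "compact K" "K \<subseteq> Om" "!!x. x \<notin> K ==> f x = 0"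
 shows "integrable (lebesgue_on Om) (%x. W x * \<bar>f x\<bar> powr p)"
proof (rule integrable_extend_by_zero[OF compact_imp_sets_lebesgue[OF f(2)] setsOm f(3)])
 obtain B where B: "0 < B" "!!x. norm (f x) <= B" using compact_support_bounded[OF f(1,2,4)] by blast
 have fm: "f \<in> borel_measurable (lebesgue_on K)"
  using f(1) by (intro measurable_restrict_space1 measurable_completion) (auto intro: borel_measurable_continuous_onI)
 note [measurable] = fm Lp_locD(1)[OF W f(2,3)]
 show "integrable (lebesgue_on K) (%x. W x * \<bar>f x\<bar> powr p)"
 proof (rule Bochner_Integration.integrable_bound[where f="%x. W x * B powr p"])
  show "AE x in lebesgue_on K. norm (W x * \<bar>f x\<bar> powr p) <= norm (W x * B powr p)"
   using B p1 by (auto simp: abs_mult intro!: AE_I2 mult_left_mono powr_mono2)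
 qed (use Lp_locD(2)[OF W f(2,3)] in auto)
qed (use f(4) in auto)

lemma indicator_Lp_loc:
 fixes T :: "(real ^ 'n) set"
 assumes T: "compact T" shows "(indicator T :: real ^ 'n => real) \<in> Lp_loc 1 U"
proof -
 have "integrable lborel (%x. norm (indicator T x :: real) powr 1)"
  using emeasure_compact_finite[OF T] borel_compact[OF T] by simp
 then have "(indicator T :: real^'n => real) \<in> Lp 1 K" if "compact K" for K :: "(real^'n) set"
  using compact_imp_sets_lebesgue[OF that] borel_compact[OF T] by (intro Lp_I) auto
 then show ?thesis by (simp add: Lp_loc_def)
qed

lemma Lp_loc_borel_measurable:
 fixes f :: "real ^ 'n => 'b::euclidean_space"
 assumes U: "open U" and f: "f \<in> Lp_loc r U" shows "f \<in> borel_measurable (lebesgue_on U)"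
proof -
 obtain C where C: "!!n. compact (C n)" "!!n. C n \<subseteq> U" "!!n. C n \<subseteq> interior (C (Suc n))" "\<Union>(range C) = U"
  by (rule open_Union_compact_subsets[OF U]) (rule that; assumption)
 have mono: "C n \<subseteq> C m" if "n <= m" for n m
  by (rule lift_Suc_mono_le[of C, OF order_trans[OF C(3) interior_subset] that])
 have "(%x. if x \<in> C n then f x else 0) \<in> borel_measurable lebesgue" for n
  using f C(1,2)[of n] by (intro borel_measurable_if_I compact_imp_sets_lebesgue) (auto simp: Lp_loc_def Lp_def)
 moreover have "(%n. if x \<in> C n then f x else 0) ~~> (if x \<in> U then f x else 0)" for x
 proof (cases "x \<in> U")
  case True
  then obtain n where "x \<in> C n" using C(4) by blast
  then have "x \<in> C m" if "n <= m" for m using mono[OF that] by blast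
  then show ?thesis using True by (intro tendsto_eventually) (auto simp: eventually_sequentially)
 next
  case False
  then have "x \<notin> C n" for n using C(2)[of n] by blast
  then show ?thesis using False by simp
 qed
 ultimately have "(%x. if x \<in> U then f x else 0) \<in> borel_measurable lebesgue"
  by (rule borel_measurable_LIMSEQ_metric)
 then show ?thesis by (rule borel_measurable_if_D)
qed

locale norm_family_domain =
 fixes p :: real and Om :: "(real ^ 'n) set" and om :: "nat => (real ^ 'n) set"
  and H :: "real ^ 'n => real ^ 'n => real"
 assumes p1: "1 < p" and dom: "is_domain Om" and ex: "smooth_exhaustion Om om" and adm: "admissible Om H"
begin

abbreviation M where "M \<equiv> lebesgue_on Om"

lemma openOm: "open Om" and setsOm [simp]: "Om \<in> sets lebesgue"
 using dom by (auto simp: is_domain_def)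

lemma om: "is_domain (om i)" "om i \<Subset> Om" "closure (om i) \<subseteq> om (Suc i)" "compact (closure (om i))" "open (om i)" "om i \<subseteq> Om"
 "closure (om i) \<subseteq> Om"
proof -
 have e: "C1_domain (om i)" "om i \<Subset> om (Suc i)" "om (Suc i) \<Subset> Om"
  using ex by (auto simp: smooth_exhaustion_def)
 show "is_domain (om i)" using e(1) by (simp add: C1_domain_def)
 then show "open (om i)" by (simp add: is_domain_def)
 show c: "closure (om i) \<subseteq> om (Suc i)" "compact (closure (om i))" using e(2) by (auto simp: compactly_in_def)
 show "closure (om i) \<subseteq> Om" using c(1) e(3) closure_subset[of "om (Suc i)"] by (auto simp: compactly_in_def)
 then show "om i \<Subset> Om" "om i \<subseteq> Om" using c closure_subset[of "om i"] by (auto simp: compactly_in_def)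
qed

lemma om_mono: "i <= j ==> om i \<subseteq> om j"
 by (rule lift_Suc_mono_le[of om, OF order_trans[OF closure_subset om(3)]])

lemma om_Union: "(\<Union>i. om i) = Om"
 using ex by (simp add: smooth_exhaustion_def)

lemma compact_subset_om:
 assumes "compact K" "K \<subseteq> Om" obtains i where "K \<subseteq> om i"
proof -
 have "K \<subseteq> (\<Union>i\<in>UNIV. om i)" using assms(2) om_Union by simp
 then obtain I where "I \<subseteq> UNIV" and I: "finite I" "K \<subseteq> (\<Union>i\<in>I. om i)"
  by (rule compactE_image[OF assms(1) om(5)])
 have "(\<Union>i\<in>I. om i) \<subseteq> om (Max (insert 0 I))"
  using I(1) om_mono by (intro UN_least) simp
 then show thesis using that I(2) by blast
qed

lemma AE_norm: "AE x in M. is_norm (H x)"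
 using adm by (simp add: admissible_def)

lemma AE_M_iff: "(AE x in M. P x) \<longleftrightarrow> (AE x in lebesgue. x \<in> Om --> P x)"
 by (subst AE_restrict_space_iff) auto

text \<open>Admissibility bounds \<open>H\<close> on domains only; a compact set is contained in one
  of the exhausting domains.\<close>

lemma local_bounds:
 assumes "compact K" "K \<subseteq> Om"
 obtains \<kappa> \<nu> where "0 < \<kappa>" "0 < \<nu>" "AE x in M. x \<in> K --> (\<forall>\<xi>. \<kappa> * norm \<xi> <= H x \<xi> \<and> H x \<xi> <= \<nu> * norm \<xi>)"
proof -
 obtain i where i: "K \<subseteq> om i" using compact_subset_om[OF assms] .
 obtain \<kappa> \<nu> where k: "0 < \<kappa>" "\<kappa> <= \<nu>" "AE x in lebesgue_on (om i). \<forall>\<xi>. \<kappa> * norm \<xi> <= H x \<xi> \<and> H x \<xi> <= \<nu> * norm \<xi>"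
  using adm om(1,2)[of i] unfolding admissible_def by blast
 have "AE x in lebesgue. x \<in> om i --> (\<forall>\<xi>. \<kappa> * norm \<xi> <= H x \<xi> \<and> H x \<xi> <= \<nu> * norm \<xi>)"
  using k(3) om(5)[of i] by (subst (asm) AE_restrict_space_iff) auto
 then have "AE x in M. x \<in> K --> (\<forall>\<xi>. \<kappa> * norm \<xi> <= H x \<xi> \<and> H x \<xi> <= \<nu> * norm \<xi>)"
  unfolding AE_M_iff by eventually_elim (use i in blast)
 then show thesis using that[of \<kappa> \<nu>] k by simp
qed

lemma measurable_H:
 assumes "G \<in> borel_measurable M" shows "(%x. H x (G x)) \<in> borel_measurable M"
 by (rule borel_measurable_norm_family[OF setsOm AE_norm _ assms]) (use adm in \<open>simp add: admissible_def\<close>)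

lemma borel_M: "f \<in> borel_measurable borel ==> f \<in> borel_measurable M"
 by (intro measurable_restrict_space1 measurable_completion) auto

lemmas Lp_loc_measurable = Lp_loc_borel_measurable[OF openOm]

lemmas potential_integrable = potential_integrable_on[OF p1 setsOm]

text \<open>Gradient part and potential part are kept apart since they converge for different
  reasons. \<open>E\<close> takes the field as its argument, so that differences of gradients and
  limits not yet known to be weak gradients can be inserted.\<close>

definition E :: "(real ^ 'n => real ^ 'n) => real" where
 "E G = (LINT x|M. H x (G x) powr p)"

definition P :: "(real ^ 'n => real) => (real ^ 'n => real) => real" where
 "P W \<phi> = (LINT x|M. W x * \<bar>\<phi> x\<bar> powr p)"

lemma E_nonneg: "0 <= E G"
 unfolding E_def by (intro Bochner_Integration.integral_nonneg) simp

lemma sob_measurable: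
 assumes "sob p Om \<phi> G"
 shows "\<phi> \<in> borel_measurable M" "G \<in> borel_measurable M" "(%x. H x (G x)) \<in> borel_measurable M"
 using sobD(2,3)[OF assms] by (auto intro: measurable_H borel_M)

lemma H_powr_integrable:
 assumes "G \<in> borel_measurable borel" "integrable lborel (%x. norm (G x) powr p)"
  and K: "compact K" "K \<subseteq> Om" "!!x. x \<notin> K ==> G x = 0"
  and \<nu>: "0 < \<nu>" "AE x in M. x \<in> K --> (\<forall>\<xi>. H x \<xi> <= \<nu> * norm \<xi>)"
 shows "integrable M (%x. H x (G x) powr p)" "E G <= \<nu> powr p * (LINT x|lborel. norm (G x) powr p)"
proof -
 have L: "integrable M (%x. norm (G x) powr p)" using Lp_I[OF assms(1,2) setsOm] by (simp add: Lp_def)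
 have le: "AE x in M. H x (G x) powr p <= \<nu> powr p * norm (G x) powr p"
  using \<nu>(2) AE_norm
 proof eventually_elim
  case *: (elim x)
  show ?case
  proof (cases "x \<in> K")
   case True
   then have "H x (G x) powr p <= (\<nu> * norm (G x)) powr p" using * is_normD(1)[OF *(2)] p1 by (intro powr_mono2) auto
   then show ?thesis using \<nu> by (simp add: powr_mult)
  qed (use K(3) is_normD(7)[OF *(2)] in simp)
 qed
 have [measurable]: "(%x. H x (G x)) \<in> borel_measurable M" using assms(1) by (intro measurable_H borel_M)
 show int: "integrable M (%x. H x (G x) powr p)"
 proof (rule Bochner_Integration.integrable_bound)
  show "integrable M (%x. \<nu> powr p * norm (G x) powr p)" using L by auto
  show "AE x in M. norm (H x (G x) powr p) <= norm (\<nu> powr p * norm (G x) powr p)"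
   using le by eventually_elim simp
 qed measurable
 have "E G <= (LINT x|M. \<nu> powr p * norm (G x) powr p)"
  unfolding E_def by (rule integral_mono_AE[OF int _ le]) (use L in auto)
 also have "... = \<nu> powr p * (LINT x|M. norm (G x) powr p)" by simp
 also have "(LINT x|M. norm (G x) powr p) = (LINT x|lborel. norm (G x) powr p)"
  by (rule integral_lebesgue_on_eq_lborel) (use assms(1) K p1 in \<open>auto intro!: AE_I2\<close>)
 finally show "E G <= \<nu> powr p * (LINT x|lborel. norm (G x) powr p)" .
qed

lemma sob_integrable_H:
 assumes "sob p Om \<phi> G" shows "integrable M (%x. H x (G x) powr p)"
proof -
 obtain K where K: "compact K" "K \<subseteq> Om" "!!x. x \<notin> K ==> G x = 0" using sobD(5)[OF assms] by blast
 obtain \<kappa> \<nu> where k: "0 < \<kappa>" "0 < \<nu>" "AE x in M. x \<in> K --> (\<forall>\<xi>. \<kappa> * norm \<xi> <= H x \<xi> \<and> H x \<xi> <= \<nu> * norm \<xi>)"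
  using local_bounds[OF K(1,2)] .
 show ?thesis
  by (rule H_powr_integrable(1)[OF sobD(2,4)[OF assms] K k(2)]) (use k(3) in auto)
qed

lemma sob_integrable_P:
 assumes "sob p Om \<phi> G" "W \<in> Lp_loc 1 Om" shows "integrable M (%x. W x * \<bar>\<phi> x\<bar> powr p)"
proof -
 obtain K where K: "compact K" "K \<subseteq> Om" "!!x. x \<notin> K ==> \<phi> x = 0" using sobD(5)[OF assms(1)] by blast
 show ?thesis by (rule potential_integrable[OF assms(2) sobD(1)[OF assms(1)] K])
qed

text \<open>Both the chosen weak gradient and the subdomain disappear: \<phi> and \<open>G\<close>
  vanish off a compact subset of \<open>U\<close>, so all integrals may be taken over
  \<open>Om\<close>.\<close>

lemma energy_sob:
 assumes U: "open U" "U \<subseteq> Om" and s: "sob p U \<phi> G" and W: "W \<in> Lp_loc 1 Om"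
 shows "energy p H W U \<phi> = E G + P W \<phi>"
proof -
 have s': "sob p Om \<phi> G" by (rule sob_mono[OF s U(2)])
 obtain K where K: "compact K" "K \<subseteq> U" "!!x. x \<notin> K ==> \<phi> x = 0" "!!x. x \<notin> K ==> G x = 0"
  using sobD(5)[OF s] by blast
 have wg: "AE x in lebesgue_on U. weak_gradient U \<phi> x = G x"
  by (rule weak_gradient_AE[OF U(1) sob_has_weak_gradient(1)[OF s _ U(1)]]) (use p1 in simp)
 have UM: "U \<in> sets lebesgue" using U(1) by simp
 have int: "integrable M (%x. H x (G x) powr p)" "integrable M (%x. W x * \<bar>\<phi> x\<bar> powr p)"
  by (rule sob_integrable_H[OF s'], rule sob_integrable_P[OF s' W])
 then have int': "integrable M (%x. H x (G x) powr p + W x * \<bar>\<phi> x\<bar> powr p)" by simp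
 have mU: "(%x. H x (G x) powr p + W x * \<bar>\<phi> x\<bar> powr p) \<in> borel_measurable (lebesgue_on U)"
  by (rule measurable_restrict_mono[OF borel_measurable_integrable[OF int'] U(2)])
 have AEU: "AE x in lebesgue_on U. H x (G x) powr p + W x * \<bar>\<phi> x\<bar> powr p = H x (weak_gradient U \<phi> x) powr p + W x * \<bar>\<phi> x\<bar> powr p"
  using wg by eventually_elim simp
 have "energy p H W U \<phi> = (LINT x|lebesgue_on U. H x (G x) powr p + W x * \<bar>\<phi> x\<bar> powr p)"
  unfolding energy_def
 proof (rule integral_cong_AE[OF borel_measurable_lebesgue_on_AE[OF UM mU AEU] mU])
  show "AE x in lebesgue_on U. H x (weak_gradient U \<phi> x) powr p + W x * \<bar>\<phi> x\<bar> powr p = H x (G x) powr p + W x * \<bar>\<phi> x\<bar> powr p"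
   using wg by eventually_elim simp
 qed
 also have "... = (LINT x|M. H x (G x) powr p + W x * \<bar>\<phi> x\<bar> powr p)"
 proof (rule integral_extend_by_zero[OF UM setsOm U(2)])
  show "AE x in M. x \<notin> U --> H x (G x) powr p + W x * \<bar>\<phi> x\<bar> powr p = 0"
  proof -
   have "\<phi> x = 0" "G x = 0" if "x \<notin> U" for x using K that by blast+
   then show ?thesis using AE_norm by (auto simp: is_normD(7) elim!: eventually_mono)
  qed
 qed (use int' in auto)
 also have "... = E G + P W \<phi>" using int by (simp add: E_def P_def)
 finally show ?thesis .
qed

text \<open>With \<open>W\<close> merely locally integrable, convergence in L^p would not control
  the potential term; uniform convergence on a common compact set yields a dominating
  function.\<close>

lemma P_tendsto_uniform:
 fixes W :: "real ^ 'n => real"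
 assumes W: "W \<in> Lp_loc 1 Om" and \<phi>: "continuous_on UNIV \<phi>" and K: "compact K" "K \<subseteq> Om"
  "!!x. x \<notin> K ==> \<phi> x = 0" "!!m x. x \<notin> K ==> \<phi>' m x = 0" and \<phi>': "!!m. continuous_on UNIV (\<phi>' m)"
  and le: "!!m x. \<bar>\<phi>' m x - \<phi> x\<bar> <= e m" "e ~~> 0"
 shows "(%m. P W (\<phi>' m)) ~~> P W \<phi>"
proof -
 obtain B where B: "0 < B" "!!x. norm (\<phi> x) <= B" using compact_support_bounded[OF \<phi> K(1,3)] by blast
 obtain b where b: "!!m. \<bar>e m\<bar> <= b"
  using convergent_imp_Bseq[OF convergentI[OF le(2)]] by (auto simp: Bseq_def)
 have mW: "W \<in> borel_measurable M" by (rule Lp_loc_measurable[OF W])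
 have m\<phi>: "\<phi> \<in> borel_measurable M" "\<phi>' m \<in> borel_measurable M" for m
  using \<phi> \<phi>' by (auto intro!: borel_M borel_measurable_continuous_onI)
 note [measurable] = mW m\<phi>
 have lim: "(%m. \<phi>' m x) ~~> \<phi> x" for x
  by (rule LIM_zero_cancel, rule Lim_null_comparison[OF _ le(2)]) (use le(1) in auto)
 show ?thesis unfolding P_def
 proof (rule integral_dominated_convergence[where w="%x. \<bar>W x\<bar> * (indicator K x * (B + b) powr p)"])
  show "AE x in M. (%m. W x * \<bar>\<phi>' m x\<bar> powr p) ~~> W x * \<bar>\<phi> x\<bar> powr p"
   using p1 by (intro AE_I2 tendsto_mult tendsto_const tendsto_powr2 tendsto_rabs lim) auto
  have KM: "K \<in> sets M" using K compact_imp_sets_lebesgue[OF K(1)] by (auto simp: sets_restrict_space)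
  have "integrable (lebesgue_on K) (%x. \<bar>W x\<bar> * (B + b) powr p)" using Lp_locD(2)[OF W K(1,2)] by auto
  then have iK: "integrable (lebesgue_on K) (%x. \<bar>W x\<bar> * (indicator K x * (B + b) powr p))"
   by (rule Bochner_Integration.integrable_cong[THEN iffD1, rotated 2]) (auto simp: indicator_def)
  show "integrable M (%x. \<bar>W x\<bar> * (indicator K x * (B + b) powr p))"
   by (rule integrable_extend_by_zero[OF compact_imp_sets_lebesgue[OF K(1)] setsOm K(2)])
     (use iK in auto)
  show "AE x in M. norm (W x * \<bar>\<phi>' m x\<bar> powr p) <= \<bar>W x\<bar> * (indicator K x * (B + b) powr p)" for m
  proof (rule AE_I2)
   fix x
   have "\<bar>\<phi>' m x\<bar> <= B + b" using le(1)[of m x] B(2)[of x] b[of m] by (simp add: abs_le_iff)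
   then have "\<bar>\<phi>' m x\<bar> powr p <= (B + b) powr p" using p1 by (intro powr_mono2) auto
   then show "norm (W x * \<bar>\<phi>' m x\<bar> powr p) <= \<bar>W x\<bar> * (indicator K x * (B + b) powr p)"
    using K(4)[of x m] p1 by (cases "x \<in> K") (auto simp: abs_mult intro!: mult_left_mono)
  qed
 qed measurable
qed

lemma E_tendsto:
 assumes G: "G \<in> borel_measurable M" "integrable M (%x. H x (G x) powr p)"
  and G': "!!m. G' m \<in> borel_measurable M" "!!m. integrable M (%x. H x (G' m x - G x) powr p)"
  and lim: "(%m. E (%x. G' m x - G x)) ~~> 0"
 shows "(%m. E (G' m)) ~~> E G"
 unfolding E_def
proof (rule integral_powr_tendsto(2)[where dj="%m x. H x (G' m x - G x)"])
 show "AE x in M. 0 <= H x (G x)" using AE_norm by eventually_elim (rule is_normD)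
 show "AE x in M. 0 <= H x (G' m x)" for m using AE_norm by eventually_elim (rule is_normD)
 show "AE x in M. 0 <= H x (G' m x - G x) \<and> \<bar>H x (G' m x) - H x (G x)\<bar> <= H x (G' m x - G x)" for m
  using AE_norm by eventually_elim (auto intro: is_normD)
qed (use p1 G G' lim measurable_H in \<open>auto simp: E_def\<close>)

text \<open>Nonnegativity is given on smooth functions only. For the approximants of
  \<open>sob_approx\<close> the gradient energies converge because \<open>H\<close> is bounded above
  on the common compact set, and the potential terms converge because the functions do so
  uniformly.\<close>

lemma nonneg_sob:
 assumes W: "W \<in> Lp_loc 1 Om" and nn: "nonneg_functional p H W Om" and s: "sob p Om \<phi> G"
 shows "0 <= E G + P W \<phi>"
proof -
 have p: "1 <= p" using p1 by simp
 obtain K \<phi>' where K: "compact K" "K \<subseteq> Om" "!!x. x \<notin> K ==> \<phi> x = 0 \<and> G x = 0"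
  and \<phi>': "!!m::nat. \<phi>' m \<in> Cc_infty Om" "!!m x. x \<notin> K ==> \<phi>' m x = 0 \<and> gradient (\<phi>' m) x = 0"
  "!!m x. \<bar>\<phi>' m x - \<phi> x\<bar> <= inverse (real (Suc m)) ^ 2"
  "!!m. (NL x. ennreal (norm (gradient (\<phi>' m) x - G x) powr p)) <= ennreal (inverse (real (Suc m)))"
  by (rule sob_approx[OF s p openOm p sobD(4)[OF s]]) (rule that; assumption)
 obtain \<kappa> \<nu> where k: "0 < \<kappa>" "0 < \<nu>" "AE x in M. x \<in> K --> (\<forall>\<xi>. \<kappa> * norm \<xi> <= H x \<xi> \<and> H x \<xi> <= \<nu> * norm \<xi>)"
  using local_bounds[OF K(1,2)] .
 have k': "AE x in M. x \<in> K --> (\<forall>\<xi>. H x \<xi> <= \<nu> * norm \<xi>)" using k(3) by eventually_elim blast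
 have s': "sob p Om (\<phi>' m) (gradient (\<phi>' m))" for m by (rule Cc_infty_sob[OF \<phi>'(1) p])
 note [measurable] = sobD(2)[OF s] Cc_infty_borel[OF \<phi>'(1)]
 have intd: "integrable lborel (%x. norm (gradient (\<phi>' m) x - G x) powr p)" for m
  using \<phi>'(4)[of m] by (intro integrableI_nonneg) (auto simp: le_less_trans)
 have dle: "(LINT x|lborel. norm (gradient (\<phi>' m) x - G x) powr p) <= inverse (real (Suc m))" for m
  using \<phi>'(4)[of m] nn_integral_eq_integral[OF intd[of m]] by (simp add: ennreal_le_iff)
 have gb: "(%x. gradient (\<phi>' m) x - G x) \<in> borel_measurable borel" for m by measurable
 have z: "gradient (\<phi>' m) x - G x = 0" if "x \<notin> K" for m x using K(3) \<phi>'(2) that by simp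
 note HD = H_powr_integrable[OF gb intd K(1,2) z k(2) k']
 have "(%m. E (%x. gradient (\<phi>' m) x - G x)) ~~> 0"
 proof (rule Lim_null_comparison)
  show "\<forall>\<^sub>F m in sequentially. norm (E (%x. gradient (\<phi>' m) x - G x)) <= \<nu> powr p * inverse (real (Suc m))"
  proof (intro always_eventually allI)
   fix m
   have "E (%x. gradient (\<phi>' m) x - G x) <= \<nu> powr p * (LINT x|lborel. norm (gradient (\<phi>' m) x - G x) powr p)"
    by (rule HD(2))
   also have "... <= \<nu> powr p * inverse (real (Suc m))" by (intro mult_left_mono dle) simp
   finally show "norm (E (%x. gradient (\<phi>' m) x - G x)) <= \<nu> powr p * inverse (real (Suc m))"
    using E_nonneg by simp
  qed
  show "(%m. \<nu> powr p * inverse (real (Suc m))) ~~> 0"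
   by (rule tendsto_mult_right_zero[OF LIMSEQ_inverse_real_of_nat])
 qed
 then have 1: "(%m. E (gradient (\<phi>' m))) ~~> E G"
  by (intro E_tendsto sob_measurable[OF s] sob_measurable[OF s'] sob_integrable_H[OF s] HD(1))
 have e0: "(%m. inverse (real (Suc m)) ^ 2) ~~> 0"
  using tendsto_power[OF LIMSEQ_inverse_real_of_nat, of 2] by simp
 have 2: "(%m. P W (\<phi>' m)) ~~> P W \<phi>"
  by (rule P_tendsto_uniform[OF W sobD(1)[OF s] K(1,2) _ _ _ \<phi>'(3) e0])
    (use K(3) \<phi>'(2) Cc_inftyD(3)[OF \<phi>'(1)] in auto)
 have "0 <= E (gradient (\<phi>' m)) + P W (\<phi>' m)" for m
 proof -
  have "0 <= energy p H W Om (\<phi>' m)" using nn \<phi>'(1)[of m] unfolding nonneg_functional_def by blast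
  then show ?thesis by (simp add: energy_sob[OF openOm subset_refl s' W])
 qed
 then show ?thesis by (intro LIMSEQ_le_const[OF tendsto_add[OF 1 2]]) auto
qed

lemma Lp_loc_linear:
 fixes f g :: "real ^ 'n => real"
 assumes "f \<in> Lp_loc 1 Om" "g \<in> Lp_loc 1 Om"
 shows "(%x. \<bar>f x\<bar>) \<in> Lp_loc 1 Om" "(%x. f x + g x) \<in> Lp_loc 1 Om" "(%x. c * f x) \<in> Lp_loc 1 Om"
  "(%x. f x - c * g x) \<in> Lp_loc 1 Om" "(%x. max (f x) 0) \<in> Lp_loc 1 Om" "(%x. max (- f x) 0) \<in> Lp_loc 1 Om"
 using Lp_locD[OF assms(1)] Lp_locD[OF assms(2)] by (auto simp: Lp_loc_def Lp_def)

text \<open>A Hardy inequality is nonnegativity of the functional with potential V - C|g|, so its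
  extension from smooth functions is \<open>nonneg_sob\<close> for that potential.\<close>

lemma hardy_sob:
 assumes V: "V \<in> Lp_loc 1 Om" and g: "g \<in> hardy_weights p H V Om"
 obtains C where "0 < C" "!!\<phi> G. sob p Om \<phi> G ==> C * P (%x. \<bar>g x\<bar>) \<phi> <= E G + P V \<phi>"
proof -
 obtain C where C: "0 < C" "!!\<phi>. \<phi> \<in> Cc_infty Om ==> C * (LINT x|M. \<bar>g x\<bar> * \<bar>\<phi> x\<bar> powr p) <= energy p H V Om \<phi>"
  and gL: "g \<in> Lp_loc 1 Om" using g by (auto simp: hardy_weights_def)
 let ?W = "%x. V x - C * \<bar>g x\<bar>"
 have W: "?W \<in> Lp_loc 1 Om" by (rule Lp_loc_linear(4)[OF V Lp_loc_linear(1)[OF gL gL]])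
 have split: "P ?W \<phi> = P V \<phi> - C * P (%x. \<bar>g x\<bar>) \<phi>" if "sob p Om \<phi> G" for \<phi> G
  using sob_integrable_P[OF that V] sob_integrable_P[OF that Lp_loc_linear(1)[OF gL gL]]
  by (simp add: P_def left_diff_distrib mult.assoc)
 have "nonneg_functional p H ?W Om" unfolding nonneg_functional_def
 proof
  fix \<phi> assume \<phi>: "\<phi> \<in> Cc_infty Om"
  have s: "sob p Om \<phi> (gradient \<phi>)" using p1 by (intro Cc_infty_sob \<phi>) simp
  show "0 <= energy p H ?W Om \<phi>"
   using C(2)[OF \<phi>] energy_sob[OF openOm subset_refl s V] energy_sob[OF openOm subset_refl s W] split[OF s]
   by (simp add: P_def)
 qed
 from nonneg_sob[OF W this] split C(1) show thesis by (intro that[of C]) force+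
qed

text \<open>Half the sum minus or plus half the absolute difference. Where \<open>u\<close> and
  \<open>v\<close> differ, the two gradients are merely exchanged and the energies agree. Where they
  coincide, \<open>sgn 0 = 0\<close> assigns the mean of the gradients to both functions and
  convexity gives an inequality, which avoids proving that the gradients coincide there.\<close>

lemma sob_min_max:
 assumes u: "sob p Om u Gu" and v: "sob p Om v Gv"
 obtains Gm GM where "sob p Om (%x. min (u x) (v x)) Gm" "sob p Om (%x. max (u x) (v x)) GM"
  "E Gm + E GM <= E Gu + E Gv"
proof -
 have p: "1 <= p" using p1 by simp
 define S where "S x = sgn (u x - v x)" for x
 define Gm GM where "Gm x = (1/2) *r ((Gu x + Gv x) + (-1) *r (S x *r (Gu x + (-1) *r Gv x)))"
  and "GM x = (1/2) *r ((Gu x + Gv x) + S x *r (Gu x + (-1) *r Gv x))" for x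
 have d: "sob p Om (%x. u x + (-1) * v x) (%x. Gu x + (-1) *r Gv x)"
  by (intro sob_add u sob_cmult v p)
 have a: "sob p Om (%x. \<bar>u x + (-1) * v x\<bar>) (%x. S x *r (Gu x + (-1) *r Gv x))"
  using sob_abs[OF d p] by (simp add: S_def)
 have "sob p Om (%x. (1/2) * ((u x + v x) + (-1) * \<bar>u x + (-1) * v x\<bar>)) Gm"
  unfolding Gm_def by (intro sob_add u v a sob_cmult p)
 moreover have "(%x. (1/2) * ((u x + v x) + (-1) * \<bar>u x + (-1) * v x\<bar>)) = (%x. min (u x) (v x))"
  by (auto simp: fun_eq_iff min_def)
 ultimately have m: "sob p Om (%x. min (u x) (v x)) Gm" by simp
 have "sob p Om (%x. (1/2) * ((u x + v x) + \<bar>u x + (-1) * v x\<bar>)) GM"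
  unfolding GM_def by (intro sob_add u v a sob_cmult p)
 moreover have "(%x. (1/2) * ((u x + v x) + \<bar>u x + (-1) * v x\<bar>)) = (%x. max (u x) (v x))"
  by (auto simp: fun_eq_iff max_def)
 ultimately have mx: "sob p Om (%x. max (u x) (v x)) GM" by simp
 note i = sob_integrable_H[OF m] sob_integrable_H[OF mx] sob_integrable_H[OF u] sob_integrable_H[OF v]
 have "(LINT x|M. H x (Gm x) powr p + H x (GM x) powr p) <= (LINT x|M. H x (Gu x) powr p + H x (Gv x) powr p)"
 proof (rule integral_mono_AE)
  show "AE x in M. H x (Gm x) powr p + H x (GM x) powr p <= H x (Gu x) powr p + H x (Gv x) powr p"
   using AE_norm
  proof eventually_elim
   case (elim x)
   note n = elim
   consider "u x < v x" | "u x = v x" | "v x < u x" by linarith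
   then show ?case
   proof cases
    case 1
    then have "Gm x = Gu x" "GM x = Gv x" by (auto simp: Gm_def GM_def S_def scaleR_2[symmetric])
    then show ?thesis by simp
   next
    case 3
    then have "Gm x = Gv x" "GM x = Gu x" by (auto simp: Gm_def GM_def S_def scaleR_2[symmetric])
    then show ?thesis by simp
   next
    case 2
    then have e: "Gm x = (1/2) *r (Gu x + Gv x)" "GM x = (1/2) *r (Gu x + Gv x)"
     by (auto simp: Gm_def GM_def S_def)
    have "H x ((1/2) *r (Gu x + Gv x)) powr p <= ((1 - 1/2) * H x (Gu x) + (1/2) * H x (Gv x)) powr p"
     using is_normD(1)[OF n] is_normD(3)[OF n, of "1/2" "Gu x + Gv x"] is_normD(4)[OF n, of "Gu x" "Gv x"] p
     by (intro powr_mono2) auto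
    also have "... <= (1 - 1/2) * H x (Gu x) powr p + (1/2) * H x (Gv x) powr p"
     using is_normD(1)[OF n] p by (intro powr_convex_combination) auto
    finally show ?thesis unfolding e by simp
   qed
  qed
 qed (use i in auto)
 then have "E Gm + E GM <= E Gu + E Gv" using i by (simp add: E_def)
 then show thesis by (rule that[OF m mx])
qed

lemma P_min_max:
 assumes "sob p Om u Gu" "sob p Om v Gv" "W \<in> Lp_loc 1 Om"
  and "sob p Om (%x. min (u x) (v x)) Gm" "sob p Om (%x. max (u x) (v x)) GM"
 shows "P W (%x. min (u x) (v x)) + P W (%x. max (u x) (v x)) = P W u + P W v"
proof -
 have "P W (%x. min (u x) (v x)) + P W (%x. max (u x) (v x))
   = (LINT x|M. W x * \<bar>min (u x) (v x)\<bar> powr p + W x * \<bar>max (u x) (v x)\<bar> powr p)"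
  unfolding P_def
  by (rule Bochner_Integration.integral_add[symmetric]) (rule sob_integrable_P[OF assms(4,3)] sob_integrable_P[OF assms(5,3)])+
 also have "... = (LINT x|M. W x * \<bar>u x\<bar> powr p + W x * \<bar>v x\<bar> powr p)"
  by (rule Bochner_Integration.integral_cong) (auto simp: min_def max_def)
 also have "... = P W u + P W v"
  unfolding P_def using sob_integrable_P[OF assms(1,3)] sob_integrable_P[OF assms(2,3)]
  by (rule Bochner_Integration.integral_add)
 finally show ?thesis .
qed

end

section \<open>Almost everywhere limits and Morrey weights on compact sets\<close>

lemma AE_tendsto_zero_of_geometric:
 fixes f :: "nat => 'a => real"
 assumes [measurable]: "!!j. f j \<in> borel_measurable M" and pos: "!!j x. 0 <= f j x"
  and le: "!!j. (\<integral>\<^sup>+x. ennreal (f j x) \<partial>M) <= ennreal ((1/2) ^ j)"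
 shows "AE x in M. (%j. f j x) ~~> 0"
proof -
 have "(\<integral>\<^sup>+x. (\<Sum>j. ennreal (f j x)) \<partial>M) = (\<Sum>j. \<integral>\<^sup>+x. ennreal (f j x) \<partial>M)"
  by (rule nn_integral_suminf) measurable
 also have "... <= (\<Sum>j. ennreal ((1/2) ^ j))" by (intro suminf_le le) auto
 also have "... = ennreal (\<Sum>j. (1/2) ^ j)" by (rule suminf_ennreal2) (auto intro: summable_geometric)
 also have "... < \<infinity>" by simp
 finally have "(\<integral>\<^sup>+x. (\<Sum>j. ennreal (f j x)) \<partial>M) \<noteq> \<infinity>" by simp
 then have "AE x in M. (\<Sum>j. ennreal (f j x)) \<noteq> \<infinity>"
  by (intro nn_integral_noteq_infinite) measurable
 then show ?thesis
 proof eventually_elim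
  fix x assume "(\<Sum>j. ennreal (f j x)) \<noteq> \<infinity>"
  then have "summable (%j. f j x)" using pos by (intro summable_suminf_not_top) auto
  then show "(%j. f j x) ~~> 0" by (rule summable_LIMSEQ_zero)
 qed
qed

lemma nn_integral_Fatou_le:
 fixes f :: "nat => 'a => real"
 assumes [measurable]: "!!j. f j \<in> borel_measurable N" and lim: "AE x in N. (%j. f j x) ~~> g x"
  and le: "\<forall>\<^sub>F j in sequentially. (\<integral>\<^sup>+x. ennreal (f j x) \<partial>N) <= C"
 shows "(\<integral>\<^sup>+x. ennreal (g x) \<partial>N) <= C"
proof -
 have "(\<integral>\<^sup>+x. ennreal (g x) \<partial>N) = (\<integral>\<^sup>+x. liminf (%j. ennreal (f j x)) \<partial>N)"
 proof (rule nn_integral_cong_AE)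
  show "AE x in N. ennreal (g x) = liminf (%j. ennreal (f j x))"
   using lim by eventually_elim (rule lim_imp_Liminf[OF trivial_limit_sequentially tendsto_ennrealI, symmetric])
 qed
 also have "... <= liminf (%j. \<integral>\<^sup>+x. ennreal (f j x) \<partial>N)" by (rule nn_integral_liminf) measurable
 also have "... <= liminf (%j::nat. C)" by (rule Liminf_mono[OF le])
 also have "... = C" by (simp add: Liminf_const)
 finally show ?thesis .
qed

text \<open>The weight is absorbed into the functions as W^(1/p), so that
  \<open>integral_powr_tendsto\<close> applies to W^(1/p) |u|.\<close>

lemma weighted_powr_tendsto:
 fixes W u :: "'a => real"
 assumes p: "1 < p" and [measurable]: "W \<in> borel_measurable M" "u \<in> borel_measurable M" "!!j. v j \<in> borel_measurable M"
  and W0: "AE x in M. 0 <= W x" and i: "integrable M (%x. W x * \<bar>u x\<bar> powr p)"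
  and id: "!!j. integrable M (%x. W x * \<bar>v j x - u x\<bar> powr p)"
  and lim: "(%j. LINT x|M. W x * \<bar>v j x - u x\<bar> powr p) ~~> 0"
 shows "integrable M (%x. W x * \<bar>v j x\<bar> powr p)"
  "(%j. LINT x|M. W x * \<bar>v j x\<bar> powr p) ~~> (LINT x|M. W x * \<bar>u x\<bar> powr p)"
proof -
 have eq: "AE x in M. (W x powr (1 / p) * \<bar>f x\<bar>) powr p = W x * \<bar>f x\<bar> powr p" for f :: "'a => real"
  using W0 by eventually_elim (use p in \<open>simp add: powr_mult powr_powr\<close>)
 have cong: "integrable M (%x. (W x powr (1 / p) * \<bar>f x\<bar>) powr p) \<longleftrightarrow> integrable M (%x. W x * \<bar>f x\<bar> powr p)"
  "(LINT x|M. (W x powr (1 / p) * \<bar>f x\<bar>) powr p) = (LINT x|M. W x * \<bar>f x\<bar> powr p)"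
  if [measurable]: "f \<in> borel_measurable M" for f :: "'a => real"
 proof -
  have m: "(%x. (W x powr (1 / p) * \<bar>f x\<bar>) powr p) \<in> borel_measurable M" "(%x. W x * \<bar>f x\<bar> powr p) \<in> borel_measurable M"
   by measurable
  show "integrable M (%x. (W x powr (1 / p) * \<bar>f x\<bar>) powr p) \<longleftrightarrow> integrable M (%x. W x * \<bar>f x\<bar> powr p)"
   by (rule integrable_cong_AE[OF m eq])
  show "(LINT x|M. (W x powr (1 / p) * \<bar>f x\<bar>) powr p) = (LINT x|M. W x * \<bar>f x\<bar> powr p)"
   by (rule integral_cong_AE[OF m eq])
 qed
 have dAE: "AE x in M. 0 <= W x powr (1 / p) * \<bar>v j x - u x\<bar> \<and>
    \<bar>W x powr (1 / p) * \<bar>v j x\<bar> - W x powr (1 / p) * \<bar>u x\<bar>\<bar> <= W x powr (1 / p) * \<bar>v j x - u x\<bar>" for j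
  proof (rule AE_I2)
   fix x
   have "\<bar>W x powr (1 / p) * \<bar>v j x\<bar> - W x powr (1 / p) * \<bar>u x\<bar>\<bar> = W x powr (1 / p) * \<bar>\<bar>v j x\<bar> - \<bar>u x\<bar>\<bar>"
    by (simp add: right_diff_distrib[symmetric] abs_mult)
   also have "... <= W x powr (1 / p) * \<bar>v j x - u x\<bar>" by (intro mult_left_mono) auto
   finally show "0 <= W x powr (1 / p) * \<bar>v j x - u x\<bar> \<and>
    \<bar>W x powr (1 / p) * \<bar>v j x\<bar> - W x powr (1 / p) * \<bar>u x\<bar>\<bar> <= W x powr (1 / p) * \<bar>v j x - u x\<bar>" by simp
  qed
 have *: "integrable M (%x. (W x powr (1 / p) * \<bar>v j x\<bar>) powr p)" for j
  by (rule integral_powr_tendsto(1)[where a="%x. W x powr (1 / p) * \<bar>u x\<bar>" and dj="%j x. W x powr (1 / p) * \<bar>v j x - u x\<bar>"])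
    (use p i id lim dAE in \<open>simp_all add: cong\<close>)
 have **: "(%j. LINT x|M. (W x powr (1 / p) * \<bar>v j x\<bar>) powr p) ~~> (LINT x|M. (W x powr (1 / p) * \<bar>u x\<bar>) powr p)"
  by (rule integral_powr_tendsto(2)[where dj="%j x. W x powr (1 / p) * \<bar>v j x - u x\<bar>"])
    (use p i id lim dAE in \<open>simp_all add: cong\<close>)
 show "integrable M (%x. W x * \<bar>v j x\<bar> powr p)" using *[of j] by (simp add: cong)
 show "(%j. LINT x|M. W x * \<bar>v j x\<bar> powr p) ~~> (LINT x|M. W x * \<bar>u x\<bar> powr p)" using ** by (simp add: cong)
qed

lemma sob_restrict:
 fixes \<phi> :: "real ^ 'n => real"
 assumes "sob p U \<phi> G" "compact S" "S \<subseteq> U'" "!!x. x \<notin> S ==> \<phi> x = 0" "!!x. x \<notin> S ==> G x = 0"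
 shows "sob p U' \<phi> G"
 using assms unfolding sob_def by blast

lemma morrey_ball_bound:
 fixes f :: "real ^ 'n => real"
 assumes fin: "morrey_sup (%r. r powr (- \<theta>)) D f < \<infinity>"
 obtains C where "0 <= C" "!!y r. y \<in> D ==> 0 < r ==> r < diameter D ==>
  (\<integral>\<^sup>+x. ennreal \<bar>f x\<bar> \<partial>lebesgue_on (D \<inter> ball y r)) <= ennreal (C * r powr \<theta>)"
proof -
 define C where "C = enn2real (morrey_sup (%r. r powr (- \<theta>)) D f)"
 have C: "morrey_sup (%r. r powr (- \<theta>)) D f = ennreal C" using fin by (simp add: C_def)
 show thesis
 proof (rule that[of C])
  fix y r assume yr: "y \<in> D" "0 < r" "r < diameter D"
  let ?I = "\<integral>\<^sup>+x. ennreal \<bar>f x\<bar> \<partial>lebesgue_on (D \<inter> ball y r)"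
  have "ennreal (r powr (- \<theta>)) * ?I <= ennreal C"
   unfolding C[symmetric] morrey_sup_def using yr by (intro SUP_upper2[of "(y, r)"]) auto
  then have "ennreal (r powr \<theta>) * (ennreal (r powr (- \<theta>)) * ?I) <= ennreal (r powr \<theta>) * ennreal C"
   by (rule mult_left_mono) simp
  moreover have "ennreal (r powr \<theta>) * (ennreal (r powr (- \<theta>)) * ?I) = ?I"
   using yr by (simp add: mult.assoc[symmetric] ennreal_mult[symmetric] powr_minus)
  ultimately show "?I <= ennreal (C * r powr \<theta>)" by (simp add: ennreal_mult C_def mult.commute)
 qed (simp add: C_def)
qed

text \<open>Above the dimension the pointwise bound and the total mass of the weight suffice. Below
  it, the Morrey exponent is n - n/q, which exceeds n - 1 because q > n; at p = n such an exponent
  is supplied by the additional condition of the space.\<close>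

lemma morrey_core:
 fixes g g' :: "real ^ 'n => real"
 assumes p: "1 < p" and n: "2 <= CARD('n)" and g: "g \<in> morrey_tilde_loc p q Om" and D: "is_domain D" "D \<Subset> Om"
  and g'[measurable]: "g' \<in> borel_measurable borel" and g'0: "!!x. 0 <= g' x"
  and eq: "AE x in lebesgue. (if x \<in> D then \<bar>g x\<bar> else 0) = g' x"
  and A: "(NL x. ennreal (g' x)) <= ennreal A" "0 <= A" and M: "0 <= M" and ep: "0 < ep"
 obtains \<eta> where "0 < \<eta>" "!!u. u \<in> Cc_infty D ==>
   (NL x. ennreal (norm (gradient u x) powr p)) <= ennreal M ==>
   (NL x. ennreal (\<bar>u x\<bar> powr p)) <= ennreal \<eta> ==>
   (NL x. ennreal (g' x) * ennreal (\<bar>u x\<bar> powr p)) <= ennreal ep"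
proof (cases "real CARD('n) < p")
 case True
 \<comment> \<open>A pointwise bound \<open>e\<close> contributes at most
   \<open>A * e powr p\<close>, which stays below \<open>ep\<close>.\<close>
 define e where "e = (ep / (A + 1)) powr (1 / p)"
 have e: "0 < e" "e powr p = ep / (A + 1)" using ep A p by (auto simp: e_def powr_powr)
 obtain \<eta> where \<eta>: "0 < \<eta>" "!!u x. u \<in> Cc_infty D ==>
   (NL x. ennreal (norm (gradient u x) powr p)) <= ennreal M ==>
   (NL x. ennreal (\<bar>u x\<bar> powr p)) <= ennreal \<eta> ==> \<bar>u x\<bar> <= e"
  by (rule morrey_core_high[OF True M e(1)]) (rule that; assumption)
 show thesis
 proof (rule that[OF \<eta>(1)])
  fix u assume u: "u \<in> Cc_infty D" "(NL x. ennreal (norm (gradient u x) powr p)) <= ennreal M"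
   "(NL x. ennreal (\<bar>u x\<bar> powr p)) <= ennreal \<eta>"
  have "(NL x. ennreal (g' x) * ennreal (\<bar>u x\<bar> powr p)) <= (NL x. ennreal (g' x) * ennreal (e powr p))"
   using \<eta>(2)[OF u] p by (intro nn_integral_mono mult_left_mono ennreal_leI powr_mono2) auto
  also have "... = (NL x. ennreal (g' x)) * ennreal (e powr p)" by (rule nn_integral_multc) simp
  also have "... <= ennreal A * ennreal (e powr p)" by (intro mult_right_mono A) auto
  also have "... = ennreal (A * (ep / (A + 1)))" using A e ep by (simp add: ennreal_mult[symmetric])
  also have "... <= ennreal ep" using A ep by (intro ennreal_leI) (simp add: divide_le_eq mult_left_mono)
  finally show "(NL x. ennreal (g' x) * ennreal (\<bar>u x\<bar> powr p)) <= ennreal ep" .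
 qed
next
 case False
 let ?n = "real CARD('n)"
 have n2: "2 <= ?n" using n by simp
 obtain \<theta> where \<theta>: "?n - 1 < \<theta>" and fin: "morrey_sup (%r. r powr (- \<theta>)) D g < \<infinity>"
 proof (cases "p = ?n")
  case True
  then show ?thesis using g D that by (auto simp: morrey_tilde_loc_def)
 next
  case False
  then have pn: "p < ?n" using \<open>\<not> ?n < p\<close> by simp
  then have q: "?n < q" using g by (auto simp: morrey_tilde_loc_def)
  have "g \<in> morrey p q D" using g D by (auto simp: morrey_tilde_loc_def morrey_loc_def)
  then have f: "morrey_sup (%r. r powr (- ?n / (q / (q - 1)))) D g < \<infinity>"
   using pn by (auto simp: morrey_def Let_def)
  define \<theta> where "\<theta> = ?n / (q / (q - 1))"
  have "\<theta> = ?n - ?n / q" using q n2 by (simp add: \<theta>_def field_simps)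
  moreover have "?n / q < 1" using q n2 by simp
  ultimately have "?n - 1 < \<theta>" by linarith
  then show ?thesis using that[of \<theta>] f by (simp add: \<theta>_def)
 qed
 obtain C where C: "0 <= C" "!!y r. y \<in> D ==> 0 < r ==> r < diameter D ==>
  (\<integral>\<^sup>+x. ennreal \<bar>g x\<bar> \<partial>lebesgue_on (D \<inter> ball y r)) <= ennreal (C * r powr \<theta>)"
  by (rule morrey_ball_bound[OF fin]) (rule that; assumption)
 have oD: "open D" and bD: "bounded D"
  using D compact_imp_bounded[of "closure D"] bounded_subset[OF _ closure_subset]
  by (auto simp: is_domain_def compactly_in_def)
 have dpos: "0 < diameter D"
 proof -
  obtain z where z: "z \<in> D" using D(1) by (auto simp: is_domain_def)
  then obtain e where e: "0 < e" "ball z e \<subseteq> D" using oD openE by blast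
  obtain v :: "real^'n" where v: "norm v = e / 2" using vector_choose_size[of "e / 2"] e(1) by auto
  have "z + v \<in> D" using e v by (intro subsetD[OF e(2)]) (simp add: dist_norm)
  then have "dist z (z + v) <= diameter D" using diameter_bounded_bound[OF bD z] by simp
  then show ?thesis using v e(1) by (simp add: dist_norm)
 qed
 have mor: "(NL x. ennreal (g' x) * (if norm (y - x) < r then 1 else 0)) <= ennreal (C * r powr \<theta>)"
  if yr: "y \<in> D" "0 < r" "r < diameter D" for y r
 proof -
  have "(NL x. ennreal (g' x) * (if norm (y - x) < r then 1 else 0))
   = (\<integral>\<^sup>+x. ennreal (g' x) * (if norm (y - x) < r then 1 else 0) \<partial>lebesgue)"
   by (rule nn_integral_completion[symmetric])
  also have "... = (\<integral>\<^sup>+x. ennreal \<bar>g x\<bar> * indicator (D \<inter> ball y r) x \<partial>lebesgue)"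
   by (rule nn_integral_cong_AE) (use eq in \<open>eventually_elim, auto simp: indicator_def dist_norm\<close>)
  also have "... = (\<integral>\<^sup>+x. ennreal \<bar>g x\<bar> \<partial>lebesgue_on (D \<inter> ball y r))"
   using oD by (subst nn_integral_restrict_space) auto
  also have "... <= ennreal (C * r powr \<theta>)" by (rule C(2)[OF yr])
  finally show ?thesis .
 qed
 show thesis
 proof (rule morrey_core_low[OF p g' g'0 A \<theta> C(1) dpos _ M ep])
  show "(NL x. ennreal (g' x) * (if norm (y - x) < r then 1 else 0)) <= ennreal (C * r powr \<theta>)"
   if "y \<in> D" "0 < r" "r < diameter D" for y r by (rule mor[OF that])
 qed (rule that; assumption)
qed

lemma nn_integral_powr_add_le:
 fixes f g :: "'a => 'b::{real_normed_vector, second_countable_topology}" and w :: "'a => ennreal"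
 assumes [measurable]: "f \<in> borel_measurable M" "g \<in> borel_measurable M" "w \<in> borel_measurable M" and p: "0 <= p"
 shows "(\<integral>\<^sup>+x. w x * ennreal (norm (f x + g x) powr p) \<partial>M) <=
  ennreal (2 powr p) * ((\<integral>\<^sup>+x. w x * ennreal (norm (f x) powr p) \<partial>M) + (\<integral>\<^sup>+x. w x * ennreal (norm (g x) powr p) \<partial>M))"
proof -
 have "(\<integral>\<^sup>+x. w x * ennreal (norm (f x + g x) powr p) \<partial>M) <=
  (\<integral>\<^sup>+x. ennreal (2 powr p) * (w x * ennreal (norm (f x) powr p) + w x * ennreal (norm (g x) powr p)) \<partial>M)"
 proof (rule nn_integral_mono)
  fix x
  have "norm (f x + g x) powr p <= (norm (f x) + norm (g x)) powr p"
   using p by (intro powr_mono2 norm_triangle_ineq) auto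
  also have "... <= 2 powr p * (norm (f x) powr p + norm (g x) powr p)" using p by (intro powr_add_le) auto
  finally have "ennreal (norm (f x + g x) powr p) <= ennreal (2 powr p) * (ennreal (norm (f x) powr p) + ennreal (norm (g x) powr p))"
   by (simp add: ennreal_mult[symmetric] ennreal_plus[symmetric] ennreal_leI del: ennreal_plus)
  from mult_left_mono[OF this, of "w x"]
  show "w x * ennreal (norm (f x + g x) powr p) <= ennreal (2 powr p) * (w x * ennreal (norm (f x) powr p) + w x * ennreal (norm (g x) powr p))"
   by (simp add: distrib_left mult.left_commute)
 qed
 then show ?thesis by (simp add: nn_integral_cmult nn_integral_add)
qed

context norm_family_domain
begin

lemma nn_integral_M_eq_lborel:
 assumes "f' \<in> borel_measurable borel" "AE x in lebesgue. (if x \<in> Om then f x else 0) = f' x"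
 shows "(\<integral>\<^sup>+x. f x \<partial>M) = (NL x. f' x)"
proof -
 have "(\<integral>\<^sup>+x. f x \<partial>M) = (\<integral>\<^sup>+x. f x * indicator Om x \<partial>lebesgue)" by (subst nn_integral_restrict_space) auto
 also have "... = (\<integral>\<^sup>+x. f' x \<partial>lebesgue)"
  by (rule nn_integral_cong_AE) (use assms(2) in \<open>eventually_elim, auto simp: indicator_def split: if_splits\<close>)
 finally show ?thesis by (simp add: nn_integral_completion)
qed

text \<open>After multiplication by a cut-off and smoothing, \<open>morrey_core\<close> applies on a
  precompact domain containing \<open>K\<close>. Its bound on gradients comes from the energies, its
  small L^p norm from the assumed local vanishing.\<close>

lemma morrey_local_vanish:
 assumes n: "2 <= CARD('n)" and g: "g \<in> morrey_tilde_loc p q Om" and gL: "g \<in> Lp_loc 1 Om"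
  and s: "!!k. sob p Om (w k) (G k)" and bd: "!!k. E (G k) <= B"
  and van: "!!K. compact K ==> K \<subseteq> Om ==> (%k. P (indicator K) (w k)) ~~> 0"
  and K: "compact K" "K \<subseteq> Om"
 shows "(%k. P (%x. indicator K x * \<bar>g x\<bar>) (w k)) ~~> 0"
proof -
 have p: "1 <= p" using p1 by simp
 obtain i where i: "K \<subseteq> om i" using compact_subset_om[OF K] .
 define D where "D = om i"
 have D: "is_domain D" "D \<Subset> Om" "open D" "D \<subseteq> Om" "compact (closure D)" "closure D \<subseteq> Om" using om by (auto simp: D_def)
 obtain \<zeta> where z: "\<zeta> \<in> Cc_infty D" "!!x. 0 <= \<zeta> x" "!!x. \<zeta> x <= 1" "!!x. x \<in> K ==> \<zeta> x = 1"
  using cutoff_exists[OF K(1) D(3)] i unfolding D_def by metis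
 obtain S where S: "compact S" "S \<subseteq> D" "!!x. x \<notin> S ==> \<zeta> x = 0" "!!x. x \<notin> S ==> gradient \<zeta> x = 0"
  using Cc_inftyD(5)[OF z(1)] by blast
 have SOm: "S \<subseteq> Om" using S(2) D(4) by blast
 obtain b where b: "0 < b" "!!x. norm (gradient \<zeta> x) <= b" using Cc_infty_bounded[OF z(1)] by metis
 define u where "u k x = \<zeta> x * w k x" for k x
 define Gu where "Gu k x = \<zeta> x *r G k x + w k x *r gradient \<zeta> x" for k x
 have su: "sob p D (u k) (Gu k)" for k
  unfolding u_def[abs_def] Gu_def[abs_def]
  by (rule sob_restrict[OF sob_smooth_mult[OF s p Cc_inftyD(4)[OF z(1)]] S(1,2)]) (use S in auto)
 note mb[measurable] = Cc_infty_borel[OF z(1)] sobD(2,3)[OF s] sobD(2,3)[OF su]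
 have Sb[measurable]: "S \<in> sets borel" "K \<in> sets borel" using S(1) K(1) by (auto intro: borel_compact)
 have PS: "(%k. P (indicator S) (w k)) ~~> 0" by (rule van[OF S(1) SOm])
 have PSeq: "(NL x. indicator T x * ennreal (\<bar>w k x\<bar> powr p)) = ennreal (P (indicator T) (w k))"
  if T: "compact T" "T \<subseteq> Om" for k T
 proof -
  have [measurable]: "T \<in> sets borel" using T(1) by (rule borel_compact)
  have "(NL x. indicator T x * ennreal (\<bar>w k x\<bar> powr p)) = (\<integral>\<^sup>+x. ennreal (indicator T x * \<bar>w k x\<bar> powr p) \<partial>M)"
   by (rule nn_integral_M_eq_lborel[symmetric]) (use T(2) in \<open>auto intro!: AE_I2 simp: indicator_def\<close>)
  also have "... = ennreal (P (indicator T) (w k))"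
   unfolding P_def by (rule nn_integral_eq_integral[OF sob_integrable_P[OF s indicator_Lp_loc[OF T(1)]]]) auto
  finally show ?thesis .
 qed
 obtain \<kappa> \<nu> where k: "0 < \<kappa>" "0 < \<nu>" "AE x in M. x \<in> S --> (\<forall>\<xi>. \<kappa> * norm \<xi> <= H x \<xi> \<and> H x \<xi> <= \<nu> * norm \<xi>)"
  using local_bounds[OF S(1) SOm] .
 \<comment> \<open>On the support of the cut-off the lower bound \<kappa> of the norms turns the
   energy bound into one for the Euclidean norm.\<close>
 have GS: "(NL x. indicator S x * ennreal (norm (G k x) powr p)) <= ennreal (\<kappa> powr (- p) * B)" for k
 proof -
  have "(NL x. indicator S x * ennreal (norm (G k x) powr p)) = (\<integral>\<^sup>+x. indicator S x * ennreal (norm (G k x) powr p) \<partial>M)"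
   by (rule nn_integral_M_eq_lborel[symmetric]) (use SOm in \<open>auto intro!: AE_I2 simp: indicator_def\<close>)
  also have "... <= (\<integral>\<^sup>+x. ennreal (\<kappa> powr (- p) * H x (G k x) powr p) \<partial>M)"
  proof (rule nn_integral_mono_AE)
   show "AE x in M. indicator S x * ennreal (norm (G k x) powr p) <= ennreal (\<kappa> powr (- p) * H x (G k x) powr p)"
    using k(3)
   proof eventually_elim
    case (elim x)
    note kx = elim
    show ?case
    proof (cases "x \<in> S")
     case True
     have "norm (G k x) powr p = \<kappa> powr (- p) * (\<kappa> * norm (G k x)) powr p"
      using k(1) by (simp add: powr_mult powr_minus)
     also have "... <= \<kappa> powr (- p) * H x (G k x) powr p"
      using kx True k(1) p by (intro mult_left_mono powr_mono2) auto
     finally show ?thesis using True by (simp add: ennreal_leI)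
    qed simp
   qed
  qed
  also have "... = ennreal (\<kappa> powr (- p) * E (G k))"
   unfolding E_def using sob_integrable_H[OF s] by (subst nn_integral_eq_integral) auto
  also have "... <= ennreal (\<kappa> powr (- p) * B)" using bd by (intro ennreal_leI mult_left_mono) auto
  finally show ?thesis .
 qed
 \<comment> \<open>A convergent sequence is bounded, which controls the term of the product rule
   that contains the gradient of the cut-off.\<close>
 obtain b1 where b1: "!!k. P (indicator S) (w k) <= b1"
  using convergent_imp_Bseq[OF convergentI[OF PS]] by (auto simp: Bseq_def abs_le_iff)
 have Gu_bd: "(NL x. ennreal (norm (Gu k x) powr p)) <= ennreal (2 powr p * (\<kappa> powr (- p) * max B 0 + b powr p * max b1 0))" for k
 proof -
  have "(NL x. ennreal (norm (Gu k x) powr p)) = (NL x. 1 * ennreal (norm (\<zeta> x *r G k x + w k x *r gradient \<zeta> x) powr p))"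
   by (simp add: Gu_def)
  also have "... <= ennreal (2 powr p) * ((NL x. 1 * ennreal (norm (\<zeta> x *r G k x) powr p))
    + (NL x. 1 * ennreal (norm (w k x *r gradient \<zeta> x) powr p)))"
   using p by (intro nn_integral_powr_add_le) auto
  also have "... <= ennreal (2 powr p) * ((NL x. indicator S x * ennreal (norm (G k x) powr p))
    + (NL x. ennreal (b powr p) * (indicator S x * ennreal (\<bar>w k x\<bar> powr p))))"
  proof (intro mult_left_mono add_mono nn_integral_mono)
   fix x
   have "\<bar>\<zeta> x\<bar> * norm (G k x) <= 1 * norm (G k x)" using z(2,3) by (intro mult_right_mono) auto
   then have "norm (\<zeta> x *r G k x) powr p <= norm (G k x) powr p" using p by (intro powr_mono2) auto
   then show "1 * ennreal (norm (\<zeta> x *r G k x) powr p) <= indicator S x * ennreal (norm (G k x) powr p)"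
    using S(3)[of x] p by (cases "x \<in> S") (auto intro: ennreal_leI)
   have "norm (w k x *r gradient \<zeta> x) powr p <= (\<bar>w k x\<bar> * b) powr p"
    using p b(2) by (intro powr_mono2) (auto intro: mult_left_mono)
   also have "... = b powr p * \<bar>w k x\<bar> powr p" using b(1) by (simp add: powr_mult)
   finally have "ennreal (norm (w k x *r gradient \<zeta> x) powr p) <= ennreal (b powr p) * ennreal (\<bar>w k x\<bar> powr p)"
    by (simp add: ennreal_mult[symmetric] ennreal_leI)
   then show "1 * ennreal (norm (w k x *r gradient \<zeta> x) powr p) <= ennreal (b powr p) * (indicator S x * ennreal (\<bar>w k x\<bar> powr p))"
    using S(4)[of x] p by (cases "x \<in> S") auto
  qed auto
  also have "... <= ennreal (2 powr p) * (ennreal (\<kappa> powr (- p) * max B 0) + ennreal (b powr p) * ennreal (max b1 0))"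
  proof (intro mult_left_mono add_mono)
   show "(NL x. indicator S x * ennreal (norm (G k x) powr p)) <= ennreal (\<kappa> powr (- p) * max B 0)"
    by (rule order_trans[OF GS]) (auto intro!: ennreal_leI mult_left_mono)
   have "(NL x. ennreal (b powr p) * (indicator S x * ennreal (\<bar>w k x\<bar> powr p))) = ennreal (b powr p) * ennreal (P (indicator S) (w k))"
    by (subst nn_integral_cmult) (auto simp: PSeq[OF S(1) SOm])
   also have "... <= ennreal (b powr p) * ennreal (max b1 0)"
    using b1[of k] by (intro mult_left_mono ennreal_leI) auto
   finally show "(NL x. ennreal (b powr p) * (indicator S x * ennreal (\<bar>w k x\<bar> powr p))) <= ennreal (b powr p) * ennreal (max b1 0)" .
  qed auto
  also have "... = ennreal (2 powr p * (\<kappa> powr (- p) * max B 0 + b powr p * max b1 0))"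
   by (simp add: ennreal_mult[symmetric] ennreal_plus[symmetric] del: ennreal_plus)
  finally show ?thesis .
 qed
 define M0 where "M0 = 2 powr p * (\<kappa> powr (- p) * max B 0 + b powr p * max b1 0)"
 have M0: "0 <= M0" by (simp add: M0_def)
 define d where "d k = inverse (real (Suc k))" for k
 have d: "0 < d k" "d k <= 1" for k by (auto simp: d_def field_simps)
 have dlim: "d ~~> 0" unfolding d_def[abs_def] by (rule LIMSEQ_inverse_real_of_nat)
 have "\<exists>v. v \<in> Cc_infty D \<and> (\<forall>x. \<bar>v x - u k x\<bar> <= d k ^ 2) \<and>
   (NL x. ennreal (norm (gradient v x - Gu k x) powr p)) <= ennreal (d k)" for k
 proof -
  obtain K' \<phi>' where "!!m::nat. \<phi>' m \<in> Cc_infty D" "!!m x. \<bar>\<phi>' m x - u k x\<bar> <= inverse (real (Suc m)) ^ 2"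
   "!!m. (NL x. ennreal (norm (gradient (\<phi>' m) x - Gu k x) powr p)) <= ennreal (inverse (real (Suc m)))"
   by (rule sob_approx[OF su p D(3) p sobD(4)[OF su]]) (rule that; assumption)
  then show ?thesis unfolding d_def by blast
 qed
 then have "\<forall>k. \<exists>v. v \<in> Cc_infty D \<and> (\<forall>x. \<bar>v x - u k x\<bar> <= d k ^ 2) \<and>
   (NL x. ennreal (norm (gradient v x - Gu k x) powr p)) <= ennreal (d k)" by blast
 from choice[OF this] obtain v where v: "!!k. v k \<in> Cc_infty D" "!!k x. \<bar>v k x - u k x\<bar> <= d k ^ 2"
   "!!k. (NL x. ennreal (norm (gradient (v k) x - Gu k x) powr p)) <= ennreal (d k)" by blast
 note [measurable] = Cc_infty_borel[OF v(1)]
 have Db[measurable]: "D \<in> sets borel" using D(3) by simp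
 define m where "m = measure lborel D"
 have m: "emeasure lborel D = ennreal m" "0 <= m"
 proof -
  have "emeasure lborel D <= emeasure lborel (closure D)" by (rule emeasure_mono[OF closure_subset]) simp
  also have "... < \<infinity>" by (rule emeasure_compact_finite[OF D(5)])
  finally show "emeasure lborel D = ennreal m" by (simp add: m_def emeasure_eq_ennreal_measure)
 qed (simp add: m_def)
 have dp: "(d k ^ 2) powr p <= d k" for k
 proof -
  have "d k ^ 2 <= d k" using d[of k] by (simp add: power2_eq_square mult_left_le)
  then have "(d k ^ 2) powr p <= d k powr p" using p by (intro powr_mono2) auto
  also have "... <= d k powr 1" using d[of k] p by (intro powr_mono') auto
  finally show ?thesis using d[of k] by simp
 qed
 \<comment> \<open>The smoothing error vanishes off \<open>D\<close> and its p-th power is at most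
   \<open>d k\<close>; hence it is small both in L^p, as \<open>D\<close> has finite measure, and
   against the weight, whose mass \<open>A\<close> is finite.\<close>
 have vuD: "ennreal (norm (v k x - u k x) powr p) <= ennreal (d k) * indicator D x" for k x
 proof (cases "x \<in> D")
  case True
  have "norm (v k x - u k x) powr p <= (d k ^ 2) powr p" using v(2)[of k x] p by (intro powr_mono2) auto
  then show ?thesis using True dp[of k] by (simp add: ennreal_leI)
 next
  case False
  then have "v k x = 0" "u k x = 0" using Cc_inftyD(5)[OF v(1)[of k]] S by (auto simp: u_def)
  then show ?thesis using p by simp
 qed
 have gradv: "(NL x. ennreal (norm (gradient (v k) x) powr p)) <= ennreal (2 powr p * (1 + M0))" for k
 proof -
  have "(NL x. 1 * ennreal (norm ((gradient (v k) x - Gu k x) + Gu k x) powr p)) <=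
   ennreal (2 powr p) * ((NL x. 1 * ennreal (norm (gradient (v k) x - Gu k x) powr p)) + (NL x. 1 * ennreal (norm (Gu k x) powr p)))"
   using p by (intro nn_integral_powr_add_le) auto
  also have "... <= ennreal (2 powr p) * (ennreal 1 + ennreal M0)"
   using order_trans[OF v(3)[of k] ennreal_leI[OF d(2)]] Gu_bd[of k] unfolding M0_def by (intro mult_left_mono add_mono) auto
  also have "... = ennreal (2 powr p * (1 + M0))"
   using M0 by (simp add: ennreal_mult)
  finally show ?thesis by simp
 qed
 have vsmall: "(NL x. ennreal (\<bar>v k x\<bar> powr p)) <= ennreal (2 powr p * (d k * m + P (indicator S) (w k)))" for k
 proof -
  have "(NL x. 1 * ennreal (norm ((v k x - u k x) + u k x) powr p)) <=
   ennreal (2 powr p) * ((NL x. 1 * ennreal (norm (v k x - u k x) powr p)) + (NL x. 1 * ennreal (norm (u k x) powr p)))"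
   using p by (intro nn_integral_powr_add_le) auto
  also have "... <= ennreal (2 powr p) * ((NL x. ennreal (d k) * indicator D x) + (NL x. indicator S x * ennreal (\<bar>w k x\<bar> powr p)))"
  proof (intro mult_left_mono add_mono nn_integral_mono)
   fix x
   show "1 * ennreal (norm (v k x - u k x) powr p) <= ennreal (d k) * indicator D x" using vuD[of k x] by simp
   have "\<bar>\<zeta> x\<bar> * \<bar>w k x\<bar> <= 1 * \<bar>w k x\<bar>" using z(2,3) by (intro mult_right_mono) auto
   then have "norm (u k x) powr p <= \<bar>w k x\<bar> powr p" using p by (intro powr_mono2) (auto simp: u_def abs_mult)
   then show "1 * ennreal (norm (u k x) powr p) <= indicator S x * ennreal (\<bar>w k x\<bar> powr p)"
    using S(3)[of x] p by (cases "x \<in> S") (auto intro: ennreal_leI simp: u_def)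
  qed auto
  also have "... = ennreal (2 powr p) * (ennreal (d k) * ennreal m + ennreal (P (indicator S) (w k)))"
   by (simp add: nn_integral_cmult_indicator m PSeq[OF S(1) SOm])
  also have "... = ennreal (2 powr p * (d k * m + P (indicator S) (w k)))"
  proof -
   have "0 <= P (indicator S) (w k)" unfolding P_def by (intro Bochner_Integration.integral_nonneg) simp
   then show ?thesis using d[of k] m(2) by (simp add: ennreal_mult[symmetric] ennreal_plus[symmetric] del: ennreal_plus)
  qed
  finally show ?thesis by simp
 qed
 have "(%x. if x \<in> D then \<bar>g x\<bar> else 0) \<in> borel_measurable lebesgue"
 proof (rule borel_measurable_if_I)
  have "g \<in> borel_measurable (lebesgue_on D)"
   by (rule measurable_restrict_mono[OF Lp_loc_measurable[OF gL] D(4)])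
  then show "(%x. \<bar>g x\<bar>) \<in> borel_measurable (lebesgue_on D)" by measurable
 qed (use D(3) in simp)
 then obtain g0 where g0: "g0 \<in> borel_measurable borel" "AE x in lebesgue. (if x \<in> D then \<bar>g x\<bar> else 0) = g0 x"
  by (rule borel_representative_real)
 define g' where "g' x = \<bar>g0 x\<bar>" for x
 have g'[measurable]: "g' \<in> borel_measurable borel" and g'0: "0 <= g' x" for x using g0(1) by (auto simp: g'_def[abs_def])
 have geq: "AE x in lebesgue. (if x \<in> D then \<bar>g x\<bar> else 0) = g' x"
  using g0(2) by eventually_elim (auto simp: g'_def split: if_splits)
 have gfin: "(NL x. ennreal (g' x)) < \<infinity>"
 proof -
  have "(NL x. ennreal (g' x)) = (\<integral>\<^sup>+x. ennreal (g' x) \<partial>lebesgue)" by (rule nn_integral_completion[symmetric])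
  also have "... <= (\<integral>\<^sup>+x. ennreal \<bar>g x\<bar> * indicator (closure D) x \<partial>lebesgue)"
  proof (rule nn_integral_mono_AE)
   show "AE x in lebesgue. ennreal (g' x) <= ennreal \<bar>g x\<bar> * indicator (closure D) x"
    using geq by eventually_elim (use closure_subset[of D] in \<open>auto simp: indicator_def split: if_splits\<close>)
  qed
  also have "... = (\<integral>\<^sup>+x. ennreal \<bar>g x\<bar> \<partial>lebesgue_on (closure D))"
   by (subst nn_integral_restrict_space) auto
  also have "... < \<infinity>" using Lp_locD(2)[OF gL D(5,6)] by (simp add: integrable_iff_bounded)
  finally show ?thesis .
 qed
 define A where "A = enn2real (NL x. ennreal (g' x))"
 have A: "(NL x. ennreal (g' x)) = ennreal A" "0 <= A" using gfin by (auto simp: A_def)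
 have absgL: "(%x. indicator K x * \<bar>g x\<bar>) \<in> Lp_loc 1 Om"
 proof -
  have "integrable (lebesgue_on K') (%x. indicator K x * \<bar>g x\<bar>)" if "compact K'" "K' \<subseteq> Om" for K'
   using Lp_locD(2)[OF gL that] borel_compact[OF K(1)]
    integrable_mult_indicator[of K "lebesgue_on K'" "%x. \<bar>g x\<bar>"] integrable_real_mult_indicator[of K "lebesgue_on K'" "%x. \<bar>g x\<bar>"]
    integrable_bounded_scaleR[of "lebesgue_on K'" "%x. \<bar>g x\<bar>" "indicator K" 1] borel_measurable_indicator[of K borel]
    measurable_restrict_space1[OF measurable_completion, of "indicator K" lborel borel K']
   by (auto simp: indicator_def)
  then show ?thesis by (auto simp: Lp_loc_def Lp_def)
 qed
 have main: "ennreal (P (%x. indicator K x * \<bar>g x\<bar>) (w k)) <=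
   ennreal (2 powr p) * (ennreal A * ennreal (d k) + (NL x. ennreal (g' x) * ennreal (\<bar>v k x\<bar> powr p)))" for k
 proof -
  have "ennreal (P (%x. indicator K x * \<bar>g x\<bar>) (w k)) = (\<integral>\<^sup>+x. ennreal (indicator K x * \<bar>g x\<bar> * \<bar>w k x\<bar> powr p) \<partial>M)"
   unfolding P_def by (rule nn_integral_eq_integral[OF sob_integrable_P[OF s absgL], symmetric]) auto
  also have "... = (NL x. ennreal (indicator K x * g' x * \<bar>w k x\<bar> powr p))"
  proof (rule nn_integral_M_eq_lborel)
   show "AE x in lebesgue. (if x \<in> Om then ennreal (indicator K x * \<bar>g x\<bar> * \<bar>w k x\<bar> powr p) else 0) = ennreal (indicator K x * g' x * \<bar>w k x\<bar> powr p)"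
    using geq by eventually_elim (use K(2) i D_def in \<open>auto simp: indicator_def split: if_splits\<close>)
  qed measurable
  also have "... <= (NL x. ennreal (g' x) * ennreal (norm ((u k x - v k x) + v k x) powr p))"
   by (intro nn_integral_mono) (auto simp: indicator_def u_def z(4) ennreal_mult[symmetric] g'0)
  also have "... <= ennreal (2 powr p) * ((NL x. ennreal (g' x) * ennreal (norm (u k x - v k x) powr p))
     + (NL x. ennreal (g' x) * ennreal (norm (v k x) powr p)))"
   using p by (intro nn_integral_powr_add_le) auto
  also have "... <= ennreal (2 powr p) * ((NL x. ennreal (g' x) * ennreal (d k))
     + (NL x. ennreal (g' x) * ennreal (norm (v k x) powr p)))"
  proof (intro mult_left_mono add_right_mono nn_integral_mono)
   fix x show "ennreal (norm (u k x - v k x) powr p) <= ennreal (d k)"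
   proof -
    have "ennreal (norm (v k x - u k x) powr p) <= ennreal (d k) * indicator D x" using vuD by simp
    also have "... <= ennreal (d k)" by (auto simp: indicator_def)
    finally show ?thesis by (simp add: abs_minus_commute)
   qed
  qed auto
  also have "(NL x. ennreal (g' x) * ennreal (d k)) = ennreal A * ennreal (d k)"
   by (subst nn_integral_multc) (auto simp: A)
  finally show ?thesis by simp
 qed
 have P0: "0 <= P (%x. indicator K x * \<bar>g x\<bar>) (w k)" for k unfolding P_def by (intro Bochner_Integration.integral_nonneg) simp
 show ?thesis
 proof (rule order_tendstoI)
  fix y :: real assume "y < 0"
  then show "\<forall>\<^sub>F k in sequentially. y < P (%x. indicator K x * \<bar>g x\<bar>) (w k)"
   by (intro always_eventually allI) (rule less_le_trans[OF _ P0])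
 next
  fix y :: real assume y: "0 < y"
  define ep where "ep = y / (4 * 2 powr p)"
  have ep: "0 < ep" using y by (simp add: ep_def)
  obtain \<eta> where \<eta>: "0 < \<eta>" "!!u. u \<in> Cc_infty D ==>
   (NL x. ennreal (norm (gradient u x) powr p)) <= ennreal (2 powr p * (1 + M0)) ==>
   (NL x. ennreal (\<bar>u x\<bar> powr p)) <= ennreal \<eta> ==>
   (NL x. ennreal (g' x) * ennreal (\<bar>u x\<bar> powr p)) <= ennreal ep"
  proof (rule morrey_core[OF p1 n g D(1,2) g' g'0 geq _ A(2) _ ep])
   show "(NL x. ennreal (g' x)) <= ennreal A" by (simp add: A)
   show "0 <= 2 powr p * (1 + M0)" using M0 by simp
  qed (rule that; assumption)
  have "(%k. 2 powr p * (d k * m + P (indicator S) (w k))) ~~> 2 powr p * (0 * m + 0)"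
   by (intro tendsto_intros dlim PS)
  then have "\<forall>\<^sub>F k in sequentially. 2 powr p * (d k * m + P (indicator S) (w k)) < \<eta>"
   using \<eta>(1) by (intro order_tendstoD) auto
  moreover have "(%k. A * d k) ~~> A * 0" by (intro tendsto_intros dlim)
  then have "\<forall>\<^sub>F k in sequentially. A * d k < ep" using ep by (intro order_tendstoD) auto
  ultimately show "\<forall>\<^sub>F k in sequentially. P (%x. indicator K x * \<bar>g x\<bar>) (w k) < y"
  proof eventually_elim
   case *: (elim k)
   have "(NL x. ennreal (g' x) * ennreal (\<bar>v k x\<bar> powr p)) <= ennreal ep"
    by (rule \<eta>(2)[OF v(1) gradv order_trans[OF vsmall ennreal_leI]]) (use * in simp)
   then have "ennreal (P (%x. indicator K x * \<bar>g x\<bar>) (w k)) <= ennreal (2 powr p) * (ennreal A * ennreal (d k) + ennreal ep)"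
    by (intro order_trans[OF main] mult_left_mono add_left_mono) auto
   also have "... = ennreal (2 powr p * (A * d k + ep))"
    using A(2) d[of k] ep by (simp add: ennreal_mult[symmetric] ennreal_plus[symmetric] del: ennreal_plus)
   finally have "P (%x. indicator K x * \<bar>g x\<bar>) (w k) <= 2 powr p * (A * d k + ep)"
    using A(2) d[of k] ep by (subst (asm) ennreal_le_iff) auto
   also have "... < 2 powr p * (ep + ep)" using * by simp
   also have "... = y / 2" by (simp add: ep_def)
   also have "... < y" using y by simp
   finally show ?case .
  qed
 qed
qed

end

section \<open>The energy space on subdomains\<close>

lemma integrable_restrict_subset:
 fixes h :: "real ^ 'n => 'b::{banach, second_countable_topology}"
 assumes "U \<in> sets lebesgue" "Om \<in> sets lebesgue" "U \<subseteq> Om" "integrable (lebesgue_on Om) h"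
 shows "integrable (lebesgue_on U) h"
proof -
 have "integrable lebesgue (%x. indicator Om x *r h x)"
  using assms(2,4) by (simp add: integrable_restrict_space)
 from integrable_mult_indicator[OF assms(1) this]
 have "integrable lebesgue (%x. indicator U x *r (indicator Om x *r h x))" .
 moreover have "(%x. indicator U x *r (indicator Om x *r h x)) = (%x. indicator U x *r h x)"
  using assms(3) by (auto simp: fun_eq_iff indicator_def)
 ultimately show ?thesis using assms(1) by (simp add: integrable_restrict_space)
qed

lemma integrable_test_gradient:
 fixes u :: "real ^ 'n => real"
 assumes U: "open U" and u: "u \<in> Lp_loc 1 U" and \<psi>: "\<psi> \<in> Cc_infty U"
 shows "integrable (lebesgue_on U) (%x. u x *r gradient \<psi> x)"
proof -
 obtain S where S: "compact S" "S \<subseteq> U" "!!x. x \<notin> S ==> gradient \<psi> x = 0"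
  using Cc_inftyD(5)[OF \<psi>] by blast
 obtain B where B: "!!x. norm (gradient \<psi> x) <= B" using Cc_infty_bounded[OF \<psi>] by metis
 have "integrable (lebesgue_on S) (%x. u x *r gradient \<psi> x)"
 proof (rule Bochner_Integration.integrable_bound[where f="%x. u x * B"])
  show "(%x. u x *r gradient \<psi> x) \<in> borel_measurable (lebesgue_on S)"
   by (intro borel_measurable_scaleR Lp_locD(1)[OF u S(1,2)] measurable_restrict_space1 measurable_completion)
    (simp add: Cc_infty_borel(2)[OF \<psi>])
  show "AE x in lebesgue_on S. norm (u x *r gradient \<psi> x) <= norm (u x * B)"
   unfolding norm_scaleR real_norm_def abs_mult
   by (intro AE_I2 mult_left_mono order_trans[OF B abs_ge_self] abs_ge_zero)
  show "integrable (lebesgue_on S) (%x. u x * B)"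
   by (intro integrable_mult_left impI Lp_locD(2)[OF u S(1,2)])
 qed
 then show ?thesis
  by (rule integrable_extend_by_zero[OF compact_imp_sets_lebesgue[OF S(1)] _ S(2), rotated 2]) (use U S(3) in auto)
qed

lemma has_weak_gradient_diff:
 fixes u v :: "real ^ 'n => real"
 assumes U: "open U" and u: "has_weak_gradient U u G" and v: "has_weak_gradient U v G'"
 shows "has_weak_gradient U (%x. u x - v x) (%x. G x - G' x)"
proof -
 have L: "u \<in> Lp_loc 1 U" "v \<in> Lp_loc 1 U" "G \<in> Lp_loc 1 U" "G' \<in> Lp_loc 1 U"
  using u v by (auto simp: has_weak_gradient_def)
 show ?thesis unfolding has_weak_gradient_def
 proof (intro conjI ballI)
  show "(%x. u x - v x) \<in> Lp_loc 1 U" by (rule Lp_loc_diff[OF L(1,2)])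
  show "(%x. G x - G' x) \<in> Lp_loc 1 U"
   using Lp_locD[OF L(3)] Lp_locD[OF L(4)] unfolding Lp_loc_def Lp_def by auto
  fix \<psi> assume \<psi>: "\<psi> \<in> Cc_infty U"
  have "(LINT x|lebesgue_on U. u x *r gradient \<psi> x) = - (LINT x|lebesgue_on U. \<psi> x *r G x)"
   "(LINT x|lebesgue_on U. v x *r gradient \<psi> x) = - (LINT x|lebesgue_on U. \<psi> x *r G' x)"
   using u v \<psi> by (auto simp: has_weak_gradient_def)
  then show "(LINT x|lebesgue_on U. (u x - v x) *r gradient \<psi> x) = - (LINT x|lebesgue_on U. \<psi> x *r (G x - G' x))"
   using integrable_test_gradient[OF U L(1) \<psi>] integrable_test_gradient[OF U L(2) \<psi>]
    integrable_test_scaleR[OF U L(3) \<psi>] integrable_test_scaleR[OF U L(4) \<psi>]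
   by (simp add: scaleR_diff_left scaleR_diff_right)
 qed
qed

lemma has_weak_gradient_zero: "has_weak_gradient U (%x. 0) (%x. 0 :: real ^ 'n)"
 by (auto simp: has_weak_gradient_def Lp_loc_def Lp_def)

lemma continuous_on_imp_Lp_loc:
 fixes f :: "real ^ 'n => real"
 assumes "continuous_on U f" shows "f \<in> Lp_loc 1 U"
proof -
 have "f \<in> Lp 1 K" if K: "compact K" "K \<subseteq> U" for K
 proof -
  have "integrable lborel (%x. indicator K x *r f x)"
   using borel_integrable_compact[OF K(1)] continuous_on_subset[OF assms K(2)] by blast
  then have "integrable lebesgue (%x. indicator K x *r f x)"
   by (subst integrable_completion) auto
  then have "integrable (lebesgue_on K) f"
   using compact_imp_sets_lebesgue[OF K(1)] by (simp add: integrable_restrict_space)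
  then show ?thesis by (auto simp: Lp_def)
 qed
 then show ?thesis by (simp add: Lp_loc_def)
qed

lemma Lp_loc_mono: "f \<in> Lp_loc r Om ==> U \<subseteq> Om ==> f \<in> Lp_loc r U"
 by (auto simp: Lp_loc_def)

context norm_family_domain
begin

lemma P_restrict:
 assumes U: "open U" "U \<subseteq> Om" and s: "sob p U \<phi> G" and W: "W \<in> Lp_loc 1 Om"
 shows "(LINT x|lebesgue_on U. W x * \<bar>\<phi> x\<bar> powr p) = P W \<phi>"
proof -
 obtain K where K: "K \<subseteq> U" "!!x. x \<notin> K ==> \<phi> x = 0" using sobD(5)[OF s] by blast
 have z: "\<phi> x = 0" if "x \<notin> U" for x using K that by blast
 show ?thesis unfolding P_def
  by (rule integral_extend_by_zero[OF _ setsOm U(2)])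
    (use U(1) z p1 borel_measurable_integrable[OF sob_integrable_P[OF sob_mono[OF s U(2)] W]] in \<open>auto intro!: AE_I2\<close>)
qed

lemma E_scale: "E (%x. c *r G x) = \<bar>c\<bar> powr p * E G" if "G \<in> borel_measurable M"
proof -
 have "E (%x. c *r G x) = (LINT x|M. \<bar>c\<bar> powr p * H x (G x) powr p)"
  unfolding E_def
 proof (rule integral_cong_AE)
  have [measurable]: "(%x. H x (G x)) \<in> borel_measurable M" "(%x. H x (c *r G x)) \<in> borel_measurable M"
   using that by (auto intro!: measurable_H)
  show "(%x. H x (c *r G x) powr p) \<in> borel_measurable M" "(%x. \<bar>c\<bar> powr p * H x (G x) powr p) \<in> borel_measurable M"
   by measurable
  show "AE x in M. H x (c *r G x) powr p = \<bar>c\<bar> powr p * H x (G x) powr p"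
   using AE_norm by eventually_elim (simp add: is_normD(1,3) powr_mult)
 qed
 then show ?thesis by (simp add: E_def)
qed

lemma P_scale: "P W (%x. c * \<phi> x) = \<bar>c\<bar> powr p * P W \<phi>"
proof -
 have "P W (%x. c * \<phi> x) = (LINT x|M. \<bar>c\<bar> powr p * (W x * \<bar>\<phi> x\<bar> powr p))"
  unfolding P_def by (rule Bochner_Integration.integral_cong) (auto simp: abs_mult powr_mult)
 then show ?thesis by (simp add: P_def)
qed

text \<open>Test functions in \<open>U\<close> are test functions in \<open>Om\<close> with the same
  energy, so \<open>v\<close> remains a Hardy-weight; being positive, it is not almost everywhere
  zero on a nonempty open set.\<close>

lemma subcritical_subdomain:
 assumes V: "V \<in> Lp_loc 1 Om" and nn: "nonneg_functional p H V Om"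
  and v: "v \<in> hardy_weights p H V Om" "!!x. x \<in> Om ==> 0 < v x"
  and U: "open U" "U \<noteq> {}" "U \<subseteq> Om"
 shows "subcritical p H V U"
proof -
 have p: "1 <= p" using p1 by simp
 have en: "energy p H V U \<phi> = energy p H V Om \<phi>" "\<phi> \<in> Cc_infty Om" "sob p U \<phi> (gradient \<phi>)" if "\<phi> \<in> Cc_infty U" for \<phi>
 proof -
  show s: "sob p U \<phi> (gradient \<phi>)" by (rule Cc_infty_sob[OF that p])
  show "energy p H V U \<phi> = energy p H V Om \<phi>"
   using energy_sob[OF U(1,3) s V] energy_sob[OF openOm subset_refl sob_mono[OF s U(3)] V] by simp
  show "\<phi> \<in> Cc_infty Om" using that Cc_infty_mono[OF U(3)] by blast
 qed
 have nnU: "nonneg_functional p H V U"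
  using nn en by (auto simp: nonneg_functional_def)
 have vL: "v \<in> Lp_loc 1 Om" using v(1) by (simp add: hardy_weights_def)
 obtain C where C: "0 < C" "!!\<phi>. \<phi> \<in> Cc_infty Om ==> C * (LINT x|M. \<bar>v x\<bar> * \<bar>\<phi> x\<bar> powr p) <= energy p H V Om \<phi>"
  using v(1) by (auto simp: hardy_weights_def)
 have "C * (LINT x|lebesgue_on U. \<bar>v x\<bar> * \<bar>\<phi> x\<bar> powr p) <= energy p H V U \<phi>" if \<phi>: "\<phi> \<in> Cc_infty U" for \<phi>
  using P_restrict[OF U(1,3) en(3)[OF \<phi>] Lp_loc_linear(1)[OF vL vL]] C(2)[OF en(2)[OF \<phi>]] en(1)[OF \<phi>]
  by (simp add: P_def)
 then have "v \<in> hardy_weights p H V U"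
  unfolding hardy_weights_def using Lp_loc_mono[OF vL U(3)] C(1) by blast
 moreover have "\<not> (AE x in lebesgue_on U. v x = 0)"
 proof
  assume "AE x in lebesgue_on U. v x = 0"
  then have "AE x in lebesgue. x \<in> U --> v x = 0" using U(1) by (subst (asm) AE_restrict_space_iff) auto
  then have "AE x in lebesgue. x \<notin> U" by eventually_elim (use v(2) U(3) in fastforce)
  then have "AE x in lborel. x \<notin> U" by (simp add: AE_completion_iff)
  then show False using AE_avoid_open_imp_empty[OF U(1)] U(2) by blast
 qed
 ultimately show ?thesis using nnU by (auto simp: subcritical_def critical_def)
qed

lemma sob_in_W_tilde0:
 assumes V: "V \<in> Lp_loc 1 Om" and U: "open U" "U \<subseteq> Om" and v: "continuous_on U v" and s: "sob p U \<phi> G"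
 shows "\<phi> \<in> W_tilde0 p H V v U" "\<phi> \<in> W_tilde p H V v U" "\<phi> \<in> W1p p U" "\<phi> \<in> Cc U"
proof -
 have p: "1 <= p" using p1 by simp
 have UM: "U \<in> sets lebesgue" using U by simp
 note wg = sob_has_weak_gradient[OF s p U(1)]
 show W: "\<phi> \<in> W1p p U" "\<phi> \<in> Cc U" by (rule wg)+
 obtain K where K: "compact K" "K \<subseteq> U" "!!x. x \<notin> K ==> \<phi> x = 0" using sobD(5)[OF s] by blast
 have "V \<in> Lp_loc 1 U" "v \<in> Lp_loc 1 U" using Lp_loc_mono[OF V U(2)] continuous_on_imp_Lp_loc[OF v] by auto
 note L = this
 have "(%x. \<bar>V x\<bar> + v x) \<in> Lp 1 K'" if K': "compact K'" "K' \<subseteq> U" for K'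
 proof -
  have [measurable]: "V \<in> borel_measurable (lebesgue_on K')" "v \<in> borel_measurable (lebesgue_on K')"
   using Lp_locD(1)[OF L(1) K'] Lp_locD(1)[OF L(2) K'] by auto
  have "integrable (lebesgue_on K') V" "integrable (lebesgue_on K') v"
   using Lp_locD(2)[OF L(1) K'] Lp_locD(2)[OF L(2) K'] by auto
  then show ?thesis by (simp add: Lp_def)
 qed
 then have "(%x. \<bar>V x\<bar> + v x) \<in> Lp_loc 1 U" by (simp add: Lp_loc_def)
 then have i: "integrable (lebesgue_on U) (%x. (\<bar>V x\<bar> + v x) * \<bar>\<phi> x\<bar> powr p)"
  by (rule potential_integrable_on[OF p1 UM _ sobD(1)[OF s] K])
 have "integrable (lebesgue_on U) (%x. H x (G x) powr p)"
  by (rule integrable_restrict_subset[OF UM setsOm U(2) sob_integrable_H[OF sob_mono[OF s U(2)]]])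
 moreover have "\<phi> \<in> borel_measurable (lebesgue_on U)" using wg(3) by (simp add: Lp_def)
 ultimately show Wt: "\<phi> \<in> W_tilde p H V v U" unfolding W_tilde_def using i wg(1) by blast
 have 0: "W_tilde_norm p H V v U (%x. \<phi> x - \<phi> x) = 0"
 proof -
  \<comment> \<open>The chosen gradient of the zero function is known to vanish only almost
    everywhere.\<close>
  have "AE x in lebesgue_on U. weak_gradient U (%x. 0) x = 0"
   by (rule weak_gradient_AE[OF U(1) has_weak_gradient_zero])
  moreover have "AE x in lebesgue_on U. is_norm (H x)"
   using AE_norm U UM unfolding AE_M_iff by (subst AE_restrict_space_iff) (auto elim!: eventually_mono)
  ultimately have "AE x in lebesgue_on U. H x (weak_gradient U (%x. 0) x) powr p + (\<bar>V x\<bar> + v x) * \<bar>0\<bar> powr p = 0"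
   by eventually_elim (use p1 in \<open>simp add: is_normD(7)\<close>)
  then have "(LINT x|lebesgue_on U. H x (weak_gradient U (%x. 0) x) powr p + (\<bar>V x\<bar> + v x) * \<bar>0\<bar> powr p) = 0"
   by (rule integral_eq_zero_AE)
  then show ?thesis by (simp add: W_tilde_norm_def)
 qed
 show "\<phi> \<in> W_tilde0 p H V v U" unfolding W_tilde0_def
  using Wt W 0 by (auto intro!: bexI[of _ \<phi>])
qed

text \<open>Numerator and denominator are homogeneous of degree \<open>p\<close>, so the competitor
  can be normalised to satisfy the constraint.\<close>

lemma hardy_infimum_le:
 assumes V: "V \<in> Lp_loc 1 Om" and gL: "g \<in> Lp_loc 1 Om" and U: "open U" "U \<subseteq> Om" and v: "continuous_on U v"
  and s: "sob p U \<phi> G" and D: "0 < P (%x. \<bar>g x\<bar>) \<phi>"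
 shows "(INF \<phi> \<in> {\<phi> \<in> W_tilde0 p H V v U. (LINT x|lebesgue_on U. \<bar>g x\<bar> * \<bar>\<phi> x\<bar> powr p) = 1}. ereal (energy p H V U \<phi>))
  <= ereal ((E G + P V \<phi>) / P (%x. \<bar>g x\<bar>) \<phi>)"
proof -
 have p: "1 <= p" using p1 by simp
 have ag: "(%x. \<bar>g x\<bar>) \<in> Lp_loc 1 Om" by (rule Lp_loc_linear(1)[OF gL gL])
 define c where "c = P (%x. \<bar>g x\<bar>) \<phi> powr (- 1 / p)"
 have c: "\<bar>c\<bar> powr p = 1 / P (%x. \<bar>g x\<bar>) \<phi>"
 proof -
  have "\<bar>c\<bar> powr p = P (%x. \<bar>g x\<bar>) \<phi> powr (- 1 / p * p)" by (simp only: c_def abs_of_nonneg[OF powr_ge_zero] powr_powr)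
  also have "- 1 / p * p = - 1" using p1 by simp
  finally show ?thesis using D by (simp add: powr_minus_divide)
 qed
 have s': "sob p U (%x. c * \<phi> x) (%x. c *r G x)" by (rule sob_cmult[OF s p])
 have "(LINT x|lebesgue_on U. \<bar>g x\<bar> * \<bar>c * \<phi> x\<bar> powr p) = 1"
  using P_restrict[OF U s' ag] D by (simp add: P_scale c)
 moreover have "energy p H V U (%x. c * \<phi> x) = (E G + P V \<phi>) / P (%x. \<bar>g x\<bar>) \<phi>"
  using energy_sob[OF U s' V] E_scale[OF sob_measurable(2)[OF sob_mono[OF s U(2)]], of c]
  by (simp add: P_scale c add_divide_distrib)
 ultimately show ?thesis
  using sob_in_W_tilde0(1)[OF V U v s'] by (intro INF_lower2[of "%x. c * \<phi> x"]) auto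
qed

text \<open>The inequality for compactly supported functions passes to their closure. The energies
  converge in the norm of the space. For the integral against |g| there is no such control, but
  Fatou's lemma goes in the right direction along an almost everywhere convergent sequence.\<close>

lemma hardy_infimum_ge:
 assumes V: "V \<in> Lp_loc 1 Om" and gL: "g \<in> Lp_loc 1 Om" and U: "open U" "U \<subseteq> Om"
  and v: "continuous_on U v" "!!x. x \<in> U ==> 0 < v x"
  and S: "0 <= S" "!!\<phi> G. sob p Om \<phi> G ==> S * P (%x. \<bar>g x\<bar>) \<phi> <= E G + P V \<phi>"
 shows "ereal S <= (INF \<phi> \<in> {\<phi> \<in> W_tilde0 p H V v U. (LINT x|lebesgue_on U. \<bar>g x\<bar> * \<bar>\<phi> x\<bar> powr p) = 1}. ereal (energy p H V U \<phi>))"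
proof (rule INF_greatest)
 let ?N = "lebesgue_on U"
 have p: "1 <= p" "0 <= p" using p1 by auto
 have UM: "U \<in> sets lebesgue" using U by simp
 have ag: "(%x. \<bar>g x\<bar>) \<in> Lp_loc 1 Om" by (rule Lp_loc_linear(1)[OF gL gL])
 fix \<phi> assume "\<phi> \<in> {\<phi> \<in> W_tilde0 p H V v U. (LINT x|?N. \<bar>g x\<bar> * \<bar>\<phi> x\<bar> powr p) = 1}"
 then have \<phi>: "\<phi> \<in> W_tilde0 p H V v U" "(LINT x|?N. \<bar>g x\<bar> * \<bar>\<phi> x\<bar> powr p) = 1" by auto
 then have "\<phi> \<in> W_tilde p H V v U" by (simp add: W_tilde0_def)
 then obtain G0 where m\<phi>: "\<phi> \<in> borel_measurable ?N" and i\<phi>: "integrable ?N (%x. (\<bar>V x\<bar> + v x) * \<bar>\<phi> x\<bar> powr p)"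
  and G0: "has_weak_gradient U \<phi> G0" "integrable ?N (%x. H x (G0 x) powr p)"
  by (auto simp: W_tilde_def)
 \<comment> \<open>Geometric errors are summable, so the approximants converge almost everywhere
   without passing to a further subsequence.\<close>
 define e where "e j = (1/2::real) ^ j" for j :: nat
 have e: "0 < e j" "e j <= 1" for j by (auto simp: e_def power_le_one)
 have "\<forall>j. \<exists>f. f \<in> W1p p U \<inter> Cc U \<inter> W_tilde p H V v U \<and> W_tilde_norm p H V v U (%x. \<phi> x - f x) < e j"
  using \<phi>(1) e(1) unfolding W_tilde0_def by blast
 from choice[OF this] obtain f where f: "!!j. f j \<in> W1p p U" "!!j. f j \<in> Cc U" "!!j. f j \<in> W_tilde p H V v U"
  "!!j. W_tilde_norm p H V v U (%x. \<phi> x - f j x) < e j" by blast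
 have "\<forall>j. \<exists>G. sob p U (f j) G" using W1p_Cc_imp_sob[OF U(1) p(1) f(1,2)] by blast
 from choice[OF this] obtain G where G: "!!j. sob p U (f j) (G j)" by blast
 have G': "sob p Om (f j) (G j)" for j by (rule sob_mono[OF G U(2)])
 have i_f: "integrable ?N (%x. (\<bar>V x\<bar> + v x) * \<bar>f j x\<bar> powr p)" for j using f(3)[of j] by (simp add: W_tilde_def)
 have mN: "h \<in> borel_measurable ?N" if "h \<in> borel_measurable M" for h :: "real^'n => real"
  by (rule measurable_restrict_mono[OF that U(2)])
 have mN': "h \<in> borel_measurable ?N" if "h \<in> borel_measurable M" for h :: "real^'n => real^'n"
  by (rule measurable_restrict_mono[OF that U(2)])
 have mf: "f j \<in> borel_measurable ?N" and mG: "G j \<in> borel_measurable ?N" for j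
  using mN[OF sob_measurable(1)[OF G']] mN'[OF sob_measurable(2)[OF G']] by auto
 have mV: "V \<in> borel_measurable ?N" and mg: "g \<in> borel_measurable ?N"
  using mN[OF Lp_loc_measurable[OF V]] mN[OF Lp_loc_measurable[OF gL]] by auto
 have mv: "v \<in> borel_measurable ?N" by (rule continuous_imp_measurable_on_sets_lebesgue[OF v(1) UM])
 have normN: "AE x in ?N. is_norm (H x)"
  using AE_norm U UM unfolding AE_M_iff by (subst AE_restrict_space_iff) (auto elim!: eventually_mono)
 have mHN: "(%x. H x (F x)) \<in> borel_measurable ?N" if "F \<in> borel_measurable ?N" for F
 proof (rule borel_measurable_norm_family[OF UM normN _ that])
  fix \<xi> show "(%x. H x \<xi>) \<in> borel_measurable ?N" using adm by (intro mN) (simp add: admissible_def)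
 qed
 have mG0: "G0 \<in> borel_measurable ?N"
  by (rule Lp_loc_borel_measurable[OF U(1), where r = 1]) (use G0(1) in \<open>simp add: has_weak_gradient_def\<close>)
 note [measurable] = m\<phi> mf mG mV mg mv mG0
 have iG: "integrable ?N (%x. H x (G j x) powr p)" for j
  by (rule integrable_restrict_subset[OF UM setsOm U(2) sob_integrable_H[OF G']])
 have [measurable]: "(%x. H x (G0 x - G j x)) \<in> borel_measurable ?N" for j by (rule mHN) measurable
 have iHd: "integrable ?N (%x. H x (G0 x - G j x) powr p)" for j
 proof (rule Bochner_Integration.integrable_bound)
  show "integrable ?N (%x. 2 powr p * (H x (G0 x) powr p + H x (G j x) powr p))" using G0(2) iG by auto
  show "AE x in ?N. norm (H x (G0 x - G j x) powr p) <= norm (2 powr p * (H x (G0 x) powr p + H x (G j x) powr p))"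
   using normN
  proof eventually_elim
   case (elim x)
   note n = elim
   have "H x (G0 x - G j x) powr p <= (H x (G0 x) + H x (G j x)) powr p"
    using is_normD(1,6)[OF n] p by (intro powr_mono2) auto
   also have "... <= 2 powr p * (H x (G0 x) powr p + H x (G j x) powr p)"
    using is_normD(1)[OF n] p by (intro powr_add_le) auto
   finally show ?case by simp
  qed
 qed measurable
 have vpos: "AE x in ?N. 0 < v x" using v(2) UM by (subst AE_restrict_space_iff) auto
 have ifd: "integrable ?N (%x. (\<bar>V x\<bar> + v x) * \<bar>\<phi> x - f j x\<bar> powr p)" for j
 proof (rule Bochner_Integration.integrable_bound)
  show "integrable ?N (%x. 2 powr p * ((\<bar>V x\<bar> + v x) * \<bar>\<phi> x\<bar> powr p + (\<bar>V x\<bar> + v x) * \<bar>f j x\<bar> powr p))"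
   using i\<phi> i_f by auto
  show "AE x in ?N. norm ((\<bar>V x\<bar> + v x) * \<bar>\<phi> x - f j x\<bar> powr p) <=
    norm (2 powr p * ((\<bar>V x\<bar> + v x) * \<bar>\<phi> x\<bar> powr p + (\<bar>V x\<bar> + v x) * \<bar>f j x\<bar> powr p))"
   using vpos
  proof eventually_elim
   case (elim x)
   note vx = elim
   have "\<bar>\<phi> x - f j x\<bar> powr p <= (\<bar>\<phi> x\<bar> + \<bar>f j x\<bar>) powr p" using p by (intro powr_mono2) auto
   also have "... <= 2 powr p * (\<bar>\<phi> x\<bar> powr p + \<bar>f j x\<bar> powr p)" using p by (intro powr_add_le) auto
   finally have "(\<bar>V x\<bar> + v x) * \<bar>\<phi> x - f j x\<bar> powr p <= (\<bar>V x\<bar> + v x) * (2 powr p * (\<bar>\<phi> x\<bar> powr p + \<bar>f j x\<bar> powr p))"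
    using vx by (intro mult_left_mono) auto
   then show ?case
    using vx by (simp add: algebra_simps)
  qed
 qed measurable
 define I1 where "I1 j = (LINT x|?N. H x (G0 x - G j x) powr p)" for j
 define I2 where "I2 j = (LINT x|?N. (\<bar>V x\<bar> + v x) * \<bar>\<phi> x - f j x\<bar> powr p)" for j
 have I0: "0 <= I1 j" "0 <= I2 j" for j
 proof -
  show "0 <= I1 j" unfolding I1_def by (intro Bochner_Integration.integral_nonneg) simp
  show "0 <= I2 j" unfolding I2_def by (intro integral_nonneg_AE) (use vpos in \<open>eventually_elim, simp\<close>)
 qed
 have Isum: "I1 j + I2 j <= e j" for j
 proof -
  have "AE x in ?N. weak_gradient U (%x. \<phi> x - f j x) x = G0 x - G j x"
   by (rule weak_gradient_AE[OF U(1) has_weak_gradient_diff[OF U(1) G0(1) sob_has_weak_gradient(1)[OF G p(1) U(1)]]])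
  then have AEw: "AE x in ?N. H x (G0 x - G j x) powr p + (\<bar>V x\<bar> + v x) * \<bar>\<phi> x - f j x\<bar> powr p
    = H x (weak_gradient U (%x. \<phi> x - f j x) x) powr p + (\<bar>V x\<bar> + v x) * \<bar>\<phi> x - f j x\<bar> powr p"
   by eventually_elim simp
  have m1: "(%x. H x (G0 x - G j x) powr p + (\<bar>V x\<bar> + v x) * \<bar>\<phi> x - f j x\<bar> powr p) \<in> borel_measurable ?N" by measurable
  have "(LINT x|?N. H x (weak_gradient U (%x. \<phi> x - f j x) x) powr p + (\<bar>V x\<bar> + v x) * \<bar>\<phi> x - f j x\<bar> powr p)
   = (LINT x|?N. H x (G0 x - G j x) powr p + (\<bar>V x\<bar> + v x) * \<bar>\<phi> x - f j x\<bar> powr p)"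
   by (rule integral_cong_AE[OF m1 borel_measurable_lebesgue_on_AE[OF UM m1 AEw] AEw, symmetric])
  also have "... = I1 j + I2 j" using iHd ifd by (simp add: I1_def I2_def)
  finally have "(I1 j + I2 j) powr (1 / p) < e j" using f(4)[of j] by (simp add: W_tilde_norm_def)
  then have "((I1 j + I2 j) powr (1 / p)) powr p <= e j powr p" using p by (intro powr_mono2) auto
  also have "... <= e j powr 1" using e[of j] p by (intro powr_mono') auto
  finally show ?thesis using p1 I0[of j] e(1)[of j] by (simp add: powr_powr)
 qed
 have elim: "e ~~> 0" unfolding e_def[abs_def] by (rule LIMSEQ_power_zero) simp
 have I1lim: "I1 ~~> 0"
 proof (rule Lim_null_comparison[OF always_eventually elim], rule allI)
  fix j show "norm (I1 j) <= e j" using Isum[of j] I0[of j] by simp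
 qed
 have I2le: "I2 j <= e j" for j using Isum[of j] I0[of j] by simp
 have HG0: "(%j. LINT x|?N. H x (G j x) powr p) ~~> (LINT x|?N. H x (G0 x) powr p)"
 proof (rule integral_powr_tendsto(2)[where dj="%j x. H x (G0 x - G j x)"])
  show "AE x in ?N. 0 <= H x (G0 x)" using normN by eventually_elim (rule is_normD)
  show "AE x in ?N. 0 <= H x (G j x)" for j using normN by eventually_elim (rule is_normD)
  show "AE x in ?N. 0 <= H x (G0 x - G j x) \<and> \<bar>H x (G j x) - H x (G0 x)\<bar> <= H x (G0 x - G j x)" for j
   using normN by eventually_elim (metis is_normD(1,8,9))
 qed (use p G0(2) iHd I1lim mHN in \<open>auto simp: I1_def[abs_def]\<close>)
 have PW: "integrable ?N (%x. W x * \<bar>\<phi> x\<bar> powr p)"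
  "(%j. LINT x|?N. W x * \<bar>f j x\<bar> powr p) ~~> (LINT x|?N. W x * \<bar>\<phi> x\<bar> powr p)"
  "!!j. integrable ?N (%x. W x * \<bar>f j x\<bar> powr p)"
  if W[measurable]: "W \<in> borel_measurable ?N" "!!x. 0 <= W x" "!!x. W x <= \<bar>V x\<bar>" for W
 proof -
  have le: "AE x in ?N. norm (W x * \<bar>h x\<bar> powr p) <= norm ((\<bar>V x\<bar> + v x) * \<bar>h x\<bar> powr p)" for h :: "real^'n => real"
   using vpos
  proof eventually_elim
   case (elim x)
   then have "W x * \<bar>h x\<bar> powr p <= (\<bar>V x\<bar> + v x) * \<bar>h x\<bar> powr p" using W(3)[of x] by (intro mult_right_mono) auto
   then show ?case using W(2)[of x] \<open>0 < v x\<close> by simp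
  qed
  show i1: "integrable ?N (%x. W x * \<bar>\<phi> x\<bar> powr p)"
   by (rule Bochner_Integration.integrable_bound[OF i\<phi> _ le]) measurable
  have i2: "integrable ?N (%x. W x * \<bar>f j x - \<phi> x\<bar> powr p)" for j
   by (rule Bochner_Integration.integrable_bound[OF ifd[of j]])
     (use le[of "%x. \<phi> x - f j x"] in \<open>simp_all add: abs_minus_commute\<close>)
  have "(%j. LINT x|?N. W x * \<bar>f j x - \<phi> x\<bar> powr p) ~~> 0"
  proof (rule Lim_null_comparison[OF always_eventually elim], rule allI)
   fix j
   have "(LINT x|?N. W x * \<bar>f j x - \<phi> x\<bar> powr p) <= I2 j"
    unfolding I2_def
   proof (rule integral_mono_AE[OF i2 ifd])
    show "AE x in ?N. W x * \<bar>f j x - \<phi> x\<bar> powr p <= (\<bar>V x\<bar> + v x) * \<bar>\<phi> x - f j x\<bar> powr p"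
     using vpos
    proof eventually_elim
     case (elim x)
     then show ?case
      using W(3)[of x] unfolding abs_minus_commute[of "f j x"] by (intro mult_right_mono) auto
    qed
   qed
   moreover have "0 <= (LINT x|?N. W x * \<bar>f j x - \<phi> x\<bar> powr p)"
    using W(2) by (intro Bochner_Integration.integral_nonneg) simp
   ultimately show "norm (LINT x|?N. W x * \<bar>f j x - \<phi> x\<bar> powr p) <= e j" using I2le[of j] by simp
  qed
  note w = weighted_powr_tendsto[OF p1 W(1) m\<phi> mf AE_I2[OF W(2)] i1 i2 this]
  show "(%j. LINT x|?N. W x * \<bar>f j x\<bar> powr p) ~~> (LINT x|?N. W x * \<bar>\<phi> x\<bar> powr p)" by (rule w(2))
  show "!!j. integrable ?N (%x. W x * \<bar>f j x\<bar> powr p)" by (rule w(1))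
 qed
 have mpm: "(%x. max (V x) 0) \<in> borel_measurable ?N" "(%x. max (- V x) 0) \<in> borel_measurable ?N" by measurable
 note PWp = PW[OF mpm(1)] and PWm = PW[OF mpm(2)]
 \<comment> \<open>Convergence in weighted norms is available for nonnegative weights, so
   \<open>V\<close> enters through its positive and negative parts.\<close>
 have Vsplit: "V x * t = max (V x) 0 * t - max (- V x) 0 * t" for x t by (auto simp: max_def)
 have enj: "energy p H V U (f j) = (LINT x|?N. H x (G j x) powr p) + ((LINT x|?N. max (V x) 0 * \<bar>f j x\<bar> powr p) - (LINT x|?N. max (- V x) 0 * \<bar>f j x\<bar> powr p))" for j
 proof -
  have "(LINT x|?N. H x (G j x) powr p) = E (G j)"
  proof -
   obtain K where K: "K \<subseteq> U" "!!x. x \<notin> K ==> G j x = 0" using sobD(5)[OF G] by blast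
   have z: "G j x = 0" if "x \<notin> U" for x using K that by blast
   show ?thesis unfolding E_def
   proof (rule integral_extend_by_zero[OF UM setsOm U(2)])
    show "AE x in M. x \<notin> U --> H x (G j x) powr p = 0"
     using AE_norm by eventually_elim (simp add: z is_normD(7))
   qed (use sob_integrable_H[OF G'] in auto)
  qed
  moreover have "P V (f j) = (LINT x|?N. max (V x) 0 * \<bar>f j x\<bar> powr p) - (LINT x|?N. max (- V x) 0 * \<bar>f j x\<bar> powr p)"
   unfolding P_restrict[OF U G V, symmetric] Vsplit using PWp(3) PWm(3)
   by (subst Bochner_Integration.integral_diff) auto
  ultimately show ?thesis using energy_sob[OF U G V] by simp
 qed
 have en0: "energy p H V U \<phi> = (LINT x|?N. H x (G0 x) powr p) + ((LINT x|?N. max (V x) 0 * \<bar>\<phi> x\<bar> powr p) - (LINT x|?N. max (- V x) 0 * \<bar>\<phi> x\<bar> powr p))"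
 proof -
  have "AE x in ?N. weak_gradient U \<phi> x = G0 x" by (rule weak_gradient_AE[OF U(1) G0(1)])
  then have AEw: "AE x in ?N. H x (G0 x) powr p + V x * \<bar>\<phi> x\<bar> powr p = H x (weak_gradient U \<phi> x) powr p + V x * \<bar>\<phi> x\<bar> powr p"
   by eventually_elim simp
  have [measurable]: "(%x. H x (G0 x)) \<in> borel_measurable ?N" by (rule mHN[OF mG0])
  have m1: "(%x. H x (G0 x) powr p + V x * \<bar>\<phi> x\<bar> powr p) \<in> borel_measurable ?N" by measurable
  have "energy p H V U \<phi> = (LINT x|?N. H x (G0 x) powr p + V x * \<bar>\<phi> x\<bar> powr p)"
   unfolding energy_def by (rule integral_cong_AE[OF m1 borel_measurable_lebesgue_on_AE[OF UM m1 AEw] AEw, symmetric])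
  also have "... = (LINT x|?N. H x (G0 x) powr p + (max (V x) 0 * \<bar>\<phi> x\<bar> powr p - max (- V x) 0 * \<bar>\<phi> x\<bar> powr p))"
   by (simp only: Vsplit)
  also have "... = (LINT x|?N. H x (G0 x) powr p) + ((LINT x|?N. max (V x) 0 * \<bar>\<phi> x\<bar> powr p) - (LINT x|?N. max (- V x) 0 * \<bar>\<phi> x\<bar> powr p))"
   using G0(2) PWp(1) PWm(1) by simp
  finally show ?thesis .
 qed
 have enlim: "(%j. energy p H V U (f j)) ~~> energy p H V U \<phi>"
  unfolding enj en0 by (intro tendsto_add tendsto_diff HG0 PWp(2) PWm(2)) auto
 have iPg: "integrable ?N (%x. \<bar>g x\<bar> * \<bar>f j x\<bar> powr p)" for j
  by (rule integrable_restrict_subset[OF UM setsOm U(2) sob_integrable_P[OF G' ag]])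
 define T where "T j = (LINT x|?N. \<bar>g x\<bar> * \<bar>f j x\<bar> powr p)" for j
 have T: "S * T j <= energy p H V U (f j)" for j
  using S(2)[OF G'[of j]] energy_sob[OF U G V] P_restrict[OF U G ag] by (simp add: T_def)
 have "AE x in ?N. (%j. (\<bar>V x\<bar> + \<bar>v x\<bar>) * \<bar>\<phi> x - f j x\<bar> powr p) ~~> 0"
 proof (rule AE_tendsto_zero_of_geometric)
  fix j
  have "(\<integral>\<^sup>+x. ennreal ((\<bar>V x\<bar> + \<bar>v x\<bar>) * \<bar>\<phi> x - f j x\<bar> powr p) \<partial>?N) = (\<integral>\<^sup>+x. ennreal ((\<bar>V x\<bar> + v x) * \<bar>\<phi> x - f j x\<bar> powr p) \<partial>?N)"
   by (rule nn_integral_cong_AE) (use vpos in \<open>eventually_elim, simp\<close>)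
  also have "... = ennreal (I2 j)"
   unfolding I2_def by (rule nn_integral_eq_integral[OF ifd]) (use vpos in \<open>eventually_elim, simp\<close>)
  also have "... <= ennreal ((1/2) ^ j)" using I2le[of j] unfolding e_def by (rule ennreal_leI)
  finally show "(\<integral>\<^sup>+x. ennreal ((\<bar>V x\<bar> + \<bar>v x\<bar>) * \<bar>\<phi> x - f j x\<bar> powr p) \<partial>?N) <= ennreal ((1/2) ^ j)" .
 qed (auto intro!: mult_nonneg_nonneg)
 then have AEf: "AE x in ?N. (%j. f j x) ~~> \<phi> x"
  using vpos
 proof eventually_elim
  case (elim x)
  note l = elim(1) and vx = elim(2)
  from tendsto_mult_left[OF l, of "inverse (\<bar>V x\<bar> + \<bar>v x\<bar>)"] have "(%j. \<bar>\<phi> x - f j x\<bar> powr p) ~~> 0"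
   using vx by (simp add: mult.assoc[symmetric] add_nonneg_eq_0_iff)
  then have "(%j. (\<bar>\<phi> x - f j x\<bar> powr p) powr (1 / p)) ~~> 0 powr (1 / p)"
   using p1 by (intro tendsto_powr2) auto
  then have "(%j. \<bar>\<phi> x - f j x\<bar>) ~~> 0" using p1 by (simp add: powr_powr)
  then have "(%j. \<phi> x - f j x) ~~> 0" by (rule tendsto_rabs_zero_cancel)
  from tendsto_diff[OF tendsto_const[of "\<phi> x"] this] show ?case by simp
 qed
 have AEg: "AE x in ?N. (%j. \<bar>g x\<bar> * \<bar>f j x\<bar> powr p) ~~> \<bar>g x\<bar> * \<bar>\<phi> x\<bar> powr p"
  using AEf by eventually_elim (use p1 in \<open>intro tendsto_mult tendsto_const tendsto_powr2 tendsto_rabs, auto\<close>)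
 \<comment> \<open>The integral is 1, and a function that is not integrable would have integral
   0.\<close>
 have ig: "integrable ?N (%x. \<bar>g x\<bar> * \<bar>\<phi> x\<bar> powr p)"
  using \<phi>(2) not_integrable_integral_eq by fastforce
 show "ereal S <= ereal (energy p H V U \<phi>)"
 proof (rule ccontr)
  assume "\<not> ?thesis"
  then have lt: "energy p H V U \<phi> < S" by simp
  have T0: "0 <= T j" for j unfolding T_def by (intro Bochner_Integration.integral_nonneg) simp
  have e0: "0 <= energy p H V U \<phi>"
   by (rule LIMSEQ_le_const[OF enlim]) (use order_trans[OF mult_nonneg_nonneg[OF S(1) T0] T] in blast)
  \<comment> \<open>Were the energy below \<open>S\<close>, the integrals against |g| of the
    approximants would eventually be at most s/S < 1, and by Fatou's lemma so would the integral for
    \<phi>, which is 1.\<close>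
  obtain s where s: "energy p H V U \<phi> < s" "s < S" using lt dense by blast
  have "\<forall>\<^sub>F j in sequentially. energy p H V U (f j) < s" by (rule order_tendstoD(2)[OF enlim s(1)])
  then have ev: "\<forall>\<^sub>F j in sequentially. (\<integral>\<^sup>+x. ennreal (\<bar>g x\<bar> * \<bar>f j x\<bar> powr p) \<partial>?N) <= ennreal (s / S)"
  proof eventually_elim
   case (elim j)
   then have "T j * S <= s" using T[of j] by (simp add: mult.commute)
   then have "T j <= s / S" using lt e0 by (simp add: le_divide_eq)
   then show ?case unfolding T_def using nn_integral_eq_integral[OF iPg[of j]] by (simp add: ennreal_leI)
  qed
  have "ennreal 1 = (\<integral>\<^sup>+x. ennreal (\<bar>g x\<bar> * \<bar>\<phi> x\<bar> powr p) \<partial>?N)"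
   using nn_integral_eq_integral[OF ig] \<phi>(2) by simp
  also have "... <= ennreal (s / S)" by (rule nn_integral_Fatou_le[OF _ AEg ev]) measurable
  also have "... < 1" using s lt e0 by (simp add: ennreal_less_one_iff divide_less_eq)
  finally show False by simp
 qed
qed

end

section \<open>Concentration at infinity\<close>

lemma integral_norm_tendsto_zero_of_powr:
 fixes f :: "nat => 'a => 'b::{banach, second_countable_topology}"
 assumes p: "1 < p" and fin: "finite_measure N"
  and [measurable]: "!!j. f j \<in> borel_measurable N"
  and i: "!!j. integrable N (%x. norm (f j x) powr p)"
  and lim: "(%j. LINT x|N. norm (f j x) powr p) ~~> 0"
 shows "integrable N (f j)" "(%j. LINT x|N. norm (f j x)) ~~> 0"
proof -
 interpret finite_measure N by (rule fin)
 \<comment> \<open>This splitting, with the constant integrated over a finite measure space, stands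
   in for Hoelder's inequality.\<close>
 have le: "t <= e + e powr (1 - p) * t powr p" if e: "0 < e" "0 <= t" for e t
 proof (cases "t <= e")
  case True
  have "0 <= e powr (1 - p) * t powr p" by simp
  then show ?thesis using True by linarith
 next
  case False
  then have t: "0 < t" "e <= t" using e by auto
  have "t powr (1 - p) * t powr p <= e powr (1 - p) * t powr p"
   using p e t by (intro mult_right_mono powr_mono2') auto
  moreover have "t powr (1 - p) * t powr p = t" using t by (simp add: powr_add[symmetric])
  ultimately show ?thesis using e by linarith
 qed
 show int: "integrable N (f j)" for j
 proof (rule Bochner_Integration.integrable_bound)
  show "integrable N (%x. 1 + 1 powr (1 - p) * norm (f j x) powr p)"
   by (intro Bochner_Integration.integrable_add integrable_mult_right impI i) simp
  show "AE x in N. norm (f j x) <= norm (1 + 1 powr (1 - p) * norm (f j x) powr p)"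
  proof (rule AE_I2)
   fix x show "norm (f j x) <= norm (1 + 1 powr (1 - p) * norm (f j x) powr p)"
    using le[of 1 "norm (f j x)"] unfolding real_norm_def by linarith
  qed
 qed simp
 show "(%j. LINT x|N. norm (f j x)) ~~> 0"
 proof (rule LIMSEQ_I)
  fix d :: real assume d: "0 < d"
  \<comment> \<open>The constant term then contributes at most \<open>d / 2\<close>, whatever the
    total measure.\<close>
  define e where "e = d / (2 * (measure N (space N) + 1))"
  have m0: "0 <= measure N (space N)" by simp
  have e: "0 < e" unfolding e_def using d m0 by (intro divide_pos_pos mult_pos_pos) linarith+
  have em: "e * measure N (space N) <= d / 2"
  proof -
   have "e * measure N (space N) <= e * (measure N (space N) + 1)" using e by (intro mult_left_mono) auto
   also have "... = d / 2"
   proof -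
    have "d / (2 * c) * c = d / 2" if "c \<noteq> 0" for c :: real using that by (simp add: field_simps)
    moreover have "measure N (space N) + 1 \<noteq> 0" using m0 by linarith
    ultimately show ?thesis unfolding e_def by blast
   qed
   finally show ?thesis .
  qed
  have bd: "(LINT x|N. norm (f j x)) <= d / 2 + e powr (1 - p) * (LINT x|N. norm (f j x) powr p)" for j
  proof -
   have "(LINT x|N. norm (f j x)) <= (LINT x|N. e + e powr (1 - p) * norm (f j x) powr p)"
    by (rule integral_mono) (use int i le[OF e] in \<open>auto intro!: Bochner_Integration.integrable_add integrable_mult_right\<close>)
   also have "... = e * measure N (space N) + e powr (1 - p) * (LINT x|N. norm (f j x) powr p)"
    using i by (subst Bochner_Integration.integral_add) auto
   finally show ?thesis using em by linarith
  qed
  have "(%j. d / 2 + e powr (1 - p) * (LINT x|N. norm (f j x) powr p)) ~~> d / 2 + e powr (1 - p) * 0"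
   by (intro tendsto_intros lim)
  then have "\<forall>\<^sub>F j in sequentially. d / 2 + e powr (1 - p) * (LINT x|N. norm (f j x) powr p) < d"
   by (rule order_tendstoD(2)) (use d in simp)
  then obtain n where n: "!!j. n <= j ==> d / 2 + e powr (1 - p) * (LINT x|N. norm (f j x) powr p) < d"
   by (auto simp: eventually_sequentially)
  have "norm ((LINT x|N. norm (f j x)) - 0) < d" if "n <= j" for j
  proof -
   have "0 <= (LINT x|N. norm (f j x))" by (intro Bochner_Integration.integral_nonneg) simp
   then show ?thesis using bd[of j] n[OF that] by simp
  qed
  then show "\<exists>n. \<forall>j\<ge>n. norm ((LINT x|N. norm (f j x)) - 0) < d" by blast
 qed
qed

context norm_family_domain
begin

text \<open>The cut-off costs only a multiple of \<open>\<integral> w\<^sup>p\<close> over a fixed compact set, because \<open>(a + d)\<^sup>p\<close> is at most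
 \<open>(1 - t) powr (1 - p) * a\<^sup>p + t powr (1 - p) * d\<^sup>p\<close>; then \<open>t \<rightarrow> 0\<close>.\<close>
lemma hardy_infimum_concentration:
 assumes n: "2 <= CARD('n)" and V: "V \<in> Lp_loc 1 Om" and g: "g \<in> morrey_tilde_loc p q Om" and gL: "g \<in> Lp_loc 1 Om"
  and s: "!!k. sob p Om (w k) (G k)" and one: "!!k. P (%x. \<bar>g x\<bar>) (w k) = 1"
  and lim: "(%k. E (G k) + P V (w k)) ~~> S" "(%k. P (%x. max (- V x) 0) (w k)) ~~> 0"
  and van: "!!K. compact K ==> K \<subseteq> Om ==> (%k. P (indicator K) (w k)) ~~> 0"
  and v: "continuous_on (Om - closure (om i)) v"
 shows "(INF \<phi> \<in> {\<phi> \<in> W_tilde0 p H V v (Om - closure (om i)). (LINT x|lebesgue_on (Om - closure (om i)). \<bar>g x\<bar> * \<bar>\<phi> x\<bar> powr p) = 1}.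
   ereal (energy p H V (Om - closure (om i)) \<phi>)) <= ereal S" (is "?I <= _")
proof -
 let ?U = "Om - closure (om i)"
 have p: "1 <= p" "0 <= p" using p1 by auto
 have U: "open ?U" "?U \<subseteq> Om" using openOm by auto
 have ag: "(%x. \<bar>g x\<bar>) \<in> Lp_loc 1 Om" by (rule Lp_loc_linear(1)[OF gL gL])
 have Vp: "(%x. max (V x) 0) \<in> Lp_loc 1 Om" "(%x. max (- V x) 0) \<in> Lp_loc 1 Om"
  using Lp_loc_linear(5,6)[OF V V] by auto
 obtain \<zeta> where \<zeta>: "\<zeta> \<in> Cc_infty Om" "!!x. 0 <= \<zeta> x" "!!x. \<zeta> x <= 1" "!!x. x \<in> closure (om (Suc i)) ==> \<zeta> x = 1"
  by (rule cutoff_exists[OF om(4)[of "Suc i"] openOm om(7)[of "Suc i"]]) (rule that; assumption)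
 obtain T where T: "compact T" "T \<subseteq> Om" "!!x. x \<notin> T ==> \<zeta> x = 0 \<and> gradient \<zeta> x = 0"
  using Cc_inftyD(5)[OF \<zeta>(1)] by blast
 obtain b where b: "0 < b" "!!x. norm (gradient \<zeta> x) <= b"
  by (rule Cc_infty_bounded[OF \<zeta>(1)]) (rule that; assumption)
 obtain \<kappa> \<nu> where \<nu>: "0 < \<kappa>" "0 < \<nu>" "AE x in M. x \<in> T --> (\<forall>\<xi>. \<kappa> * norm \<xi> <= H x \<xi> \<and> H x \<xi> <= \<nu> * norm \<xi>)"
  by (rule local_bounds[OF T(1,2)]) (rule that; assumption)
 \<comment> \<open>This is (1 - \<zeta>) w, written as a sum to fit \<open>sob_add\<close>. Since
   \<zeta> is 1 on the next set of the exhaustion, it vanishes on a neighbourhood of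
   \<open>closure (om i)\<close> and so has compact support in the complement.\<close>
 define u where "u k x = w k x + (-1) * (\<zeta> x * w k x)" for k x
 define Gu where "Gu k x = G k x + (-1) *r (\<zeta> x *r G k x + w k x *r gradient \<zeta> x)" for k x
 have su: "sob p Om (u k) (Gu k)" for k
  unfolding u_def[abs_def] Gu_def[abs_def]
  by (rule sob_add[OF s sob_cmult[OF sob_smooth_mult[OF s p(1) Cc_inftyD(4)[OF \<zeta>(1)]] p(1)] p(1)])
 have grad0: "gradient \<zeta> x = 0" if x: "x \<in> om (Suc i)" for x
 proof (rule GDERIV_unique[OF Cc_inftyD(1)[OF \<zeta>(1)]])
  have "((%y. 1 :: real) has_derivative (%h. inner h 0)) (at x)" by simp
  then show "GDERIV \<zeta> x :> 0" unfolding gderiv_def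
   by (rule has_derivative_transform_within_open[OF _ om(5) x]) (use \<zeta>(4) closure_subset in fastforce)
 qed
 have sU: "sob p ?U (u k) (Gu k)" for k
 proof (rule sob_mono[OF sob_shrink[OF su om(5)[of "Suc i"]]])
  fix x assume x: "x \<in> om (Suc i)"
  then have "\<zeta> x = 1" using \<zeta>(4) closure_subset by blast
  then show "u k x = 0" "Gu k x = 0" using grad0[OF x] by (auto simp: u_def Gu_def)
 qed (use om(3) in blast)
 define c where "c = (\<nu> * b) powr p"
 have Eb: "E (Gu k) <= (1 - t) powr (1 - p) * E (G k) + t powr (1 - p) * (c * P (indicator T) (w k))"
  if t: "0 < t" "t < 1" for t k
 proof -
  note iT = sob_integrable_P[OF s[of k] indicator_Lp_loc[OF T(1)]]
  have "E (Gu k) <= (LINT x|M. (1 - t) powr (1 - p) * H x (G k x) powr p + t powr (1 - p) * (c * (indicator T x * \<bar>w k x\<bar> powr p)))"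
   unfolding E_def
  proof (rule integral_mono_AE[OF sob_integrable_H[OF su]])
   show "integrable M (%x. (1 - t) powr (1 - p) * H x (G k x) powr p + t powr (1 - p) * (c * (indicator T x * \<bar>w k x\<bar> powr p)))"
    by (intro Bochner_Integration.integrable_add integrable_mult_right impI sob_integrable_H[OF s] iT)
   show "AE x in M. H x (Gu k x) powr p <= (1 - t) powr (1 - p) * H x (G k x) powr p + t powr (1 - p) * (c * (indicator T x * \<bar>w k x\<bar> powr p))"
    using AE_norm \<nu>(3)
   proof eventually_elim
    case (elim x)
    note N = elim(1) and B = elim(2)
    have Gx: "Gu k x = (1 - \<zeta> x) *r G k x + (- w k x) *r gradient \<zeta> x" by (simp add: Gu_def algebra_simps)
    have "H x (Gu k x) <= H x ((1 - \<zeta> x) *r G k x) + H x ((- w k x) *r gradient \<zeta> x)"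
     unfolding Gx by (rule is_normD(4)[OF N])
    also have "H x ((1 - \<zeta> x) *r G k x) <= H x (G k x)"
     using \<zeta>(2,3)[of x] is_normD(1)[OF N, of "G k x"] by (simp add: is_normD(3)[OF N] mult_left_le_one_le)
    also have "H x ((- w k x) *r gradient \<zeta> x) <= indicator T x * (\<nu> * b * \<bar>w k x\<bar>)"
    proof (cases "x \<in> T")
     case True
     have "H x (gradient \<zeta> x) <= \<nu> * norm (gradient \<zeta> x)" using B True by blast
     also have "... <= \<nu> * b" using b(2) \<nu>(2) by (intro mult_left_mono) auto
     finally have "\<bar>w k x\<bar> * H x (gradient \<zeta> x) <= \<bar>w k x\<bar> * (\<nu> * b)" by (intro mult_left_mono) auto
     then show ?thesis using True unfolding is_normD(3)[OF N] by (simp add: mult.commute)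
    next
     case False
     then show ?thesis using T(3) by (simp add: is_normD(7)[OF N])
    qed
    finally have "H x (Gu k x) <= H x (G k x) + indicator T x * (\<nu> * b * \<bar>w k x\<bar>)" by simp
    then have "H x (Gu k x) powr p <= (H x (G k x) + indicator T x * (\<nu> * b * \<bar>w k x\<bar>)) powr p"
     using p is_normD(1)[OF N] by (intro powr_mono2) auto
    also have "... <= (1 - t) powr (1 - p) * H x (G k x) powr p + t powr (1 - p) * (indicator T x * (\<nu> * b * \<bar>w k x\<bar>)) powr p"
     using p t is_normD(1)[OF N] \<nu>(2) b(1) by (intro powr_add_le_split) auto
    also have "(indicator T x * (\<nu> * b * \<bar>w k x\<bar>)) powr p = c * (indicator T x * \<bar>w k x\<bar> powr p)"
     using \<nu>(2) b(1) p1 by (simp add: c_def indicator_def powr_mult)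
    finally show ?case .
   qed
  qed
  also have "... = (1 - t) powr (1 - p) * E (G k) + t powr (1 - p) * (c * P (indicator T) (w k))"
   unfolding E_def P_def by (subst Bochner_Integration.integral_add) (use sob_integrable_H[OF s] iT in auto)
  finally show ?thesis .
 qed
 have ule: "\<bar>u k x\<bar> powr p <= \<bar>w k x\<bar> powr p" for k x
 proof -
  have "u k x = (1 - \<zeta> x) * w k x" by (simp add: u_def algebra_simps)
  then have "\<bar>u k x\<bar> = (1 - \<zeta> x) * \<bar>w k x\<bar>" using \<zeta>(3)[of x] by (simp add: abs_mult)
  also have "... <= \<bar>w k x\<bar>" using \<zeta>(2,3)[of x] by (intro mult_left_le_one_le) auto
  finally show ?thesis using p by (intro powr_mono2) auto
 qed
 \<comment> \<open>Cutting off may remove negative contributions of the potential, so the comparison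
   is with the positive part; it exceeds the potential term of \<open>w k\<close> by the integral
   against V^-, which tends to 0.\<close>
 have PV: "P V (u k) <= P (%x. max (V x) 0) (w k)" for k
  unfolding P_def
 proof (rule integral_mono[OF sob_integrable_P[OF su V] sob_integrable_P[OF s Vp(1)]])
  fix x
  have "V x * \<bar>u k x\<bar> powr p <= max (V x) 0 * \<bar>u k x\<bar> powr p" by (intro mult_right_mono) auto
  also have "... <= max (V x) 0 * \<bar>w k x\<bar> powr p" by (intro mult_left_mono ule) auto
  finally show "V x * \<bar>u k x\<bar> powr p <= max (V x) 0 * \<bar>w k x\<bar> powr p" .
 qed
 have PVp: "P (%x. max (V x) 0) (w k) = P V (w k) + P (%x. max (- V x) 0) (w k)" for k
 proof -
  have "P V (w k) + P (%x. max (- V x) 0) (w k) = (LINT x|M. V x * \<bar>w k x\<bar> powr p + max (- V x) 0 * \<bar>w k x\<bar> powr p)"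
   unfolding P_def by (rule Bochner_Integration.integral_add[OF sob_integrable_P[OF s V] sob_integrable_P[OF s Vp(2)], symmetric])
  also have "... = P (%x. max (V x) 0) (w k)"
   unfolding P_def by (rule Bochner_Integration.integral_cong) (auto simp: max_def)
  finally show ?thesis by simp
 qed
 have PVp0: "0 <= P (%x. max (V x) 0) (w k)" for k
  unfolding P_def by (intro Bochner_Integration.integral_nonneg) simp
 have E1: "\<exists>C. \<forall>k. E (G k) <= C"
 proof -
  have "(%k. E (G k) + P V (w k) + P (%x. max (- V x) 0) (w k)) ~~> S + 0" by (intro tendsto_add lim)
  then have "Bseq (%k. E (G k) + P V (w k) + P (%x. max (- V x) 0) (w k))" by (rule convergent_imp_Bseq[OF convergentI])
  then obtain C where C: "!!k. norm (E (G k) + P V (w k) + P (%x. max (- V x) 0) (w k)) <= C" by (auto simp: Bseq_def)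
  have "E (G k) <= C" for k using C[of k] PVp[of k] PVp0[of k] unfolding real_norm_def by linarith
  then show ?thesis by blast
 qed
 then obtain C where C: "!!k. E (G k) <= C" by blast
 define e where "e k = P (%x. indicator T x * \<bar>g x\<bar>) (w k)" for k
 have elim: "e ~~> 0" unfolding e_def[abs_def] by (rule morrey_local_vanish[OF n g gL s C van T(1,2)])
 \<comment> \<open>The cut-off changes \<open>w k\<close> only on \<open>T\<close>, and there the
   mass against |g| tends to 0 by \<open>morrey_local_vanish\<close>.\<close>
 have De: "1 - e k <= P (%x. \<bar>g x\<bar>) (u k)" for k
 proof -
  have ig: "integrable M (%x. indicator T x * \<bar>g x\<bar> * \<bar>w k x\<bar> powr p)"
  proof -
   have "T \<in> sets M" using T compact_imp_sets_lebesgue[OF T(1)] by (auto simp: sets_restrict_space)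
   from integrable_mult_indicator[OF this sob_integrable_P[OF s[of k] ag]] show ?thesis by (simp add: mult.assoc)
  qed
  have "1 - e k = (LINT x|M. \<bar>g x\<bar> * \<bar>w k x\<bar> powr p - indicator T x * \<bar>g x\<bar> * \<bar>w k x\<bar> powr p)"
   unfolding one[of k, symmetric] e_def P_def
   by (rule Bochner_Integration.integral_diff[OF sob_integrable_P[OF s ag] ig, symmetric])
  also have "... <= P (%x. \<bar>g x\<bar>) (u k)"
   unfolding P_def
  proof (rule integral_mono[OF Bochner_Integration.integrable_diff[OF sob_integrable_P[OF s ag] ig] sob_integrable_P[OF su ag]])
   fix x show "\<bar>g x\<bar> * \<bar>w k x\<bar> powr p - indicator T x * \<bar>g x\<bar> * \<bar>w k x\<bar> powr p <= \<bar>g x\<bar> * \<bar>u k x\<bar> powr p"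
    using T(3)[of x] by (cases "x \<in> T") (auto simp: u_def)
  qed
  finally show ?thesis .
 qed
 have main: "?I <= ereal ((1 - t) powr (1 - p) * S)" if t: "0 < t" "t < 1" for t
 proof -
  define B where "B k = (1 - t) powr (1 - p) * (E (G k) + P V (w k) + P (%x. max (- V x) 0) (w k))
   + t powr (1 - p) * (c * P (indicator T) (w k))" for k
  have "B ~~> (1 - t) powr (1 - p) * (S + 0) + t powr (1 - p) * (c * 0)"
   unfolding B_def[abs_def] by (intro tendsto_add tendsto_mult tendsto_const lim van[OF T(1,2)])
  then have "(%k. B k / (1 - e k)) ~~> ((1 - t) powr (1 - p) * (S + 0) + t powr (1 - p) * (c * 0)) / (1 - 0)"
   by (intro tendsto_divide tendsto_diff tendsto_const elim) auto
  then have L: "(%k. ereal (B k / (1 - e k))) ~~> ereal ((1 - t) powr (1 - p) * S)" by simp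
  have "\<forall>\<^sub>F k in sequentially. e k < 1" using elim by (rule order_tendstoD) simp
  then have "\<forall>\<^sub>F k in sequentially. ?I <= ereal (B k / (1 - e k))"
  proof eventually_elim
   case (elim k)
   note ek = elim
   have D: "0 < P (%x. \<bar>g x\<bar>) (u k)" using De[of k] ek by simp
   have PT: "0 <= P (indicator T) (w k)" unfolding P_def by (intro Bochner_Integration.integral_nonneg) simp
   \<comment> \<open>The potential term may thus be enlarged by the same factor as the gradient
     term, so that the two recombine to the functional.\<close>
   have "1 <= (1 - t) powr (1 - p)"
    using powr_mono2'[of "1 - p" "1 - t" 1] p t by simp
   then have X: "1 * P (%x. max (V x) 0) (w k) <= (1 - t) powr (1 - p) * P (%x. max (V x) 0) (w k)"
    by (intro mult_right_mono PVp0)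
   have B: "B k = (1 - t) powr (1 - p) * E (G k) + (1 - t) powr (1 - p) * P (%x. max (V x) 0) (w k) + t powr (1 - p) * (c * P (indicator T) (w k))"
    by (simp add: B_def PVp algebra_simps)
   have QB: "E (Gu k) + P V (u k) <= B k" unfolding B using Eb[OF t, of k] PV[of k] X by linarith
   have B0: "0 <= B k" unfolding B using E_nonneg PVp0 PT by (intro add_nonneg_nonneg mult_nonneg_nonneg) (auto simp: c_def)
   have "?I <= ereal ((E (Gu k) + P V (u k)) / P (%x. \<bar>g x\<bar>) (u k))"
    by (rule hardy_infimum_le[OF V gL U v sU D])
   also have "(E (Gu k) + P V (u k)) / P (%x. \<bar>g x\<bar>) (u k) <= B k / P (%x. \<bar>g x\<bar>) (u k)"
    using QB D by (intro divide_right_mono) auto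
   also have "... <= B k / (1 - e k)" using De[of k] ek B0 D by (intro divide_left_mono mult_pos_pos) auto
   finally show ?case by simp
  qed
  then show ?thesis by (intro tendsto_lowerbound[OF L]) auto
 qed
 have "((%t. ereal ((1 - t) powr (1 - p) * S)) \<longlongrightarrow> ereal (1 * S)) (at_right 0)"
  by (intro tendsto_ereal tendsto_mult tendsto_const powr_split_factor_tendsto)
 moreover have "\<forall>\<^sub>F t in at_right (0::real). ?I <= ereal ((1 - t) powr (1 - p) * S)"
  by (rule eventually_mono[OF eventually_at_right_real[of 0 1]]) (auto intro: main)
 ultimately show ?thesis by (auto intro: tendsto_lowerbound)
qed

text \<open>At each step the nonnegative value of the functional at the maximum is dropped, so the
  bounds of the members add up to a geometric sum.\<close>

lemma sob_Min:
 assumes W: "W \<in> Lp_loc 1 Om" and nn: "!!\<phi> G. sob p Om \<phi> G ==> 0 <= E G + P W \<phi>"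
  and s: "!!k. sob p Om (\<phi> k) (G k)" and e: "!!k. E (G k) + P W (\<phi> k) <= (1/2) ^ k"
 shows "\<exists>G'. sob p Om (%x. Min ((%j. \<phi> (k + j) x) ` {..l})) G' \<and>
  E G' + P W (%x. Min ((%j. \<phi> (k + j) x) ` {..l})) <= (\<Sum>j\<le>l. (1/2) ^ (k + j))"
proof (induction l)
 case 0
 show ?case using s[of k] e[of k] by (auto intro!: exI[of _ "G k"])
next
 case (Suc l)
 define m where "m x = Min ((%j. \<phi> (k + j) x) ` {..l})" for x
 from Suc obtain G' where G': "sob p Om m G'" "E G' + P W m <= (\<Sum>j\<le>l. (1/2) ^ (k + j))"
  unfolding m_def by blast
 obtain Gm GM where mm: "sob p Om (%x. min (\<phi> (k + Suc l) x) (m x)) Gm" "sob p Om (%x. max (\<phi> (k + Suc l) x) (m x)) GM"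
  "E Gm + E GM <= E (G (k + Suc l)) + E G'"
  by (rule sob_min_max[OF s[of "k + Suc l"] G'(1)]) (rule that; assumption)
 have "(%x. Min ((%j. \<phi> (k + j) x) ` {..Suc l})) = (%x. min (\<phi> (k + Suc l) x) (m x))"
  by (auto simp: fun_eq_iff m_def atMost_Suc)
 moreover have "E Gm + P W (%x. min (\<phi> (k + Suc l) x) (m x)) <= (\<Sum>j\<le>Suc l. (1/2) ^ (k + j))"
  using mm(3) P_min_max[OF s[of "k + Suc l"] G'(1) W mm(1,2)] nn[OF mm(2)] G'(2) e[of "k + Suc l"]
  by simp
 ultimately show ?case using mm(1) by auto
qed

section \<open>Minima of null sequences\<close>

text \<open>The infimum \<open>mk k\<close> over the tail from \<open>k\<close> on lies below \<Phi>
  and tends to \<Phi>, because the members do so pointwise. Finite minima decrease to it and are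
  dominated by the first member, whose p-th power is integrable against \<open>Y\<close>; so some
  finite length \<open>L k\<close> leaves an excess \<open>r k\<close> below the prescribed bound.
  The geometric bound and Y >= 1 make \<open>r k\<close> tend to 0 almost everywhere.\<close>

lemma minimizing_minima:
 fixes \<phi> :: "nat => real ^ 'n => real"
 assumes W: "W \<in> Lp_loc 1 Om" and nn: "!!\<phi> G. sob p Om \<phi> G ==> 0 <= E G + P W \<phi>"
  and s: "!!k. sob p Om (\<phi> k) (G k)" and e: "!!k. E (G k) + P W (\<phi> k) <= (1/2) ^ k"
  and pos: "!!k x. 0 <= \<phi> k x" and lim: "AE x in M. (%k. \<phi> k x) ~~> \<Phi> x"
  and Y: "Y \<in> Lp_loc 1 Om" "!!x. x \<in> Om ==> 1 <= Y x"
 obtains v Gv r where "!!k::nat. sob p Om (v k) (Gv k)" "!!k x. 0 <= v k x" "!!k. E (Gv k) + P W (v k) <= 2 * (1/2) ^ k"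
  "!!k. r k \<in> borel_measurable M" "!!k x. 0 <= r k x"
  "!!k. (\<integral>\<^sup>+x. ennreal (Y x * r k x powr p) \<partial>M) <= ennreal ((1/2) ^ k)"
  "AE x in M. (%k. v k x) ~~> \<Phi> x" "AE x in M. \<forall>k. v k x <= \<Phi> x + r k x"
proof -
 have p: "1 <= p" "0 < p" using p1 by auto
 define m where "m k l x = Min ((%j. \<phi> (k + j) x) ` {..l})" for k l x
 have "\<forall>k l. \<exists>G'. sob p Om (m k l) G' \<and> E G' + P W (m k l) <= (\<Sum>j\<le>l. (1/2) ^ (k + j))"
  using sob_Min[OF W nn s e] unfolding m_def[abs_def] by blast
 then obtain Gm where Gm: "!!k l. sob p Om (m k l) (Gm k l)" "!!k l. E (Gm k l) + P W (m k l) <= (\<Sum>j\<le>l. (1/2) ^ (k + j))"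
  by metis
 have sum2: "(\<Sum>j\<le>l. (1/2) ^ (k + j)) <= 2 * (1/2 :: real) ^ k" for k l
 proof -
  have "(\<Sum>j\<le>l. (1/2) ^ (k + j)) = (1/2 :: real) ^ k * (\<Sum>j\<le>l. (1/2) ^ j)" by (simp add: power_add sum_distrib_left)
  also have "(\<Sum>j\<le>l. (1/2 :: real) ^ j) <= 2" by (simp add: sum_gp0)
  finally show ?thesis by (simp add: mult.commute)
 qed
 have m0: "0 <= m k l x" for k l x unfolding m_def using pos by (subst Min_ge_iff) auto
 have mle: "m k l x <= \<phi> (k + j) x" if "j <= l" for k l j x unfolding m_def using that by (intro Min_le) auto
 have mdec: "decseq (%l. m k l x)" for k x
  unfolding decseq_def m_def by (intro allI impI Min_antimono image_mono) auto
 have bdd: "bdd_below (range (%l. m k l x))" for k x by (rule bdd_belowI[of _ 0]) (use m0 in auto)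
 define mk where "mk k x = (INF l. m k l x)" for k x
 have mlim: "(%l. m k l x) ~~> mk k x" for k x
  unfolding mk_def by (rule LIMSEQ_decseq_INF[OF bdd mdec])
 have mk0: "0 <= mk k x" for k x unfolding mk_def by (rule cINF_greatest) (use m0 in auto)
 have mk_le: "mk k x <= m k l x" for k l x unfolding mk_def by (rule cINF_lower[OF bdd]) simp
 note [measurable] = sob_measurable(1)[OF s] sob_measurable(1)[OF Gm(1)] Lp_loc_measurable[OF Y(1)]
 have [measurable]: "mk k \<in> borel_measurable M" for k
  by (rule borel_measurable_LIMSEQ_real[OF mlim]) measurable
 have YM: "AE x in M. 1 <= Y x" using Y(2) by (auto intro!: AE_I2)
 have dl: "integrable M (%x. Y x * (m k l x - mk k x) powr p)" (is ?th1)
  "(%l. LINT x|M. Y x * (m k l x - mk k x) powr p) ~~> 0" (is ?th2) for k l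
 proof -
  have 1: "integrable M (%x. Y x * \<phi> k x powr p)" using sob_integrable_P[OF s Y(1), of k] pos by simp
  have 2: "AE x in M. (%l. Y x * (m k l x - mk k x) powr p) ~~> 0"
  proof (rule AE_I2)
   fix x
   have "(%l. m k l x - mk k x) ~~> 0" using tendsto_diff[OF mlim[of k x] tendsto_const[of "mk k x"]] by simp
   then have "(%l. (m k l x - mk k x) powr p) ~~> 0 powr p"
    using p mk_le by (intro tendsto_powr2) (auto intro!: always_eventually)
   from tendsto_mult[OF tendsto_const[of "Y x"] this] show "(%l. Y x * (m k l x - mk k x) powr p) ~~> 0" using p by simp
  qed
  have 3: "AE x in M. norm (Y x * (m k l x - mk k x) powr p) <= Y x * \<phi> k x powr p" for l
   using YM
  proof eventually_elim
   case (elim x)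
   moreover have "(m k l x - mk k x) powr p <= \<phi> k x powr p"
    using mk_le[of k x l] mk0[of k x] mle[of 0 l k x] p by (intro powr_mono2) auto
   ultimately show ?case
    by (simp add: abs_mult)
  qed
  have m1: "(%x. 0::real) \<in> borel_measurable M" "!!l. (%x. Y x * (m k l x - mk k x) powr p) \<in> borel_measurable M" by measurable
  show ?th1 by (rule Bochner_Integration.integrable_bound[OF 1 m1(2)]) (use 3[of l] in \<open>auto elim!: eventually_mono\<close>)
  show ?th2 using integral_dominated_convergence[OF m1 1 2 3] by simp
 qed
 have "\<exists>l. (LINT x|M. Y x * (m k l x - mk k x) powr p) < (1/2) ^ k" for k
  using order_tendstoD(2)[OF dl(2)[of k], of "(1/2) ^ k"] by (auto simp: eventually_sequentially)
 then obtain L where L: "!!k. (LINT x|M. Y x * (m k (L k) x - mk k x) powr p) < (1/2) ^ k" by metis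
 define r where "r k x = m k (L k) x - mk k x" for k x
 have r0: "0 <= r k x" for k x using mk_le by (simp add: r_def)
 have rm: "r k \<in> borel_measurable M" for k unfolding r_def[abs_def] by measurable
 have rI: "(\<integral>\<^sup>+x. ennreal (Y x * r k x powr p) \<partial>M) <= ennreal ((1/2) ^ k)" for k
 proof -
  have "(\<integral>\<^sup>+x. ennreal (Y x * r k x powr p) \<partial>M) = ennreal (LINT x|M. Y x * (m k (L k) x - mk k x) powr p)"
   unfolding r_def by (rule nn_integral_eq_integral[OF dl(1)]) (use YM in \<open>eventually_elim, simp\<close>)
  also have "... <= ennreal ((1/2) ^ k)" using L[of k] by (intro ennreal_leI) simp
  finally show ?thesis .
 qed
 have mk\<Phi>: "AE x in M. (\<forall>k. mk k x <= \<Phi> x) \<and> (%k. mk k x) ~~> \<Phi> x"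
  using lim
 proof eventually_elim
  case (elim x)
  note l = elim
  have le: "mk k x <= \<Phi> x" for k
  proof (rule LIMSEQ_le_const[OF LIMSEQ_ignore_initial_segment[OF l, of k]], rule exI, intro allI impI)
   fix j show "mk k x <= \<phi> (j + k) x" using mk_le[of k x j] mle[of j j k x] by (simp add: add.commute)
  qed
  have "(%k. mk k x) ~~> \<Phi> x"
  proof (rule LIMSEQ_I)
   fix d :: real assume d: "0 < d"
   then obtain n where n: "!!k. n <= k ==> norm (\<phi> k x - \<Phi> x) < d / 2"
    using LIMSEQ_D[OF l, of "d / 2"] by auto
   have "\<Phi> x - d / 2 <= mk k x" if "n <= k" for k
    unfolding mk_def
   proof (rule cINF_greatest)
    fix l
    have "\<Phi> x - d / 2 <= \<phi> (k + j) x" for j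
    proof -
     have "norm (\<phi> (k + j) x - \<Phi> x) < d / 2" by (rule n) (use that in simp)
     then show ?thesis unfolding real_norm_def abs_less_iff by linarith
    qed
    then show "\<Phi> x - d / 2 <= m k l x" unfolding m_def by (subst Min_ge_iff) auto
   qed simp
   then have "norm (mk k x - \<Phi> x) < d" if "n <= k" for k using le[of k] that d by fastforce
   then show "\<exists>n. \<forall>k\<ge>n. norm (mk k x - \<Phi> x) < d" by blast
  qed
  then show ?case using le by blast
 qed
 have "AE x in M. (%k. \<bar>Y x\<bar> * r k x powr p) ~~> 0"
 proof (rule AE_tendsto_zero_of_geometric)
  fix k
  have "(\<integral>\<^sup>+x. ennreal (\<bar>Y x\<bar> * r k x powr p) \<partial>M) = (\<integral>\<^sup>+x. ennreal (Y x * r k x powr p) \<partial>M)"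
   by (rule nn_integral_cong_AE) (use YM in \<open>eventually_elim, simp\<close>)
  then show "(\<integral>\<^sup>+x. ennreal (\<bar>Y x\<bar> * r k x powr p) \<partial>M) <= ennreal ((1/2) ^ k)" using rI by simp
  show "(%x. \<bar>Y x\<bar> * r k x powr p) \<in> borel_measurable M"
   by (intro borel_measurable_times borel_measurable_abs powr_real_measurable Lp_loc_measurable[OF Y(1)] rm) simp
 qed simp
 then have rlim: "AE x in M. (%k. r k x) ~~> 0"
  using YM
 proof eventually_elim
  case (elim x)
  note l = elim(1) and y = elim(2)
  have "(%k. r k x powr p) ~~> 0"
  proof (rule Lim_null_comparison[OF always_eventually l], rule allI)
   fix k show "norm (r k x powr p) <= \<bar>Y x\<bar> * r k x powr p"
    using mult_right_mono[of 1 "\<bar>Y x\<bar>" "r k x powr p"] y by simp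
  qed
  then have "(%k. (r k x powr p) powr (1 / p)) ~~> 0 powr (1 / p)" using p by (intro tendsto_powr2) auto
  then show ?case using p r0 by (simp add: powr_powr)
 qed
 have mL: "m k (L k) x = mk k x + r k x" for k x by (simp add: r_def)
 show ?thesis
 proof (rule that[of "%k. m k (L k)" "%k. Gm k (L k)" r])
  show "E (Gm k (L k)) + P W (m k (L k)) <= 2 * (1/2) ^ k" for k using Gm(2)[of k "L k"] sum2[of k "L k"] by linarith
  show "AE x in M. (%k. m k (L k) x) ~~> \<Phi> x"
   using mk\<Phi> rlim
  proof eventually_elim
   case (elim x)
   then show ?case unfolding mL using tendsto_add[of "%k. mk k x" "\<Phi> x" sequentially "%k. r k x" 0] by simp
  qed
  show "AE x in M. \<forall>k. m k (L k) x <= \<Phi> x + r k x"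
   using mk\<Phi> by eventually_elim (simp add: mL)
 qed (use Gm(1) m0 r0 rI rm in auto)
qed

text \<open>A diagonal choice: the j-th member is within (1/2)^j of the limit on
  \<open>closure (om j)\<close>. A fixed set \<open>closure (om i)\<close> is contained in all of
  these from j = i on, hence the shift by \<open>i\<close> below; the errors on it are summable and
  convergence holds almost everywhere.\<close>

lemma ground_state_subsequence:
 assumes W: "W \<in> Lp_loc 1 Om" and \<Phi>: "\<Phi> \<in> Lp_loc p Om" and ns: "null_sequence p H W Om \<phi>"
  and conv: "!!K. compact K ==> K \<subseteq> Om ==> (%k. LINT x|lebesgue_on K. \<bar>\<phi> k x - \<Phi> x\<bar> powr p) ~~> 0"
 obtains f G where "!!k::nat. sob p Om (f k) (G k)" "!!k x. 0 <= f k x" "!!k. E (G k) + P W (f k) <= (1/2) ^ k"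
  "AE x in M. (%k. f k x) ~~> \<Phi> x"
proof -
 have p: "1 <= p" "0 < p" using p1 by auto
 have "\<exists>G. sob p Om (\<phi> k) G" for k
 proof -
  have "\<phi> k \<in> W1p p Om" "\<phi> k \<in> Cc Om" using ns by (auto simp: null_sequence_def)
  from W1p_Cc_imp_sob[OF openOm p(1) this] show ?thesis by blast
 qed
 then obtain G0 where G0: "!!k. sob p Om (\<phi> k) (G0 k)" by metis
 have e0: "(%k. E (G0 k) + P W (\<phi> k)) ~~> 0"
  using ns energy_sob[OF openOm subset_refl G0 W] by (simp add: null_sequence_def)
 let ?K = "%j. closure (om j)"
 have "\<exists>k. E (G0 k) + P W (\<phi> k) < (1/2) ^ j \<and> (LINT x|lebesgue_on (?K j). \<bar>\<phi> k x - \<Phi> x\<bar> powr p) < (1/2) ^ j" for j :: nat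
 proof -
  have "\<forall>\<^sub>F k in sequentially. E (G0 k) + P W (\<phi> k) < (1/2) ^ j" by (rule order_tendstoD(2)[OF e0]) simp
  moreover have "\<forall>\<^sub>F k in sequentially. (LINT x|lebesgue_on (?K j). \<bar>\<phi> k x - \<Phi> x\<bar> powr p) < (1/2) ^ j"
   by (rule order_tendstoD(2)[OF conv[OF om(4,7)]]) simp
  ultimately have "\<forall>\<^sub>F k in sequentially. E (G0 k) + P W (\<phi> k) < (1/2) ^ j \<and> (LINT x|lebesgue_on (?K j). \<bar>\<phi> k x - \<Phi> x\<bar> powr p) < (1/2) ^ j"
   by eventually_elim simp
  then show ?thesis by (auto simp: eventually_sequentially)
 qed
 then have "\<exists>\<tau>. \<forall>j. E (G0 (\<tau> j)) + P W (\<phi> (\<tau> j)) < (1/2) ^ j \<and> (LINT x|lebesgue_on (?K j). \<bar>\<phi> (\<tau> j) x - \<Phi> x\<bar> powr p) < (1/2) ^ j"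
  by (intro choice allI)
 then obtain \<tau> where \<tau>: "!!j::nat. E (G0 (\<tau> j)) + P W (\<phi> (\<tau> j)) < (1/2) ^ j"
  "!!j. (LINT x|lebesgue_on (?K j). \<bar>\<phi> (\<tau> j) x - \<Phi> x\<bar> powr p) < (1/2) ^ j" by blast
 have AEi: "AE x in lebesgue. x \<in> ?K i --> (%j. \<phi> (\<tau> j) x) ~~> \<Phi> x" for i
 proof -
  let ?N = "lebesgue_on (?K i)"
  have Ki: "?K i \<in> sets lebesgue" by simp
  have \<Phi>m: "\<Phi> \<in> borel_measurable ?N" using \<Phi> om(4,7)[of i] by (auto simp: Lp_loc_def Lp_def)
  have fm: "\<phi> k \<in> borel_measurable (lebesgue_on A)" for k A
   by (intro measurable_restrict_space1 measurable_completion) (simp add: sobD(3)[OF G0])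
  have int: "integrable (lebesgue_on (?K j)) (%x. \<bar>\<phi> k x - \<Phi> x\<bar> powr p)" for k j
  proof -
   have a: "\<phi> k \<in> Lp p Om" by (rule sob_has_weak_gradient(3)[OF G0 p(1) openOm])
   have b: "\<Phi> \<in> Lp p (?K j)" using \<Phi> om(4,7)[of j] by (auto simp: Lp_loc_def)
   have "integrable (lebesgue_on (?K j)) (%x. norm (\<phi> k x + (- \<Phi> x)) powr p)"
   proof (rule integrable_powr_add)
    show "\<phi> k \<in> borel_measurable (lebesgue_on (?K j))" by (rule fm)
    show "integrable (lebesgue_on (?K j)) (%x. norm (\<phi> k x) powr p)"
     by (rule integrable_restrict_subset[OF _ setsOm om(7)]) (use a in \<open>auto simp: Lp_def\<close>)
   qed (use b p in \<open>auto simp: Lp_def\<close>)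
   then show ?thesis by simp
  qed
  have "AE x in ?N. (%j. \<bar>\<phi> (\<tau> (j + i)) x - \<Phi> x\<bar> powr p) ~~> 0"
  proof (rule AE_tendsto_zero_of_geometric)
   fix j
   have sub: "?K i \<subseteq> ?K (j + i)" by (intro closure_mono om_mono) simp
   have "(\<integral>\<^sup>+x. ennreal (\<bar>\<phi> (\<tau> (j + i)) x - \<Phi> x\<bar> powr p) \<partial>?N) <= (\<integral>\<^sup>+x. ennreal (\<bar>\<phi> (\<tau> (j + i)) x - \<Phi> x\<bar> powr p) \<partial>lebesgue_on (?K (j + i)))"
    using sub by (subst (1 2) nn_integral_restrict_space) (auto intro!: nn_integral_mono simp: indicator_def)
   also have "... = ennreal (LINT x|lebesgue_on (?K (j + i)). \<bar>\<phi> (\<tau> (j + i)) x - \<Phi> x\<bar> powr p)"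
    by (rule nn_integral_eq_integral[OF int]) simp
   also have "... <= ennreal ((1/2) ^ j)"
   proof (rule ennreal_leI)
    have "(1/2 :: real) ^ (j + i) <= (1/2) ^ j" by (rule power_decreasing) auto
    then show "(LINT x|lebesgue_on (?K (j + i)). \<bar>\<phi> (\<tau> (j + i)) x - \<Phi> x\<bar> powr p) <= (1/2) ^ j"
     using \<tau>(2)[of "j + i"] by linarith
   qed
   finally show "(\<integral>\<^sup>+x. ennreal (\<bar>\<phi> (\<tau> (j + i)) x - \<Phi> x\<bar> powr p) \<partial>?N) <= ennreal ((1/2) ^ j)" .
   show "(%x. \<bar>\<phi> (\<tau> (j + i)) x - \<Phi> x\<bar> powr p) \<in> borel_measurable ?N"
    by (intro powr_real_measurable borel_measurable_abs borel_measurable_diff fm \<Phi>m) simp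
  qed simp
  then have "AE x in ?N. (%j. \<phi> (\<tau> j) x) ~~> \<Phi> x"
  proof eventually_elim
   case (elim x)
   note l = elim
   have "(%j. (\<bar>\<phi> (\<tau> (j + i)) x - \<Phi> x\<bar> powr p) powr (1 / p)) ~~> 0 powr (1 / p)" using p l by (intro tendsto_powr2) auto
   then have "(%j. \<bar>\<phi> (\<tau> (j + i)) x - \<Phi> x\<bar>) ~~> 0" using p by (simp add: powr_powr)
   then have "(%j. \<phi> (\<tau> (j + i)) x) ~~> \<Phi> x" by (rule LIM_zero_cancel[OF tendsto_rabs_zero_cancel])
   then show ?case by (rule LIMSEQ_offset)
  qed
  then show ?thesis using Ki by (subst (asm) AE_restrict_space_iff) auto
 qed
 have "AE x in lebesgue. \<forall>i. x \<in> ?K i --> (%j. \<phi> (\<tau> j) x) ~~> \<Phi> x"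
  unfolding AE_all_countable using AEi by blast
 then have AE: "AE x in M. (%j. \<phi> (\<tau> j) x) ~~> \<Phi> x"
  unfolding AE_M_iff
 proof eventually_elim
  case (elim x)
  note a = elim
  show "x \<in> Om --> (%j. \<phi> (\<tau> j) x) ~~> \<Phi> x"
  proof
   assume "x \<in> Om"
   then obtain i where "x \<in> om i" using om_Union by blast
   then have "x \<in> ?K i" using closure_subset by blast
   then show "(%j. \<phi> (\<tau> j) x) ~~> \<Phi> x" using a by blast
  qed
 qed
 show ?thesis
  by (rule that[of "%j. \<phi> (\<tau> j)" "%j. G0 (\<tau> j)"])
    (use G0 ns AE \<tau>(1) in \<open>auto simp: null_sequence_def intro: less_imp_le\<close>)
qed


section \<open>Weighted bounds and limits along the minima\<close>

lemma H_diff_integrable: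
 assumes [measurable]: "A \<in> borel_measurable M" "B \<in> borel_measurable M"
  and i: "integrable M (%x. H x (A x) powr p)" "integrable M (%x. H x (B x) powr p)"
 shows "integrable M (%x. H x (A x - B x) powr p)"
proof (rule Bochner_Integration.integrable_bound)
 show "integrable M (%x. 2 powr p * (H x (A x) powr p + H x (B x) powr p))"
  by (intro integrable_mult_right impI Bochner_Integration.integrable_add i)
 have [measurable]: "(%x. H x (A x - B x)) \<in> borel_measurable M" by (rule measurable_H) measurable
 show "(%x. H x (A x - B x) powr p) \<in> borel_measurable M" by measurable
 show "AE x in M. norm (H x (A x - B x) powr p) <= norm (2 powr p * (H x (A x) powr p + H x (B x) powr p))"
  using AE_norm
 proof eventually_elim
  case (elim x)
  note N = elim
  have "H x (A x - B x) powr p <= (H x (A x) + H x (B x)) powr p"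
   using p1 is_normD(1,6)[OF N] by (intro powr_mono2) auto
  also have "... <= 2 powr p * (H x (A x) powr p + H x (B x) powr p)"
   using p1 is_normD(1)[OF N] by (intro powr_add_le) auto
  finally show ?case by simp
 qed
qed

lemma P_diff:
 assumes "sob p Om \<phi> G" "V \<in> Lp_loc 1 Om" "g \<in> Lp_loc 1 Om"
 shows "P (%x. V x - S * \<bar>g x\<bar>) \<phi> = P V \<phi> - S * P (%x. \<bar>g x\<bar>) \<phi>"
proof -
 have "P V \<phi> - S * P (%x. \<bar>g x\<bar>) \<phi> = (LINT x|M. V x * \<bar>\<phi> x\<bar> powr p - S * (\<bar>g x\<bar> * \<bar>\<phi> x\<bar> powr p))"
  unfolding P_def using sob_integrable_P[OF assms(1,2)] sob_integrable_P[OF assms(1) Lp_loc_linear(1)[OF assms(3,3)]]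
  by (subst Bochner_Integration.integral_diff) auto
 also have "... = P (%x. V x - S * \<bar>g x\<bar>) \<phi>"
  unfolding P_def by (rule Bochner_Integration.integral_cong) (auto simp: algebra_simps)
 finally show ?thesis by simp
qed

lemma P_nonneg: "AE x in M. 0 <= X x ==> 0 <= P X u"
 unfolding P_def by (rule integral_nonneg_AE) (auto elim!: eventually_mono)

text \<open>Finiteness of a weighted norm of \<Phi> is transferred to the minima: they lie between 0
  and \<Phi> + \<open>r\<close>, and \<open>Y\<close> dominates the weight. The constant depends on
  neither \<open>v\<close> nor \<open>r\<close>.\<close>

lemma weighted_minima_bound:
 assumes s: "sob p Om v G" "!!x. 0 <= v x" and r[measurable]: "r \<in> borel_measurable M" and r0: "!!x. 0 <= r x"
  and rI: "(\<integral>\<^sup>+x. ennreal (Y x * r x powr p) \<partial>M) <= ennreal 1"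
  and le: "AE x in M. v x <= \<Phi> x + r x" and [measurable]: "\<Phi> \<in> borel_measurable M"
  and X: "X \<in> Lp_loc 1 Om" "AE x in M. 0 <= X x \<and> X x <= Y x"
  and I: "0 <= I" "(\<integral>\<^sup>+x. ennreal (X x * \<bar>\<Phi> x\<bar> powr p) \<partial>M) <= ennreal I"
 shows "P X v <= 2 powr p * (I + 1)"
proof -
 have [measurable]: "X \<in> borel_measurable M" by (rule Lp_loc_measurable[OF X(1)])
 have "ennreal (P X v) = (\<integral>\<^sup>+x. ennreal (X x * \<bar>v x\<bar> powr p) \<partial>M)"
  unfolding P_def by (rule nn_integral_eq_integral[OF sob_integrable_P[OF s(1) X(1)], symmetric])
   (use X(2) in \<open>auto elim!: eventually_mono\<close>)
 also have "... <= (\<integral>\<^sup>+x. ennreal (X x) * ennreal (norm (\<Phi> x + r x) powr p) \<partial>M)"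
 proof (rule nn_integral_mono_AE)
  show "AE x in M. ennreal (X x * \<bar>v x\<bar> powr p) <= ennreal (X x) * ennreal (norm (\<Phi> x + r x) powr p)"
   using X(2) le
  proof eventually_elim
   case (elim x)
   note a = elim(1-2)
   have "\<bar>v x\<bar> powr p <= norm (\<Phi> x + r x) powr p" using a(2) s(2)[of x] p1 by (intro powr_mono2) auto
   then show ?case
    using a(1) by (subst ennreal_mult[symmetric]) (auto intro!: ennreal_leI mult_left_mono)
  qed
 qed
 also have "... <= ennreal (2 powr p) * ((\<integral>\<^sup>+x. ennreal (X x) * ennreal (norm (\<Phi> x) powr p) \<partial>M) + (\<integral>\<^sup>+x. ennreal (X x) * ennreal (norm (r x) powr p) \<partial>M))"
  using p1 by (intro nn_integral_powr_add_le) auto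
 also have "... <= ennreal (2 powr p) * (ennreal I + ennreal 1)"
 proof (intro mult_left_mono add_mono)
  have "(\<integral>\<^sup>+x. ennreal (X x) * ennreal (norm (\<Phi> x) powr p) \<partial>M) = (\<integral>\<^sup>+x. ennreal (X x * \<bar>\<Phi> x\<bar> powr p) \<partial>M)"
   by (rule nn_integral_cong_AE) (use X(2) in \<open>eventually_elim, simp add: ennreal_mult\<close>)
  then show "(\<integral>\<^sup>+x. ennreal (X x) * ennreal (norm (\<Phi> x) powr p) \<partial>M) <= ennreal I" using I(2) by simp
  have "(\<integral>\<^sup>+x. ennreal (X x) * ennreal (norm (r x) powr p) \<partial>M) <= (\<integral>\<^sup>+x. ennreal (Y x * r x powr p) \<partial>M)"
  proof (rule nn_integral_mono_AE)
   show "AE x in M. ennreal (X x) * ennreal (norm (r x) powr p) <= ennreal (Y x * r x powr p)"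
    using X(2)
   proof eventually_elim
    case (elim x)
    then show ?case
     using r0[of x] by (subst ennreal_mult[symmetric]) (auto intro!: ennreal_leI mult_right_mono)
   qed
  qed
  then show "(\<integral>\<^sup>+x. ennreal (X x) * ennreal (norm (r x) powr p) \<partial>M) <= ennreal 1" using rI by (rule order_trans)
 qed simp
 also have "... = ennreal (2 powr p * (I + 1))"
  using I(1) by (simp add: ennreal_mult)
 finally show ?thesis using I(1) by (subst (asm) ennreal_le_iff) auto
qed

text \<open>Where \<open>v k\<close> is below \<Phi> the difference is dominated by \<Phi>, and
  where it is above the difference is at most \<open>r k\<close>. Dominated convergence settles the
  first part and the geometric bound the second, without a common majorant for all
  \<open>v k\<close>.\<close>

lemma weighted_minima_tendsto:
 assumes vm[measurable]: "!!k::nat. v k \<in> borel_measurable M" and v0: "!!k x. 0 <= v k x" and r[measurable]: "!!k. r k \<in> borel_measurable M" and r0: "!!k x. 0 <= r k x"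
  and rI: "!!k. (\<integral>\<^sup>+x. ennreal (Y x * r k x powr p) \<partial>M) <= ennreal ((1/2) ^ k)"
  and lim: "AE x in M. (%k. v k x) ~~> \<Phi> x" and le: "AE x in M. \<forall>k. v k x <= \<Phi> x + r k x"
  and \<Phi>[measurable]: "\<Phi> \<in> borel_measurable M" and \<Phi>0: "AE x in M. 0 < \<Phi> x"
  and X[measurable]: "X \<in> borel_measurable M" and X0: "AE x in M. 0 <= X x \<and> X x <= Y x"
  and I: "integrable M (%x. X x * \<bar>\<Phi> x\<bar> powr p)"
 shows "!!k. integrable M (%x. X x * \<bar>v k x - \<Phi> x\<bar> powr p)"
  "(%k. LINT x|M. X x * \<bar>v k x - \<Phi> x\<bar> powr p) ~~> 0"
proof -
 have ri: "integrable M (%x. X x * r k x powr p)" "(LINT x|M. X x * r k x powr p) <= (1/2) ^ k" for k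
 proof -
  have "(\<integral>\<^sup>+x. ennreal (X x * r k x powr p) \<partial>M) <= (\<integral>\<^sup>+x. ennreal (Y x * r k x powr p) \<partial>M)"
  proof (rule nn_integral_mono_AE)
   show "AE x in M. ennreal (X x * r k x powr p) <= ennreal (Y x * r k x powr p)"
    using X0 by eventually_elim (auto intro!: ennreal_leI mult_right_mono)
  qed
  also note rI[of k]
  finally have b: "(\<integral>\<^sup>+x. ennreal (X x * r k x powr p) \<partial>M) <= ennreal ((1/2) ^ k)" .
  have pos: "AE x in M. 0 <= X x * r k x powr p" using X0 by eventually_elim simp
  show i: "integrable M (%x. X x * r k x powr p)"
   by (rule integrableI_nonneg[OF _ pos le_less_trans[OF b]]) simp_all
  show "(LINT x|M. X x * r k x powr p) <= (1/2) ^ k"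
   using b unfolding nn_integral_eq_integral[OF i pos] by (subst (asm) ennreal_le_iff) auto
 qed
 define a where "a k x = X x * (\<Phi> x - min (v k x) (\<Phi> x)) powr p" for k x
 have am[measurable]: "a k \<in> borel_measurable M" for k unfolding a_def[abs_def] by measurable
 have ale: "AE x in M. norm (a k x) <= X x * \<bar>\<Phi> x\<bar> powr p" for k
  using X0 \<Phi>0
 proof eventually_elim
  case (elim x)
  note x = elim(1-2)
  have "(\<Phi> x - min (v k x) (\<Phi> x)) powr p <= \<bar>\<Phi> x\<bar> powr p"
   using x v0[of k x] p1 by (intro powr_mono2) auto
  then show ?case using x by (simp add: a_def mult_left_mono)
 qed
 have al: "AE x in M. (%k. a k x) ~~> 0"
  using lim
 proof eventually_elim
  case (elim x)
  note l = elim
  have "(%k. \<Phi> x - min (v k x) (\<Phi> x)) ~~> \<Phi> x - min (\<Phi> x) (\<Phi> x)" by (intro tendsto_intros l)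
  then have "(%k. (\<Phi> x - min (v k x) (\<Phi> x)) powr p) ~~> 0 powr p"
   using p1 by (intro tendsto_powr2) (auto intro!: always_eventually)
  from tendsto_mult[OF tendsto_const[of "X x"] this] show ?case using p1 by (simp add: a_def)
 qed
 have ai: "integrable M (a k)" for k
  by (rule Bochner_Integration.integrable_bound[OF I am]) (use ale[of k] in \<open>auto elim!: eventually_mono\<close>)
 have alim: "(%k. LINT x|M. a k x) ~~> 0"
  using integral_dominated_convergence[OF borel_measurable_const[of 0] am I al ale] by simp
 have dle: "AE x in M. 0 <= X x * \<bar>v k x - \<Phi> x\<bar> powr p \<and> X x * \<bar>v k x - \<Phi> x\<bar> powr p <= a k x + X x * r k x powr p" for k
  using X0 le
 proof eventually_elim
  case (elim x)
  note x = elim(1-2)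
  have "\<bar>v k x - \<Phi> x\<bar> powr p <= (\<Phi> x - min (v k x) (\<Phi> x)) powr p + r k x powr p"
  proof (cases "v k x <= \<Phi> x")
   case True then show ?thesis by (simp add: abs_if min_def)
  next
   case False
   then have "\<bar>v k x - \<Phi> x\<bar> powr p <= r k x powr p" using x(2)[rule_format, of k] p1 by (intro powr_mono2) auto
   then show ?thesis by (simp add: add_increasing)
  qed
  then have "X x * \<bar>v k x - \<Phi> x\<bar> powr p <= X x * ((\<Phi> x - min (v k x) (\<Phi> x)) powr p + r k x powr p)"
   using x(1) by (intro mult_left_mono) auto
  then show ?case
   using x(1) by (simp add: a_def distrib_left)
 qed
 have ari: "integrable M (%x. a k x + X x * r k x powr p)" for k
  by (rule Bochner_Integration.integrable_add[OF ai ri(1)])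
 show i: "integrable M (%x. X x * \<bar>v k x - \<Phi> x\<bar> powr p)" for k
 proof (rule Bochner_Integration.integrable_bound[OF ari[of k]])
  show "AE x in M. norm (X x * \<bar>v k x - \<Phi> x\<bar> powr p) <= norm (a k x + X x * r k x powr p)"
   using dle[of k]
  proof eventually_elim
   case (elim x)
   then show ?case
    unfolding real_norm_def by linarith
  qed
 qed measurable
 have pw: "(%k. (1/2 :: real) ^ k) ~~> 0" by (rule LIMSEQ_power_zero) simp
 show "(%k. LINT x|M. X x * \<bar>v k x - \<Phi> x\<bar> powr p) ~~> 0"
 proof (rule Lim_null_comparison[OF always_eventually], rule allI)
  fix k
  have "0 <= (LINT x|M. X x * \<bar>v k x - \<Phi> x\<bar> powr p)"
   by (rule integral_nonneg_AE) (use dle[of k] in \<open>eventually_elim, simp\<close>)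
  moreover have "(LINT x|M. X x * \<bar>v k x - \<Phi> x\<bar> powr p) <= (LINT x|M. a k x + X x * r k x powr p)"
   by (rule integral_mono_AE[OF i ari]) (use dle[of k] in \<open>eventually_elim, simp\<close>)
  moreover have "(LINT x|M. a k x + X x * r k x powr p) = (LINT x|M. a k x) + (LINT x|M. X x * r k x powr p)"
   by (rule Bochner_Integration.integral_add[OF ai ri(1)])
  ultimately show "norm (LINT x|M. X x * \<bar>v k x - \<Phi> x\<bar> powr p) <= (LINT x|M. a k x) + (1/2) ^ k"
   using ri(2)[of k] by simp
  show "(%k. (LINT x|M. a k x) + (1/2) ^ k) ~~> 0" using tendsto_add[OF alim pw] by simp
 qed
qed

text \<open>Division by the unbounded integrals against |g| makes everything bounded tend to zero:
  the integrals against V^-, the local integrals, and the values of the functional with potential V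
  - S|g|. As the integral against |g| has become 1, the last of these says that the functional with
  potential V tends to \<open>S\<close>.\<close>

lemma normalized_concentrating_sequence:
 assumes V: "V \<in> Lp_loc 1 Om" and gL: "g \<in> Lp_loc 1 Om"
  and nn: "!!\<phi> G. sob p Om \<phi> G ==> S * P (%x. \<bar>g x\<bar>) \<phi> <= E G + P V \<phi>"
  and s: "!!k. sob p Om (v k) (G k)"
  and e: "!!k. E (G k) + P (%x. V x - S * \<bar>g x\<bar>) (v k) <= 2 * (1/2) ^ k"
  and B1: "!!k. P (%x. max (- V x) 0) (v k) <= B1"
  and BK: "!!K. compact K ==> K \<subseteq> Om ==> \<exists>B. \<forall>k. P (indicator K) (v k) <= B"
  and unb: "!!B. \<exists>k. B < P (%x. \<bar>g x\<bar>) (v k)"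
 obtains w F where "!!j::nat. sob p Om (w j) (F j)" "!!j. P (%x. \<bar>g x\<bar>) (w j) = 1"
  "(%j. E (F j) + P V (w j)) ~~> S" "(%j. P (%x. max (- V x) 0) (w j)) ~~> 0"
  "!!K. compact K ==> K \<subseteq> Om ==> (%j. P (indicator K) (w j)) ~~> 0"
proof -
 let ?N = "%k. P (%x. \<bar>g x\<bar>) (v k)"
 have p: "1 <= p" using p1 by simp
 have "\<forall>j. \<exists>k. real (Suc j) < ?N k" using unb by blast
 then obtain \<tau> where \<tau>: "!!j. real (Suc j) < ?N (\<tau> j)" by metis
 have N: "0 < ?N (\<tau> j)" for j using \<tau>[of j] by (rule less_trans[rotated]) simp
 define c where "c j = ?N (\<tau> j) powr (- 1 / p)" for j
 have c: "\<bar>c j\<bar> powr p = 1 / ?N (\<tau> j)" for j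
 proof -
  have "\<bar>c j\<bar> powr p = ?N (\<tau> j) powr (- 1 / p * p)" by (simp only: c_def abs_of_nonneg[OF powr_ge_zero] powr_powr)
  also have "- 1 / p * p = - 1" using p1 by simp
  finally show ?thesis using N[of j] by (simp add: powr_minus_divide)
 qed
 have cle: "1 / ?N (\<tau> j) <= inverse (real (Suc j))" for j
  using \<tau>[of j] N[of j] by (simp add: divide_inverse le_imp_inverse_le less_imp_le del: of_nat_Suc)
 have inv0: "(%j. C * inverse (real (Suc j))) ~~> 0" for C
  using tendsto_mult[OF tendsto_const[of C] LIMSEQ_inverse_real_of_nat] by simp
 have small: "(%j. 1 / ?N (\<tau> j) * a (\<tau> j)) ~~> 0" if a: "!!k. 0 <= a k" "!!k. a k <= C" for a :: "nat => real" and C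
 proof (rule Lim_null_comparison[OF always_eventually inv0[of C]], rule allI)
  fix j
  have "1 / ?N (\<tau> j) * a (\<tau> j) <= inverse (real (Suc j)) * C"
   using cle[of j] a N[of j] by (intro mult_mono) auto
  then show "norm (1 / ?N (\<tau> j) * a (\<tau> j)) <= C * inverse (real (Suc j))"
   using a(1)[of "\<tau> j"] N[of j] by (simp add: mult.commute)
 qed
 define w where "w j x = c j * v (\<tau> j) x" for j x
 define F where "F j x = c j *r G (\<tau> j) x" for j x
 have Pw: "P X (w j) = 1 / ?N (\<tau> j) * P X (v (\<tau> j))" for X j unfolding w_def P_scale c ..
 show ?thesis
 proof (rule that[of w F])
  show "sob p Om (w j) (F j)" for j unfolding w_def[abs_def] F_def[abs_def] by (rule sob_cmult[OF s p])
  show "P (%x. \<bar>g x\<bar>) (w j) = 1" for j using N[of j] by (simp add: Pw)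
  show "(%j. P (%x. max (- V x) 0) (w j)) ~~> 0" unfolding Pw
   by (rule small[OF _ B1]) (rule P_nonneg, simp)
  show "(%j. P (indicator K) (w j)) ~~> 0" if K: "compact K" "K \<subseteq> Om" for K
  proof -
   obtain B where "!!k. P (indicator K) (v k) <= B" using BK[OF K] by blast
   then show ?thesis unfolding Pw by (rule small[rotated]) (rule P_nonneg, simp)
  qed
  have EF: "E (F j) = 1 / ?N (\<tau> j) * E (G (\<tau> j))" for j
   unfolding F_def[abs_def] using E_scale[OF sob_measurable(2)[OF s], of "c j" "\<tau> j"] by (simp only: c)
  define Q where "Q k = E (G k) + P (%x. V x - S * \<bar>g x\<bar>) (v k)" for k
  have Q: "Q k = E (G k) + P V (v k) - S * ?N k" for k unfolding Q_def P_diff[OF s V gL] by simp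
  have "(%j. 1 / ?N (\<tau> j) * Q (\<tau> j)) ~~> 0"
  proof (rule small)
   show "0 <= Q k" for k using nn[OF s[of k]] by (simp add: Q)
   have "(1/2 :: real) ^ k <= 1" for k by (rule power_le_one) auto
   then show "Q k <= 2" for k using e[of k] unfolding Q_def[symmetric] by (smt (verit))
  qed
  from tendsto_add[OF this tendsto_const[of S]]
  have "(%j. 1 / ?N (\<tau> j) * Q (\<tau> j) + S) ~~> S" by simp
  moreover have "E (F j) + P V (w j) = 1 / ?N (\<tau> j) * Q (\<tau> j) + S" for j
   unfolding EF Pw Q using N[of j] by (simp add: field_simps)
  ultimately show "(%j. E (F j) + P V (w j)) ~~> S" by simp
 qed
qed

text \<open>Completeness, by the argument of Riesz and Fischer. The norms vary with the point, so
  pointwise convergence uses that almost every \<open>H x\<close> dominates a positive multiple of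
  the Euclidean norm.\<close>

lemma Cauchy_gradients_limit:
 fixes G :: "nat => real ^ 'n => real ^ 'n"
 assumes Gm[measurable]: "!!k. G k \<in> borel_measurable M" and i: "!!k. integrable M (%x. H x (G k x) powr p)"
  and cauchy: "!!e. 0 < e ==> \<exists>n. \<forall>k\<ge>n. \<forall>l\<ge>n. E (%x. G k x - G l x) < e"
 obtains F where "F \<in> borel_measurable M" "integrable M (%x. H x (F x) powr p)"
  "!!k. integrable M (%x. H x (G k x - F x) powr p)" "(%k. E (%x. G k x - F x)) ~~> 0"
proof -
 have p: "1 <= p" "0 < p" using p1 by auto
 \<comment> \<open>So small that even 2^j times the j-th increment has p-th powers with integral at
   most (1/2)^j; the increments are then eventually smaller than (1/2)^j almost everywhere, hence
   summable.\<close>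
 define c where "c j = (1/2) ^ j / (2 ^ j) powr p" for j :: nat
 have c0: "0 < c j" for j by (simp add: c_def)
 have c1: "c j <= (1/2) ^ j" for j
 proof -
  have "1 <= (2 ^ j :: real) powr p" using p by (intro ge_one_powr_ge_zero) auto
  then show ?thesis unfolding c_def by (simp add: divide_le_eq mult_le_cancel_left1)
 qed
 have "\<forall>j. \<exists>n. \<forall>k\<ge>n. \<forall>l\<ge>n. E (%x. G k x - G l x) < c j" using cauchy c0 by blast
 then obtain n where n: "!!j k l. n j <= k ==> n j <= l ==> E (%x. G k x - G l x) < c j" by metis
 \<comment> \<open>The sum dominates every \<open>n i\<close> with i <= j, so all the earlier Cauchy
   estimates remain available at index \<open>\<tau> j\<close>.\<close>
 define \<tau> where "\<tau> j = (\<Sum>i\<le>j. n i)" for j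
 have \<tau>: "n i <= \<tau> j" if "i <= j" for i j unfolding \<tau>_def using that by (intro member_le_sum) auto
 have Hd[measurable]: "(%x. H x (G k x - G l x)) \<in> borel_measurable M" for k l by (rule measurable_H) measurable
 have id: "integrable M (%x. H x (G k x - G l x) powr p)" for k l by (rule H_diff_integrable[OF Gm Gm i i])
 have "AE x in M. (%j. (2 ^ j * \<bar>H x (G (\<tau> (Suc j)) x - G (\<tau> j) x)\<bar>) powr p) ~~> 0"
 proof (rule AE_tendsto_zero_of_geometric)
  fix j
  show "(%x. (2 ^ j * \<bar>H x (G (\<tau> (Suc j)) x - G (\<tau> j) x)\<bar>) powr p) \<in> borel_measurable M" by measurable
  have "(\<integral>\<^sup>+x. ennreal ((2 ^ j * \<bar>H x (G (\<tau> (Suc j)) x - G (\<tau> j) x)\<bar>) powr p) \<partial>M)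
   = (\<integral>\<^sup>+x. ennreal ((2 ^ j) powr p * H x (G (\<tau> (Suc j)) x - G (\<tau> j) x) powr p) \<partial>M)"
   by (rule nn_integral_cong_AE) (use AE_norm in \<open>eventually_elim, simp add: powr_mult is_normD(1)\<close>)
  also have "... = ennreal (LINT x|M. (2 ^ j) powr p * H x (G (\<tau> (Suc j)) x - G (\<tau> j) x) powr p)"
   by (rule nn_integral_eq_integral) (auto intro!: integrable_mult_right id)
  also have "(LINT x|M. (2 ^ j) powr p * H x (G (\<tau> (Suc j)) x - G (\<tau> j) x) powr p) = (2 ^ j) powr p * E (%x. G (\<tau> (Suc j)) x - G (\<tau> j) x)"
   by (simp add: E_def)
  also have "ennreal ... <= ennreal ((2 ^ j) powr p * c j)"
   using n[OF \<tau>[of j "Suc j"] \<tau>[of j j]] by (intro ennreal_leI mult_left_mono) auto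
  also have "(2 ^ j) powr p * c j = (1/2) ^ j" by (simp add: c_def)
  finally show "(\<integral>\<^sup>+x. ennreal ((2 ^ j * \<bar>H x (G (\<tau> (Suc j)) x - G (\<tau> j) x)\<bar>) powr p) \<partial>M) <= ennreal ((1/2) ^ j)" .
 qed simp
 note AE1 = this
 have AE2: "AE x in M. \<exists>\<kappa>>0. \<forall>\<xi>. \<kappa> * norm \<xi> <= H x \<xi>"
 proof -
  have "AE x in M. x \<in> closure (om i) --> (\<exists>\<kappa>>0. \<forall>\<xi>. \<kappa> * norm \<xi> <= H x \<xi>)" for i
  proof -
   obtain \<kappa> \<nu> where k: "0 < \<kappa>" "0 < \<nu>" "AE x in M. x \<in> closure (om i) --> (\<forall>\<xi>. \<kappa> * norm \<xi> <= H x \<xi> \<and> H x \<xi> <= \<nu> * norm \<xi>)"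
    by (rule local_bounds[OF om(4,7)]) (rule that; assumption)
   show ?thesis using k(3) by eventually_elim (use k(1) in blast)
  qed
  then have "AE x in M. \<forall>i. x \<in> closure (om i) --> (\<exists>\<kappa>>0. \<forall>\<xi>. \<kappa> * norm \<xi> <= H x \<xi>)"
   unfolding AE_all_countable by blast
  moreover have "AE x in M. x \<in> Om" by (rule AE_I2) simp
  ultimately show ?thesis
  proof eventually_elim
   fix x assume a: "\<forall>i. x \<in> closure (om i) --> (\<exists>\<kappa>>0. \<forall>\<xi>. \<kappa> * norm \<xi> <= H x \<xi>)" and "x \<in> Om"
   then obtain i where "x \<in> om i" using om_Union by blast
   then have "x \<in> closure (om i)" using closure_subset by blast
   then show "\<exists>\<kappa>>0. \<forall>\<xi>. \<kappa> * norm \<xi> <= H x \<xi>" using a by blast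
  qed
 qed
 define F where "F x = lim (%j. G (\<tau> j) x)" for x
 have Fm[measurable]: "F \<in> borel_measurable M" unfolding F_def[abs_def] by (rule borel_measurable_lim_metric) measurable
 have AE3: "AE x in M. (%j. G (\<tau> j) x) ~~> F x"
  using AE1 AE2
 proof eventually_elim
  case (elim x)
  note l = elim(1) and k = elim(2)
  obtain \<kappa> where \<kappa>: "0 < \<kappa>" "!!\<xi>. \<kappa> * norm \<xi> <= H x \<xi>" using k by blast
  let ?d = "%j. G (\<tau> (Suc j)) x - G (\<tau> j) x"
  have "\<forall>\<^sub>F j in sequentially. (2 ^ j * \<bar>H x (?d j)\<bar>) powr p < 1" by (rule order_tendstoD(2)[OF l]) simp
  then have ev: "\<forall>\<^sub>F j in sequentially. norm (norm (?d j)) <= (1 / \<kappa>) * (1/2) ^ j"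
  proof eventually_elim
   fix j assume a: "(2 ^ j * \<bar>H x (?d j)\<bar>) powr p < 1"
   have "2 ^ j * \<bar>H x (?d j)\<bar> < 1"
   proof (rule ccontr)
    assume "\<not> ?thesis"
    then have "1 <= (2 ^ j * \<bar>H x (?d j)\<bar>) powr p" using p by (intro ge_one_powr_ge_zero) auto
    then show False using a by simp
   qed
   then have "\<bar>H x (?d j)\<bar> <= (1/2) ^ j" by (simp add: power_one_over field_simps)
   then have "\<kappa> * norm (?d j) <= (1/2) ^ j" using \<kappa>(2)[of "?d j"] by linarith
   then show "norm (norm (?d j)) <= (1 / \<kappa>) * (1/2) ^ j" using \<kappa>(1) by (simp add: field_simps)
  qed
  have "summable (%j. norm (?d j))"
   by (rule summable_comparison_test_ev[OF ev]) (intro summable_mult summable_geometric, simp)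
  then have "summable ?d" by (rule summable_norm_cancel)
  then have "(%m. \<Sum>j<m. ?d j) ~~> (\<Sum>j. ?d j)" by (rule summable_LIMSEQ)
  then have "(%m. G (\<tau> m) x - G (\<tau> 0) x) ~~> (\<Sum>j. ?d j)" by (simp add: sum_lessThan_telescope[where f="%j. G (\<tau> j) x"])
  from tendsto_add[OF this tendsto_const[of "G (\<tau> 0) x"]]
  have "convergent (%m. G (\<tau> m) x)" by (auto simp: convergent_def)
  then show ?case unfolding F_def by (simp add: convergent_LIMSEQ_iff)
 qed
 have HF[measurable]: "(%x. H x (G k x - F x)) \<in> borel_measurable M" for k by (rule measurable_H) measurable
 \<comment> \<open>With \<open>k\<close> fixed, the Cauchy estimate for \<open>k\<close> and
   \<open>\<tau> j\<close> passes to the limit in \<open>j\<close>.\<close>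
 have fatou: "(\<integral>\<^sup>+x. ennreal (H x (G k x - F x) powr p) \<partial>M) <= ennreal (c i)" if k: "n i <= k" for i k
 proof (rule nn_integral_Fatou_le)
  show "AE x in M. (%j. H x (G k x - G (\<tau> j) x) powr p) ~~> H x (G k x - F x) powr p"
   using AE3 AE_norm
  proof eventually_elim
   case (elim x)
   have "(%j. H x (G k x - G (\<tau> j) x)) ~~> H x (G k x - F x)"
    by (rule is_norm_tendsto[OF elim(2)]) (intro tendsto_intros elim(1))
   then show ?case
    using p is_normD(1)[OF elim(2)] by (intro tendsto_powr2 tendsto_const) (auto intro!: always_eventually)
  qed
  show "\<forall>\<^sub>F j in sequentially. (\<integral>\<^sup>+x. ennreal (H x (G k x - G (\<tau> j) x) powr p) \<partial>M) <= ennreal (c i)"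
   using eventually_ge_at_top[of i]
  proof eventually_elim
   case (elim j)
   then show ?case
    using n[OF k \<tau>[of i j]] nn_integral_eq_integral[OF id[of k "\<tau> j"]] by (simp add: E_def ennreal_leI)
  qed
 qed measurable
 have int0: "integrable M (%x. H x (G k x - F x) powr p)" if "n i <= k" for i k
  by (rule integrableI_nonneg) (use le_less_trans[OF fatou[OF that]] in simp_all)
 have iF: "integrable M (%x. H x (F x) powr p)"
  using H_diff_integrable[OF Gm _ i int0[of 0 "n 0"], of "n 0"] by simp
 have int: "integrable M (%x. H x (G k x - F x) powr p)" for k by (rule H_diff_integrable[OF Gm Fm i iF])
 have Ele: "E (%x. G k x - F x) <= c i" if "n i <= k" for i k
 proof -
  have "ennreal (E (%x. G k x - F x)) <= ennreal (c i)"
   unfolding E_def using fatou[OF that] nn_integral_eq_integral[OF int[of k]] by simp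
  then show ?thesis using c0[of i] by (subst (asm) ennreal_le_iff) auto
 qed
 have "(%k. E (%x. G k x - F x)) ~~> 0"
 proof (rule LIMSEQ_I)
  fix e :: real assume e: "0 < e"
  have "(%k. (1/2 :: real) ^ k) ~~> 0" by (rule LIMSEQ_power_zero) simp
  from order_tendstoD(2)[OF this e] obtain i where i: "(1/2) ^ i < e" by (auto simp: eventually_sequentially)
  have "norm (E (%x. G k x - F x) - 0) < e" if "n i <= k" for k
   using Ele[OF that] E_nonneg[of "%x. G k x - F x"] c1[of i] i by simp
  then show "\<exists>m. \<forall>k\<ge>m. norm (E (%x. G k x - F x) - 0) < e" by blast
 qed
 then show ?thesis using that Fm iF int by blast
qed

text \<open>A test function confines the integrals to a compact set. There the lower bound of the
  norms and finiteness of the measure turn both convergences into convergence in L^1, under which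
  the defining identity passes to the limit.\<close>

lemma has_weak_gradient_limit:
 assumes s: "!!k::nat. sob p Om (v k) (G k)"
  and \<Phi>[measurable]: "\<Phi> \<in> borel_measurable M" and Fm[measurable]: "F \<in> borel_measurable M"
  and iF: "!!k. integrable M (%x. H x (G k x - F x) powr p)" and lF: "(%k. E (%x. G k x - F x)) ~~> 0"
  and i\<Phi>: "!!K k. compact K ==> K \<subseteq> Om ==> integrable M (%x. indicator K x * \<bar>v k x - \<Phi> x\<bar> powr p)"
  and l\<Phi>: "!!K. compact K ==> K \<subseteq> Om ==> (%k. LINT x|M. indicator K x * \<bar>v k x - \<Phi> x\<bar> powr p) ~~> 0"
 shows "has_weak_gradient Om \<Phi> F"
proof -
 have p: "1 <= p" "0 < p" using p1 by auto
 note wg = sob_has_weak_gradient(1)[OF s p(1) openOm]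
 have vL: "v k \<in> Lp_loc 1 Om" "G k \<in> Lp_loc 1 Om" for k using wg by (auto simp: has_weak_gradient_def)
 have loc: "integrable (lebesgue_on K) (%x. v k x - \<Phi> x)" "(%k. LINT x|lebesgue_on K. norm (v k x - \<Phi> x)) ~~> 0"
  "integrable (lebesgue_on K) (%x. G k x - F x)" "(%k. LINT x|lebesgue_on K. norm (G k x - F x)) ~~> 0"
  if K: "compact K" "K \<subseteq> Om" for K k
 proof -
  have KM: "K \<in> sets lebesgue" by (rule compact_imp_sets_lebesgue[OF K(1)])
  have fin: "finite_measure (lebesgue_on K)"
   using emeasure_compact_finite[OF K(1)] KM borel_compact[OF K(1)]
   by (intro finite_measureI) (simp add: emeasure_restrict_space)
  have meas: "f \<in> borel_measurable (lebesgue_on K)" if "f \<in> borel_measurable M" for f :: "real^'n => 'c::euclidean_space"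
   by (rule measurable_restrict_mono[OF that K(2)])
  have [measurable]: "v k \<in> borel_measurable M" "G k \<in> borel_measurable M" for k
   using sob_measurable(1,2)[OF s] by auto
  have on_K: "integrable (lebesgue_on K) f" "(LINT x|lebesgue_on K. f x) = (LINT x|M. indicator K x * f x)"
   if i: "integrable M (%x. indicator K x * f x)" for f :: "real^'n => real"
  proof -
   have a: "integrable (lebesgue_on K) (%x. indicator K x * f x)" by (rule integrable_restrict_subset[OF KM setsOm K(2) i])
   have "integrable (lebesgue_on K) (%x. indicator K x * f x) = integrable (lebesgue_on K) f"
    by (rule Bochner_Integration.integrable_cong) auto
   then show "integrable (lebesgue_on K) f" using a by simp
   have "(LINT x|lebesgue_on K. f x) = (LINT x|lebesgue_on K. indicator K x * f x)"
    by (rule Bochner_Integration.integral_cong) auto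
   also have "... = (LINT x|M. indicator K x * f x)"
    by (rule integral_extend_by_zero[OF KM setsOm K(2)]) (use borel_measurable_integrable[OF i] in auto)
   finally show "(LINT x|lebesgue_on K. f x) = (LINT x|M. indicator K x * f x)" .
  qed
  have 1: "integrable (lebesgue_on K) (%x. norm (v k x - \<Phi> x) powr p)" for k using on_K(1)[OF i\<Phi>[OF K]] by simp
  have 2: "(%k. LINT x|lebesgue_on K. norm (v k x - \<Phi> x) powr p) ~~> 0"
   using l\<Phi>[OF K] on_K(2)[OF i\<Phi>[OF K]] by simp
  have m1: "(%x. v k x - \<Phi> x) \<in> borel_measurable (lebesgue_on K)" for k by (rule meas) measurable
  show "integrable (lebesgue_on K) (%x. v k x - \<Phi> x)" "(%k. LINT x|lebesgue_on K. norm (v k x - \<Phi> x)) ~~> 0"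
   using integral_norm_tendsto_zero_of_powr[OF p1 fin m1 1 2] by auto
  obtain \<kappa> \<nu> where k: "0 < \<kappa>" "0 < \<nu>" "AE x in M. x \<in> K --> (\<forall>\<xi>. \<kappa> * norm \<xi> <= H x \<xi> \<and> H x \<xi> <= \<nu> * norm \<xi>)"
   by (rule local_bounds[OF K]) (rule that; assumption)
  have ge: "AE x in M. norm (indicator K x * norm (G k x - F x) powr p) <= norm (\<kappa> powr (- p) * H x (G k x - F x) powr p)" for k
   using k(3)
  proof eventually_elim
   case (elim x)
   note a = elim
   show ?case
   proof (cases "x \<in> K")
    case True
    have "norm (G k x - F x) powr p = \<kappa> powr (- p) * (\<kappa> * norm (G k x - F x)) powr p"
     using k(1) by (simp add: powr_mult powr_minus)
    also have "... <= \<kappa> powr (- p) * H x (G k x - F x) powr p"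
     using a True k(1) p by (intro mult_left_mono powr_mono2) auto
    finally show ?thesis using True by simp
   qed simp
  qed
  have iH: "integrable M (%x. \<kappa> powr (- p) * H x (G k x - F x) powr p)" for k by (intro integrable_mult_right impI iF)
  have iK: "integrable M (%x. indicator K x * norm (G k x - F x) powr p)" for k
  proof (rule Bochner_Integration.integrable_bound[OF iH _ ge])
   have [measurable]: "K \<in> sets M" using KM K(2) by (auto simp: sets_restrict_space)
   show "(%x. indicator K x * norm (G k x - F x) powr p) \<in> borel_measurable M" by measurable
  qed
  have 3: "integrable (lebesgue_on K) (%x. norm (G k x - F x) powr p)" for k using on_K(1)[OF iK] by simp
  have 4: "(%k. LINT x|lebesgue_on K. norm (G k x - F x) powr p) ~~> 0"
  proof (rule Lim_null_comparison[OF always_eventually], rule allI)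
   fix k
   have "(LINT x|lebesgue_on K. norm (G k x - F x) powr p) <= (LINT x|M. \<kappa> powr (- p) * H x (G k x - F x) powr p)"
    unfolding on_K(2)[OF iK] by (rule integral_mono_AE[OF iK iH]) (use ge[of k] in \<open>auto elim!: eventually_mono\<close>)
   also have "... = \<kappa> powr (- p) * E (%x. G k x - F x)" by (simp add: E_def)
   finally show "norm (LINT x|lebesgue_on K. norm (G k x - F x) powr p) <= \<kappa> powr (- p) * E (%x. G k x - F x)"
    by (simp add: Bochner_Integration.integral_nonneg)
   show "(%k. \<kappa> powr (- p) * E (%x. G k x - F x)) ~~> 0" using tendsto_mult[OF tendsto_const lF] by simp
  qed
  have m2: "(%x. G k x - F x) \<in> borel_measurable (lebesgue_on K)" for k by (rule meas) measurable
  show "integrable (lebesgue_on K) (%x. G k x - F x)" "(%k. LINT x|lebesgue_on K. norm (G k x - F x)) ~~> 0"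
   using integral_norm_tendsto_zero_of_powr[OF p1 fin m2 3 4] by auto
 qed
 have \<Phi>L: "\<Phi> \<in> Lp_loc 1 Om"
 proof -
  have "\<Phi> \<in> Lp 1 K" if K: "compact K" "K \<subseteq> Om" for K
  proof -
   have "integrable (lebesgue_on K) (%x. v 0 x - (v 0 x - \<Phi> x))"
    by (rule Bochner_Integration.integrable_diff[OF Lp_locD(2)[OF vL(1) K] loc(1)[OF K]])
   then have "integrable (lebesgue_on K) \<Phi>" by simp
   then show ?thesis by (simp add: Lp_def)
  qed
  then show ?thesis by (simp add: Lp_loc_def)
 qed
 have FL: "F \<in> Lp_loc 1 Om"
 proof -
  have "F \<in> Lp 1 K" if K: "compact K" "K \<subseteq> Om" for K
  proof -
   have "integrable (lebesgue_on K) (%x. G 0 x - (G 0 x - F x))"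
    by (rule Bochner_Integration.integrable_diff[OF Lp_locD(2)[OF vL(2) K] loc(3)[OF K]])
   then have "integrable (lebesgue_on K) F" by simp
   then show ?thesis by (simp add: Lp_def)
  qed
  then show ?thesis by (simp add: Lp_loc_def)
 qed
 show ?thesis unfolding has_weak_gradient_def
 proof (intro conjI ballI \<Phi>L FL)
  fix \<psi> assume \<psi>: "\<psi> \<in> Cc_infty Om"
  obtain K where K: "compact K" "K \<subseteq> Om" "!!x. x \<notin> K ==> \<psi> x = 0 \<and> gradient \<psi> x = 0"
   using Cc_inftyD(5)[OF \<psi>] by blast
  have KM: "K \<in> sets lebesgue" by (rule compact_imp_sets_lebesgue[OF K(1)])
  obtain B where B: "0 < B" "!!x. \<bar>\<psi> x\<bar> <= B" "!!x. norm (gradient \<psi> x) <= B"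
   by (rule Cc_infty_bounded[OF \<psi>]) (rule that; assumption)
  \<comment> \<open>One estimate for both sides of the identity; \<open>d\<close> is the distance of
    the functions or that of the gradients, and \<open>B\<close> bounds the test function and its
    gradient.\<close>
  have lim: "(%k. LINT x|M. h k x) ~~> (LINT x|M. h0 x)"
   if h: "!!k. integrable M (h k)" "integrable M h0" and z: "!!k x. x \<notin> K ==> h k x = h0 x"
    and le: "!!k x. norm (h k x - h0 x) <= B * d k x" and d: "!!k. integrable (lebesgue_on K) (d k)" "(%k. LINT x|lebesgue_on K. d k x) ~~> 0"
   for h :: "nat => real ^ 'n => real ^ 'n" and h0 d
  proof -
   have "norm ((LINT x|M. h k x) - (LINT x|M. h0 x)) <= B * (LINT x|lebesgue_on K. d k x)" for k
   proof -
    have i: "integrable M (%x. h k x - h0 x)" by (rule Bochner_Integration.integrable_diff[OF h])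
    have "(LINT x|M. h k x) - (LINT x|M. h0 x) = (LINT x|M. h k x - h0 x)"
     by (rule Bochner_Integration.integral_diff[OF h, symmetric])
    also have "... = (LINT x|lebesgue_on K. h k x - h0 x)"
     by (rule integral_extend_by_zero[OF KM setsOm K(2) _ borel_measurable_integrable[OF i], symmetric])
      (rule AE_I2, simp add: z)
    also have "norm ... <= (LINT x|lebesgue_on K. B * d k x)"
     by (rule Bochner_Integration.integral_norm_bound_integral[OF integrable_restrict_subset[OF KM setsOm K(2) i]])
      (intro integrable_mult_right impI d(1), rule le)
    also have "... = B * (LINT x|lebesgue_on K. d k x)" by simp
    finally show ?thesis .
   qed
   then have "(%k. (LINT x|M. h k x) - (LINT x|M. h0 x)) ~~> 0"
    by (intro Lim_null_comparison[OF always_eventually tendsto_mult_right_zero[OF d(2)]] allI)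
   then show ?thesis by (rule LIM_zero_cancel)
  qed
  have "(%k. LINT x|M. v k x *r gradient \<psi> x) ~~> (LINT x|M. \<Phi> x *r gradient \<psi> x)"
  proof (rule lim[where d="%k x. norm (v k x - \<Phi> x)"])
   fix k x show "norm (v k x *r gradient \<psi> x - \<Phi> x *r gradient \<psi> x) <= B * norm (v k x - \<Phi> x)"
    using mult_left_mono[OF B(3)[of x], of "\<bar>v k x - \<Phi> x\<bar>"] by (simp add: scaleR_diff_left[symmetric] mult.commute)
  qed (use integrable_test_gradient[OF openOm vL(1) \<psi>] integrable_test_gradient[OF openOm \<Phi>L \<psi>] K(3) loc(1,2)[OF K(1,2)] in auto)
  moreover have "(%k. LINT x|M. \<psi> x *r G k x) ~~> (LINT x|M. \<psi> x *r F x)"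
  proof (rule lim[where d="%k x. norm (G k x - F x)"])
   fix k x show "norm (\<psi> x *r G k x - \<psi> x *r F x) <= B * norm (G k x - F x)"
    using mult_right_mono[OF B(2)[of x], of "norm (G k x - F x)"] by (simp add: scaleR_diff_right[symmetric])
  qed (use integrable_test_scaleR[OF openOm vL(2) \<psi>] integrable_test_scaleR[OF openOm FL \<psi>] K(3) loc(3,4)[OF K(1,2)] in auto)
  then have "(%k. - (LINT x|M. \<psi> x *r G k x)) ~~> - (LINT x|M. \<psi> x *r F x)" by (rule tendsto_minus)
  moreover have "(LINT x|M. v k x *r gradient \<psi> x) = - (LINT x|M. \<psi> x *r G k x)" for k
   using wg[of k] \<psi> by (auto simp: has_weak_gradient_def)
  ultimately show "(LINT x|M. \<Phi> x *r gradient \<psi> x) = - (LINT x|M. \<psi> x *r F x)"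
   using LIMSEQ_unique by simp
 qed
qed


text \<open>The infimum over the points becomes the modulus. It is a genuine lower bound because the
  moduli are nonnegative wherever \<open>H x\<close> is a norm.\<close>

lemma common_modulus:
 assumes "commonly_uniformly_convex Om H"
 obtains m where "!!ep. 0 < ep ==> ep <= 2 ==> 0 < m ep"
  "AE x in M. is_norm (H x) \<and> (\<forall>ep. 0 < ep \<and> ep <= 2 --> m ep <= convexity_modulus (H x) ep)"
proof -
 obtain N where N: "N \<in> null_sets lebesgue" "\<forall>x\<in>Om - N. is_norm (H x)"
  "\<forall>ep\<in>{0<..2}. 0 < (INF x\<in>Om - N. convexity_modulus (H x) ep)"
  using assms unfolding commonly_uniformly_convex_def by blast
 show ?thesis
 proof (rule that[of "%ep. INF x\<in>Om - N. convexity_modulus (H x) ep"])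
  have "AE x in lebesgue. x \<notin> N" using N(1) by (rule AE_not_in)
  then show "AE x in M. is_norm (H x) \<and> (\<forall>ep. 0 < ep \<and> ep <= 2 --> (INF x\<in>Om - N. convexity_modulus (H x) ep) <= convexity_modulus (H x) ep)"
   unfolding AE_M_iff
  proof eventually_elim
   fix x assume x: "x \<notin> N"
   show "x \<in> Om --> is_norm (H x) \<and> (\<forall>ep. 0 < ep \<and> ep <= 2 --> (INF x\<in>Om - N. convexity_modulus (H x) ep) <= convexity_modulus (H x) ep)"
   proof (intro impI conjI allI)
    assume xOm: "x \<in> Om"
    show "is_norm (H x)" using N(2) x xOm by blast
    fix ep :: real assume ep: "0 < ep \<and> ep <= 2"
    have "bdd_below ((%x. convexity_modulus (H x) ep) ` (Om - N))"
     by (rule bdd_belowI[of _ 0]) (use N(2) ep convexity_modulus_nonneg in blast)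
    then show "(INF x\<in>Om - N. convexity_modulus (H x) ep) <= convexity_modulus (H x) ep"
     using x xOm by (intro cINF_lower) auto
   qed
  qed
 qed (use N(3) in auto)
qed

text \<open>Bounded weighted norms put \<Phi> into the weighted space by Fatou's lemma, after which
  \<open>v\<close> converges to it there and the potential terms converge. As the whole functional
  tends to 0, the gradient energies converge to minus the limit \<open>R \<Phi>\<close> of the
  potential terms. Midpoints of the \<open>v k\<close> converge to \<Phi> in the same weights, so
  their energies are bounded below by quantities with the same limit, and uniform convexity gives a
  Cauchy sequence of gradients.\<close>

lemma minimizing_sequence_converges:
 assumes cc: "commonly_uniformly_convex Om H"
  and V: "V \<in> Lp_loc 1 Om" and gL: "g \<in> Lp_loc 1 Om" and cL: "c \<in> Lp_loc 1 Om"
  and nn: "!!\<phi> G. sob p Om \<phi> G ==> S * P (%x. \<bar>g x\<bar>) \<phi> <= E G + P V \<phi>"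
  and C: "0 < C" "!!\<phi> G. sob p Om \<phi> G ==> C * P (%x. \<bar>c x\<bar>) \<phi> <= E G + P V \<phi>"
  and s: "!!k. sob p Om (v k) (G k)" and v0: "!!k x. 0 <= v k x"
  and e: "!!k. E (G k) + P (%x. V x - S * \<bar>g x\<bar>) (v k) <= 2 * (1/2) ^ k"
  and r: "!!k. r k \<in> borel_measurable M" "!!k x. 0 <= r k x"
  and rI: "!!k. (\<integral>\<^sup>+x. ennreal ((\<bar>V x\<bar> + \<bar>g x\<bar> + \<bar>c x\<bar> + 1) * r k x powr p) \<partial>M) <= ennreal ((1/2) ^ k)"
  and lim: "AE x in M. (%k. v k x) ~~> \<Phi> x" and le: "AE x in M. \<forall>k. v k x <= \<Phi> x + r k x"
  and \<Phi>: "\<Phi> \<in> Lp_loc p Om" and \<Phi>0: "AE x in M. 0 < \<Phi> x"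
  and B1: "!!k. P (%x. max (- V x) 0) (v k) <= B1" and B2: "!!k. P (%x. \<bar>g x\<bar>) (v k) <= B2"
 obtains F where "has_weak_gradient Om \<Phi> F" "F \<in> borel_measurable M" "integrable M (%x. H x (F x) powr p)"
  "integrable M (%x. (\<bar>V x\<bar> + \<bar>g x\<bar> + \<bar>c x\<bar>) * \<bar>\<Phi> x\<bar> powr p)"
  "E F + P (%x. V x - S * \<bar>g x\<bar>) \<Phi> = 0"
  "!!k. integrable M (%x. H x (G k x - F x) powr p)" "(%k. E (%x. G k x - F x)) ~~> 0"
  "!!k. integrable M (%x. (\<bar>V x\<bar> + \<bar>g x\<bar> + \<bar>c x\<bar>) * \<bar>v k x - \<Phi> x\<bar> powr p)"
  "(%k. LINT x|M. (\<bar>V x\<bar> + \<bar>g x\<bar> + \<bar>c x\<bar>) * \<bar>v k x - \<Phi> x\<bar> powr p) ~~> 0"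
proof -
 have p: "1 <= p" "0 <= p" "0 < p" using p1 by auto
 define X where "X x = \<bar>V x\<bar> + \<bar>g x\<bar> + \<bar>c x\<bar>" for x
 have L: "(%x. \<bar>V x\<bar>) \<in> Lp_loc 1 Om" "(%x. \<bar>g x\<bar>) \<in> Lp_loc 1 Om" "(%x. \<bar>c x\<bar>) \<in> Lp_loc 1 Om"
  "(%x. max (V x) 0) \<in> Lp_loc 1 Om" "(%x. max (- V x) 0) \<in> Lp_loc 1 Om"
  using Lp_loc_linear(1,5,6)[OF V V] Lp_loc_linear(1)[OF gL gL] Lp_loc_linear(1)[OF cL cL] by auto
 note [measurable] = Lp_loc_measurable[OF V] Lp_loc_measurable[OF gL] Lp_loc_measurable[OF cL]
  Lp_loc_measurable[OF \<Phi>] sob_measurable(1,2)[OF s]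
 have Xm[measurable]: "X \<in> borel_measurable M" unfolding X_def[abs_def] by measurable
 have X0: "0 <= X x" for x by (simp add: X_def)
 have PX: "P X (v k) = P (%x. \<bar>V x\<bar>) (v k) + P (%x. \<bar>g x\<bar>) (v k) + P (%x. \<bar>c x\<bar>) (v k)"
  and iX: "integrable M (%x. X x * \<bar>v k x\<bar> powr p)" for k
 proof -
  note i = sob_integrable_P[OF s[of k] L(1)] sob_integrable_P[OF s[of k] L(2)] sob_integrable_P[OF s[of k] L(3)]
  have eq: "X x * t = \<bar>V x\<bar> * t + \<bar>g x\<bar> * t + \<bar>c x\<bar> * t" for x t by (simp add: X_def algebra_simps)
  show "integrable M (%x. X x * \<bar>v k x\<bar> powr p)" unfolding eq by (intro Bochner_Integration.integrable_add i)
  show "P X (v k) = P (%x. \<bar>V x\<bar>) (v k) + P (%x. \<bar>g x\<bar>) (v k) + P (%x. \<bar>c x\<bar>) (v k)"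
   unfolding P_def eq using i by simp
 qed
 \<comment> \<open>|V| = V + 2 V^-: the part with \<open>V\<close> is controlled by the functional
   and the part with V^- by hypothesis.\<close>
 have PabsV: "P (%x. \<bar>V x\<bar>) (v k) = P V (v k) + 2 * P (%x. max (- V x) 0) (v k)" for k
 proof -
  have "P V (v k) + 2 * P (%x. max (- V x) 0) (v k) = (LINT x|M. V x * \<bar>v k x\<bar> powr p + 2 * (max (- V x) 0 * \<bar>v k x\<bar> powr p))"
   unfolding P_def using sob_integrable_P[OF s[of k] V] sob_integrable_P[OF s[of k] L(5)]
   by (subst Bochner_Integration.integral_add) auto
  also have "... = P (%x. \<bar>V x\<bar>) (v k)"
   unfolding P_def by (rule Bochner_Integration.integral_cong) (auto simp: max_def)
  finally show ?thesis by simp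
 qed
 have Q0: "0 <= E (G k) + P (%x. V x - S * \<bar>g x\<bar>) (v k)" for k
  using nn[OF s[of k]] by (simp add: P_diff[OF s V gL])
 have Q1: "E (G k) + P V (v k) <= 2 + \<bar>S\<bar> * B2" for k
 proof -
  have "(1/2 :: real) ^ k <= 1" by (rule power_le_one) auto
  moreover have "S * P (%x. \<bar>g x\<bar>) (v k) <= \<bar>S\<bar> * B2"
  proof -
   have "0 <= P (%x. \<bar>g x\<bar>) (v k)" by (rule P_nonneg) simp
   then have "S * P (%x. \<bar>g x\<bar>) (v k) <= \<bar>S\<bar> * P (%x. \<bar>g x\<bar>) (v k)" by (intro mult_right_mono) auto
   also have "... <= \<bar>S\<bar> * B2" by (intro mult_left_mono B2) auto
   finally show ?thesis .
  qed
  ultimately show ?thesis using e[of k] unfolding P_diff[OF s V gL] by linarith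
 qed
 \<comment> \<open>The sum of the bounds for the three weights |V|, |g| and |c|; the last comes from
   the Hardy inequality with constant \<open>C\<close>.\<close>
 define BX where "BX = (2 + \<bar>S\<bar> * B2 + 2 * B1) + B2 + (2 + \<bar>S\<bar> * B2) / C"
 have PXle: "P X (v k) <= BX" for k
 proof -
  have "P (%x. \<bar>c x\<bar>) (v k) <= (2 + \<bar>S\<bar> * B2) / C"
   using order_trans[OF C(2)[OF s[of k]] Q1[of k]] C(1) by (simp add: le_divide_eq mult.commute)
  moreover have "P (%x. \<bar>V x\<bar>) (v k) <= 2 + \<bar>S\<bar> * B2 + 2 * B1"
   unfolding PabsV using Q1[of k] B1[of k] E_nonneg[of "G k"] by linarith
  ultimately show ?thesis unfolding PX BX_def using B2[of k] by linarith
 qed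
 have i\<Phi>: "integrable M (%x. X x * \<bar>\<Phi> x\<bar> powr p)"
 proof (rule integrableI_nonneg)
  have "(\<integral>\<^sup>+x. ennreal (X x * \<bar>\<Phi> x\<bar> powr p) \<partial>M) <= ennreal BX"
  proof (rule nn_integral_Fatou_le)
   show "AE x in M. (%k. X x * \<bar>v k x\<bar> powr p) ~~> X x * \<bar>\<Phi> x\<bar> powr p"
    using lim by eventually_elim (use p1 in \<open>intro tendsto_mult tendsto_const tendsto_powr2 tendsto_rabs, auto\<close>)
   show "\<forall>\<^sub>F k in sequentially. (\<integral>\<^sup>+x. ennreal (X x * \<bar>v k x\<bar> powr p) \<partial>M) <= ennreal BX"
    using nn_integral_eq_integral[OF iX] X0 PXle by (auto simp: P_def intro!: always_eventually ennreal_leI)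
  qed measurable
  then show "(\<integral>\<^sup>+x. ennreal (X x * \<bar>\<Phi> x\<bar> powr p) \<partial>M) < \<infinity>" by (rule le_less_trans) simp
 qed (use X0 in \<open>measurable, simp\<close>)
 \<comment> \<open>Weights up to \<open>X + 1\<close> are allowed, in line with the estimate of
   \<open>r\<close>; the extra 1 admits indicators of compact sets, which give convergence in L^p
   there.\<close>
 have conv: "integrable M (%x. Z x * \<bar>v k x - \<Phi> x\<bar> powr p)" "(%k. LINT x|M. Z x * \<bar>v k x - \<Phi> x\<bar> powr p) ~~> 0"
  if "Z \<in> borel_measurable M" "!!x. 0 <= Z x" "!!x. Z x <= X x + 1" "integrable M (%x. Z x * \<bar>\<Phi> x\<bar> powr p)" for Z k
 proof -
  have Z: "AE x in M. 0 <= Z x \<and> Z x <= \<bar>V x\<bar> + \<bar>g x\<bar> + \<bar>c x\<bar> + 1" using that(2,3) by (simp add: X_def)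
  show "integrable M (%x. Z x * \<bar>v k x - \<Phi> x\<bar> powr p)" "(%k. LINT x|M. Z x * \<bar>v k x - \<Phi> x\<bar> powr p) ~~> 0"
   by (rule weighted_minima_tendsto[OF sob_measurable(1)[OF s] v0 r rI lim le Lp_loc_measurable[OF \<Phi>] \<Phi>0 that(1) Z that(4)])+
 qed
 note convX = conv[OF Xm X0 _ i\<Phi>, simplified]
 have convZ: "integrable M (%x. Z x * \<bar>\<Phi> x\<bar> powr p)" "(%k. P Z (u k)) ~~> P Z \<Phi>"
  if Zm[measurable]: "Z \<in> borel_measurable M" and Z: "!!x. 0 <= Z x" "!!x. Z x <= X x" and um[measurable]: "!!k. u k \<in> borel_measurable M"
   and i: "!!k. integrable M (%x. X x * \<bar>u k x - \<Phi> x\<bar> powr p)" and l: "(%k. LINT x|M. X x * \<bar>u k x - \<Phi> x\<bar> powr p) ~~> 0"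
  for Z and u :: "nat => real ^ 'n => real"
 proof -
  have le: "norm (Z x * t powr p) <= norm (X x * t powr p)" for x t
   using Z(1,2)[of x] by (simp add: mult_right_mono)
  show i1: "integrable M (%x. Z x * \<bar>\<Phi> x\<bar> powr p)"
   by (rule Bochner_Integration.integrable_bound[OF i\<Phi>]) (measurable, rule AE_I2, rule le)
  have i2: "integrable M (%x. Z x * \<bar>u k x - \<Phi> x\<bar> powr p)" for k
   by (rule Bochner_Integration.integrable_bound[OF i[of k]]) (measurable, rule AE_I2, rule le)
  have "(%k. LINT x|M. Z x * \<bar>u k x - \<Phi> x\<bar> powr p) ~~> 0"
  proof (rule Lim_null_comparison[OF always_eventually l], rule allI)
   fix k
   have "(LINT x|M. Z x * \<bar>u k x - \<Phi> x\<bar> powr p) <= (LINT x|M. X x * \<bar>u k x - \<Phi> x\<bar> powr p)"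
    by (rule integral_mono[OF i2 i]) (use Z in \<open>simp add: mult_right_mono\<close>)
   moreover have "0 <= (LINT x|M. Z x * \<bar>u k x - \<Phi> x\<bar> powr p)"
    using Z(1) by (intro Bochner_Integration.integral_nonneg) simp
   ultimately show "norm (LINT x|M. Z x * \<bar>u k x - \<Phi> x\<bar> powr p) <= (LINT x|M. X x * \<bar>u k x - \<Phi> x\<bar> powr p)" by simp
  qed
  from weighted_powr_tendsto(2)[OF p1 Zm Lp_loc_measurable[OF \<Phi>] um AE_I2[OF Z(1)] i1 i2 this]
  show "(%k. P Z (u k)) ~~> P Z \<Phi>" unfolding P_def .
 qed
 \<comment> \<open>The potential part written with nonnegative weights, each of which is dominated
   by \<open>X\<close>; in this form continuity in the weighted norm is immediate.\<close>
 define R where "R u = P (%x. max (V x) 0) u - P (%x. max (- V x) 0) u - S * P (%x. \<bar>g x\<bar>) u" for u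
 have Zs: "(%x. max (V x) 0) \<in> borel_measurable M" "(%x. max (- V x) 0) \<in> borel_measurable M" "(%x. \<bar>g x\<bar>) \<in> borel_measurable M"
  "max (V x) 0 <= X x" "max (- V x) 0 <= X x" "\<bar>g x\<bar> <= X x" for x
  by (measurable, auto simp: X_def)
 have Req: "P (%x. V x - S * \<bar>g x\<bar>) u = R u"
  if "integrable M (%x. max (V x) 0 * \<bar>u x\<bar> powr p)" "integrable M (%x. max (- V x) 0 * \<bar>u x\<bar> powr p)"
   "integrable M (%x. \<bar>g x\<bar> * \<bar>u x\<bar> powr p)" for u
 proof -
  have "(V x - S * \<bar>g x\<bar>) * t = max (V x) 0 * t - max (- V x) 0 * t - S * (\<bar>g x\<bar> * t)" for x t
   by (auto simp: max_def algebra_simps)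
  then show ?thesis unfolding P_def R_def using that by simp
 qed
 have Rsob: "P (%x. V x - S * \<bar>g x\<bar>) u = R u" if "sob p Om u A" for u A
  by (rule Req) (rule sob_integrable_P[OF that] L)+
 have Rlim: "(%k. R (u k)) ~~> R \<Phi>"
  if "!!k. u k \<in> borel_measurable M" "!!k. integrable M (%x. X x * \<bar>u k x - \<Phi> x\<bar> powr p)"
   "(%k. LINT x|M. X x * \<bar>u k x - \<Phi> x\<bar> powr p) ~~> 0" for u :: "nat => real ^ 'n => real"
  unfolding R_def
  by (intro tendsto_diff tendsto_mult tendsto_const convZ(2)[OF Zs(1) _ Zs(4) that] convZ(2)[OF Zs(2) _ Zs(5) that] convZ(2)[OF Zs(3) _ Zs(6) that]) auto
 have Elim: "(%k. E (G k)) ~~> - R \<Phi>"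
 proof -
  have "(%k. E (G k) + R (v k)) ~~> 0"
  proof (rule Lim_null_comparison[OF always_eventually], rule allI)
   show "norm (E (G k) + R (v k)) <= 2 * (1/2) ^ k" for k using Q0[of k] e[of k] unfolding Rsob[OF s] by simp
   show "(%k. 2 * (1/2 :: real) ^ k) ~~> 0" by (intro tendsto_mult_right_zero LIMSEQ_power_zero) simp
  qed
  from tendsto_diff[OF this Rlim[OF sob_measurable(1)[OF s] convX(1) convX(2)]] show ?thesis by simp
 qed
 obtain m where m: "!!ep. 0 < ep ==> ep <= 2 ==> 0 < m ep"
  "AE x in M. is_norm (H x) \<and> (\<forall>ep. 0 < ep \<and> ep <= 2 --> m ep <= convexity_modulus (H x) ep)"
  by (rule common_modulus[OF cc]) (rule that; assumption)
 have cauchy: "\<exists>n. \<forall>k\<ge>n. \<forall>l\<ge>n. E (%x. G k x - G l x) < d" if d: "0 < d" for d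
 proof (rule ccontr)
  assume "\<not> ?thesis"
  then have "\<forall>n. \<exists>k l. n <= k \<and> n <= l \<and> d <= E (%x. G k x - G l x)" by (auto simp: not_less)
  \<comment> \<open>If the Cauchy property fails, pairs of indices beyond every bound keep a
    distance \<open>d\<close>; both index sequences tend to infinity, though they need not
    increase.\<close>
  then obtain a b where ab: "!!n. n <= a n" "!!n. n <= b n" "!!n. d <= E (%x. G (a n) x - G (b n) x)" by metis
  have at: "filterlim a sequentially sequentially" "filterlim b sequentially sequentially"
   by (rule filterlim_at_top_mono[OF filterlim_ident], use ab in \<open>auto intro!: always_eventually\<close>)+
  define u where "u n x = (1/2) * (v (a n) x + v (b n) x)" for n x
  have su: "sob p Om (u n) (%x. (1/2) *r (G (a n) x + G (b n) x))" for n
   unfolding u_def[abs_def] by (rule sob_cmult[OF sob_add[OF s s p(1)] p(1)])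
  have ule: "X x * \<bar>u n x - \<Phi> x\<bar> powr p <= X x * \<bar>v (a n) x - \<Phi> x\<bar> powr p + X x * \<bar>v (b n) x - \<Phi> x\<bar> powr p" for n x
  proof -
   have "\<bar>u n x - \<Phi> x\<bar> <= max \<bar>v (a n) x - \<Phi> x\<bar> \<bar>v (b n) x - \<Phi> x\<bar>" 
   proof -
    have "\<bar>1 / 2 * (a + b) - c\<bar> <= d" if "\<bar>a - c\<bar> <= d" "\<bar>b - c\<bar> <= d" for a b c d :: real
     using that by (auto simp: abs_le_iff field_simps)
    then show ?thesis unfolding u_def by (meson max.cobounded1 max.cobounded2)
   qed
   then have "\<bar>u n x - \<Phi> x\<bar> powr p <= (max \<bar>v (a n) x - \<Phi> x\<bar> \<bar>v (b n) x - \<Phi> x\<bar>) powr p" using p by (intro powr_mono2) auto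
   also have "... <= \<bar>v (a n) x - \<Phi> x\<bar> powr p + \<bar>v (b n) x - \<Phi> x\<bar> powr p" by (simp add: max_def)
   finally show ?thesis unfolding distrib_left[symmetric] using X0 by (intro mult_left_mono) auto
  qed
  have iab: "integrable M (%x. X x * \<bar>v (a n) x - \<Phi> x\<bar> powr p + X x * \<bar>v (b n) x - \<Phi> x\<bar> powr p)" for n
   by (intro Bochner_Integration.integrable_add convX(1))
  have um[measurable]: "u n \<in> borel_measurable M" for n by (rule sob_measurable(1)[OF su])
  have ui: "integrable M (%x. X x * \<bar>u n x - \<Phi> x\<bar> powr p)" for n
  proof (rule Bochner_Integration.integrable_bound[OF iab[of n]])
   show "AE x in M. norm (X x * \<bar>u n x - \<Phi> x\<bar> powr p) <= norm (X x * \<bar>v (a n) x - \<Phi> x\<bar> powr p + X x * \<bar>v (b n) x - \<Phi> x\<bar> powr p)"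
    using ule[of _ n] X0 by (intro AE_I2) (simp add: abs_mult)
  qed measurable
  have ul: "(%n. LINT x|M. X x * \<bar>u n x - \<Phi> x\<bar> powr p) ~~> 0"
  proof (rule Lim_null_comparison[OF always_eventually], rule allI)
   fix n
   have "(LINT x|M. X x * \<bar>u n x - \<Phi> x\<bar> powr p) <= (LINT x|M. X x * \<bar>v (a n) x - \<Phi> x\<bar> powr p) + (LINT x|M. X x * \<bar>v (b n) x - \<Phi> x\<bar> powr p)"
    unfolding Bochner_Integration.integral_add[OF convX(1) convX(1), symmetric] by (rule integral_mono[OF ui iab ule])
   moreover have "0 <= (LINT x|M. X x * \<bar>u n x - \<Phi> x\<bar> powr p)" using X0 by (intro Bochner_Integration.integral_nonneg) simp
   ultimately show "norm (LINT x|M. X x * \<bar>u n x - \<Phi> x\<bar> powr p) <= (LINT x|M. X x * \<bar>v (a n) x - \<Phi> x\<bar> powr p) + (LINT x|M. X x * \<bar>v (b n) x - \<Phi> x\<bar> powr p)" by simp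
   show "(%n. (LINT x|M. X x * \<bar>v (a n) x - \<Phi> x\<bar> powr p) + (LINT x|M. X x * \<bar>v (b n) x - \<Phi> x\<bar> powr p)) ~~> 0"
    using tendsto_add[OF filterlim_compose[OF convX(2) at(1)] filterlim_compose[OF convX(2) at(2)]] by simp
  qed
  have "(%n. LINT x|M. H x (G (a n) x - G (b n) x) powr p) ~~> 0"
  proof (rule uniform_convexity_integral[OF p1 m(1) m(2)])
   show "(%n. LINT x|M. H x (G (a n) x) powr p) ~~> - R \<Phi>" "(%n. LINT x|M. H x (G (b n) x) powr p) ~~> - R \<Phi>"
    using filterlim_compose[OF Elim at(1)] filterlim_compose[OF Elim at(2)] by (simp_all add: E_def)
   show "(%n. - R (u n)) ~~> - R \<Phi>" by (intro tendsto_minus Rlim um ui ul)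
   \<comment> \<open>This is nonnegativity of the functional at the midpoint.\<close>
   show "- R (u n) <= (LINT x|M. H x ((1 / 2) *r (G (a n) x + G (b n) x)) powr p)" for n
    using nn[OF su[of n]] Rsob[OF su[of n]] P_diff[OF su[of n] V gL, of S] by (simp add: E_def)
   show "integrable M (%x. H x ((1 / 2) *r (G (a n) x + G (b n) x)) powr p)" for n by (rule sob_integrable_H[OF su])
   show "integrable M (%x. H x (G (a n) x - G (b n) x) powr p)" for n
    by (intro H_diff_integrable sob_measurable(2)[OF s] sob_integrable_H[OF s])
  qed (assumption | rule sob_integrable_H[OF s])+
  then have "(%n. E (%x. G (a n) x - G (b n) x)) ~~> 0" by (simp add: E_def)
  then have "d <= 0" by (rule LIMSEQ_le_const) (use ab(3) in blast)
  then show False using d by simp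
 qed
 obtain F where F: "F \<in> borel_measurable M" "integrable M (%x. H x (F x) powr p)"
  "!!k. integrable M (%x. H x (G k x - F x) powr p)" "(%k. E (%x. G k x - F x)) ~~> 0"
 proof (rule Cauchy_gradients_limit[OF sob_measurable(2)[OF s] sob_integrable_H[OF s] _])
  show "\<exists>n. \<forall>k\<ge>n. \<forall>l\<ge>n. E (%x. G k x - G l x) < d" if "0 < d" for d by (rule cauchy[OF that])
 qed (rule that; assumption)
 have loc: "integrable M (%x. indicator K x * \<bar>v k x - \<Phi> x\<bar> powr p)" "(%k. LINT x|M. indicator K x * \<bar>v k x - \<Phi> x\<bar> powr p) ~~> 0"
  if K: "compact K" "K \<subseteq> Om" for K k
 proof -
  have KM: "K \<in> sets lebesgue" by (rule compact_imp_sets_lebesgue[OF K(1)])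
  have "K \<in> sets M" using KM K(2) by (auto simp: sets_restrict_space)
  then have 1: "(indicator K :: _ => real) \<in> borel_measurable M" by simp
  have "integrable (lebesgue_on K) (%x. indicator K x * \<bar>\<Phi> x\<bar> powr p) = integrable (lebesgue_on K) (%x. norm (\<Phi> x) powr p)"
   by (rule Bochner_Integration.integrable_cong) auto
  moreover have "\<Phi> \<in> Lp p K" using \<Phi> K by (auto simp: Lp_loc_def)
  ultimately have "integrable (lebesgue_on K) (%x. indicator K x * \<bar>\<Phi> x\<bar> powr p)" by (auto simp: Lp_def)
  then have 2: "integrable M (%x. indicator K x * \<bar>\<Phi> x\<bar> powr p)"
   by (rule integrable_extend_by_zero[OF KM setsOm K(2), rotated]) auto
  have 3: "indicator K x <= X x + 1" for x using X0[of x] by (simp add: indicator_def)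
  show "integrable M (%x. indicator K x * \<bar>v k x - \<Phi> x\<bar> powr p)" "(%k. LINT x|M. indicator K x * \<bar>v k x - \<Phi> x\<bar> powr p) ~~> 0"
   by (rule conv[OF 1 _ 3 2], simp)+
 qed
 have wgF: "has_weak_gradient Om \<Phi> F"
  by (rule has_weak_gradient_limit[OF s Lp_loc_measurable[OF \<Phi>] F(1,3,4) loc])
 have "(%k. E (G k)) ~~> E F" by (rule E_tendsto[OF F(1,2) sob_measurable(2)[OF s] F(3,4)])
 then have "E F = - R \<Phi>" using Elim by (rule LIMSEQ_unique)
 moreover have "P (%x. V x - S * \<bar>g x\<bar>) \<Phi> = R \<Phi>"
  by (rule Req) (rule convZ(1)[OF Zs(1) _ Zs(4) sob_measurable(1)[OF s] convX] convZ(1)[OF Zs(2) _ Zs(5) sob_measurable(1)[OF s] convX]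
   convZ(1)[OF Zs(3) _ Zs(6) sob_measurable(1)[OF s] convX], simp)+
 ultimately have "E F + P (%x. V x - S * \<bar>g x\<bar>) \<Phi> = 0" by simp
 then show ?thesis
  using that[OF wgF F(1,2) i\<Phi>[unfolded X_def] _ F(3,4) convX[unfolded X_def]] by blast
qed

section \<open>Membership in the energy space and the Hardy constant\<close>

lemma W_tilde0_limit:
 assumes V: "V \<in> Lp_loc 1 Om" and c: "continuous_on Om c" "!!x. x \<in> Om ==> 0 < c x"
  and \<Phi>: "\<Phi> \<in> borel_measurable M" "integrable M (%x. (\<bar>V x\<bar> + c x) * \<bar>\<Phi> x\<bar> powr p)"
  and F: "has_weak_gradient Om \<Phi> F" "F \<in> borel_measurable M" "integrable M (%x. H x (F x) powr p)"
  and s: "!!k::nat. sob p Om (v k) (G k)"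
  and lG: "!!k. integrable M (%x. H x (G k x - F x) powr p)" "(%k. E (%x. G k x - F x)) ~~> 0"
  and lv: "!!k. integrable M (%x. (\<bar>V x\<bar> + c x) * \<bar>v k x - \<Phi> x\<bar> powr p)"
   "(%k. LINT x|M. (\<bar>V x\<bar> + c x) * \<bar>v k x - \<Phi> x\<bar> powr p) ~~> 0"
 shows "\<Phi> \<in> W_tilde0 p H V c Om"
 unfolding W_tilde0_def
proof (intro CollectI conjI allI impI)
 have p: "1 <= p" "0 < p" using p1 by auto
 show "\<Phi> \<in> W_tilde p H V c Om" unfolding W_tilde_def using \<Phi> F by blast
 fix ep :: real assume ep: "0 < ep"
 define D where "D k = E (%x. G k x - F x) + (LINT x|M. (\<bar>V x\<bar> + c x) * \<bar>v k x - \<Phi> x\<bar> powr p)" for k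
 have "D ~~> 0 + 0" unfolding D_def[abs_def] by (intro tendsto_add lG(2) lv(2))
 then have "\<forall>\<^sub>F k in sequentially. D k < ep powr p" by (rule order_tendstoD(2)) (use ep in simp)
 then obtain k where k: "D k < ep powr p" by (auto simp: eventually_sequentially)
 have "0 <= (LINT x|M. (\<bar>V x\<bar> + c x) * \<bar>v k x - \<Phi> x\<bar> powr p)"
  by (rule integral_nonneg_AE, rule AE_I2) (use c(2) in \<open>simp add: less_imp_le\<close>)
 then have D0: "0 <= D k" unfolding D_def using E_nonneg[of "%x. G k x - F x"] by linarith
 note [measurable] = Lp_loc_measurable[OF V] Lp_loc_measurable[OF continuous_on_imp_Lp_loc[OF c(1)]] \<Phi>(1) F(2) sob_measurable(1,2)[OF s]
 have [measurable]: "(%x. H x (G k x - F x)) \<in> borel_measurable M" by (rule measurable_H) measurable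
 let ?f = "%x. H x (G k x - F x) powr p + (\<bar>V x\<bar> + c x) * \<bar>v k x - \<Phi> x\<bar> powr p"
 have fm: "?f \<in> borel_measurable M" by measurable
 have "AE x in M. weak_gradient Om (%x. \<Phi> x - v k x) x = F x - G k x"
  by (rule weak_gradient_AE[OF openOm has_weak_gradient_diff[OF openOm F(1) sob_has_weak_gradient(1)[OF s p(1) openOm]]])
 then have AEw: "AE x in M. ?f x = H x (weak_gradient Om (%x. \<Phi> x - v k x) x) powr p + (\<bar>V x\<bar> + c x) * \<bar>\<Phi> x - v k x\<bar> powr p"
  using AE_norm by eventually_elim (simp add: is_normD(8) abs_minus_commute)
 have "(LINT x|M. H x (weak_gradient Om (%x. \<Phi> x - v k x) x) powr p + (\<bar>V x\<bar> + c x) * \<bar>\<Phi> x - v k x\<bar> powr p) = (LINT x|M. ?f x)"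
  by (rule integral_cong_AE[OF fm borel_measurable_lebesgue_on_AE[OF setsOm fm AEw] AEw, symmetric])
 also have "... = D k" unfolding D_def E_def by (rule Bochner_Integration.integral_add[OF lG(1) lv(1)])
 finally have "W_tilde_norm p H V c Om (%x. \<Phi> x - v k x) = D k powr (1 / p)" by (simp add: W_tilde_norm_def)
 also have "... < (ep powr p) powr (1 / p)" using k D0 p by (intro powr_less_mono2) auto
 also have "... = ep" using ep p by (simp add: powr_powr)
 finally show "\<exists>\<phi>\<in>W1p p Om \<inter> Cc Om \<inter> W_tilde p H V c Om. W_tilde_norm p H V c Om (%x. \<Phi> x - \<phi> x) < ep"
  using sob_in_W_tilde0(2,3,4)[OF V openOm subset_refl c(1) s] by blast
qed

text \<open>The real infimum is a lower bound only of a set bounded below, which nonnegativity of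
  the functional guarantees. If the integral against |g| vanishes, the claim is this
  nonnegativity.\<close>

lemma hardy_const_le:
 assumes V: "V \<in> Lp_loc 1 Om" and gL: "g \<in> Lp_loc 1 Om" and nn: "nonneg_functional p H V Om" and s: "sob p Om \<phi> G"
 shows "hardy_const p H V Om g * P (%x. \<bar>g x\<bar>) \<phi> <= E G + P V \<phi>"
proof -
 have p: "1 <= p" using p1 by simp
 let ?A = "{energy p H V Om \<phi> / (LINT x|M. \<bar>g x\<bar> * \<bar>\<phi> x\<bar> powr p) | \<phi>.
    \<phi> \<in> W1p p Om \<inter> Cc Om \<and> 0 < (LINT x|M. \<bar>g x\<bar> * \<bar>\<phi> x\<bar> powr p)}"
 have e0: "0 <= energy p H V Om \<phi>" if \<phi>: "\<phi> \<in> W1p p Om" "\<phi> \<in> Cc Om" for \<phi>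
 proof -
  obtain A where A: "sob p Om \<phi> A" by (rule W1p_Cc_imp_sob[OF openOm p \<phi>])
  show ?thesis using nonneg_sob[OF V nn A] energy_sob[OF openOm subset_refl A V] by simp
 qed
 have bdd: "bdd_below ?A" by (rule bdd_belowI[of _ 0]) (use e0 in auto)
 have P0: "0 <= P (%x. \<bar>g x\<bar>) \<phi>" by (rule P_nonneg) simp
 show ?thesis
 proof (cases "P (%x. \<bar>g x\<bar>) \<phi> = 0")
  case True then show ?thesis using nonneg_sob[OF V nn s] by simp
 next
  case False
  then have D: "0 < P (%x. \<bar>g x\<bar>) \<phi>" using P0 by simp
  have "energy p H V Om \<phi> / P (%x. \<bar>g x\<bar>) \<phi> \<in> ?A"
   using sob_has_weak_gradient(4,5)[OF s p openOm] D unfolding P_def by blast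
  then have "hardy_const p H V Om g <= (E G + P V \<phi>) / P (%x. \<bar>g x\<bar>) \<phi>"
   unfolding hardy_const_def energy_sob[OF openOm subset_refl s V, symmetric] by (intro cInf_lower bdd)
  then show ?thesis using D by (simp add: le_divide_eq)
 qed
qed

text \<open>A compact set lies in some \<open>om i\<close>, and in every range of \<open>p\<close>
  the Morrey space there consists of functions that are integrable at least locally.\<close>

lemma morrey_tilde_imp_Lp_loc:
 assumes "V \<in> morrey_tilde_loc p q Om" shows "V \<in> Lp_loc 1 Om"
proof -
 have "V \<in> Lp 1 K" if K: "compact K" "K \<subseteq> Om" for K
 proof -
  obtain i where i: "K \<subseteq> om i" by (rule compact_subset_om[OF K])
  have "V \<in> morrey p q (om i)"
   using assms om(1,2)[of i] by (auto simp: morrey_tilde_loc_def morrey_loc_def)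
  then consider "V \<in> Lp_loc 1 (om i)" | "V \<in> Lp 1 (om i)"
   unfolding morrey_def Let_def by (auto split: if_splits)
  then show ?thesis
  proof cases
   case 1 then show ?thesis using K(1) i by (auto simp: Lp_loc_def)
  next
   case 2
   have "K \<in> sets lebesgue" by (rule compact_imp_sets_lebesgue[OF K(1)])
   then have "integrable (lebesgue_on K) (%x. norm (V x) powr 1)"
    using 2 om(5)[of i] by (intro integrable_restrict_subset[OF _ _ i]) (auto simp: Lp_def)
   moreover have "V \<in> borel_measurable (lebesgue_on K)"
    by (rule measurable_restrict_mono[OF _ i]) (use 2 in \<open>simp add: Lp_def\<close>)
   ultimately show ?thesis by (simp add: Lp_def)
  qed
 qed
 then show ?thesis by (simp add: Lp_loc_def)
qed

end

theorem theorem4p27: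
  fixes p q S :: real
    and \<Omega> :: "(real ^ 'n) set"
    and \<omega> :: "nat \<Rightarrow> (real ^ 'n) set"
    and H :: "real ^ 'n \<Rightarrow> real ^ 'n \<Rightarrow> real"
    and \<delta> V g \<Phi> :: "real ^ 'n \<Rightarrow> real"
    and \<V> :: "(real ^ 'n) set \<Rightarrow> real ^ 'n \<Rightarrow> real"
  assumes "1 < p" and "2 \<le> CARD('n)"
    and "is_domain \<Omega>"
    and "smooth_exhaustion \<Omega> \<omega>"
    and "\<And>i. is_domain (\<omega> (Suc i) - closure (\<omega> i))"
    and "admissible \<Omega> H"
    and "commonly_uniformly_convex \<Omega> H"
    and "bregman_bound p \<Omega> H \<delta>"
    and "V \<in> morrey_tilde_loc p q \<Omega>"
    and "gradient_regularity p \<delta> H V \<Omega>"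
    and "subcritical p H V \<Omega>"
    and "reference_weights p H V \<Omega> \<V>"
    and "g \<in> hardy_weights p H V \<Omega> \<inter> morrey_tilde_loc p q \<Omega>"
    and "\<not> (AE x in lebesgue_on \<Omega>. g x = 0)"
    and "S = hardy_const p H V \<Omega> g"
    and "ereal S < hardy_const_infty p H V \<V> \<Omega> \<omega> g"
    and "critical p H (\<lambda>x. V x - S * \<bar>g x\<bar>) \<Omega>"
    and "gradient_regularity p \<delta> H (\<lambda>x. V x - S * \<bar>g x\<bar>) \<Omega>"
    and "\<And>i. gradient_regularity p \<delta> H (\<lambda>x. V x - S * \<bar>g x\<bar>) (\<Omega> - closure (\<omega> i))"
    and "ground_state p H (\<lambda>x. V x - S * \<bar>g x\<bar>) \<Omega> \<Phi>"
    and "(\<integral>\<^sup>+x. ennreal (- min (V x) 0 * \<Phi> x powr p) \<partial>lebesgue_on \<Omega>) < \<infinity>"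
  shows "\<Phi> \<in> W_tilde0 p H V (\<V> \<Omega>) \<Omega> \<and>
    0 < (LINT x|lebesgue_on \<Omega>. \<bar>g x\<bar> * \<Phi> x powr p) \<and>
    S = energy p H V \<Omega> \<Phi> / (LINT x|lebesgue_on \<Omega>. \<bar>g x\<bar> * \<Phi> x powr p)"
proof -
 interpret norm_family_domain p \<Omega> \<omega> H by unfold_locales (fact assms)+
 have p: "1 <= p" "0 < p" using p1 by auto
 note n = \<open>2 <= CARD('n)\<close> and gr = \<open>ground_state p H (%x. V x - S * \<bar>g x\<bar>) \<Omega> \<Phi>\<close>
 have V: "V \<in> Lp_loc 1 \<Omega>" by (rule morrey_tilde_imp_Lp_loc[OF \<open>V \<in> morrey_tilde_loc p q \<Omega>\<close>])
 have g: "g \<in> morrey_tilde_loc p q \<Omega>" and gL: "g \<in> Lp_loc 1 \<Omega>" using assms(13) by (auto simp: hardy_weights_def)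
 have ag: "(%x. \<bar>g x\<bar>) \<in> Lp_loc 1 \<Omega>" by (rule Lp_loc_linear(1)[OF gL gL])
 have nnV: "nonneg_functional p H V \<Omega>" using assms(11) by (simp add: subcritical_def)
 define c where "c = \<V> \<Omega>"
 have c: "continuous_on \<Omega> c" "!!x. x \<in> \<Omega> ==> 0 < c x" "c \<in> hardy_weights p H V \<Omega>"
  using \<open>reference_weights p H V \<Omega> \<V>\<close> dom assms(11) by (auto simp: reference_weights_def c_def)
 have cL: "c \<in> Lp_loc 1 \<Omega>" by (rule continuous_on_imp_Lp_loc[OF c(1)])
 obtain C where C: "0 < C" "!!\<phi> G. sob p \<Omega> \<phi> G ==> C * P (%x. \<bar>c x\<bar>) \<phi> <= E G + P V \<phi>"
  by (rule hardy_sob[OF V c(3)]) (rule that; assumption)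
 have nn: "S * P (%x. \<bar>g x\<bar>) \<phi> <= E G + P V \<phi>" if "sob p \<Omega> \<phi> G" for \<phi> G
  unfolding \<open>S = hardy_const p H V \<Omega> g\<close> by (rule hardy_const_le[OF V gL nnV that])
 let ?VS = "%x. V x - S * \<bar>g x\<bar>"
 have VSL: "?VS \<in> Lp_loc 1 \<Omega>" by (rule Lp_loc_linear(4)[OF V ag])
 have nnS: "0 <= E G + P ?VS \<phi>" if "sob p \<Omega> \<phi> G" for \<phi> G
  using nn[OF that] by (simp add: P_diff[OF that V gL])
 have \<Phi>L: "\<Phi> \<in> Lp_loc p \<Omega>" and \<Phi>0: "AE x in M. 0 < \<Phi> x"
  using gr by (auto simp: ground_state_def W1p_loc_def)
 have \<Phi>m: "\<Phi> \<in> borel_measurable M" by (rule Lp_loc_measurable[OF \<Phi>L])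
 obtain \<phi> where \<phi>: "null_sequence p H ?VS \<Omega> \<phi>"
  "!!K. compact K ==> K \<subseteq> \<Omega> ==> (%k. LINT x|lebesgue_on K. \<bar>\<phi> k x - \<Phi> x\<bar> powr p) ~~> 0"
  using gr unfolding ground_state_def by blast
 obtain f Gf where f: "!!k::nat. sob p \<Omega> (f k) (Gf k)" "!!k x. 0 <= f k x" "!!k. E (Gf k) + P ?VS (f k) <= (1/2) ^ k"
  "AE x in M. (%k. f k x) ~~> \<Phi> x"
 proof (rule ground_state_subsequence[OF VSL \<Phi>L \<phi>(1)])
  show "(%k. LINT x|lebesgue_on K. \<bar>\<phi> k x - \<Phi> x\<bar> powr p) ~~> 0" if "compact K" "K \<subseteq> \<Omega>" for K
   by (rule \<phi>(2)[OF that])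
 qed (rule that; assumption)
 \<comment> \<open>All the weights in which the minima have to be controlled, together with 1, which
   accounts for L^p norms on compact sets and for the lower bound on \<open>Y\<close>.\<close>
 define Y where "Y x = \<bar>V x\<bar> + \<bar>g x\<bar> + \<bar>c x\<bar> + 1" for x
 have YL: "Y \<in> Lp_loc 1 \<Omega>" unfolding Y_def[abs_def]
  by (rule Lp_loc_linear(2)[OF Lp_loc_linear(2)[OF Lp_loc_linear(2)[OF Lp_loc_linear(1)[OF V V] ag] Lp_loc_linear(1)[OF cL cL]]])
    (rule continuous_on_imp_Lp_loc, rule continuous_on_const)
 have Y1: "1 <= Y x" for x by (simp add: Y_def)
 obtain v G r where v: "!!k::nat. sob p \<Omega> (v k) (G k)" "!!k x. 0 <= v k x" "!!k. E (G k) + P ?VS (v k) <= 2 * (1/2) ^ k"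
  and r: "!!k. r k \<in> borel_measurable M" "!!k x. 0 <= r k x"
  "!!k. (\<integral>\<^sup>+x. ennreal (Y x * r k x powr p) \<partial>M) <= ennreal ((1/2) ^ k)"
  and vlim: "AE x in M. (%k. v k x) ~~> \<Phi> x" and vle: "AE x in M. \<forall>k. v k x <= \<Phi> x + r k x"
 proof (rule minimizing_minima[OF VSL _ f(1,3,2,4) YL Y1])
  show "0 <= E G + P ?VS \<phi>" if "sob p \<Omega> \<phi> G" for \<phi> G by (rule nnS[OF that])
 qed (rule that; assumption)
 have bound: "\<exists>B. \<forall>k. P X (v k) <= B"
  if X: "X \<in> Lp_loc 1 \<Omega>" "!!x. 0 <= X x" "!!x. X x <= Y x" and fin: "(\<integral>\<^sup>+x. ennreal (X x * \<bar>\<Phi> x\<bar> powr p) \<partial>M) < \<infinity>" for X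
 proof -
  define I where "I = enn2real (\<integral>\<^sup>+x. ennreal (X x * \<bar>\<Phi> x\<bar> powr p) \<partial>M)"
  have I: "0 <= I" "(\<integral>\<^sup>+x. ennreal (X x * \<bar>\<Phi> x\<bar> powr p) \<partial>M) <= ennreal I" using fin by (auto simp: I_def)
  have "P X (v k) <= 2 powr p * (I + 1)" for k
  proof (rule weighted_minima_bound[OF v(1,2) r(1,2) _ _ \<Phi>m X(1) _ I])
   have "ennreal ((1/2) ^ k) <= ennreal 1" by (intro ennreal_leI power_le_one) auto
   then show "(\<integral>\<^sup>+x. ennreal (Y x * r k x powr p) \<partial>M) <= ennreal 1" using r(3)[of k] by (rule order_trans[rotated])
   show "AE x in M. v k x <= \<Phi> x + r k x" using vle by eventually_elim blast
   show "AE x in M. 0 <= X x \<and> X x <= Y x" using X(2,3) by simp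
  qed
  then show ?thesis by blast
 qed
 \<comment> \<open>This is where the integrability of V^- \<Phi>^p enters.\<close>
 have "\<exists>B. \<forall>k. P (%x. max (- V x) 0) (v k) <= B"
 proof (rule bound[OF Lp_loc_linear(6)[OF V V]])
  have "(\<integral>\<^sup>+x. ennreal (max (- V x) 0 * \<bar>\<Phi> x\<bar> powr p) \<partial>M) = (\<integral>\<^sup>+x. ennreal (- min (V x) 0 * \<Phi> x powr p) \<partial>M)"
   by (rule nn_integral_cong_AE) (use \<Phi>0 in \<open>eventually_elim, auto simp: max_def min_def\<close>)
  then show "(\<integral>\<^sup>+x. ennreal (max (- V x) 0 * \<bar>\<Phi> x\<bar> powr p) \<partial>M) < \<infinity>" using assms(21) by simp
 qed (auto simp: Y_def)
 then obtain B1 where B1: "!!k. P (%x. max (- V x) 0) (v k) <= B1" by blast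
 have BK: "\<exists>B. \<forall>k. P (indicator K) (v k) <= B" if K: "compact K" "K \<subseteq> \<Omega>" for K
 proof (rule bound[OF indicator_Lp_loc[OF K(1)]])
  have KM: "K \<in> sets lebesgue" by (rule compact_imp_sets_lebesgue[OF K(1)])
  have "integrable (lebesgue_on K) (%x. indicator K x * \<bar>\<Phi> x\<bar> powr p) = integrable (lebesgue_on K) (%x. norm (\<Phi> x) powr p)"
   by (rule Bochner_Integration.integrable_cong) auto
  moreover have "\<Phi> \<in> Lp p K" using \<Phi>L K by (auto simp: Lp_loc_def)
  ultimately have "integrable (lebesgue_on K) (%x. indicator K x * \<bar>\<Phi> x\<bar> powr p)" by (auto simp: Lp_def)
  then have "integrable M (%x. indicator K x * \<bar>\<Phi> x\<bar> powr p)"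
   by (rule integrable_extend_by_zero[OF KM setsOm K(2), rotated]) auto
  from nn_integral_eq_integral[OF this] show "(\<integral>\<^sup>+x. ennreal (indicator K x * \<bar>\<Phi> x\<bar> powr p) \<partial>M) < \<infinity>" by simp
  show "indicator K x <= Y x" for x using Y1[of x] by (simp add: indicator_def)
 qed simp
 \<comment> \<open>No integrability of |g| \<Phi>^p is known yet, so this bound cannot be
   transferred from \<Phi>; it comes from the strict inequality between the constants.\<close>
 have "\<exists>B. \<forall>k. P (%x. \<bar>g x\<bar>) (v k) <= B"
 proof (rule ccontr)
  assume "\<not> ?thesis"
  then have unb: "\<exists>k. B < P (%x. \<bar>g x\<bar>) (v k)" for B by (meson not_le)
  obtain w F where w: "!!j::nat. sob p \<Omega> (w j) (F j)" "!!j. P (%x. \<bar>g x\<bar>) (w j) = 1"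
   "(%j. E (F j) + P V (w j)) ~~> S" "(%j. P (%x. max (- V x) 0) (w j)) ~~> 0"
   "!!K. compact K ==> K \<subseteq> \<Omega> ==> (%j. P (indicator K) (w j)) ~~> 0"
  proof (rule normalized_concentrating_sequence[OF V gL _ v(1,3) B1 _ unb])
   show "S * P (%x. \<bar>g x\<bar>) \<phi> <= E G + P V \<phi>" if "sob p \<Omega> \<phi> G" for \<phi> G by (rule nn[OF that])
   show "\<exists>B. \<forall>k. P (indicator K) (v k) <= B" if "compact K" "K \<subseteq> \<Omega>" for K by (rule BK[OF that])
  qed (rule that; assumption)
  have S0: "0 <= S" by (rule LIMSEQ_le_const[OF w(3)]) (use nonneg_sob[OF V nnV w(1)] in blast)
  \<comment> \<open>Each infimum equals \<open>S\<close>: the concentrating sequence bounds it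
    above, and the Hardy inequality with constant \<open>S\<close> below. The sequence is constant,
    so its limit exists and has this value.\<close>
  have "(let U = \<Omega> - closure (\<omega> i) in
    INF \<phi> \<in> {\<phi> \<in> W_tilde0 p H V (\<V> U) U. (LINT x|lebesgue_on U. \<bar>g x\<bar> * \<bar>\<phi> x\<bar> powr p) = 1}.
     ereal (energy p H V U \<phi>)) = ereal S" for i
  proof -
   define U where "U = \<Omega> - closure (\<omega> i)"
   \<comment> \<open>The reference weights are prescribed on subcritical subdomains that are
     domains, so connectedness of the complement has to be known.\<close>
   have Ud: "is_domain U" unfolding U_def by (rule exhaustion_complement_domain[OF ex assms(5) openOm])
   then have U: "open U" "U \<noteq> {}" "U \<subseteq> \<Omega>" by (auto simp: is_domain_def U_def)
   have "subcritical p H V U" by (rule subcritical_subdomain[OF V nnV c(3,2) U])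
   then have c': "continuous_on U (\<V> U)" "!!x. x \<in> U ==> 0 < \<V> U x"
    using \<open>reference_weights p H V \<Omega> \<V>\<close> Ud U(3) by (auto simp: reference_weights_def)
   show ?thesis unfolding Let_def U_def[symmetric]
   proof (rule antisym)
    show "(INF \<phi> \<in> {\<phi> \<in> W_tilde0 p H V (\<V> U) U. (LINT x|lebesgue_on U. \<bar>g x\<bar> * \<bar>\<phi> x\<bar> powr p) = 1}. ereal (energy p H V U \<phi>)) <= ereal S"
     unfolding U_def by (rule hardy_infimum_concentration[OF n V g gL w c'(1)[unfolded U_def]])
    show "ereal S <= (INF \<phi> \<in> {\<phi> \<in> W_tilde0 p H V (\<V> U) U. (LINT x|lebesgue_on U. \<bar>g x\<bar> * \<bar>\<phi> x\<bar> powr p) = 1}. ereal (energy p H V U \<phi>))"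
     by (rule hardy_infimum_ge[OF V gL U(1,3) c' S0 nn])
   qed
  qed
  then have "hardy_const_infty p H V \<V> \<Omega> \<omega> g = lim (%i. ereal S)" unfolding hardy_const_infty_def by simp
  also have "... = ereal S" by (rule limI) (rule tendsto_const)
  finally show False using assms(16) by simp
 qed
 then obtain B2 where B2: "!!k. P (%x. \<bar>g x\<bar>) (v k) <= B2" by blast
 obtain F where F: "has_weak_gradient \<Omega> \<Phi> F" "F \<in> borel_measurable M" "integrable M (%x. H x (F x) powr p)"
  and i\<Phi>: "integrable M (%x. (\<bar>V x\<bar> + \<bar>g x\<bar> + \<bar>c x\<bar>) * \<bar>\<Phi> x\<bar> powr p)"
  and EF: "E F + P ?VS \<Phi> = 0"
  and lF: "!!k. integrable M (%x. H x (G k x - F x) powr p)" "(%k. E (%x. G k x - F x)) ~~> 0"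
  and lv: "!!k. integrable M (%x. (\<bar>V x\<bar> + \<bar>g x\<bar> + \<bar>c x\<bar>) * \<bar>v k x - \<Phi> x\<bar> powr p)"
  "(%k. LINT x|M. (\<bar>V x\<bar> + \<bar>g x\<bar> + \<bar>c x\<bar>) * \<bar>v k x - \<Phi> x\<bar> powr p) ~~> 0"
 proof (rule minimizing_sequence_converges[OF assms(7) V gL cL _ C(1) _ v r(1,2) r(3)[unfolded Y_def] vlim vle \<Phi>L \<Phi>0 B1 B2])
  show "S * P (%x. \<bar>g x\<bar>) \<phi> <= E G + P V \<phi>" if "sob p \<Omega> \<phi> G" for \<phi> G by (rule nn[OF that])
  show "C * P (%x. \<bar>c x\<bar>) \<phi> <= E G + P V \<phi>" if "sob p \<Omega> \<phi> G" for \<phi> G by (rule C(2)[OF that])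
 qed (rule that; assumption)
 note [measurable] = Lp_loc_measurable[OF V] Lp_loc_measurable[OF gL] Lp_loc_measurable[OF cL] \<Phi>m sob_measurable(1)[OF v(1)]
 have cM: "AE x in M. 0 < c x" by (rule AE_I2) (simp add: c(2))
 \<comment> \<open>The weight |V| + c of the energy space is dominated by the one in which
   convergence is known, and so are \<open>V\<close> and |g|.\<close>
 have dom: "AE x in M. norm (Z x * t x powr p) <= norm ((\<bar>V x\<bar> + \<bar>g x\<bar> + \<bar>c x\<bar>) * t x powr p)"
  if "AE x in M. \<bar>Z x\<bar> <= \<bar>V x\<bar> + \<bar>g x\<bar> + \<bar>c x\<bar>" for Z t :: "real ^ 'n => real"
  using that by eventually_elim (simp add: abs_mult mult_right_mono)
 have ZV: "AE x in M. \<bar>V x\<bar> <= \<bar>V x\<bar> + \<bar>g x\<bar> + \<bar>c x\<bar>" and Zg: "AE x in M. \<bar>\<bar>g x\<bar>\<bar> <= \<bar>V x\<bar> + \<bar>g x\<bar> + \<bar>c x\<bar>"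
  and Zc: "AE x in M. \<bar>\<bar>V x\<bar> + c x\<bar> <= \<bar>V x\<bar> + \<bar>g x\<bar> + \<bar>c x\<bar>"
  by (rule AE_I2, linarith)+
 have iV: "integrable M (%x. V x * \<bar>\<Phi> x\<bar> powr p)" and ig: "integrable M (%x. \<bar>g x\<bar> * \<bar>\<Phi> x\<bar> powr p)"
  and ic: "integrable M (%x. (\<bar>V x\<bar> + c x) * \<bar>\<Phi> x\<bar> powr p)"
  by (rule Bochner_Integration.integrable_bound[OF i\<Phi> _ dom[OF ZV]] Bochner_Integration.integrable_bound[OF i\<Phi> _ dom[OF Zg]]
   Bochner_Integration.integrable_bound[OF i\<Phi> _ dom[OF Zc]], measurable)+
 have icd: "integrable M (%x. (\<bar>V x\<bar> + c x) * \<bar>v k x - \<Phi> x\<bar> powr p)" for k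
  by (rule Bochner_Integration.integrable_bound[OF lv(1)[of k] _ dom[OF Zc]]) measurable
 have lc: "(%k. LINT x|M. (\<bar>V x\<bar> + c x) * \<bar>v k x - \<Phi> x\<bar> powr p) ~~> 0"
 proof (rule Lim_null_comparison[OF always_eventually lv(2)], rule allI)
  fix k
  have "0 <= (LINT x|M. (\<bar>V x\<bar> + c x) * \<bar>v k x - \<Phi> x\<bar> powr p)"
   by (rule integral_nonneg_AE) (use cM in \<open>eventually_elim, simp add: less_imp_le\<close>)
  moreover have "(LINT x|M. (\<bar>V x\<bar> + c x) * \<bar>v k x - \<Phi> x\<bar> powr p) <= (LINT x|M. (\<bar>V x\<bar> + \<bar>g x\<bar> + \<bar>c x\<bar>) * \<bar>v k x - \<Phi> x\<bar> powr p)"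
   by (rule integral_mono_AE[OF icd lv(1)]) (use cM in \<open>eventually_elim, intro mult_right_mono, auto\<close>)
  ultimately show "norm (LINT x|M. (\<bar>V x\<bar> + c x) * \<bar>v k x - \<Phi> x\<bar> powr p) <= (LINT x|M. (\<bar>V x\<bar> + \<bar>g x\<bar> + \<bar>c x\<bar>) * \<bar>v k x - \<Phi> x\<bar> powr p)" by simp
 qed
 have mem: "\<Phi> \<in> W_tilde0 p H V (\<V> \<Omega>) \<Omega>"
  unfolding c_def[symmetric] by (rule W_tilde0_limit[OF V c(1,2) \<Phi>m ic F v(1) lF icd lc])
 have Pg: "(LINT x|M. \<bar>g x\<bar> * \<Phi> x powr p) = P (%x. \<bar>g x\<bar>) \<Phi>"
  unfolding P_def
 proof (rule integral_cong_AE)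
  show "AE x in M. \<bar>g x\<bar> * \<Phi> x powr p = \<bar>g x\<bar> * \<bar>\<Phi> x\<bar> powr p" using \<Phi>0 by eventually_elim simp
 qed measurable
 \<comment> \<open>\<Phi> is positive almost everywhere, so a vanishing integral would force
   \<open>g\<close> to vanish.\<close>
 have Pg0: "0 < P (%x. \<bar>g x\<bar>) \<Phi>"
 proof -
  have "P (%x. \<bar>g x\<bar>) \<Phi> \<noteq> 0"
  proof
   assume "P (%x. \<bar>g x\<bar>) \<Phi> = 0"
   then have "AE x in M. \<bar>g x\<bar> * \<bar>\<Phi> x\<bar> powr p = 0"
    unfolding P_def using integral_nonneg_eq_0_iff_AE[OF ig] by simp
   then have "AE x in M. g x = 0" using \<Phi>0 by eventually_elim auto
   then show False using assms(14) by simp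
  qed
  moreover have "0 <= P (%x. \<bar>g x\<bar>) \<Phi>" by (rule P_nonneg) simp
  ultimately show ?thesis by simp
 qed
 have en: "energy p H V \<Omega> \<Phi> = E F + P V \<Phi>"
 proof -
  have [measurable]: "(%x. H x (F x)) \<in> borel_measurable M" by (rule measurable_H[OF F(2)])
  have m: "(%x. H x (F x) powr p + V x * \<bar>\<Phi> x\<bar> powr p) \<in> borel_measurable M" by measurable
  have "AE x in M. weak_gradient \<Omega> \<Phi> x = F x" by (rule weak_gradient_AE[OF openOm F(1)])
  then have a: "AE x in M. H x (F x) powr p + V x * \<bar>\<Phi> x\<bar> powr p = H x (weak_gradient \<Omega> \<Phi> x) powr p + V x * \<bar>\<Phi> x\<bar> powr p"
   by eventually_elim simp
  have "energy p H V \<Omega> \<Phi> = (LINT x|M. H x (F x) powr p + V x * \<bar>\<Phi> x\<bar> powr p)"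
   unfolding energy_def by (rule integral_cong_AE[OF m borel_measurable_lebesgue_on_AE[OF setsOm m a] a, symmetric])
  also have "... = E F + P V \<Phi>" unfolding E_def P_def by (rule Bochner_Integration.integral_add[OF F(3) iV])
  finally show ?thesis .
 qed
 \<comment> \<open>\<Phi> need not have compact support; the integral may be split because both of
   its parts are known to be integrable by now.\<close>
 have "P ?VS \<Phi> = P V \<Phi> - S * P (%x. \<bar>g x\<bar>) \<Phi>"
 proof -
  have "P ?VS \<Phi> = (LINT x|M. V x * \<bar>\<Phi> x\<bar> powr p - S * (\<bar>g x\<bar> * \<bar>\<Phi> x\<bar> powr p))"
   unfolding P_def by (rule Bochner_Integration.integral_cong) (auto simp: algebra_simps)
  also have "... = P V \<Phi> - S * P (%x. \<bar>g x\<bar>) \<Phi>"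
   unfolding P_def using iV ig by simp
  finally show ?thesis .
 qed
 then have "energy p H V \<Omega> \<Phi> = S * P (%x. \<bar>g x\<bar>) \<Phi>" using EF en by simp
 then show ?thesis using mem Pg0 unfolding Pg by simp
qed

end
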